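(* Let $\{G_n\}_{n\ge1}$ be a nondecreasing sequence of finite connected graphs with a fixed origin $o$ (a vertex of $G_1$). Let $d_n$ and $k_n$ be the diameter and the number of edges of $G_n$. Suppose that $k_n=O(d_n^\theta)$ as $n\to\infty$ for some fixed $\theta\ge1$. Let the edge weights be i.i.d. from a nondegenerate distribution $F$ on $[0,\infty)$, and suppose a generic edge weight $\omega$ satisfies $\mathbb{E}[\omega^p]<\infty$ for some $p>2$. Let $a_n(G_n)$ be the first-passage time from $(0,o)$ to $(n,o)$ in $\mathbb{Z}\times G_n$. Then $$\frac{a_n(G_n)-\mathbb{E}[a_n(G_n)]}{\sqrt{\operatorname{Var}(a_n(G_n))}}\Longrightarrow N(0,1)\quad\text{as }n\to\infty,$$ provided one of the following holds: A. there is a fixed connected graph $G$ such that $G_n=G$ for all $n\ge1$; or B. the $G_n$ are connected subgraphs of $\mathbb{Z}^{d-1}$ for some $d>1$, the edge weight distribution $F$ is admissible, and $d_n=o(n^\alpha)$, where $$\alpha<\frac{1}{2+\theta+2\theta/(p-2)}.$$ Moreover, the same result holds with $t_n(G_n)$ and with $T_n(G_n)$ in place of $a_n(G_n)$.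
   Context: Nondecreasing means $G_n$ is a (not necessarily induced) subgraph of $G_{n+1}$ for all $n$. For graphs $H,G$, the product graph $H\times G$ has an edge between $(u,w)$ and $(v,z)$ iff either $(u,v)$ is an edge of $H$ and $w=z$, or $u=v$ and $(w,z)$ is an edge of $G$. $\mathbb{Z}$ and $[0,n]=\{0,\ldots,n\}$ carry the nearest-neighbor graph structure. Edges carry i.i.d. weights $\omega_e\sim F$, and the weight of a finite nearest-neighbor path is $\omega(\mathcal{P})=\sum_{e\in\mathcal{P}}\omega_e$. For a finite connected graph $G$ containing $o$ define - $a_n(G)=\inf\{\omega(\mathcal{P}):\mathcal{P}\text{ a path from }(0,o)\text{ to }(n,o)\text{ in }\mathbb{Z}\times G\}$; - $t_n(G)=\inf\{\omega(\mathcal{P}):\mathcal{P}\text{ a path from }(0,o)\text{ to }(n,o)\text{ in }[0,n]\times G\}$; - $T_n(G)=\min\{\omega(\mathcal{P}):\mathcal{P}\text{ a path in }[0,n]\times G\text{ connecting }\{0\}\times G\text{ and }\{n\}\times G\}$. $F$ is admissible (in dimension $d$) if it is supported on $[0,\infty)$, is nondegenerate, and $F(\lambda)<p_c(d)$, where $\lambda$ is the smallest point of the support of $F$ and $p_c(d)$ is the critical probability for Bernoulli bond percolation on $\mathbb{Z}^d$. *)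

theory Defs
  imports "HOL-Probability.Probability" "HOL-Library.Landau_Symbols"
begin

text \<open>Simple undirected graphs; an edge is the two-element set of its endpoints.\<close>

record 'v ugraph =
  verts :: "'v set"
  edges :: "'v set set"

definition simple_graph :: "'v ugraph \<Rightarrow> bool" where
  "simple_graph G \<longleftrightarrow>
     (\<forall>e\<in>edges G. \<exists>u\<in>verts G. \<exists>v\<in>verts G. u \<noteq> v \<and> e = {u, v})"

definition subgraph :: "'v ugraph \<Rightarrow> 'v ugraph \<Rightarrow> bool" where
  "subgraph H G \<longleftrightarrow> verts H \<subseteq> verts G \<and> edges H \<subseteq> edges G"

definition map_graph :: "('v \<Rightarrow> 'w) \<Rightarrow> 'v ugraph \<Rightarrow> 'w ugraph" where
  "map_graph f G = \<lparr>verts = f ` verts G, edges = (\<lambda>e. f ` e) ` edges G\<rparr>"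

text \<open>A finite nearest-neighbour path is given by the list of its successive vertices; vertices
  and edges may repeat, and the one-vertex list is the trivial path.\<close>

definition is_path :: "'v ugraph \<Rightarrow> 'v \<Rightarrow> 'v list \<Rightarrow> 'v \<Rightarrow> bool" where
  "is_path G u xs v \<longleftrightarrow>
     xs \<noteq> [] \<and> hd xs = u \<and> last xs = v \<and> set xs \<subseteq> verts G \<and>
     successively (\<lambda>x y. {x, y} \<in> edges G) xs"

definition path_edges :: "'v list \<Rightarrow> 'v set list" where
  "path_edges xs = map (\<lambda>(x, y). {x, y}) (zip xs (tl xs))"

definition connected_graph :: "'v ugraph \<Rightarrow> bool" where
  "connected_graph G \<longleftrightarrow>
     simple_graph G \<and> verts G \<noteq> {} \<and> (\<forall>u\<in>verts G. \<forall>v\<in>verts G. \<exists>xs. is_path G u xs v)"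

definition finite_graph :: "'v ugraph \<Rightarrow> bool" where
  "finite_graph G \<longleftrightarrow> finite (verts G) \<and> finite (edges G)"

definition graph_dist :: "'v ugraph \<Rightarrow> 'v \<Rightarrow> 'v \<Rightarrow> nat" where
  "graph_dist G u v = (INF xs\<in>{xs. is_path G u xs v}. length (path_edges xs))"

text \<open>Meant for finite connected graphs, where the maximum is over a finite nonempty set.\<close>

definition graph_diameter :: "'v ugraph \<Rightarrow> nat" where
  "graph_diameter G = Max {graph_dist G u v | u v. u \<in> verts G \<and> v \<in> verts G}"

definition graph_prod :: "'a ugraph \<Rightarrow> 'b ugraph \<Rightarrow> ('a \<times> 'b) ugraph" where
  "graph_prod H G =
     \<lparr>verts = verts H \<times> verts G,
      edges = {{(u, w), (v, w)} | u v w. {u, v} \<in> edges H \<and> w \<in> verts G} \<union>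
              {{(u, w), (u, z)} | u w z. u \<in> verts H \<and> {w, z} \<in> edges G}\<rparr>"

definition int_line :: "int ugraph" where
  "int_line = \<lparr>verts = UNIV, edges = {{i, i + 1} | i. True}\<rparr>"

definition int_segment :: "nat \<Rightarrow> int ugraph" where
  "int_segment n = \<lparr>verts = {0..int n}, edges = {{i, i + 1} | i. 0 \<le> i \<and> i < int n}\<rparr>"

text \<open>The nearest-neighbour graph on \<open>\<int>\<close>-vectors of length \<open>d\<close>, represented as lists.\<close>

definition lattice :: "nat \<Rightarrow> int list ugraph" where
  "lattice d =
     \<lparr>verts = {x. length x = d},
      edges = {{x, y} | x y. length x = d \<and> length y = d \<and> (\<Sum>i<d. \<bar>x ! i - y ! i\<bar>) = 1}\<rparr>"

definition bond_percolation :: "nat \<Rightarrow> real \<Rightarrow> (int list set \<Rightarrow> bool) measure" where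
  "bond_percolation d p = PiM (edges (lattice d)) (\<lambda>_. measure_pmf (bernoulli_pmf p))"

definition open_subgraph :: "'v ugraph \<Rightarrow> ('v set \<Rightarrow> bool) \<Rightarrow> 'v ugraph" where
  "open_subgraph G \<eta> = \<lparr>verts = verts G, edges = {e \<in> edges G. \<eta> e}\<rparr>"

definition open_cluster :: "'v ugraph \<Rightarrow> ('v set \<Rightarrow> bool) \<Rightarrow> 'v \<Rightarrow> 'v set" where
  "open_cluster G \<eta> u = {v. \<exists>xs. is_path (open_subgraph G \<eta>) u xs v}"

definition percolation_prob :: "nat \<Rightarrow> real \<Rightarrow> real" where
  "percolation_prob d p =
     measure (bond_percolation d p)
       {\<eta> \<in> space (bond_percolation d p). infinite (open_cluster (lattice d) \<eta> (replicate d 0))}"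

definition critical_prob :: "nat \<Rightarrow> real" where
  "critical_prob d = Sup {p. 0 \<le> p \<and> p \<le> 1 \<and> percolation_prob d p = 0}"

definition supported_nonneg :: "real measure \<Rightarrow> bool" where
  "supported_nonneg F \<longleftrightarrow> measure F {0..} = 1"

definition nondegenerate :: "real measure \<Rightarrow> bool" where
  "nondegenerate F \<longleftrightarrow> (\<forall>c. measure F {c} \<noteq> 1)"

definition dist_support :: "real measure \<Rightarrow> real set" where
  "dist_support F = {x. \<forall>\<epsilon>>0. 0 < measure F {x - \<epsilon><..<x + \<epsilon>}}"

text \<open>For a distribution on the nonnegative reals the support is closed, nonempty and bounded
  below, so it does have a smallest point.\<close>

definition admissible :: "nat \<Rightarrow> real measure \<Rightarrow> bool" where
  "admissible d F \<longleftrightarrow>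
     supported_nonneg F \<and> nondegenerate F \<and>
     cdf F (LEAST x. x \<in> dist_support F) < critical_prob d"

text \<open>The weight of a path counts an edge as often as it is traversed. For nonnegative weights this
  does not affect the infima below, and \<open>T_time\<close> is then a minimum, since erasing loops does not
  increase the weight and there are finitely many self-avoiding paths.\<close>

definition path_weight :: "('v set \<Rightarrow> real) \<Rightarrow> 'v list \<Rightarrow> real" where
  "path_weight w xs = sum_list (map w (path_edges xs))"

definition a_time :: "'v ugraph \<Rightarrow> 'v \<Rightarrow> nat \<Rightarrow> ((int \<times> 'v) set \<Rightarrow> real) \<Rightarrow> real" where
  "a_time G r n w =
     Inf {path_weight w xs | xs. is_path (graph_prod int_line G) (0, r) xs (int n, r)}"

definition t_time :: "'v ugraph \<Rightarrow> 'v \<Rightarrow> nat \<Rightarrow> ((int \<times> 'v) set \<Rightarrow> real) \<Rightarrow> real" where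
  "t_time G r n w =
     Inf {path_weight w xs | xs. is_path (graph_prod (int_segment n) G) (0, r) xs (int n, r)}"

definition T_time :: "'v ugraph \<Rightarrow> nat \<Rightarrow> ((int \<times> 'v) set \<Rightarrow> real) \<Rightarrow> real" where
  "T_time G n w =
     Inf {path_weight w xs | xs u v. u \<in> verts G \<and> v \<in> verts G \<and>
            is_path (graph_prod (int_segment n) G) (0, u) xs (int n, v)}"

definition (in prob_space) asymptotically_normal :: "(nat \<Rightarrow> 'a \<Rightarrow> real) \<Rightarrow> bool" where
  "asymptotically_normal X \<longleftrightarrow>
     weak_conv_m
       (\<lambda>n. distr M borel (\<lambda>x. (X n x - expectation (X n)) / sqrt (variance (X n))))
       std_normal_distribution"

end

theory Submission
 imports Defs "HOL-Real_Asymp.Real_Asymp"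
begin

text \<open>
 The crossing time of a tube is superadditive over consecutive slabs, with an error of at most the
 weight of a path inside the separating slice. Cutting the tube into blocks whose standard
 deviation slightly exceeds this junction error makes the sum over the blocks, which are
 independent, agree with the crossing time up to a negligible L2 error, so Lyapunov's criterion
 applies. The variance lower bound comes from slabs that every path has to cross through heavy
 edges; central moments of order p are bounded by the Efron-Stein inequality and the number of
 edges of the optimal path, which is controlled in case B by the exponential decay of subcritical
 percolation, proved with the functional of Duminil-Copin and Tassion. Finally a_n and t_n are
 within L2 distance O(d_n) of T_n.
\<close>

text \<open>The exponent in case B is a count of scales. Let the diameter be about n^a. A junction
  then costs about n^a, while a tube of length k has variance at least about k / n^(a \<theta>); so
  the standard deviation is sure to overtake the junction error only at length about n^(2a + a
  \<theta>), which leaves about n^(1 - 2a - a \<theta>) blocks. Good moment bounds are available at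
  length n^(2a), where the p-th central moment is about the p-th power of the junction error.
  Doubling such a block up to the final length multiplies the moment by at most about the ratio of
  the lengths, n^(a \<theta>). Lyapunov's criterion becomes a \<theta> < (p/2 - 1) (1 - 2a - a
  \<theta>), which is the hypothesis on the exponent; being strict, it absorbs all losses of the
  form n^\<gamma>. Case A is a = 0. The true order of the variance is unknown: this is why the block
  length is found by a stopping rule on the standard deviation and why errors are measured against
  the actual standard deviation. The constants must be uniform in n, since the graph changes with
  n.\<close>

section \<open>Expectations over finite Bernoulli configurations\<close>

definition bern_wt :: "real \<Rightarrow> 'e set \<Rightarrow> 'e set \<Rightarrow> real" where
 "bern_wt p E S = p ^ card S * (1 - p) ^ card (E - S)"

text \<open>A configuration is the finite set of its open edges, so \<open>bern_exp p E f\<close> is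
  a polynomial in \<open>p\<close>. Differentiation in \<open>p\<close>, independence and
  translation then become finite inductions, and measure spaces enter at two places only, through
  \<open>prob_random_subset\<close>.\<close>

definition bern_exp :: "real \<Rightarrow> 'e set \<Rightarrow> ('e set \<Rightarrow> real) \<Rightarrow> real" where
 "bern_exp p E f = (\<Sum>S\<in>Pow E. bern_wt p E S * f S)"

lemma bern_wt_nonneg: "0 \<le> p \<Longrightarrow> p \<le> 1 \<Longrightarrow> 0 \<le> bern_wt p E S" by (simp add: bern_wt_def)

lemma bern_exp_cong: "(\<And>S. S \<subseteq> E \<Longrightarrow> f S = g S) \<Longrightarrow> bern_exp p E f = bern_exp p E g" by (auto simp: bern_exp_def intro!: sum.cong)

lemma bern_exp_mono:
 "0 \<le> p \<Longrightarrow> p \<le> 1 \<Longrightarrow> (\<And>S. S \<subseteq> E \<Longrightarrow> f S \<le> g S) \<Longrightarrow> bern_exp p E f \<le> bern_exp p E g"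
 by (auto simp: bern_exp_def bern_wt_nonneg intro!: sum_mono mult_left_mono)

lemma bern_exp_add: "bern_exp p E (\<lambda>S. f S + g S) = bern_exp p E f + bern_exp p E g"
 by (simp add: bern_exp_def distrib_left sum.distrib)

lemma bern_exp_diff: "bern_exp p E (\<lambda>S. f S - g S) = bern_exp p E f - bern_exp p E g"
 by (simp add: bern_exp_def right_diff_distrib sum_subtractf)

lemma bern_exp_sum: "bern_exp p E (\<lambda>S. \<Sum>i\<in>I. f i S) = (\<Sum>i\<in>I. bern_exp p E (f i))"
 unfolding bern_exp_def by (simp add: sum_distrib_left) (rule sum.swap)

lemma bern_exp_cmult: "bern_exp p E (\<lambda>S. c * f S) = c * bern_exp p E f" by (simp add: bern_exp_def sum_distrib_left mult_ac)

text \<open>Conditioning on the state of \<open>e\<close>; this recursion drives the inductions over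
  \<open>E\<close> below.\<close>

lemma bern_exp_insert:
 assumes "finite E" "e \<notin> E"
 shows "bern_exp p (insert e E) f = p * bern_exp p E (\<lambda>S. f (insert e S)) + (1 - p) * bern_exp p E f"
proof -
 have inj: "inj_on (insert e) (Pow E)" using assms by (intro inj_onI) (auto dest: insert_ident)
 have "bern_exp p (insert e E) f
   = (\<Sum>S\<in>Pow E. bern_wt p (insert e E) S * f S)
    + (\<Sum>S\<in>insert e ` Pow E. bern_wt p (insert e E) S * f S)"
  unfolding bern_exp_def Pow_insert using assms by (subst sum.union_disjoint) auto
 also have "(\<Sum>S\<in>insert e ` Pow E. bern_wt p (insert e E) S * f S)
   = (\<Sum>S\<in>Pow E. bern_wt p (insert e E) (insert e S) * f (insert e S))"
  by (subst sum.reindex[OF inj]) simp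
 also have "\<dots> = p * bern_exp p E (\<lambda>S. f (insert e S))" unfolding bern_exp_def sum_distrib_left
 proof (intro sum.cong refl)
  fix S assume "S \<in> Pow E"
  then have "e \<notin> S" "finite S" using assms by (auto intro: finite_subset)
  moreover have "insert e E - insert e S = E - S" using assms by auto
  ultimately show "bern_wt p (insert e E) (insert e S) * f (insert e S)
    = p * (bern_wt p E S * f (insert e S))"
   by (simp add: bern_wt_def)
 qed
 also have "(\<Sum>S\<in>Pow E. bern_wt p (insert e E) S * f S) = (1 - p) * bern_exp p E f" unfolding bern_exp_def sum_distrib_left
 proof (intro sum.cong refl)
  fix S assume "S \<in> Pow E"
  then have "insert e E - S = insert e (E - S)" using assms by auto
  then show "bern_wt p (insert e E) S * f S = (1 - p) * (bern_wt p E S * f S)" using assms by (simp add: bern_wt_def)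
 qed
 finally show ?thesis by simp
qed

lemma bern_exp_empty [simp]: "bern_exp p {} f = f {}" by (simp add: bern_exp_def bern_wt_def)

lemma bern_exp_const: "finite E \<Longrightarrow> bern_exp p E (\<lambda>_. c) = c"
 by (induction E rule: finite_induct) (simp_all add: bern_exp_insert algebra_simps)

lemma bern_exp_le_1:
 "finite E \<Longrightarrow> 0 \<le> p \<Longrightarrow> p \<le> 1 \<Longrightarrow> (\<And>S. S \<subseteq> E \<Longrightarrow> f S \<le> 1) \<Longrightarrow> bern_exp p E f \<le> 1"
 using bern_exp_mono[of p E f "\<lambda>_. 1"] by (simp add: bern_exp_const)

lemma bern_exp_nonneg:
 "0 \<le> p \<Longrightarrow> p \<le> 1 \<Longrightarrow> (\<And>S. S \<subseteq> E \<Longrightarrow> 0 \<le> f S) \<Longrightarrow> 0 \<le> bern_exp p E f"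
 by (auto simp: bern_exp_def bern_wt_nonneg intro!: sum_nonneg mult_nonneg_nonneg)

text \<open>Independence of disjoint edge sets. The induction exposes \<open>E2\<close> one edge at
  a time, and \<open>g\<close> is generalised because an open \<open>e\<close> turns it into
  \<open>\<lambda>S. g (insert e S)\<close>.\<close>

lemma bern_exp_Un:
 assumes "finite E2" "finite E1" "E1 \<inter> E2 = {}"
 shows "bern_exp p (E1 \<union> E2) (\<lambda>S. f (S \<inter> E1) * g (S \<inter> E2)) = bern_exp p E1 f * bern_exp p E2 g"
 using assms
proof (induction E2 arbitrary: g rule: finite_induct)
 case empty
 have "bern_exp p E1 (\<lambda>S. f (S \<inter> E1) * g {}) = bern_exp p E1 (\<lambda>S. g {} * f S)" by (intro bern_exp_cong) (auto simp: Int_absorb2)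
 then show ?case by (simp add: bern_exp_cmult)
next
 case (insert e E2)
 have e: "e \<notin> E1 \<union> E2" and fin: "finite (E1 \<union> E2)" using insert by auto
 have "bern_exp p (E1 \<union> E2) (\<lambda>S. f (insert e S \<inter> E1) * g (insert e S \<inter> insert e E2)) = bern_exp p E1 f * bern_exp p E2 (\<lambda>S. g (insert e S))"
  using e insert by force
 moreover have "bern_exp p (E1 \<union> E2) (\<lambda>S. f (S \<inter> E1) * g (S \<inter> insert e E2))
   = bern_exp p (E1 \<union> E2) (\<lambda>S. f (S \<inter> E1) * g (S \<inter> E2))"
 proof (intro bern_exp_cong)
  fix S assume "S \<subseteq> E1 \<union> E2"
  then have "S \<inter> insert e E2 = S \<inter> E2" using e by auto
  then show "f (S \<inter> E1) * g (S \<inter> insert e E2) = f (S \<inter> E1) * g (S \<inter> E2)" by simp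
 qed
 moreover have "\<dots> = bern_exp p E1 f * bern_exp p E2 g" using insert by simp
 ultimately show ?case unfolding Un_insert_right bern_exp_insert[OF fin e] bern_exp_insert[OF insert.hyps(1,2)]
  by (simp add: algebra_simps)
qed

lemma bern_exp_Int:
 assumes "finite E" "E' \<subseteq> E"
 shows "bern_exp p E (\<lambda>S. f (S \<inter> E')) = bern_exp p E' f"
 using bern_exp_Un[of "E - E'" E' p f "\<lambda>_. 1"] assms by (simp add: bern_exp_const finite_subset Un_absorb1)

lemma bern_exp_indep:
 assumes "finite E" "A \<subseteq> E" "B \<subseteq> E" "A \<inter> B = {}"
 shows "bern_exp p E (\<lambda>S. f (S \<inter> A) * g (S \<inter> B)) = bern_exp p A f * bern_exp p B g"
proof -
 have "bern_exp p E (\<lambda>S. (\<lambda>S. f (S \<inter> A) * g (S \<inter> B)) (S \<inter> (A \<union> B)))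
   = bern_exp p (A \<union> B) (\<lambda>S. f (S \<inter> A) * g (S \<inter> B))"
  using assms by (intro bern_exp_Int) auto
 also have "\<dots> = bern_exp p A f * bern_exp p B g" using assms by (intro bern_exp_Un) (auto intro: finite_subset)
 moreover have "S \<inter> (A \<union> B) \<inter> A = S \<inter> A" "S \<inter> (A \<union> B) \<inter> B = S \<inter> B" for S by auto
 ultimately show ?thesis by simp
qed

lemma bern_exp_image:
 assumes "finite E" "inj_on h E"
 shows "bern_exp p (h ` E) f = bern_exp p E (\<lambda>S. f (h ` S))"
 using assms
proof (induction E arbitrary: f rule: finite_induct)
 case (insert e E)
 then show ?case by (simp add: bern_exp_insert)
qed simp

text \<open>Russo's formula. For the indicator of an increasing event the summand at
  \<open>e\<close> is the probability that \<open>e\<close> is pivotal.\<close>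

lemma bern_exp_has_derivative:
 assumes "finite E"
 shows "((\<lambda>p. bern_exp p E f) has_real_derivative
     (\<Sum>e\<in>E. bern_exp p E (\<lambda>S. f (insert e S) - f (S - {e})))) (at p)"
 using assms
proof (induction E arbitrary: f rule: finite_induct)
 case empty
 then show ?case by simp
next
 case (insert e E)
 \<comment> \<open>The difference ignores the state of \<open>e\<close>, so the new term is exactly
   what the derivative of the two weights \<open>p\<close> and \<open>1 - p\<close> in
   \<open>bern_exp_insert\<close> contributes.\<close>
 have 1: "bern_exp p (insert e E) (\<lambda>S. f (insert e S) - f (S - {e}))
   = bern_exp p E (\<lambda>S. f (insert e S)) - bern_exp p E f"
 proof -
  have "bern_exp p E (\<lambda>S. f (insert e S) - f (S - {e})) = bern_exp p E (\<lambda>S. f (insert e S) - f S)"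
   "bern_exp p E (\<lambda>S. f (insert e S) - f (insert e S - {e})) = bern_exp p E (\<lambda>S. f (insert e S) - f S)"
   using insert.hyps(2) by (auto intro!: bern_exp_cong arg_cong[where f=f])
  then show ?thesis using insert.hyps by (simp add: bern_exp_insert bern_exp_diff algebra_simps)
 qed
 have 2: "bern_exp p (insert e E) (\<lambda>S. f (insert e' S) - f (S - {e'}))
  = p * bern_exp p E (\<lambda>S. f (insert e (insert e' S)) - f (insert e (S - {e'})))
   + (1 - p) * bern_exp p E (\<lambda>S. f (insert e' S) - f (S - {e'}))" if "e' \<in> E" for e'
 proof -
  have ne: "e \<noteq> e'" using that insert.hyps by auto
  have "insert e' (insert e S) = insert e (insert e' S)" "insert e S - {e'} = insert e (S - {e'})" for S using ne by auto
  then show ?thesis using insert.hyps by (simp add: bern_exp_insert)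
 qed
 have "((\<lambda>p. p * bern_exp p E (\<lambda>S. f (insert e S)) + (1 - p) * bern_exp p E f) has_real_derivative
   (bern_exp p E (\<lambda>S. f (insert e S)) +
   (\<Sum>e'\<in>E. bern_exp p E (\<lambda>S. f (insert e (insert e' S)) - f (insert e (S - {e'})))) * p
   + (-1 * bern_exp p E f + (\<Sum>e\<in>E. bern_exp p E (\<lambda>S. f (insert e S) - f (S - {e}))) * (1 - p)))) (at p)"
  using DERIV_add[OF DERIV_mult[OF DERIV_ident insert.IH[of "\<lambda>S. f (insert e S)"]]
    DERIV_mult[OF DERIV_diff[OF DERIV_const[of 1] DERIV_ident] insert.IH[of f]]] by simp
 moreover have "(\<Sum>e'\<in>insert e E. bern_exp p (insert e E) (\<lambda>S. f (insert e' S) - f (S - {e'})))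
  = (bern_exp p E (\<lambda>S. f (insert e S)) +
   (\<Sum>e'\<in>E. bern_exp p E (\<lambda>S. f (insert e (insert e' S)) - f (insert e (S - {e'})))) * p
   + (-1 * bern_exp p E f + (\<Sum>e\<in>E. bern_exp p E (\<lambda>S. f (insert e S) - f (S - {e}))) * (1 - p)))"
  using insert.hyps by (simp add: 1 2 sum.distrib sum_distrib_left mult_ac)
 ultimately show ?case using insert.hyps by (simp add: bern_exp_insert)
qed

text \<open>Each term of Russo's formula is nonnegative for increasing \<open>f\<close>; this stands
  in for the monotone coupling of configurations.\<close>

lemma bern_exp_mono_p:
 assumes "finite E" "0 \<le> p" "p \<le> p'" "p' \<le> 1" and mono: "\<And>S T. S \<subseteq> T \<Longrightarrow> f S \<le> f T"
 shows "bern_exp p E f \<le> bern_exp p' E f"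
proof (rule DERIV_nonneg_imp_nondecreasing[OF assms(3)])
 fix x assume x: "p \<le> x" "x \<le> p'"
 have "f (S - {e}) \<le> f (insert e S)" for S e by (rule mono) auto
 then have "0 \<le> (\<Sum>e\<in>E. bern_exp x E (\<lambda>S. f (insert e S) - f (S - {e})))"
  using x assms(2,4) by (intro sum_nonneg bern_exp_nonneg) auto
 then show "\<exists>y. ((\<lambda>p. bern_exp p E f) has_real_derivative y) (at x) \<and> 0 \<le> y" using bern_exp_has_derivative[OF assms(1)] by blast
qed

section \<open>Connectivity and the differential inequality\<close>

text \<open>Connections are kept as a closure rather than as lists of vertices, so that cluster
  explorations become inductions with \<open>conn_induct\<close>. Every point is joined to itself,
  inside the graph or not.\<close>

definition conn :: "'v set set \<Rightarrow> ('v \<times> 'v) set" where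
 "conn S = {(x, y). {x, y} \<in> S}\<^sup>*"

lemma conn_refl [simp]: "(x, x) \<in> conn S" by (simp add: conn_def)

lemma conn_trans: "(x, y) \<in> conn S \<Longrightarrow> (y, z) \<in> conn S \<Longrightarrow> (x, z) \<in> conn S" unfolding conn_def by simp

lemma conn_edge: "{x, y} \<in> S \<Longrightarrow> (x, y) \<in> conn S" by (auto simp: conn_def)

lemma conn_sym: "(x, y) \<in> conn S \<Longrightarrow> (y, x) \<in> conn S"
proof -
 have "sym {(x, y). {x, y} \<in> S}" by (auto simp: sym_def insert_commute)
 then show "(x, y) \<in> conn S \<Longrightarrow> (y, x) \<in> conn S" unfolding conn_def by (meson sym_rtrancl symD)
qed

lemma conn_mono: "S \<subseteq> T \<Longrightarrow> (x, y) \<in> conn S \<Longrightarrow> (x, y) \<in> conn T" unfolding conn_def by (rule subsetD[OF rtrancl_mono]) auto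

lemma conn_induct [consumes 1, case_names refl step]:
 assumes "(x, y) \<in> conn S" "P x"
  "\<And>y z. (x, y) \<in> conn S \<Longrightarrow> {y, z} \<in> S \<Longrightarrow> P y \<Longrightarrow> P z"
 shows "P y"
 using assms(1) unfolding conn_def
proof (induction rule: rtrancl_induct)
 case base then show ?case by (rule assms(2))
next
 case (step y z)
 then show ?case using assms(3)[of y z] by (auto simp: conn_def)
qed

text \<open>Used to show that an event about a cluster depends only on edges that touch it: an
  exploration started in \<open>A\<close> meets no edge outside \<open>T\<close>, so deleting the
  other edges changes nothing.\<close>

lemma conn_Int_subset:
 assumes "(x, y) \<in> conn S" "x \<in> A" "\<And>u v. u \<in> A \<Longrightarrow> (x, u) \<in> conn S \<Longrightarrow> {u, v} \<in> S \<Longrightarrow> v \<in> A \<and> {u, v} \<in> T"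
 shows "y \<in> A \<and> (x, y) \<in> conn T"
 using assms(1)
proof (induction rule: conn_induct)
 case refl then show ?case using assms(2) by simp
next
 case (step y z)
 then show ?case using assms(3)[of y z] by (auto intro: conn_trans conn_edge)
qed

text \<open>The Duminil-Copin--Tassion differential inequality: when the root is not joined to the
 boundary, let \<open>A\<close> be the set of vertices not joined to it; an edge leaving \<open>A\<close> from the
 cluster of the root is pivotal, and the event that \<open>A\<close> is a given set is independent of
 the edges inside it.\<close>

lemma bern_exp_conn_derivative_bound:
 fixes V :: "'v set" and E :: "'v set set"
 assumes V: "finite V" and E: "finite E" "\<And>e. e \<in> E \<Longrightarrow> \<exists>u\<in>V. \<exists>v\<in>V. u \<noteq> v \<and> e = {u, v}"
  and B: "B \<subseteq> V" and r: "r \<in> V" and p: "0 \<le> p" "p \<le> 1"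
  and \<phi>: "\<And>A. A \<subseteq> V - B \<Longrightarrow> r \<in> A \<Longrightarrow>
   1 \<le> (\<Sum>(x, y)\<in>{(x, y). x \<in> A \<and> y \<in> V - A \<and> {x, y} \<in> E}.
       bern_exp p {e \<in> E. e \<subseteq> A} (\<lambda>S. of_bool ((r, x) \<in> conn S)))"
 defines "f \<equiv> \<lambda>S. of_bool (\<exists>b\<in>B. (r, b) \<in> conn S) :: real"
 shows "1 - bern_exp p E f \<le> (\<Sum>e\<in>E. bern_exp p E (\<lambda>S. f (insert e S) - f (S - {e})))"
proof -
 let ?\<A> = "{A. A \<subseteq> V - B \<and> r \<in> A}" and ?df = "\<lambda>e S. f (insert e S) - f (S - {e})"
 define bad where "bad S = {x \<in> V. \<not> (\<exists>b\<in>B. (x, b) \<in> conn S)}" for S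
 define bd where "bd A = {(x, y). x \<in> A \<and> y \<in> V - A \<and> {x, y} \<in> E}" for A
 define inn where "inn A = {e \<in> E. e \<subseteq> A}" for A
 define g where "g A S = (of_bool (bad S = A) :: real)" for A S
 define h where "h x S = (of_bool ((r, x) \<in> conn S) :: real)" for x S
 have EV: "u \<in> V \<and> v \<in> V \<and> u \<noteq> v" if "{u, v} \<in> E" for u v using E(2)[OF that] by (auto simp: doubleton_eq_iff)
 have fmono: "f S \<le> f T" if "S \<subseteq> T" for S T using conn_mono[OF that] unfolding f_def of_bool_less_eq_iff by blast
 \<comment> \<open>Edges inside \<open>A\<close> do not influence whether \<open>A\<close> is the
   set of vertices cut off from \<open>B\<close>: an open connection from \<open>B\<close> never
   enters \<open>A\<close>, and conversely inner edges alone cannot lead out of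
   \<open>A\<close>.\<close>
 have bad_cong: "bad S = A \<longleftrightarrow> bad (S - inn A) = A" if SE: "S \<subseteq> E" and "A \<subseteq> V" for S A
 proof
  assume A: "bad S = A"
  have "(x, b) \<in> conn (S - inn A)" if x: "x \<in> V" "b \<in> B" "(x, b) \<in> conn S" for x b
  proof -
   have "x \<in> {u. (b, u) \<in> conn S} \<and> (b, x) \<in> conn (S - inn A)"
   proof (rule conn_Int_subset[of b x S])
    show "(b, x) \<in> conn S" using x by (simp add: conn_sym)
    fix u v assume u: "u \<in> {u. (b, u) \<in> conn S}" "{u, v} \<in> S"
    then have bv: "(b, v) \<in> conn S" by (auto intro: conn_trans conn_edge)
    then have "v \<notin> bad S" using x(2) by (auto simp: bad_def dest: conn_sym)
    then have "{u, v} \<notin> inn A" using A by (auto simp: inn_def)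
    then show "v \<in> {u. (b, u) \<in> conn S} \<and> {u, v} \<in> S - inn A" using bv u by auto
   qed simp
   then show ?thesis by (simp add: conn_sym)
  qed
  moreover have "(x, b) \<in> conn S" if "(x, b) \<in> conn (S - inn A)" for x b by (rule conn_mono[OF _ that]) auto
  ultimately have "bad (S - inn A) = bad S" unfolding bad_def by blast
  then show "bad (S - inn A) = A" using A by simp
 next
  assume A: "bad (S - inn A) = A"
  have "(x, b) \<in> conn S" if "(x, b) \<in> conn (S - inn A)" for x b by (rule conn_mono[OF _ that]) auto
  then have "bad S \<subseteq> A" using A unfolding bad_def by blast
  moreover have "x \<in> bad S" if x: "x \<in> A" for x
  proof -
   have "y \<in> A \<and> (x, y) \<in> conn S" if "(x, y) \<in> conn S" for y
   proof (rule conn_Int_subset[OF that x])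
    fix u v assume u: "u \<in> A" "{u, v} \<in> S"
    have "v \<in> A"
    proof (rule ccontr)
     assume "v \<notin> A"
     then have "{u, v} \<in> S - inn A" using u by (auto simp: inn_def)
     moreover have "v \<in> V" using u SE EV by blast
     then obtain b where "b \<in> B" "(v, b) \<in> conn (S - inn A)" using A \<open>v \<notin> A\<close> by (auto simp: bad_def)
     ultimately have "(u, b) \<in> conn (S - inn A)" by (meson conn_edge conn_trans)
     then have "u \<notin> bad (S - inn A)" using \<open>b \<in> B\<close> by (auto simp: bad_def)
     then show False using A u by simp
    qed
    then show "v \<in> A \<and> {u, v} \<in> S" using u by simp
   qed
   moreover have "b \<notin> A" if "b \<in> B" for b
   proof -
    have "b \<notin> bad (S - inn A)" using that by (auto simp: bad_def intro: bexI[of _ b])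
    then show ?thesis using A by simp
   qed
   ultimately show ?thesis using x \<open>A \<subseteq> V\<close> by (auto simp: bad_def)
  qed
  ultimately show "bad S = A" by auto
 qed
 \<comment> \<open>Only \<open>A = bad S\<close> contributes to the left side. Its boundary edges
   \<open>{x, y}\<close> with \<open>x\<close> joined to \<open>r\<close> inside \<open>A\<close>
   are pivotal: \<open>y\<close> is joined to \<open>B\<close>, while \<open>r\<close> is
   not.\<close>
 have pointwise: "(\<Sum>A\<in>?\<A>. \<Sum>(x, y)\<in>bd A. g A (S \<inter> (E - inn A)) * h x (S \<inter> inn A))
   \<le> (\<Sum>e\<in>E. ?df e S)" if SE: "S \<subseteq> E" for S
 proof -
  have cap: "S \<inter> (E - inn A) = S - inn A" for A using SE by auto
  have gS: "g A (S \<inter> (E - inn A)) = of_bool (bad S = A)" if "A \<subseteq> V" for A using bad_cong[OF SE that] by (simp add: g_def cap)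
  have "(\<Sum>A\<in>?\<A>. \<Sum>(x, y)\<in>bd A. g A (S \<inter> (E - inn A)) * h x (S \<inter> inn A))
   = (\<Sum>A\<in>?\<A>. if A = bad S then (\<Sum>(x, y)\<in>bd A. h x (S \<inter> inn A)) else 0)"
  proof (intro sum.cong refl)
   fix A assume "A \<in> ?\<A>"
   then have "g A (S \<inter> (E - inn A)) = of_bool (bad S = A)" using gS by blast
   then show "(\<Sum>(x, y)\<in>bd A. g A (S \<inter> (E - inn A)) * h x (S \<inter> inn A))
     = (if A = bad S then (\<Sum>(x, y)\<in>bd A. h x (S \<inter> inn A)) else 0)"
    by simp
  qed
  also have "\<dots> = (if bad S \<subseteq> V - B \<and> r \<in> bad S then (\<Sum>(x, y)\<in>bd (bad S). h x (S \<inter> inn (bad S))) else 0)"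
  proof -
   have "finite ?\<A>" by (rule finite_subset[of _ "Pow V"]) (use V in auto)
   then show ?thesis by simp
  qed
  also have "\<dots> \<le> (\<Sum>e\<in>E. ?df e S)"
  proof (cases "r \<in> bad S")
   case False
   have "0 \<le> (\<Sum>e\<in>E. ?df e S)"
   proof (rule sum_nonneg)
    fix e
    have "f (S - {e}) \<le> f (insert e S)" by (rule fmono) auto
    then show "0 \<le> ?df e S" by simp
   qed
   then show ?thesis using False by simp
  next
   case True
   define A where "A = bad S"
   have "(\<Sum>(x, y)\<in>bd A. h x (S \<inter> inn A)) \<le> (\<Sum>(x, y)\<in>bd A. ?df {x, y} S)"
   proof (intro sum_mono, clarify)
    fix x y assume xy: "(x, y) \<in> bd A"
    show "h x (S \<inter> inn A) \<le> ?df {x, y} S"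
    proof (cases "(r, x) \<in> conn (S \<inter> inn A)")
     case c: True
     have "y \<notin> bad S" "y \<in> V" using xy by (auto simp: bd_def A_def)
     then obtain b where b: "b \<in> B" "(y, b) \<in> conn S" by (auto simp: bad_def)
     have "(r, b) \<in> conn (insert {x, y} S)"
     proof -
      have "(r, x) \<in> conn (insert {x, y} S)" by (rule conn_mono[OF _ c]) auto
      moreover have "(x, y) \<in> conn (insert {x, y} S)" by (rule conn_edge) simp
      moreover have "(y, b) \<in> conn (insert {x, y} S)" by (rule conn_mono[OF _ b(2)]) auto
      ultimately show ?thesis by (meson conn_trans)
     qed
     then have "f (insert {x, y} S) = 1" using b by (auto simp: f_def)
     moreover have "(r, b) \<in> conn S" if "(r, b) \<in> conn (S - {{x, y}})" for b by (rule conn_mono[OF _ that]) auto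
     then have "f (S - {{x, y}}) = 0" using True unfolding f_def bad_def by auto
     ultimately show ?thesis by (simp add: h_def)
    next
     case False
     have "f (S - {{x, y}}) \<le> f (insert {x, y} S)" by (rule fmono) auto
     then show ?thesis using False by (simp add: h_def)
    qed
   qed
   also have "\<dots> = (\<Sum>e\<in>(\<lambda>(x, y). {x, y}) ` bd A. ?df e S)"
   proof (subst sum.reindex)
    show "inj_on (\<lambda>(x, y). {x, y}) (bd A)" by (auto simp: inj_on_def bd_def doubleton_eq_iff)
   qed (simp add: case_prod_unfold)
   also have "\<dots> \<le> (\<Sum>e\<in>E. ?df e S)"
   proof (rule sum_mono2)
    show "finite E" by fact
    show "(\<lambda>(x, y). {x, y}) ` bd A \<subseteq> E" by (auto simp: bd_def)
    show "0 \<le> ?df e S" for e using fmono[of "S - {e}" "insert e S"] by auto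
   qed
   finally have "(\<Sum>(x, y)\<in>bd A. h x (S \<inter> inn A)) \<le> (\<Sum>e\<in>E. ?df e S)" .
   moreover have "A \<subseteq> V - B" by (auto simp: A_def bad_def)
   ultimately show ?thesis using True by (simp add: A_def)
  qed
  finally show ?thesis .
 qed
 have "1 - bern_exp p E f = bern_exp p E (\<lambda>S. 1 - f S)" by (simp add: bern_exp_diff bern_exp_const E)
 also have "\<dots> \<le> bern_exp p E (\<lambda>S. \<Sum>A\<in>?\<A>. g A (S \<inter> (E - inn A)))"
 proof (intro bern_exp_mono p)
  fix S assume SE: "S \<subseteq> E"
  show "1 - f S \<le> (\<Sum>A\<in>?\<A>. g A (S \<inter> (E - inn A)))"
  proof (cases "r \<in> bad S")
   case False
   then have "f S = 1" using r by (auto simp: f_def bad_def)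
   then show ?thesis by (auto intro!: sum_nonneg simp: g_def)
  next
   case True
   have "bad S \<subseteq> V - B" by (auto simp: bad_def)
   have cap: "S \<inter> (E - inn A) = S - inn A" for A using SE by auto
   have "bad S \<subseteq> V" by (auto simp: bad_def)
   then have "bad (S - inn (bad S)) = bad S" using bad_cong[OF SE, of "bad S"] by blast
   then have "g (bad S) (S \<inter> (E - inn (bad S))) = 1" by (simp add: g_def cap)
   moreover have "g (bad S) (S \<inter> (E - inn (bad S))) \<le> (\<Sum>A\<in>?\<A>. g A (S \<inter> (E - inn A)))"
   proof (rule member_le_sum)
    show "finite ?\<A>" by (rule finite_subset[of _ "Pow V"]) (use V in auto)
   qed (use True \<open>bad S \<subseteq> V - B\<close> in \<open>auto simp: g_def\<close>)
   moreover have "0 \<le> f S" by (simp add: f_def)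
   ultimately show ?thesis by simp
  qed
 qed
 also have "\<dots> = (\<Sum>A\<in>?\<A>. bern_exp p (E - inn A) (g A))" by (simp add: bern_exp_sum bern_exp_Int E)
 \<comment> \<open>Here \<open>\<phi>\<close> enters: the probability of cutting off exactly
   \<open>A\<close> is multiplied by a sum that is at least 1, and the independence of the edges
   inside \<open>A\<close> from the remaining ones then merges the two factors.\<close>
 also have "\<dots> \<le> (\<Sum>A\<in>?\<A>. \<Sum>(x, y)\<in>bd A. bern_exp p (E - inn A) (g A) * bern_exp p (inn A) (h x))"
 proof (intro sum_mono, clarify)
  fix A assume A: "A \<subseteq> V - B" "r \<in> A"
  have "0 \<le> bern_exp p (E - inn A) (g A)" by (intro bern_exp_nonneg p) (simp add: g_def)
  moreover have "1 \<le> (\<Sum>(x, y)\<in>bd A. bern_exp p (inn A) (h x))" using \<phi>[OF A] unfolding bd_def inn_def h_def .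
  ultimately have "bern_exp p (E - inn A) (g A) * 1 \<le> bern_exp p (E - inn A) (g A) * (\<Sum>(x, y)\<in>bd A. bern_exp p (inn A) (h x))"
   by (intro mult_left_mono)
  then show "bern_exp p (E - inn A) (g A) \<le> (\<Sum>(x, y)\<in>bd A. bern_exp p (E - inn A) (g A) * bern_exp p (inn A) (h x))"
   by (simp add: sum_distrib_left case_prod_unfold)
 qed
 also have "\<dots> = (\<Sum>A\<in>?\<A>. \<Sum>(x, y)\<in>bd A.
   bern_exp p E (\<lambda>S. g A (S \<inter> (E - inn A)) * h x (S \<inter> inn A)))"
  by (intro sum.cong refl, clarify, subst bern_exp_indep) (auto simp: E inn_def)
 also have "\<dots> = bern_exp p E (\<lambda>S. \<Sum>A\<in>?\<A>. \<Sum>(x, y)\<in>bd A. g A (S \<inter> (E - inn A)) * h x (S \<inter> inn A))"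
  by (simp add: bern_exp_sum case_prod_unfold)
 also have "\<dots> \<le> bern_exp p E (\<lambda>S. \<Sum>e\<in>E. ?df e S)" by (intro bern_exp_mono p pointwise)
 finally show ?thesis by (simp add: bern_exp_sum)
qed

section \<open>The lattice and subcritical exponential decay\<close>

definition ldist :: "nat \<Rightarrow> int list \<Rightarrow> int list \<Rightarrow> int" where
 "ldist d x y = (\<Sum>i<d. abs (x ! i - y ! i))"

definition lorig :: "nat \<Rightarrow> int list" where
 "lorig d = replicate d 0"

definition vadd :: "int list \<Rightarrow> int list \<Rightarrow> int list" where
 "vadd x y = map2 (+) x y"

lemma ldist_nonneg [simp]: "0 \<le> ldist d x y" by (simp add: ldist_def)

lemma ldist_refl [simp]: "ldist d x x = 0" by (simp add: ldist_def)

lemma ldist_commute: "ldist d x y = ldist d y x" by (simp add: ldist_def abs_minus_commute)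

lemma ldist_triangle: "ldist d x z \<le> ldist d x y + ldist d y z"
 unfolding ldist_def sum.distrib[symmetric] by (intro sum_mono) simp

lemma abs_nth_le_ldist: "i < d \<Longrightarrow> abs (x ! i - y ! i) \<le> ldist d x y" unfolding ldist_def by (rule member_le_sum) auto

lemma length_lorig [simp]: "length (lorig d) = d" by (simp add: lorig_def)

lemma length_vadd [simp]: "length x = d \<Longrightarrow> length y = d \<Longrightarrow> length (vadd x y) = d" by (simp add: vadd_def)

lemma ldist_vadd: "length x = d \<Longrightarrow> length y = d \<Longrightarrow> length z = d \<Longrightarrow>
  ldist d (vadd x y) (vadd x z) = ldist d y z"
 by (auto simp: ldist_def vadd_def intro!: sum.cong)

lemma vadd_lorig: "length x = d \<Longrightarrow> vadd x (lorig d) = x" by (auto simp: vadd_def lorig_def intro!: nth_equalityI)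

lemma inj_on_vadd: "length x = d \<Longrightarrow> inj_on (vadd x) {y. length y = d}"
proof (rule inj_onI)
 fix y z assume x: "length x = d" and yz: "y \<in> {y. length y = d}" "z \<in> {y. length y = d}" "vadd x y = vadd x z"
 show "y = z"
 proof (rule nth_equalityI)
  fix i assume "i < length y"
  then have "vadd x y ! i = x ! i + y ! i" "vadd x z ! i = x ! i + z ! i" using x yz(1,2) by (simp_all add: vadd_def)
  then show "y ! i = z ! i" using yz(3) by simp
 qed (use yz in simp)
qed

lemma lattice_edge_iff:
 "{x, y} \<in> edges (lattice d) \<longleftrightarrow> length x = d \<and> length y = d \<and> ldist d x y = 1"
 using ldist_commute[of d x y] by (auto simp: lattice_def ldist_def doubleton_eq_iff)

lemma lattice_edgeE:
 assumes "e \<in> edges (lattice d)"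
 obtains x y where "e = {x, y}" "length x = d" "length y = d" "ldist d x y = 1" "x \<noteq> y"
proof -
 obtain x y where e: "e = {x, y}" using assms by (auto simp: lattice_def)
 have xy: "length x = d" "length y = d" "ldist d x y = 1" using assms unfolding e lattice_edge_iff by auto
 have "x \<noteq> y" using xy(3) by auto
 with e xy show ?thesis by (rule that)
qed

lemma lattice_ball:
 fixes R :: nat
 assumes "length x = d"
 shows "finite {y. length y = d \<and> ldist d x y \<le> int R}"
  and "card {y. length y = d \<and> ldist d x y \<le> int R} \<le> (2 * R + 1) ^ d"
proof -
 let ?B = "{y. length y = d \<and> ldist d x y \<le> int R}"
 let ?Z = "{z. set z \<subseteq> {- int R..int R} \<and> length z = d}"
 have "?B \<subseteq> vadd x ` ?Z"
 proof clarify
  fix y assume y: "d = length y" "ldist (length y) x y \<le> int R"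
  define z where "z = map2 (\<lambda>a b. b - a) x y"
  have "y = vadd x z" using assms y by (auto simp: z_def vadd_def intro!: nth_equalityI)
  moreover have "z \<in> {z. set z \<subseteq> {- int R..int R} \<and> length z = length y}"
  proof -
   have "abs (y ! i - x ! i) \<le> int R" if "i < length y" for i using abs_nth_le_ldist[OF that, of x y] y(2) by simp
   moreover have "z ! i = y ! i - x ! i" if "i < length y" for i using that assms y by (simp add: z_def)
   ultimately have "z ! i \<in> {- int R..int R}" if "i < length y" for i using that by (fastforce simp: abs_le_iff)
   moreover have "length z = length y" using assms y by (simp add: z_def)
   ultimately show ?thesis by (auto simp: set_conv_nth)
  qed
  ultimately show "y \<in> vadd x ` {z. set z \<subseteq> {- int R..int R} \<and> length z = length y}" by blast
 qed
 moreover have fin: "finite ?Z" by (rule finite_lists_length_eq) simp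
 ultimately show "finite ?B" by (auto intro: finite_subset)
 have "card ?B \<le> card (vadd x ` ?Z)" by (rule card_mono) (use fin \<open>_ \<subseteq> vadd x ` ?Z\<close> in auto)
 also have "\<dots> \<le> card ?Z" by (rule card_image_le[OF fin])
 also have "\<dots> = (2 * R + 1) ^ d" by (subst card_lists_length_eq) (auto simp: nat_add_distrib nat_mult_distrib)
 finally show "card ?B \<le> (2 * R + 1) ^ d" .
qed

abbreviation inner_edges :: "nat \<Rightarrow> int list set \<Rightarrow> int list set set" where
 "inner_edges d A \<equiv> {e \<in> edges (lattice d). e \<subseteq> A}"

text \<open>A ball of the l^1 metric, in which a lattice step changes the distance by at most
  1.\<close>

definition lbox :: "nat \<Rightarrow> nat \<Rightarrow> int list set" where
 "lbox d n = {y. length y = d \<and> ldist d (lorig d) y \<le> int n}"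

definition lbox_edges :: "nat \<Rightarrow> nat \<Rightarrow> int list set set" where
 "lbox_edges d n = inner_edges d (lbox d n)"

definition reaches :: "nat \<Rightarrow> nat \<Rightarrow> int list set set \<Rightarrow> bool" where
 "reaches d n S \<longleftrightarrow> (\<exists>y. length y = d \<and> ldist d (lorig d) y = int n \<and> (lorig d, y) \<in> conn S)"

text \<open>The functional of Duminil-Copin and Tassion: the mean number of open edges leaving
  \<open>A\<close> whose inner end is joined to the origin inside \<open>A\<close>.\<close>

definition dct_phi :: "nat \<Rightarrow> real \<Rightarrow> int list set \<Rightarrow> real" where
 "dct_phi d p A = (\<Sum>(x, y)\<in>{(x, y). x \<in> A \<and> y \<notin> A \<and> {x, y} \<in> edges (lattice d)}.
  p * bern_exp p (inner_edges d A) (\<lambda>S. of_bool ((lorig d, x) \<in> conn S)))"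

lemma finite_lbox: "finite (lbox d n)" unfolding lbox_def by (rule lattice_ball) simp

lemma finite_edges_within: "finite A \<Longrightarrow> finite (inner_edges d A)" by simp

lemma finite_lbox_edges: "finite (lbox_edges d n)" unfolding lbox_edges_def by (rule finite_edges_within[OF finite_lbox])

lemma finite_lattice_boundary:
 assumes "finite A"
 shows "finite {(x, y). x \<in> A \<and> y \<notin> A \<and> {x, y} \<in> edges (lattice d)}"
proof (rule finite_subset)
 show "{(x, y). x \<in> A \<and> y \<notin> A \<and> {x, y} \<in> edges (lattice d)}
   \<subseteq> Sigma (A \<inter> {x. length x = d}) (\<lambda>x. {y. length y = d \<and> ldist d x y \<le> int 1})"
  by (auto simp: lattice_edge_iff)
 show "finite (Sigma (A \<inter> {x. length x = d}) (\<lambda>x. {y. length y = d \<and> ldist d x y \<le> int 1}))"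
  using assms lattice_ball(1)[of _ d 1] by auto
qed

lemma of_bool_conn_mono: "S \<subseteq> T \<Longrightarrow> (of_bool ((x, y) \<in> conn S) :: real) \<le> of_bool ((x, y) \<in> conn T)"
 unfolding of_bool_less_eq_iff by (intro impI) (rule conn_mono)

lemma dct_phi_mono:
 assumes "finite A" "0 \<le> p" "p \<le> p'" "p' \<le> 1"
 shows "dct_phi d p A \<le> dct_phi d p' A"
 unfolding dct_phi_def
proof (intro sum_mono, clarify)
 fix x
 have "bern_exp p (inner_edges d A) (\<lambda>S. of_bool ((lorig d, x) \<in> conn S))
   \<le> bern_exp p' (inner_edges d A) (\<lambda>S. of_bool ((lorig d, x) \<in> conn S))"
  using assms by (intro bern_exp_mono_p finite_edges_within of_bool_conn_mono) auto
 then show "p * bern_exp p (inner_edges d A) (\<lambda>S. of_bool ((lorig d, x) \<in> conn S))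
   \<le> p' * bern_exp p' (inner_edges d A) (\<lambda>S. of_bool ((lorig d, x) \<in> conn S))"
  using assms by (intro mult_mono bern_exp_nonneg) auto
qed

text \<open>Points of a set \<open>A\<close> that misses the sphere have all their lattice edges
  inside the ball, so the boundary sum of the finite graph runs over the same edges as the one in
  \<open>dct_phi\<close>; dropping the factor \<open>p\<close> there only increases the sum.\<close>

lemma reaches_derivative_bound:
 assumes p: "0 \<le> p" "p \<le> 1" and n: "n \<ge> 1"
  and \<phi>: "\<And>A. finite A \<Longrightarrow> lorig d \<in> A \<Longrightarrow> 1 \<le> dct_phi d p A"
 shows "1 - bern_exp p (lbox_edges d n) (\<lambda>S. of_bool (reaches d n S))
  \<le> (\<Sum>e\<in>lbox_edges d n. bern_exp p (lbox_edges d n)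
     (\<lambda>S. of_bool (reaches d n (insert e S)) - of_bool (reaches d n (S - {e}))))"
proof -
 define B where "B = {y. length y = d \<and> ldist d (lorig d) y = int n}"
 have eq: "reaches d n S \<longleftrightarrow> (\<exists>b\<in>B. (lorig d, b) \<in> conn S)" for S by (auto simp: reaches_def B_def)
 show ?thesis unfolding eq
 proof (rule bern_exp_conn_derivative_bound[OF finite_lbox finite_lbox_edges _ _ _ p])
  fix e assume "e \<in> lbox_edges d n"
  then show "\<exists>u\<in>lbox d n. \<exists>v\<in>lbox d n. u \<noteq> v \<and> e = {u, v}" by (auto simp: lbox_edges_def elim!: lattice_edgeE)
 next
  show "B \<subseteq> lbox d n" by (auto simp: B_def lbox_def)
  show "lorig d \<in> lbox d n" by (simp add: lbox_def)
 next
  fix A assume A: "A \<subseteq> lbox d n - B" "lorig d \<in> A"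
  have fA: "finite A" by (rule finite_subset[OF _ finite_lbox]) (use A in auto)
  have inn: "{e \<in> lbox_edges d n. e \<subseteq> A} = inner_edges d A" using A by (auto simp: lbox_edges_def)
  have "y \<in> lbox d n" if "x \<in> A" "{x, y} \<in> edges (lattice d)" for x y
  proof -
   have "ldist d (lorig d) x < int n" using A that(1) by (auto simp: lbox_def B_def)
   then show ?thesis using that(2) ldist_triangle[of d "lorig d" y x] by (auto simp: lbox_def lattice_edge_iff)
  qed
  then have bd: "{(x, y). x \<in> A \<and> y \<in> lbox d n - A \<and> {x, y} \<in> lbox_edges d n}
    = {(x, y). x \<in> A \<and> y \<notin> A \<and> {x, y} \<in> edges (lattice d)}"
   using A by (auto simp: lbox_edges_def)
  have "1 \<le> dct_phi d p A" using \<phi>[OF fA A(2)] .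
  also have "\<dots> \<le> (\<Sum>(x, y)\<in>{(x, y). x \<in> A \<and> y \<notin> A \<and> {x, y} \<in> edges (lattice d)}.
    bern_exp p (inner_edges d A) (\<lambda>S. of_bool ((lorig d, x) \<in> conn S)))"
   unfolding dct_phi_def by (intro sum_mono, clarify, intro mult_left_le_one_le bern_exp_nonneg p) auto
  finally show "1 \<le> (\<Sum>(x, y)\<in>{(x, y). x \<in> A \<and> y \<in> lbox d n - A \<and> {x, y} \<in> lbox_edges d n}.
    bern_exp p {e \<in> lbox_edges d n. e \<subseteq> A} (\<lambda>S. of_bool ((lorig d, x) \<in> conn S)))"
   unfolding bd inn .
 qed
qed

text \<open>With \<theta> the reaching probability, \<theta>' \<ge> 1 - \<theta> says that (1 -
  \<theta>) exp p is nonincreasing in p. The bound is uniform in \<open>n\<close>, so it passes to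
  the limit.\<close>

lemma reaches_ge:
 assumes p: "0 \<le> p0" "p0 < p1" "p1 \<le> 1" and n: "n \<ge> 1"
  and \<phi>: "\<And>A. finite A \<Longrightarrow> lorig d \<in> A \<Longrightarrow> 1 \<le> dct_phi d p0 A"
 shows "1 - exp (p0 - p1) \<le> bern_exp p1 (lbox_edges d n) (\<lambda>S. of_bool (reaches d n S))"
proof -
 define f where "f S = (of_bool (reaches d n S) :: real)" for S
 define E where "E = lbox_edges d n"
 define h where "h p = (1 - bern_exp p E f) * exp p" for p
 have finE: "finite E" by (simp add: E_def finite_lbox_edges)
 have "h p1 \<le> h p0"
 proof (rule DERIV_nonpos_imp_nonincreasing[of p0 p1 h])
  fix p assume pp: "p0 \<le> p" "p \<le> p1"
  define D where "D = (\<Sum>e\<in>E. bern_exp p E (\<lambda>S. f (insert e S) - f (S - {e})))"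
  have "1 - bern_exp p E f \<le> D" unfolding D_def E_def f_def
  proof (rule reaches_derivative_bound)
   fix A assume "finite A" "lorig d \<in> A"
   then show "1 \<le> dct_phi d p A" using \<phi>[of A] dct_phi_mono[of A p0 p d] pp p by fastforce
  qed (use pp p n in auto)
  moreover have "(h has_real_derivative ((0 - D) * exp p + exp p * (1 - bern_exp p E f))) (at p)" unfolding h_def D_def
   by (intro DERIV_mult DERIV_diff DERIV_const bern_exp_has_derivative finE DERIV_exp)
  moreover have "(0 - D) * exp p + exp p * (1 - bern_exp p E f) = exp p * ((1 - bern_exp p E f) - D)"
   by (simp add: algebra_simps)
  ultimately show "\<exists>y. (h has_real_derivative y) (at p) \<and> y \<le> 0"
   by (intro exI[of _ "(0 - D) * exp p + exp p * (1 - bern_exp p E f)"]) (auto simp: mult_le_0_iff)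
 qed (use p in simp)
 moreover have "h p0 \<le> exp p0"
 proof -
  have "0 \<le> bern_exp p0 E f" using p by (intro bern_exp_nonneg) (auto simp: f_def)
  then show ?thesis by (simp add: h_def)
 qed
 ultimately have "h p1 \<le> exp p0" by simp
 then have "(1 - bern_exp p1 E f) * exp p1 \<le> exp p0" by (simp only: h_def)
 then have "1 - bern_exp p1 E f \<le> exp p0 / exp p1" by (simp add: pos_le_divide_eq)
 then show ?thesis by (simp add: exp_diff E_def f_def[abs_def])
qed

text \<open>A step changes the distance to the origin by at most 1, so a connection that gets to
  distance \<open>n\<close> or beyond meets the sphere exactly, and up to that moment it stays in
  the ball.\<close>

lemma conn_reaches_Int:
 assumes "(lorig d, y) \<in> conn S" "S \<subseteq> edges (lattice d)" "int n \<le> ldist d (lorig d) y"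
 shows "reaches d n (S \<inter> lbox_edges d n)"
proof -
 have "reaches d n (S \<inter> lbox_edges d n) \<or> (y \<in> lbox d n \<and> (lorig d, y) \<in> conn (S \<inter> lbox_edges d n))" using assms(1)
 proof (induction rule: conn_induct)
  case refl
  then show ?case by (simp add: lbox_def)
 next
  case (step y z)
  show ?case
  proof (cases "reaches d n (S \<inter> lbox_edges d n)")
   case False
   then have y: "y \<in> lbox d n" "(lorig d, y) \<in> conn (S \<inter> lbox_edges d n)" using step by auto
   then have "ldist d (lorig d) y \<noteq> int n" using False by (auto simp: reaches_def lbox_def)
   then have lt: "ldist d (lorig d) y < int n" using y by (auto simp: lbox_def)
   have e: "{y, z} \<in> edges (lattice d)" using step assms(2) by auto
   then have z: "z \<in> lbox d n" using lt ldist_triangle[of d "lorig d" z y] by (auto simp: lbox_def lattice_edge_iff)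
   then have "{y, z} \<in> S \<inter> lbox_edges d n" using e step y by (auto simp: lbox_edges_def)
   then show ?thesis using z y by (auto intro: conn_trans conn_edge)
  qed simp
 qed
 moreover have "reaches d n (S \<inter> lbox_edges d n)"
  if "y \<in> lbox d n" "(lorig d, y) \<in> conn (S \<inter> lbox_edges d n)"
 using that(1) assms(3) that(2) by (auto simp: lbox_def reaches_def)
 ultimately show ?thesis by blast
qed

lemma is_path_imp_conn: "is_path G u xs v \<Longrightarrow> (u, v) \<in> conn (edges G)"
proof (induction xs arbitrary: u)
 case (Cons a xs)
 show ?case
 proof (cases xs)
  case Nil then show ?thesis using Cons by (auto simp: is_path_def)
 next
  case (Cons b ys)
  then have "(b, v) \<in> conn (edges G)" using Cons.prems by (intro Cons.IH) (auto simp: is_path_def)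
  moreover have "u = a" "{a, b} \<in> edges G" using Cons Cons.prems by (auto simp: is_path_def)
  ultimately show ?thesis by (auto intro: conn_trans conn_edge)
 qed
qed (simp add: is_path_def)

lemma conn_imp_is_path:
 assumes "(u, v) \<in> conn (edges G)" "u \<in> verts G" "\<And>x y. {x, y} \<in> edges G \<Longrightarrow> x \<in> verts G"
 shows "\<exists>xs. is_path G u xs v"
 using assms(1)
proof (induction rule: conn_induct)
 case refl
 then show ?case using assms(2) by (intro exI[of _ "[u]"]) (simp add: is_path_def)
next
 case (step y z)
 then obtain xs where xs: "is_path G u xs y" by blast
 have "z \<in> verts G" using assms(3)[of z y] step by (simp add: insert_commute)
 then have "is_path G u (xs @ [z]) z" using xs step by (auto simp: is_path_def successively_append_iff)
 then show ?case by blast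
qed

lemma bern_exp_0: "finite E \<Longrightarrow> bern_exp 0 E f = f {}" by (induction E rule: finite_induct) (simp_all add: bern_exp_insert)

lemma conn_empty: "conn {} = Id" by (simp add: conn_def)

text \<open>The bridge between probability spaces and \<open>bern_exp\<close>, for a random subset
  of \<open>E\<close> known through its finitely many point probabilities. It serves percolation as
  well as the set of edges of weight below a level.\<close>

lemma (in prob_space) prob_random_subset:
 assumes E: "finite E" and W: "\<And>T. T \<subseteq> E \<Longrightarrow> {x \<in> space M. W x = T} \<in> events"
  "\<And>T. T \<subseteq> E \<Longrightarrow> prob {x \<in> space M. W x = T} = bern_wt q E T" "\<And>x. W x \<subseteq> E"
 shows "{x \<in> space M. P (W x)} \<in> events" "prob {x \<in> space M. P (W x)} = bern_exp q E (\<lambda>S. of_bool (P S))"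
proof -
 have eq: "{x \<in> space M. P (W x)} = (\<Union>T\<in>{T \<in> Pow E. P T}. {x \<in> space M. W x = T})" using W(3) by auto
 show "{x \<in> space M. P (W x)} \<in> events" unfolding eq using E by (intro sets.finite_UN W) auto
 have "prob {x \<in> space M. P (W x)} = (\<Sum>T\<in>{T \<in> Pow E. P T}. prob {x \<in> space M. W x = T})"
  unfolding eq using E W(1) by (intro finite_measure_finite_Union) (auto simp: disjoint_family_on_def)
 also have "\<dots> = (\<Sum>T\<in>{T \<in> Pow E. P T}. bern_wt q E T)" by (intro sum.cong W(2)) auto
 also have "\<dots> = bern_exp q E (\<lambda>S. of_bool (P S))" unfolding bern_exp_def using E by (intro sum.mono_neutral_cong_left) auto
 finally show "prob {x \<in> space M. P (W x)} = bern_exp q E (\<lambda>S. of_bool (P S))" .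
qed

lemma bond_percolation_cylinder:
 assumes p: "0 \<le> p" "p \<le> 1" and J: "finite J" "J \<subseteq> edges (lattice d)"
 shows "{\<eta> \<in> space (bond_percolation d p). P {e \<in> J. \<eta> e}} \<in> sets (bond_percolation d p)"
  and "measure (bond_percolation d p) {\<eta> \<in> space (bond_percolation d p). P {e \<in> J. \<eta> e}}
   = bern_exp p J (\<lambda>S. of_bool (P S))"
proof -
 let ?M = "\<lambda>_::int list set. measure_pmf (bernoulli_pmf p)"
 interpret product_prob_space ?M "edges (lattice d)"
  by unfold_locales
 let ?B = "bond_percolation d p"
 have B: "?B = PiM (edges (lattice d)) ?M" by (simp add: bond_percolation_def)
 define C where "C T = {\<eta> \<in> space ?B. {e \<in> J. \<eta> e} = T}" for T
 have C_emb: "C T = emb (edges (lattice d)) J (PiE J (\<lambda>e. if e \<in> T then {True} else {False}))"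
  if "T \<subseteq> J" for T
 proof -
  have "{e \<in> J. \<eta> e} = T \<longleftrightarrow> restrict \<eta> J \<in> PiE J (\<lambda>e. if e \<in> T then {True} else {False})" for \<eta>
   using that by (auto simp: PiE_iff split: if_splits)
  then show ?thesis
   unfolding C_def B prod_emb_def space_PiM by (intro set_eqI) (simp only: Int_iff vimage_eq mem_Collect_eq conj_commute)
 qed
 have meas_C: "measure ?B (C T) = bern_wt p J T" if "T \<subseteq> J" for T
 proof -
  have "measure ?B (C T) = (\<Prod>e\<in>J. measure (measure_pmf (bernoulli_pmf p)) (if e \<in> T then {True} else {False}))"
   unfolding C_emb[OF that] B by (rule measure_PiM_emb) (use J in auto)
  also have "\<dots> = (\<Prod>e\<in>J. if e \<in> T then p else 1 - p)" by (intro prod.cong refl) (use p in \<open>auto simp: measure_pmf_single\<close>)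
  also have "\<dots> = bern_wt p J T"
   using J that by (simp add: prod.If_cases bern_wt_def Int_absorb1 Collect_conj_eq[symmetric] Diff_eq)
  finally show ?thesis .
 qed
 have sets_C: "C T \<in> sets ?B" if "T \<subseteq> J" for T unfolding C_emb[OF that] B by (rule sets_PiM_I) (use J in auto)
 show "{\<eta> \<in> space ?B. P {e \<in> J. \<eta> e}} \<in> sets ?B"
  "measure ?B {\<eta> \<in> space ?B. P {e \<in> J. \<eta> e}} = bern_exp p J (\<lambda>S. of_bool (P S))"
  using prob_random_subset[of J "\<lambda>\<eta>. {e \<in> J. \<eta> e}" p P] sets_C meas_C J(1) unfolding C_def B by blast+
qed

text \<open>Balls are finite, so an infinite cluster leaves each of them, and a finite one does not.
  Percolation becomes an intersection of events about finitely many edges.\<close>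

lemma infinite_open_cluster_iff:
 "infinite (open_cluster (lattice d) \<eta> (replicate d 0)) \<longleftrightarrow>
  (\<forall>n. reaches d n {e \<in> lbox_edges d n. \<eta> e})"
proof -
 define S where "S = {e \<in> edges (lattice d). \<eta> e}"
 have SE: "S \<subseteq> edges (lattice d)" by (auto simp: S_def)
 have Sn: "S \<inter> lbox_edges d n = {e \<in> lbox_edges d n. \<eta> e}" for n by (auto simp: S_def lbox_edges_def)
 define C where "C = open_cluster (lattice d) \<eta> (lorig d)"
 have path: "is_path (open_subgraph (lattice d) \<eta>) (lorig d) xs v \<Longrightarrow> length v = d" for xs v
  by (auto simp: is_path_def open_subgraph_def lattice_def dest!: last_in_set)
 have edg: "edges (open_subgraph (lattice d) \<eta>) = S" by (simp add: open_subgraph_def S_def)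
 have C: "v \<in> C \<longleftrightarrow> (lorig d, v) \<in> conn S" for v
 proof
  assume "v \<in> C"
  then show "(lorig d, v) \<in> conn S" using is_path_imp_conn edg by (fastforce simp: C_def open_cluster_def)
 next
  assume "(lorig d, v) \<in> conn S"
  then have "\<exists>xs. is_path (open_subgraph (lattice d) \<eta>) (lorig d) xs v"
  proof (intro conn_imp_is_path)
   fix x y assume "{x, y} \<in> edges (open_subgraph (lattice d) \<eta>)"
   then have "length x = d" using SE lattice_edge_iff unfolding edg by blast
   then show "x \<in> verts (open_subgraph (lattice d) \<eta>)" by (simp add: open_subgraph_def lattice_def)
  qed (simp_all add: edg, simp add: open_subgraph_def lattice_def)
  then show "v \<in> C" by (simp add: C_def open_cluster_def)
 qed
 have lenC: "length v = d" if "v \<in> C" for v using that path by (auto simp: C_def open_cluster_def)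
 have "infinite C \<longleftrightarrow> (\<forall>n. reaches d n {e \<in> lbox_edges d n. \<eta> e})"
 proof
  assume inf: "infinite C"
  show "\<forall>n. reaches d n {e \<in> lbox_edges d n. \<eta> e}"
  proof
   fix n
   have "\<not> C \<subseteq> lbox d n" using inf finite_lbox finite_subset by blast
   then obtain v where v: "v \<in> C" "v \<notin> lbox d n" by blast
   have "int n \<le> ldist d (lorig d) v" using v lenC by (auto simp: lbox_def)
   then show "reaches d n {e \<in> lbox_edges d n. \<eta> e}" using conn_reaches_Int[of d v S n] C v(1) SE Sn by auto
  qed
 next
  assume all: "\<forall>n. reaches d n {e \<in> lbox_edges d n. \<eta> e}"
  show "infinite C"
  proof
   assume fin: "finite C"
   define N where "N = nat (Max (ldist d (lorig d) ` C)) + 1"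
   obtain y where y: "ldist d (lorig d) y = int N" "(lorig d, y) \<in> conn {e \<in> lbox_edges d N. \<eta> e}"
    using all by (auto simp: reaches_def)
   have "(lorig d, y) \<in> conn S" by (rule conn_mono[OF _ y(2)]) (auto simp: S_def lbox_edges_def)
   then have "y \<in> C" using C by simp
   then have "ldist d (lorig d) y \<le> Max (ldist d (lorig d) ` C)" using fin by auto
   then show False using y(1) unfolding N_def by linarith
  qed
 qed
 then show ?thesis by (simp add: C_def lorig_def)
qed

lemma percolation_prob_bounds:
 fixes d :: nat
 assumes p: "0 \<le> p" "p \<le> 1"
 defines "\<theta> \<equiv> \<lambda>n. bern_exp p (lbox_edges d n) (\<lambda>S. of_bool (reaches d n S))"
 shows "\<theta> \<longlonglongrightarrow> percolation_prob d p" and "percolation_prob d p \<le> \<theta> n"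
proof -
 let ?B = "bond_percolation d p"
 interpret prob_space ?B
  unfolding bond_percolation_def by (intro prob_space_PiM measure_pmf.prob_space_axioms)
 define A where "A n = {\<eta> \<in> space ?B. reaches d n {e \<in> lbox_edges d n. \<eta> e}}" for n
 have J: "finite (lbox_edges d n)" "lbox_edges d n \<subseteq> edges (lattice d)" for n
  by (rule finite_lbox_edges) (auto simp: lbox_edges_def)
 have sets_A: "A n \<in> sets ?B" for n unfolding A_def by (rule bond_percolation_cylinder[OF p J])
 have meas_A: "measure ?B (A n) = \<theta> n" for n unfolding A_def \<theta>_def by (rule bond_percolation_cylinder[OF p J])
 have eq: "{\<eta> \<in> space ?B. infinite (open_cluster (lattice d) \<eta> (replicate d 0))} = (\<Inter>n. A n)"
  unfolding infinite_open_cluster_iff A_def by auto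
 have "decseq A"
 proof (rule decseq_SucI, rule subsetI)
  fix n \<eta> assume "\<eta> \<in> A (Suc n)"
  then obtain y where y: "\<eta> \<in> space ?B" "ldist d (lorig d) y = int (Suc n)"
    "(lorig d, y) \<in> conn {e \<in> lbox_edges d (Suc n). \<eta> e}"
   by (auto simp: A_def reaches_def)
  have "reaches d n ({e \<in> lbox_edges d (Suc n). \<eta> e} \<inter> lbox_edges d n)" by (rule conn_reaches_Int[OF y(3)]) (use y J in auto)
  moreover have "{e \<in> lbox_edges d (Suc n). \<eta> e} \<inter> lbox_edges d n = {e \<in> lbox_edges d n. \<eta> e}"
   by (auto simp: lbox_edges_def lbox_def)
  ultimately show "\<eta> \<in> A n" using y by (simp add: A_def)
 qed
 then have "(\<lambda>n. measure ?B (A n)) \<longlonglongrightarrow> measure ?B (\<Inter>n. A n)" using sets_A by (intro finite_Lim_measure_decseq) auto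
 then show "\<theta> \<longlonglongrightarrow> percolation_prob d p" unfolding meas_A percolation_prob_def eq by simp
 have "measure ?B (\<Inter>n. A n) \<le> measure ?B (A n)" by (rule finite_measure_mono) (use sets_A in auto)
 then show "percolation_prob d p \<le> \<theta> n" unfolding meas_A percolation_prob_def eq .
qed

text \<open>Otherwise \<open>1 - exp (q - p)\<close> would bound the percolation probability from
  below at each \<open>p\<close> above \<open>q\<close>, whereas by the supremum in
  \<open>critical_prob\<close> some such \<open>p\<close> has percolation probability 0.\<close>

lemma exists_dct_phi_less_1:
 assumes q: "0 \<le> q" "q < critical_prob d"
 shows "\<exists>A. finite A \<and> lorig d \<in> A \<and> dct_phi d q A < 1"
proof (rule ccontr)
 assume "\<not> ?thesis"
 then have \<phi>: "1 \<le> dct_phi d q A" if "finite A" "lorig d \<in> A" for A using that by fastforce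
 \<comment> \<open>The value 0 belongs to the set in \<open>critical_prob\<close>; the set is thus
   nonempty and its supremum meaningful.\<close>
 have "percolation_prob d 0 \<le> bern_exp 0 (lbox_edges d 1) (\<lambda>S. of_bool (reaches d 1 S))" by (rule percolation_prob_bounds) auto
 also have "\<dots> = 0" by (simp add: bern_exp_0 finite_lbox_edges reaches_def conn_empty)
 finally have "percolation_prob d 0 = 0" by (simp add: percolation_prob_def antisym)
 then have ne: "{p. 0 \<le> p \<and> p \<le> 1 \<and> percolation_prob d p = 0} \<noteq> {}" by force
 obtain p where p: "0 \<le> p" "p \<le> 1" "percolation_prob d p = 0" "q < p"
  using less_cSupE[OF _ ne] q(2) unfolding critical_prob_def by blast
 have "1 - exp (q - p) \<le> percolation_prob d p"
 proof (rule LIMSEQ_le_const[OF percolation_prob_bounds(1)[OF p(1,2)]])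
  show "\<exists>N. \<forall>n\<ge>N. 1 - exp (q - p) \<le> bern_exp p (lbox_edges d n) (\<lambda>S. of_bool (reaches d n S))"
   using reaches_ge[OF q(1) p(4,2) _ \<phi>] by blast
 qed
 then show False using p by simp
qed

text \<open>Last exit from \<open>C\<close>: the rest of the connection avoids \<open>C\<close>. The
  induction restarts the tail whenever the connection is at a point of \<open>C\<close>.\<close>

lemma conn_exit:
 assumes "(x, w) \<in> conn S" "x \<in> C" "w \<notin> C"
 shows "\<exists>y\<in>C. \<exists>z. z \<notin> C \<and> {y, z} \<in> S \<and> (z, w) \<in> conn {e \<in> S. e \<inter> C = {}}"
proof -
 have "w \<notin> C \<longrightarrow> ?thesis" using assms(1)
 proof (induction rule: conn_induct)
  case refl
  then show ?case using assms(2) by simp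
 next
  case (step y z)
  show ?case
  proof
   assume z: "z \<notin> C"
   show "\<exists>ya\<in>C. \<exists>za. za \<notin> C \<and> {ya, za} \<in> S \<and> (za, z) \<in> conn {e \<in> S. e \<inter> C = {}}"
   proof (cases "y \<in> C")
    case True
    then show ?thesis using step z by (intro bexI[of _ y] exI[of _ z]) auto
   next
    case False
    then have "{y, z} \<in> {e \<in> S. e \<inter> C = {}}" using step z by auto
    then show ?thesis using step False by (meson conn_edge conn_trans)
   qed
  qed
 qed
 then show ?thesis using assms(3) by simp
qed

text \<open>The edge set is arbitrary and the target is everything beyond distance \<open>n\<close>,
  so that the event stays meaningful after deleting a cluster and moving to another starting
  point.\<close>

definition far :: "nat \<Rightarrow> nat \<Rightarrow> int list \<Rightarrow> int list set set \<Rightarrow> bool" where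
 "far d n x S \<longleftrightarrow> (\<exists>y. length y = d \<and> int n \<le> ldist d x y \<and> (x, y) \<in> conn S)"

lemma far_mono: "S \<subseteq> T \<Longrightarrow> far d n x S \<Longrightarrow> far d n x T" unfolding far_def using conn_mono by metis

lemma conn_vadd_image:
 assumes "(x, y) \<in> conn S"
 shows "(vadd z x, vadd z y) \<in> conn ((`) (vadd z) ` S)"
 using assms
proof (induction rule: conn_induct)
 case (step u v)
 then have "{vadd z u, vadd z v} \<in> (`) (vadd z) ` S" by (auto intro: image_eqI[of _ _ "{u, v}"])
 then show ?case using step by (meson conn_edge conn_trans)
qed simp

lemma vadd_inverse:
 "length z = d \<Longrightarrow> length x = d \<Longrightarrow> vadd (map uminus z) (vadd z x) = x"
 by (auto simp: vadd_def intro!: nth_equalityI)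

lemma vadd_image_inverse:
 assumes "length z = d" "\<And>x. x \<in> e \<Longrightarrow> length x = d"
 shows "vadd (map uminus z) ` vadd z ` e = e"
 unfolding image_image using assms by (auto simp: vadd_inverse image_def)

lemma conn_vadd_image_iff:
 assumes z: "length z = d" and S: "S \<subseteq> edges (lattice d)" and xy: "length x = d" "length y = d"
 shows "(vadd z x, vadd z y) \<in> conn ((`) (vadd z) ` S) \<longleftrightarrow> (x, y) \<in> conn S"
proof
 assume "(vadd z x, vadd z y) \<in> conn ((`) (vadd z) ` S)"
 from conn_vadd_image[OF this, of "map uminus z"]
 have "(x, y) \<in> conn ((`) (vadd (map uminus z)) ` (`) (vadd z) ` S)" using vadd_inverse[OF z] xy by simp
 moreover have "(`) (vadd (map uminus z)) ` (`) (vadd z) ` S = S"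
 proof -
  have "vadd (map uminus z) ` vadd z ` e = e" if "e \<in> S" for e
  proof (rule vadd_image_inverse[OF z])
   show "length x = d" if "x \<in> e" for x using \<open>e \<in> S\<close> S that by (auto elim!: lattice_edgeE dest!: subsetD)
  qed
  then show ?thesis by (simp add: image_image)
 qed
 ultimately show "(x, y) \<in> conn S" by simp
qed (rule conn_vadd_image)

lemma vadd_edge_iff:
 assumes "length z = d" "length x = d" "length y = d"
 shows "{vadd z x, vadd z y} \<in> edges (lattice d) \<longleftrightarrow> {x, y} \<in> edges (lattice d)"
 using assms by (simp add: lattice_edge_iff ldist_vadd)

lemma lattice_edges_within_vadd:
 assumes z: "length z = d" and A: "A \<subseteq> {x. length x = d}"
 shows "inner_edges d (vadd z ` A) = (`) (vadd z) ` inner_edges d A"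
proof (intro set_eqI iffI)
 fix e assume "e \<in> inner_edges d (vadd z ` A)"
 then have e: "e \<in> edges (lattice d)" "e \<subseteq> vadd z ` A" by auto
 obtain x y where xy: "e = {x, y}" using e(1) by (auto elim: lattice_edgeE)
 obtain x' y' where x': "x = vadd z x'" "y = vadd z y'" "x' \<in> A" "y' \<in> A" using e xy by auto
 have l: "length x' = d" "length y' = d" using x' A by auto
 have "{x', y'} \<in> edges (lattice d)" using e(1) unfolding xy x' vadd_edge_iff[OF z l] .
 then have "{x', y'} \<in> inner_edges d A" using x' by simp
 moreover have "e = vadd z ` {x', y'}" using xy x' by simp
 ultimately show "e \<in> (`) (vadd z) ` inner_edges d A" by (rule rev_image_eqI)
next
 fix e assume "e \<in> (`) (vadd z) ` inner_edges d A"
 then obtain e' where e': "e' \<in> edges (lattice d)" "e' \<subseteq> A" "e = vadd z ` e'" by auto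
 obtain x y where xy: "e' = {x, y}" "length x = d" "length y = d" using e'(1) by (auto elim: lattice_edgeE)
 have "e \<in> edges (lattice d)" using e' xy vadd_edge_iff[OF z xy(2,3)] by simp
 then show "e \<in> inner_edges d (vadd z ` A)" using e' by auto
qed

lemma inj_on_vadd_edges:
 assumes z: "length z = d"
 shows "inj_on ((`) (vadd z)) (edges (lattice d))"
proof (rule inj_onI)
 fix e e' assume e: "e \<in> edges (lattice d)" "e' \<in> edges (lattice d)" "vadd z ` e = vadd z ` e'"
 have "vadd (map uminus z) ` vadd z ` e = e" if "e \<in> edges (lattice d)" for e
  by (rule vadd_image_inverse[OF z]) (use that in \<open>auto elim!: lattice_edgeE\<close>)
 then show "e = e'" using e by metis
qed

lemma bern_exp_conn_vadd:
 assumes z: "length z = d" and A: "finite A" "A \<subseteq> {x. length x = d}" and x: "x \<in> A" and o: "lorig d \<in> A"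
 shows "bern_exp q (inner_edges d (vadd z ` A)) (\<lambda>S. of_bool ((z, vadd z x) \<in> conn S))
  = bern_exp q (inner_edges d A) (\<lambda>S. of_bool ((lorig d, x) \<in> conn S))"
proof -
 have "bern_exp q (inner_edges d (vadd z ` A)) (\<lambda>S. of_bool ((z, vadd z x) \<in> conn S))
  = bern_exp q (inner_edges d A) (\<lambda>S. of_bool ((z, vadd z x) \<in> conn ((`) (vadd z) ` S)))"
  unfolding lattice_edges_within_vadd[OF z A(2)]
  by (intro bern_exp_image finite_edges_within A inj_on_subset[OF inj_on_vadd_edges[OF z]]) auto
 also have "\<dots> = bern_exp q (inner_edges d A) (\<lambda>S. of_bool ((lorig d, x) \<in> conn S))"
 proof (rule bern_exp_cong)
  fix S assume "S \<subseteq> inner_edges d A"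
  then have "S \<subseteq> edges (lattice d)" by auto
  from conn_vadd_image_iff[OF z this, of "lorig d" x]
  show "of_bool ((z, vadd z x) \<in> conn ((`) (vadd z) ` S)) = of_bool ((lorig d, x) \<in> conn S)" using x A vadd_lorig[OF z] by auto
 qed
 finally show ?thesis .
qed

text \<open>Iteration of the functional. The cluster \<open>C\<close> of \<open>x\<close> inside a
  translate of \<open>A\<close> is explored; the connection leaves \<open>C\<close> for the last
  time through an open boundary edge and then reaches distance \<open>m * R\<close> off
  \<open>C\<close>. The cluster, the edge and the continuation use disjoint edge sets, so each round
  contributes a factor of at most \<open>dct_phi d q A\<close>. Quantifying over all
  \<open>E\<close> lets the induction hypothesis be applied to the edges off
  \<open>C\<close>.\<close>

lemma bern_exp_far_le:
 assumes A: "finite A" "A \<subseteq> {x. length x = d}" "lorig d \<in> A"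
  and q: "0 \<le> q" "q \<le> 1"
  and R: "\<And>x. x \<in> A \<Longrightarrow> ldist d (lorig d) x < int R"
 shows "finite E \<Longrightarrow> E \<subseteq> edges (lattice d) \<Longrightarrow> length x = d \<Longrightarrow>
  bern_exp q E (\<lambda>S. of_bool (far d (m * R) x S)) \<le> dct_phi d q A ^ m"
proof (induction m arbitrary: E x)
 case 0
 then show ?case using q by (auto intro!: bern_exp_le_1)
next
 case (Suc m)
 note E = Suc.prems(1,2) and x = Suc.prems(3)
 define A' where "A' = vadd x ` A"
 define inn where "inn = {e \<in> E. e \<subseteq> A'}"
 define bd where "bd = {(y, z). y \<in> A' \<and> z \<notin> A' \<and> {y, z} \<in> E}"
 define cl where "cl S = {y. (x, y) \<in> conn (S \<inter> inn)}" for S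
 define innC where "innC C = {e \<in> inn. e \<inter> C \<noteq> {}}" for C
 define out where "out C = {e \<in> E. e \<inter> C = {}}" for C
 define \<phi> where "\<phi> = dct_phi d q A"
 let ?E' = "inner_edges d A'" and ?B' = "{(y, z). y \<in> A' \<and> z \<notin> A' \<and> {y, z} \<in> edges (lattice d)}"
 let ?m = "map_prod (vadd (map uminus x)) (vadd (map uminus x))"
 let ?c = "\<lambda>y S. of_bool ((x, y) \<in> conn S)"
 let ?t = "\<lambda>C y z S. of_bool (y \<in> C) * (of_bool (cl (S \<inter> innC C) = C) *
  (of_bool ({y, z} \<in> S) * of_bool (far d (m * R) z (S \<inter> out C)))) :: real"
 have finA': "finite A'" using A by (simp add: A'_def)
 have xA': "x \<in> A'" using vadd_lorig[OF x] A(3) by (metis A'_def imageI)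
 have bd_sub: "bd \<subseteq> ?B'" using E by (auto simp: bd_def)
 have finbd: "finite bd" by (rule finite_subset[OF bd_sub finite_lattice_boundary[OF finA']])
 have clA': "cl S \<subseteq> A'" for S
 proof
  fix y assume "y \<in> cl S"
  then have "(x, y) \<in> conn (S \<inter> inn)" by (simp add: cl_def)
  then show "y \<in> A'" by (induction rule: conn_induct) (auto simp: xA' inn_def)
 qed
 have A'dist: "ldist d x y < int R" if yA: "y \<in> A'" for y
 proof -
  obtain y' where y': "y = vadd x y'" "y' \<in> A" using yA by (auto simp: A'_def)
  have "ldist d (vadd x (lorig d)) (vadd x y') = ldist d (lorig d) y'" using A x y' by (intro ldist_vadd) auto
  then show ?thesis using R[OF y'(2)] y'(1) vadd_lorig[OF x] by simp
 qed
 \<comment> \<open>The event \<open>cl S = C\<close> is decided by the inner edges that touch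
   \<open>C\<close>, which leaves the edges off \<open>C\<close> and the exit edge independent of
   it.\<close>
 have cl_iff: "cl S = C \<longleftrightarrow> cl (S \<inter> innC C) = C" for S C
 proof
  assume C: "cl S = C"
  have "y \<in> cl (S \<inter> innC C)" if "y \<in> cl S" for y
  proof -
   have "(x, y) \<in> conn (S \<inter> inn)" using that by (simp add: cl_def)
   then have "y \<in> cl S \<and> (x, y) \<in> conn (S \<inter> innC C \<inter> inn)"
   proof (rule conn_Int_subset)
    show "x \<in> cl S" by (simp add: cl_def)
    fix u v assume uv: "u \<in> cl S" "{u, v} \<in> S \<inter> inn"
    then have "(x, v) \<in> conn (S \<inter> inn)" unfolding cl_def by (auto intro: conn_trans conn_edge)
    then show "v \<in> cl S \<and> {u, v} \<in> S \<inter> innC C \<inter> inn" using uv C by (auto simp: cl_def innC_def)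
   qed
   then show ?thesis by (simp add: cl_def)
  qed
  moreover have "y \<in> cl S" if "y \<in> cl (S \<inter> innC C)" for y
   using that conn_mono[of "S \<inter> innC C \<inter> inn" "S \<inter> inn" x y] by (auto simp: cl_def)
  ultimately show "cl (S \<inter> innC C) = C" using C by blast
 next
  assume C: "cl (S \<inter> innC C) = C"
  have "y \<in> C" if "y \<in> cl S" for y
  proof -
   have "(x, y) \<in> conn (S \<inter> inn)" using that by (simp add: cl_def)
   then have "y \<in> C \<and> (x, y) \<in> conn (S \<inter> inn)"
   proof (rule conn_Int_subset)
    show "x \<in> C" using C by (auto simp: cl_def)
    fix u v assume uv: "u \<in> C" "{u, v} \<in> S \<inter> inn"
    then have "{u, v} \<in> S \<inter> innC C \<inter> inn" by (auto simp: innC_def)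
    moreover have "(x, u) \<in> conn (S \<inter> innC C \<inter> inn)" using C uv by (auto simp: cl_def)
    ultimately have "(x, v) \<in> conn (S \<inter> innC C \<inter> inn)" by (meson conn_trans conn_edge)
    then show "v \<in> C \<and> {u, v} \<in> S \<inter> inn" using C uv by (auto simp: cl_def)
   qed
   then show ?thesis by simp
  qed
  moreover have "y \<in> cl S" if "y \<in> C" for y
  proof -
   have "y \<in> cl (S \<inter> innC C)" using C that by simp
   then show ?thesis using conn_mono[of "S \<inter> innC C \<inter> inn" "S \<inter> inn" x y] by (auto simp: cl_def)
  qed
  ultimately show "cl S = C" by blast
 qed
 have pointwise: "of_bool (far d (Suc m * R) x S) \<le> (\<Sum>C\<in>Pow A'. \<Sum>(y, z)\<in>bd.
   ?t C y z S :: real)" if SE: "S \<subseteq> E" for S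
 proof (cases "far d (Suc m * R) x S")
  case False
  then show ?thesis by (auto intro!: sum_nonneg)
 next
  case True
  then obtain w where w: "length w = d" "int (Suc m * R) \<le> ldist d x w" "(x, w) \<in> conn S" by (auto simp: far_def)
  have "int R \<le> int (Suc m * R)" by simp
  then have "w \<notin> A'" using A'dist[of w] w(2) by (meson leD order_trans)
  then have "w \<notin> cl S" using clA' by blast
  moreover have "x \<in> cl S" by (simp add: cl_def)
  ultimately obtain y z where yz: "y \<in> cl S" "z \<notin> cl S" "{y, z} \<in> S"
    "(z, w) \<in> conn {e \<in> S. e \<inter> cl S = {}}"
   using conn_exit[OF w(3)] by blast
  have "z \<notin> A'"
  proof
   assume "z \<in> A'"
   then have "{y, z} \<in> S \<inter> inn" using yz clA' SE by (auto simp: inn_def)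
   then have "z \<in> cl S" using yz(1) unfolding cl_def by (auto intro: conn_trans conn_edge)
   then show False using yz by simp
  qed
  then have bd: "(y, z) \<in> bd" using yz clA' SE by (auto simp: bd_def)
  have Sout: "{e \<in> S. e \<inter> cl S = {}} = S \<inter> out (cl S)" using SE by (auto simp: out_def)
  have edge: "length y = d" "length z = d" "ldist d y z = 1" using yz(3) SE E(2) lattice_edge_iff by blast+
  \<comment> \<open>Points of \<open>A'\<close> are at distance less than \<open>R\<close>, so the
    exit point \<open>z\<close> is at distance at most \<open>R\<close> and at least
    \<open>m * R\<close> remains.\<close>
  have "ldist d x z \<le> int R"
  proof -
   have "ldist d x y < int R" using A'dist[of y] yz(1) clA' by blast
   then show ?thesis using ldist_triangle[of d x z y] edge(3) by linarith
  qed
  then have "int (m * R) \<le> ldist d z w" using ldist_triangle[of d x w z] w(2) by simp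
  then have far: "far d (m * R) z (S \<inter> out (cl S))" using yz(4) w(1) unfolding far_def Sout by blast
  have "cl (S \<inter> innC (cl S)) = cl S" using cl_iff[of S "cl S"] by simp
  then have "of_bool (far d (Suc m * R) x S) \<le> ?t (cl S) y z S" using far yz by simp
  also have "\<dots> \<le> (\<Sum>(y, z)\<in>bd. ?t (cl S) y z S)" using member_le_sum[OF bd, of "\<lambda>(y, z). ?t (cl S) y z S"] finbd by auto
  also have "\<dots> \<le> (\<Sum>C\<in>Pow A'. \<Sum>(y, z)\<in>bd. ?t C y z S)"
   using clA' finA' by (intro member_le_sum[of "cl S"]) (auto intro!: sum_nonneg)
  finally show ?thesis .
 qed
 have trm: "bern_exp q E (\<lambda>S. ?t C y z S)
  \<le> \<phi> ^ m * (q * bern_exp q E (\<lambda>S. of_bool (y \<in> C \<and> cl S = C)))"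
  if bd: "(y, z) \<in> bd" for y z C
 proof (cases "y \<in> C")
  case True
  have yz: "{y, z} \<in> E" "z \<notin> A'" "length z = d" using bd bd_sub lattice_edge_iff by (auto simp: bd_def)
  have disj: "{y, z} \<notin> out C" "{y, z} \<notin> innC C" using True yz by (auto simp: out_def innC_def inn_def)
  have fout: "bern_exp q (out C) (\<lambda>S. of_bool (far d (m * R) z S)) \<le> \<phi> ^ m"
   unfolding \<phi>_def by (rule Suc.IH) (use E yz in \<open>auto simp: out_def\<close>)
  have 1: "bern_exp q {{y, z}} (\<lambda>S. of_bool ({y, z} \<in> S)) = q" by (simp add: bern_exp_insert)
  define h where "h S = of_bool ({y, z} \<in> S) * (of_bool (far d (m * R) z (S \<inter> out C)) :: real)" for S
  have "bern_exp q ({{y, z}} \<union> out C) h = bern_exp q ({{y, z}} \<union> out C)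
   (\<lambda>S. of_bool ({y, z} \<in> S \<inter> {{y, z}}) * of_bool (far d (m * R) z (S \<inter> out C)))"
   by (simp add: h_def[abs_def])
  also have "\<dots> = bern_exp q {{y, z}} (\<lambda>S. of_bool ({y, z} \<in> S)) * bern_exp q (out C) (\<lambda>S. of_bool (far d (m * R) z S))"
   using disj E by (intro bern_exp_Un) (auto simp: out_def)
  also have "\<dots> \<le> q * \<phi> ^ m" using fout q(1) unfolding 1 by (rule mult_left_mono)
  finally have h: "bern_exp q ({{y, z}} \<union> out C) h \<le> q * \<phi> ^ m" .
  have hS: "of_bool ({y, z} \<in> S) * of_bool (far d (m * R) z (S \<inter> out C)) = h (S \<inter> ({{y, z}} \<union> out C))" for S
  proof -
   have "S \<inter> ({{y, z}} \<union> out C) \<inter> out C = S \<inter> out C" by auto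
   then show ?thesis by (simp add: h_def)
  qed
  have "bern_exp q E (\<lambda>S. of_bool (cl (S \<inter> innC C) = C) * h (S \<inter> ({{y, z}} \<union> out C)))
   = bern_exp q (innC C) (\<lambda>S. of_bool (cl S = C)) * bern_exp q ({{y, z}} \<union> out C) h"
   using disj E yz by (intro bern_exp_indep) (auto simp: out_def innC_def inn_def)
  also have "\<dots> \<le> bern_exp q (innC C) (\<lambda>S. of_bool (cl S = C)) * (q * \<phi> ^ m)"
   using h q by (intro mult_left_mono bern_exp_nonneg) auto
  also have "bern_exp q (innC C) (\<lambda>S. of_bool (cl S = C)) = bern_exp q E (\<lambda>S. of_bool (cl (S \<inter> innC C) = C))"
   using E by (intro bern_exp_Int[symmetric]) (auto simp: innC_def inn_def)
  also have "\<dots> = bern_exp q E (\<lambda>S. of_bool (cl S = C))" using cl_iff by simp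
  finally show ?thesis using True unfolding hS by (simp add: mult_ac)
 next
  case False
  then show ?thesis by (simp add: bern_exp_const E)
 qed
 have \<phi>0: "0 \<le> \<phi>" unfolding \<phi>_def dct_phi_def using q by (auto intro!: sum_nonneg mult_nonneg_nonneg bern_exp_nonneg)
 have "bern_exp q E (\<lambda>S. of_bool (far d (Suc m * R) x S)) \<le> bern_exp q E (\<lambda>S. \<Sum>C\<in>Pow A'. \<Sum>(y, z)\<in>bd.
   ?t C y z S)"
  by (intro bern_exp_mono q pointwise)
 also have "\<dots> = (\<Sum>C\<in>Pow A'. \<Sum>(y, z)\<in>bd. bern_exp q E (\<lambda>S.
   ?t C y z S))"
  by (simp only: bern_exp_sum case_prod_unfold)
 also have "\<dots> \<le> (\<Sum>C\<in>Pow A'. \<Sum>(y, z)\<in>bd. \<phi> ^ m * (q * bern_exp q E (\<lambda>S. of_bool (y \<in> C \<and> cl S = C))))"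
  by (intro sum_mono, clarify, rule trm)
 also have "\<dots> = (\<Sum>(y, z)\<in>bd. \<Sum>C\<in>Pow A'. \<phi> ^ m * (q * bern_exp q E (\<lambda>S. of_bool (y \<in> C \<and> cl S = C))))"
  by (simp add: case_prod_unfold) (rule sum.swap)
 also have "\<dots> = \<phi> ^ m * (\<Sum>(y, z)\<in>bd. q * bern_exp q E (\<lambda>S. \<Sum>C\<in>Pow A'. of_bool (y \<in> C \<and> cl S = C)))"
  by (simp add: bern_exp_sum sum_distrib_left case_prod_unfold)
 \<comment> \<open>For fixed \<open>S\<close> only \<open>C = cl S\<close> contributes to the sum
   over \<open>C\<close>.\<close>
 also have "\<dots> = \<phi> ^ m * (\<Sum>(y, z)\<in>bd. q * bern_exp q E (\<lambda>S. of_bool (y \<in> cl S)))"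
 proof -
  have "(\<Sum>C\<in>Pow A'. of_bool (y \<in> C \<and> cl S = C)) = (of_bool (y \<in> cl S) :: real)" for y S
  proof -
   have "(\<Sum>C\<in>Pow A'. of_bool (y \<in> C \<and> cl S = C)) = (\<Sum>C\<in>Pow A'. if C = cl S then of_bool (y \<in> cl S) else (0::real))"
    by (intro sum.cong) auto
   also have "\<dots> = of_bool (y \<in> cl S)" using finA' clA' by (subst sum.delta) auto
   finally show ?thesis .
  qed
  then show ?thesis by simp
 qed
 \<comment> \<open>Passing from \<open>E\<close> to all lattice edges inside \<open>A'\<close> only
   enlarges the probabilities; the translation back to \<open>A\<close> then gives the functional
   itself.\<close>
 also have "\<dots> \<le> \<phi> ^ m * (\<Sum>(y, z)\<in>bd. q * bern_exp q ?E' (?c y))"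
 proof (intro mult_left_mono sum_mono, clarify, intro mult_left_mono)
  fix y
  have "bern_exp q E (\<lambda>S. of_bool (y \<in> cl S)) = bern_exp q inn (?c y)"
   unfolding cl_def mem_Collect_eq using E by (intro bern_exp_Int) (auto simp: inn_def)
  also have "\<dots> = bern_exp q ?E' (\<lambda>S. of_bool ((x, y) \<in> conn (S \<inter> inn)))"
   using E finA' by (intro bern_exp_Int[symmetric] finite_edges_within) (auto simp: inn_def)
  also have "\<dots> \<le> bern_exp q ?E' (?c y)" by (intro bern_exp_mono q of_bool_conn_mono) auto
  finally show "bern_exp q E (\<lambda>S. of_bool (y \<in> cl S))
    \<le> bern_exp q ?E' (?c y)" .
 qed (use q \<phi>0 in auto)
 also have "\<dots> \<le> \<phi> ^ m * (\<Sum>(y, z)\<in>?B'.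
   q * bern_exp q ?E' (?c y))"
  using q \<phi>0 bd_sub finite_lattice_boundary[OF finA']
  by (intro mult_left_mono sum_mono2) (auto intro!: mult_nonneg_nonneg bern_exp_nonneg)
 also have "(\<Sum>(y, z)\<in>?B'.
   q * bern_exp q ?E' (?c y)) = \<phi>"
  unfolding \<phi>_def dct_phi_def
 proof (rule sum.reindex_bij_witness[where j = ?m and i = "map_prod (vadd x) (vadd x)"])
  have inv: "vadd x (vadd (map uminus x) y) = y" if "length y = d" for y
   using vadd_inverse[of "map uminus x" d y] x that by (simp add: comp_def)
  have lenA: "length y = d" if "y \<in> A" for y using A(2) that by auto
  have lenA': "length y = d" if "y \<in> A'" for y using lenA x that by (auto simp: A'_def)
  fix a assume "a \<in> ?B'"
  then obtain y z where a: "a = (y, z)" "y \<in> A'" "z \<notin> A'" "{y, z} \<in> edges (lattice d)" by auto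
  have l: "length y = d" "length z = d" using a(4) by (auto simp: lattice_edge_iff)
  show "map_prod (vadd x) (vadd x) (?m a) = a" using a l by (simp add: inv)
  obtain y' where y': "y = vadd x y'" "y' \<in> A" using a(2) unfolding A'_def by blast
  have vy: "vadd (map uminus x) y = y'" using y' vadd_inverse[OF x lenA[OF y'(2)]] by simp
  have "vadd (map uminus x) z \<notin> A" using a(3) inv[OF l(2)] by (metis A'_def imageI)
  moreover have "{vadd (map uminus x) y, vadd (map uminus x) z} \<in> edges (lattice d)"
   using a(4) x l by (subst vadd_edge_iff) auto
  ultimately show "?m a
    \<in> {(x, y). x \<in> A \<and> y \<notin> A \<and> {x, y} \<in> edges (lattice d)}"
   using a y' vy by auto
  show "(case ?m a of (xa, y) \<Rightarrow>
    q * bern_exp q (inner_edges d A) (\<lambda>S. of_bool ((lorig d, xa) \<in> conn S)))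
   = (case a of (y, z) \<Rightarrow> q * bern_exp q ?E' (?c y))"
   using bern_exp_conn_vadd[OF x A(1,2) y'(2) A(3), of q] by (simp add: a vy y'(1)[symmetric] A'_def)
 next
  have lenA: "length y = d" if "y \<in> A" for y using A(2) that by auto
  fix b assume "b \<in> {(x, y). x \<in> A \<and> y \<notin> A \<and> {x, y} \<in> edges (lattice d)}"
  then obtain y z where b: "b = (y, z)" "y \<in> A" "z \<notin> A" "{y, z} \<in> edges (lattice d)" by auto
  have l: "length y = d" "length z = d" using b(4) by (auto simp: lattice_edge_iff)
  show "?m (map_prod (vadd x) (vadd x) b) = b" using b l x by (simp add: vadd_inverse)
  have "vadd x z \<notin> A'"
  proof
   assume "vadd x z \<in> A'"
   then obtain z' where z': "vadd x z = vadd x z'" "z' \<in> A" unfolding A'_def by blast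
   then have "z = z'" using inj_onD[OF inj_on_vadd[OF x]] l lenA by blast
   then show False using b z' by simp
  qed
  then show "map_prod (vadd x) (vadd x) b \<in> ?B'" using b vadd_edge_iff[OF x l] by (auto simp: A'_def)
 qed
 finally show ?case by (simp add: \<phi>_def mult.commute)
qed

lemma subcritical_decay:
 assumes q: "0 \<le> q" "q < critical_prob d" "q \<le> 1"
 obtains R \<rho> where "0 < R" "0 \<le> \<rho>" "\<rho> < 1"
  "\<And>E x m. finite E \<Longrightarrow> E \<subseteq> edges (lattice d) \<Longrightarrow> length x = d \<Longrightarrow>
   bern_exp q E (\<lambda>S. of_bool (far d (m * R) x S)) \<le> \<rho> ^ m"
proof -
 obtain A0 where A0: "finite A0" "lorig d \<in> A0" "dct_phi d q A0 < 1" using exists_dct_phi_less_1[OF q(1,2)] by blast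
 \<comment> \<open>Lists of a wrong length carry no lattice edges, so removing them from
   \<open>A0\<close> does not change the functional and makes translations available.\<close>
 define A where "A = A0 \<inter> {x. length x = d}"
 have "dct_phi d q A = dct_phi d q A0"
 proof -
  have "{(x, y). x \<in> A \<and> y \<notin> A \<and> {x, y} \<in> edges (lattice d)} = {(x, y). x \<in> A0 \<and> y \<notin> A0 \<and> {x, y} \<in> edges (lattice d)}"
   by (auto simp: A_def lattice_edge_iff)
  moreover have "inner_edges d A = inner_edges d A0" by (auto simp: A_def elim: lattice_edgeE)
  ultimately show ?thesis by (simp add: dct_phi_def)
 qed
 moreover have A: "finite A" "A \<subseteq> {x. length x = d}" "lorig d \<in> A" using A0 by (auto simp: A_def)
 define R where "R = nat (Max (ldist d (lorig d) ` A)) + 1"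
 have R: "ldist d (lorig d) x < int R" if "x \<in> A" for x
 proof -
  have "ldist d (lorig d) x \<le> Max (ldist d (lorig d) ` A)" using A that by auto
  then show ?thesis unfolding R_def by linarith
 qed
 have "0 \<le> dct_phi d q A" unfolding dct_phi_def using q by (auto intro!: sum_nonneg mult_nonneg_nonneg bern_exp_nonneg)
 ultimately show thesis using that[of R "dct_phi d q A"] A0(3) bern_exp_far_le[OF A q(1,3) R] by (simp add: R_def)
qed

section \<open>Square-integrable random variables\<close>

context prob_space
begin

definition l2norm :: "('a \<Rightarrow> real) \<Rightarrow> real" where
 "l2norm X = sqrt (expectation (\<lambda>x. (X x)^2))"

definition square_int :: "('a \<Rightarrow> real) \<Rightarrow> bool" where
 "square_int X \<longleftrightarrow> random_variable borel X \<and> integrable M (\<lambda>x. (X x)^2)"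

lemma l2norm_nonneg [simp]: "0 \<le> l2norm X" by (simp add: l2norm_def)

lemma l2norm_sq: "(l2norm X)^2 = expectation (\<lambda>x. (X x)^2)" by (simp add: l2norm_def)

lemma square_int_measurable: "square_int X \<Longrightarrow> random_variable borel X" by (simp add: square_int_def)

lemma square_int_integrable: "square_int X \<Longrightarrow> integrable M X"
 unfolding square_int_def by (auto intro: square_integrable_imp_integrable)

lemma integrable_bounded_by:
 fixes f g :: "'a \<Rightarrow> real"
 assumes "integrable M g" "random_variable borel f" "\<And>x. x \<in> space M \<Longrightarrow> abs (f x) \<le> g x"
 shows "integrable M f"
 by (rule Bochner_Integration.integrable_bound[OF assms(1,2)]) (use assms(3) in fastforce)

lemma square_int_add:
 assumes "square_int X" "square_int Y"
 shows "square_int (\<lambda>x. X x + Y x)"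
 unfolding square_int_def
proof
 have [measurable]: "random_variable borel X" "random_variable borel Y" using assms by (auto simp: square_int_def)
 show "random_variable borel (\<lambda>x. X x + Y x)" by measurable
 show "integrable M (\<lambda>x. (X x + Y x)^2)"
 proof (rule integrable_bounded_by)
  show "integrable M (\<lambda>x. 2 * (X x)^2 + 2 * (Y x)^2)" using assms by (auto simp: square_int_def)
  show "abs ((X x + Y x)^2) \<le> 2 * (X x)^2 + 2 * (Y x)^2" for x
  proof -
   have "abs ((X x + Y x)^2) = (X x + Y x)^2" by (rule abs_of_nonneg) simp
   then show ?thesis using sum_squares_bound[of "X x" "Y x"] by (simp add: power2_sum)
  qed
 qed measurable
qed

lemma square_int_cmult: "square_int X \<Longrightarrow> square_int (\<lambda>x. c * X x)" by (auto simp: square_int_def power_mult_distrib)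

lemma square_int_uminus: "square_int X \<Longrightarrow> square_int (\<lambda>x. - X x)" by (auto simp: square_int_def)

lemma square_int_const: "square_int (\<lambda>x. c)" by (auto simp: square_int_def)

lemma square_int_diff: "square_int X \<Longrightarrow> square_int Y \<Longrightarrow> square_int (\<lambda>x. X x - Y x)"
 using square_int_add[OF _ square_int_uminus, of X Y] by simp

lemma square_int_sum: "(\<And>i. i \<in> I \<Longrightarrow> square_int (X i)) \<Longrightarrow> square_int (\<lambda>x. \<Sum>i\<in>I. X i x)"
 by (induction I rule: infinite_finite_induct) (auto intro: square_int_add square_int_const)

lemma square_int_bounded_by:
 assumes "square_int Y" "random_variable borel X" "\<And>x. x \<in> space M \<Longrightarrow> abs (X x) \<le> Y x"
 shows "square_int X"
 unfolding square_int_def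
proof
 show "integrable M (\<lambda>x. (X x)^2)"
 proof (rule integrable_bounded_by)
  show "integrable M (\<lambda>x. (Y x)^2)" using assms by (simp add: square_int_def)
  show "abs ((X x)^2) \<le> (Y x)^2" if "x \<in> space M" for x using assms(3)[OF that] by (simp add: abs_le_square_iff[symmetric])
 qed (use assms(2) in measurable)
qed fact

lemma square_int_mult_integrable:
 assumes "square_int X" "square_int Y"
 shows "integrable M (\<lambda>x. X x * Y x)"
proof (rule integrable_bounded_by)
 have [measurable]: "random_variable borel X" "random_variable borel Y" using assms by (auto simp: square_int_def)
 show "integrable M (\<lambda>x. (X x)^2 + (Y x)^2)" using assms by (auto simp: square_int_def)
 show "random_variable borel (\<lambda>x. X x * Y x)" by measurable
 show "abs (X x * Y x) \<le> (X x)^2 + (Y x)^2" for x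
 proof -
  have "0 \<le> abs (X x) * abs (Y x)" by simp
  then show ?thesis using sum_squares_bound[of "abs (X x)" "abs (Y x)"] unfolding abs_mult power2_abs by linarith
 qed
qed

lemma expectation_mult_le_l2norm:
 assumes "square_int X" "square_int Y"
 shows "expectation (\<lambda>x. X x * Y x) \<le> l2norm X * l2norm Y"
proof -
 note [measurable] = assms[THEN square_int_measurable]
 have int: "integrable M (\<lambda>x. X x * Y x)" by (rule square_int_mult_integrable[OF assms])
 have sq: "(\<integral>\<^sup>+x. (ennreal (abs (Z x)))^2 \<partial>M) = ennreal (expectation (\<lambda>x. (Z x)^2))" if "square_int Z" for Z
  using that by (subst nn_integral_eq_integral[symmetric]) (auto simp: square_int_def ennreal_power)
 have "(\<integral>\<^sup>+x. ennreal (abs (X x)) * ennreal (abs (Y x)) \<partial>M)^2 \<le> ennreal (expectation (\<lambda>x. (X x)^2)) * ennreal (expectation (\<lambda>x. (Y x)^2))"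
  unfolding sq[OF assms(1), symmetric] sq[OF assms(2), symmetric] by (intro Cauchy_Schwarz_nn_integral) auto
 also have "(\<integral>\<^sup>+x. ennreal (abs (X x)) * ennreal (abs (Y x)) \<partial>M) = ennreal (expectation (\<lambda>x. abs (X x * Y x)))"
  using integrable_abs[OF int] by (subst nn_integral_eq_integral[symmetric]) (auto simp: abs_mult ennreal_mult)
 finally have "(expectation (\<lambda>x. abs (X x * Y x)))^2 \<le> (l2norm X * l2norm Y)^2"
  by (simp add: ennreal_power power_mult_distrib l2norm_sq flip: ennreal_mult)
 then have "expectation (\<lambda>x. abs (X x * Y x)) \<le> l2norm X * l2norm Y" by (rule power2_le_imp_le) simp
 moreover have "expectation (\<lambda>x. X x * Y x) \<le> expectation (\<lambda>x. abs (X x * Y x))" using int by (intro integral_mono) auto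
 ultimately show ?thesis by simp
qed

lemma l2norm_add_sq:
 assumes "square_int X" "square_int Y"
 shows "(l2norm (\<lambda>x. X x + Y x))^2 = (l2norm X)^2 + (l2norm Y)^2 + 2 * expectation (\<lambda>x. X x * Y x)"
 using assms square_int_mult_integrable[OF assms] by (simp add: l2norm_sq power2_sum square_int_def mult.assoc)

lemma l2norm_triangle:
 assumes "square_int X" "square_int Y"
 shows "l2norm (\<lambda>x. X x + Y x) \<le> l2norm X + l2norm Y"
proof (rule power2_le_imp_le)
 show "(l2norm (\<lambda>x. X x + Y x))^2 \<le> (l2norm X + l2norm Y)^2"
  using expectation_mult_le_l2norm[OF assms] by (simp add: l2norm_add_sq[OF assms] power2_sum)
qed simp

lemma l2norm_cmult: "l2norm (\<lambda>x. c * X x) = abs c * l2norm X" by (simp add: l2norm_def power_mult_distrib real_sqrt_mult)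

lemma l2norm_uminus: "l2norm (\<lambda>x. - X x) = l2norm X" by (simp add: l2norm_def)

lemma l2norm_diff_triangle:
 assumes "square_int X" "square_int Y"
 shows "l2norm (\<lambda>x. X x - Y x) \<le> l2norm X + l2norm Y"
 using l2norm_triangle[OF assms(1) square_int_uminus[OF assms(2)]] by (simp add: l2norm_uminus)

lemma l2norm_mono:
 assumes "square_int Y" "random_variable borel X" "\<And>x. x \<in> space M \<Longrightarrow> abs (X x) \<le> Y x"
 shows "l2norm X \<le> l2norm Y"
 unfolding l2norm_def
proof (intro real_sqrt_le_mono integral_mono)
 show "integrable M (\<lambda>x. (X x)^2)" using square_int_bounded_by[OF assms] by (simp add: square_int_def)
 show "integrable M (\<lambda>x. (Y x)^2)" using assms by (simp add: square_int_def)
 show "(X x)^2 \<le> (Y x)^2" if "x \<in> space M" for x using assms(3)[OF that] by (simp add: abs_le_square_iff[symmetric])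
qed

lemma expectation_abs_le_l2norm:
 assumes "square_int X"
 shows "expectation (\<lambda>x. abs (X x)) \<le> l2norm X"
proof -
 have "square_int (\<lambda>x. abs (X x))" using assms by (auto simp: square_int_def)
 from expectation_mult_le_l2norm[OF this square_int_const[of 1]]
 show ?thesis by (simp add: l2norm_def prob_space)
qed

definition centered :: "('a \<Rightarrow> real) \<Rightarrow> 'a \<Rightarrow> real" where
 "centered X x = X x - expectation X"

definition sdev :: "('a \<Rightarrow> real) \<Rightarrow> real" where
 "sdev X = l2norm (centered X)"

lemma sdev_nonneg [simp]: "0 \<le> sdev X" by (simp add: sdev_def)

lemma sdev_eq_sqrt_variance: "sdev X = sqrt (variance X)" by (simp add: sdev_def l2norm_def centered_def)

lemma sdev_sq: "(sdev X)^2 = variance X" by (simp add: sdev_eq_sqrt_variance)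

lemma square_int_centered: "square_int X \<Longrightarrow> square_int (centered X)"
 unfolding centered_def[abs_def] by (intro square_int_diff square_int_const)

lemma centered_add:
 "square_int X \<Longrightarrow> square_int Y \<Longrightarrow> centered (\<lambda>x. X x + Y x) = (\<lambda>x. centered X x + centered Y x)"
 by (auto simp: centered_def square_int_integrable fun_eq_iff)

lemma centered_diff:
 "square_int X \<Longrightarrow> square_int Y \<Longrightarrow> centered (\<lambda>x. X x - Y x) = (\<lambda>x. centered X x - centered Y x)"
 by (auto simp: centered_def square_int_integrable fun_eq_iff)

lemma centered_sum:
 "(\<And>i. i \<in> I \<Longrightarrow> square_int (X i)) \<Longrightarrow> centered (\<lambda>x. \<Sum>i\<in>I. X i x) = (\<lambda>x. \<Sum>i\<in>I. centered (X i) x)"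
 by (auto simp: centered_def square_int_integrable sum_subtractf fun_eq_iff)

lemma expectation_centered: "square_int X \<Longrightarrow> expectation (centered X) = 0"
 by (simp add: centered_def[abs_def] square_int_integrable prob_space)

lemma sdev_triangle:
 "square_int X \<Longrightarrow> square_int Y \<Longrightarrow> sdev (\<lambda>x. X x + Y x) \<le> sdev X + sdev Y"
 unfolding sdev_def by (simp add: centered_add l2norm_triangle square_int_centered)

lemma sdev_diff_triangle:
 "square_int X \<Longrightarrow> square_int Y \<Longrightarrow> sdev (\<lambda>x. X x - Y x) \<le> sdev X + sdev Y"
 unfolding sdev_def by (simp add: centered_diff l2norm_diff_triangle square_int_centered)

lemma sdev_le_l2norm:
 assumes "square_int X"
 shows "sdev X \<le> l2norm X"
proof (rule power2_le_imp_le)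
 show "(sdev X)^2 \<le> (l2norm X)^2" using assms unfolding sdev_sq l2norm_sq
  by (subst variance_eq) (auto simp: square_int_integrable square_int_def)
qed simp

lemma sdev_add_indep:
 assumes "square_int X" "square_int Y" "indep_var borel X borel Y"
 shows "(sdev (\<lambda>x. X x + Y x))^2 = (sdev X)^2 + (sdev Y)^2"
proof -
 have "indep_var borel (\<lambda>x. X x - expectation X) borel (\<lambda>x. Y x - expectation Y)"
  using indep_var_compose[OF assms(3), of "\<lambda>u. u - expectation X" borel "\<lambda>u. u - expectation Y" borel] by (simp add: comp_def)
 then have "indep_var borel (centered X) borel (centered Y)" unfolding centered_def[abs_def] .
 then have "expectation (\<lambda>x. centered X x * centered Y x) = expectation (centered X) * expectation (centered Y)"
  by (intro indep_var_lebesgue_integral square_int_integrable square_int_centered assms)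
 then show ?thesis using assms unfolding sdev_def
  by (simp add: centered_add l2norm_add_sq square_int_centered expectation_centered)
qed

end

section \<open>Characteristic functions and Lyapunov's criterion\<close>

lemma weak_conv_m_cong_eventually:
 assumes "eventually (\<lambda>n. P n = Q n) sequentially" "weak_conv_m P N"
 shows "weak_conv_m Q N"
 unfolding weak_conv_m_def weak_conv_def
proof (intro allI impI)
 fix x assume "isCont (cdf N) x"
 then have "(\<lambda>n. cdf (P n) x) \<longlonglongrightarrow> cdf N x" using assms(2) by (simp add: weak_conv_m_def weak_conv_def)
 moreover have "eventually (\<lambda>n. cdf (P n) x = cdf (Q n) x) sequentially" using assms(1) by eventually_elim simp
 ultimately show "(\<lambda>n. cdf (Q n) x) \<longlonglongrightarrow> cdf N x" by (rule Lim_transform_eventually)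
qed

lemma cmod_iexp_diff_le: "cmod (iexp a - iexp b) \<le> abs (a - b)"
proof -
 have "iexp a - iexp b = iexp b * (iexp (a - b) - 1)" by (simp add: right_diff_distrib exp_diff)
 then have "cmod (iexp a - iexp b) = cmod (iexp (a - b) - 1)" by (simp add: norm_mult)
 also have "\<dots> \<le> abs (a - b)" using iexp_approx1[of "a - b" 0] by simp
 finally show ?thesis .
qed

context prob_space
begin

text \<open>Errors that are small in L2 are invisible to characteristic functions because
  \<open>iexp\<close> is 1-Lipschitz.\<close>

lemma char_diff_le_l2norm:
 assumes "square_int X" "square_int Y"
 shows "cmod (char (distr M borel X) t - char (distr M borel Y) t) \<le> abs t * l2norm (\<lambda>x. X x - Y x)"
proof -
 have [measurable]: "random_variable borel X" "random_variable borel Y" using assms by (auto simp: square_int_def)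
 have int: "integrable M (\<lambda>x. iexp (t * X x))" "integrable M (\<lambda>x. iexp (t * Y x))"
  by (auto intro!: integrable_const_bound[where B=1])
 have sq: "square_int (\<lambda>x. X x - Y x)" by (rule square_int_diff[OF assms])
 have "char (distr M borel X) t - char (distr M borel Y) t = (CLINT x|M. iexp (t * X x) - iexp (t * Y x))"
  unfolding char_def using int by (simp add: integral_distr)
 also have "cmod \<dots> \<le> expectation (\<lambda>x. cmod (iexp (t * X x) - iexp (t * Y x)))" by simp
 also have "\<dots> \<le> expectation (\<lambda>x. abs t * abs (X x - Y x))"
 proof (rule integral_mono)
  show "integrable M (\<lambda>x. cmod (iexp (t * X x) - iexp (t * Y x)))" using int by simp
  show "integrable M (\<lambda>x. abs t * abs (X x - Y x))" using square_int_integrable[OF sq] by auto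
  show "cmod (iexp (t * X x) - iexp (t * Y x)) \<le> abs t * abs (X x - Y x)" for x using cmod_iexp_diff_le[of "t * X x" "t * Y x"]
   by (simp add: right_diff_distrib[symmetric] abs_mult)
 qed
 also have "\<dots> = abs t * expectation (\<lambda>x. abs (X x - Y x))" by simp
 also have "\<dots> \<le> abs t * l2norm (\<lambda>x. X x - Y x)" by (intro mult_left_mono expectation_abs_le_l2norm[OF sq]) auto
 finally show ?thesis .
qed

text \<open>The Taylor remainder is the minimum of a quadratic and a cubic term. Below the level
  \<open>\<eta>\<close> the cubic one is used; above it the square is at most
  \<open>\<eta> powr (2 - p)\<close> times the p-th power. This works for every
  \<open>p > 2\<close>, also below 3.\<close>

lemma char_normalized_summand_approx:
 assumes X: "square_int X" "expectation X = 0" and N: "N > 0"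
  and p: "p > 2" and int: "integrable M (\<lambda>x. abs (X x) powr p)"
  and \<eta>: "\<eta> > 0"
 shows "cmod (char (distr M borel (\<lambda>x. X x / N)) t - (1 - t^2 * (expectation (\<lambda>x. (X x)^2) / N^2) / 2))
  \<le> t^2 / 6 * (abs t * \<eta> * (expectation (\<lambda>x. (X x)^2) / N^2)
    + 6 * \<eta> powr (2 - p) * (expectation (\<lambda>x. abs (X x) powr p) / N powr p))"
proof -
 have [measurable]: "random_variable borel X" using X by (simp add: square_int_def)
 define Y where "Y x = X x / N" for x
 have [measurable]: "random_variable borel Y" unfolding Y_def by simp
 have Ysq: "square_int Y" using square_int_cmult[OF X(1), of "1 / N"] by (simp add: Y_def[abs_def])
 have EY: "expectation Y = 0" using X by (simp add: Y_def[abs_def])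
 have EY2: "expectation (\<lambda>x. (Y x)^2) = expectation (\<lambda>x. (X x)^2) / N^2" by (simp add: Y_def power_divide)
 have Yp: "abs (Y x) powr p = abs (X x) powr p / N powr p" for x using N by (simp add: Y_def powr_divide)
 have "cmod (char (distr M borel Y) t - (1 - t^2 * expectation (\<lambda>x. (Y x)^2) / 2))
   \<le> t^2 / 6 * expectation (\<lambda>x. min (6 * (Y x)^2) (abs t * abs (Y x) ^ 3))"
  using Ysq EY by (intro char_approx3') (auto simp: square_int_integrable square_int_def)
 also have "\<dots> \<le> t^2 / 6 * expectation (\<lambda>x. abs t * \<eta> * (Y x)^2 + 6 * \<eta> powr (2 - p) * abs (Y x) powr p)"
 proof (intro mult_left_mono integral_mono')
  show "integrable M (\<lambda>x. abs t * \<eta> * (Y x)^2 + 6 * \<eta> powr (2 - p) * abs (Y x) powr p)"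
   unfolding Yp using Ysq int by (auto simp: square_int_def)
  fix x
  show "min (6 * (Y x)^2) (abs t * abs (Y x) ^ 3) \<le> abs t * \<eta> * (Y x)^2 + 6 * \<eta> powr (2 - p) * abs (Y x) powr p"
  proof (cases "abs (Y x) \<le> \<eta>")
   case True
   have "abs t * abs (Y x) ^ 3 = abs t * abs (Y x) * (Y x)^2" by (simp add: power3_eq_cube power2_eq_square)
   also have "\<dots> \<le> abs t * \<eta> * (Y x)^2" using True by (intro mult_right_mono mult_left_mono) auto
   finally show ?thesis by (intro min.coboundedI2 add_increasing2) (auto simp del: power_abs)
  next
   case False
   have "1 \<le> (abs (Y x) / \<eta>) powr (p - 2)" using False \<eta> p by (intro ge_one_powr_ge_zero) auto
   then have "(Y x)^2 * 1 \<le> (Y x)^2 * (abs (Y x) / \<eta>) powr (p - 2)" by (intro mult_left_mono) auto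
   also have "(abs (Y x) / \<eta>) powr (p - 2) = abs (Y x) powr (p - 2) * \<eta> powr (2 - p)"
    by (simp add: powr_divide powr_diff field_simps)
   also have "(Y x)^2 = abs (Y x) powr 2" by simp
   also have "abs (Y x) powr 2 * (abs (Y x) powr (p - 2) * \<eta> powr (2 - p)) = \<eta> powr (2 - p) * abs (Y x) powr p"
    using powr_add[of "abs (Y x)" 2 "p - 2"] by simp
   finally have "(Y x)^2 \<le> \<eta> powr (2 - p) * abs (Y x) powr p" by simp
   then show ?thesis using \<eta> by (intro min.coboundedI1 add_increasing) auto
  qed
 qed (use \<eta> in \<open>auto intro!: add_nonneg_nonneg mult_nonneg_nonneg\<close>)
 also have "expectation (\<lambda>x. abs t * \<eta> * (Y x)^2 + 6 * \<eta> powr (2 - p) * abs (Y x) powr p)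
   = abs t * \<eta> * expectation (\<lambda>x. (Y x)^2) + 6 * \<eta> powr (2 - p) * (expectation (\<lambda>x. abs (X x) powr p) / N powr p)"
  unfolding Yp using Ysq int by (subst Bochner_Integration.integral_add) (auto simp: square_int_def)
 finally show ?thesis unfolding EY2 by (simp add: Y_def[abs_def])
qed

text \<open>The summands of a row share one variance, so every factor is compared with the same
  number 1 - t^2 / (2 m), and the product with its m-th power.\<close>

lemma lyapunov_char_limit:
 fixes X :: "nat \<Rightarrow> nat \<Rightarrow> 'a \<Rightarrow> real" and m :: "nat \<Rightarrow> nat"
 assumes ev: "eventually (\<lambda>n. indep_vars (\<lambda>_. borel) (X n) {..<m n} \<and> v n > 0 \<and>
   (\<forall>i<m n. square_int (X n i) \<and> expectation (X n i) = 0 \<and> expectation (\<lambda>x. (X n i x)^2) = v n \<and>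
    integrable M (\<lambda>x. abs (X n i x) powr p) \<and> expectation (\<lambda>x. abs (X n i x) powr p) \<le> \<beta> n)) sequentially"
  and p: "p > 2" and m: "filterlim m at_top sequentially"
  and lim: "(\<lambda>n. \<beta> n / v n powr (p / 2) * real (m n) powr (1 - p / 2)) \<longlonglongrightarrow> 0"
 shows "(\<lambda>n. char (distr M borel (\<lambda>x. (\<Sum>i<m n. X n i x) / sqrt (real (m n) * v n))) t)
  \<longlonglongrightarrow> char std_normal_distribution t"
proof -
 define S where "S n x = (\<Sum>i<m n. X n i x) / sqrt (real (m n) * v n)" for n x
 define \<gamma> where "\<gamma> n = \<beta> n / v n powr (p / 2) * real (m n) powr (1 - p / 2)" for n
 have bound: "eventually (\<lambda>n. cmod (char (distr M borel (S n)) t - (1 + (- (t^2) / 2) / real (m n)) ^ m n)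
   \<le> t^2 / 6 * (abs t * \<eta> + 6 * \<eta> powr (2 - p) * \<gamma> n)) sequentially" if \<eta>: "\<eta> > 0" for \<eta>
  using ev filterlim_at_top[THEN iffD1, rule_format, OF m, of "nat \<lceil>t^2 / 4\<rceil> + 1"]
 proof eventually_elim
  case (elim n)
  then have indep: "indep_vars (\<lambda>_. borel) (X n) {..<m n}" and v: "v n > 0"
   and X: "\<And>i. i < m n \<Longrightarrow> square_int (X n i)" "\<And>i. i < m n \<Longrightarrow> expectation (X n i) = 0"
    "\<And>i. i < m n \<Longrightarrow> expectation (\<lambda>x. (X n i x)^2) = v n"
    "\<And>i. i < m n \<Longrightarrow> integrable M (\<lambda>x. abs (X n i x) powr p)"
    "\<And>i. i < m n \<Longrightarrow> expectation (\<lambda>x. abs (X n i x) powr p) \<le> \<beta> n"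
   and mn: "nat \<lceil>t^2 / 4\<rceil> + 1 \<le> m n" by auto
  define N where "N = sqrt (real (m n) * v n)"
  have m0: "real (m n) > 0" using mn by simp
  have N: "N > 0" using m0 v by (simp add: N_def)
  have Nsq: "N^2 = real (m n) * v n" using m0 v by (simp add: N_def)
  have Np: "N powr p = real (m n) powr (p / 2) * v n powr (p / 2)"
   using m0 v by (simp add: N_def powr_half_sqrt[symmetric] powr_powr powr_mult)
  have mt: "t^2 / 4 \<le> real (m n)" using mn by linarith
  define w where "w = (1 + (- (t^2) / 2) / real (m n))"
  \<comment> \<open>The condition t^2 / 4 \<le> m is exactly what keeps 1 - t^2 / (2 m) at or above
    -1.\<close>
  have w1: "cmod (complex_of_real w) \<le> 1"
   using mt m0 by (simp add: w_def abs_le_iff field_simps del: of_real_add of_real_divide)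
  have "S n = (\<lambda>x. \<Sum>i<m n. X n i x / N)" by (simp add: S_def[abs_def] N_def sum_divide_distrib)
  then have "char (distr M borel (S n)) t = (\<Prod>i<m n. char (distr M borel (\<lambda>x. X n i x / N)) t)"
   by (simp, intro char_distr_sum indep_vars_compose2[OF indep]) auto
  then have "cmod (char (distr M borel (S n)) t - complex_of_real w ^ m n)
   = cmod ((\<Prod>i<m n. char (distr M borel (\<lambda>x. X n i x / N)) t) - (\<Prod>i<m n. complex_of_real w))"
   by simp
  also have "\<dots> \<le> (\<Sum>i<m n. cmod (char (distr M borel (\<lambda>x. X n i x / N)) t - complex_of_real w))"
  proof (rule norm_prod_diff)
   fix i assume "i \<in> {..<m n}"
   then have [measurable]: "random_variable borel (X n i)" using X(1) by (auto simp: square_int_def)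
   interpret D: real_distribution "distr M borel (\<lambda>x. X n i x / N)"
    by simp
   show "cmod (char (distr M borel (\<lambda>x. X n i x / N)) t) \<le> 1" by (rule D.cmod_char_le_1)
  qed (rule w1)
  also have "\<dots> \<le> (\<Sum>i<m n. t^2 / 6 * (abs t * \<eta> * (1 / real (m n)) + 6 * \<eta> powr (2 - p) * (\<beta> n / N powr p)))"
  proof (rule sum_mono)
   fix i assume i: "i \<in> {..<m n}"
   have e: "expectation (\<lambda>x. (X n i x)^2) / N^2 = 1 / real (m n)" using X(3) i v m0 by (simp add: Nsq)
   have "cmod (char (distr M borel (\<lambda>x. X n i x / N)) t - complex_of_real w)
    \<le> t^2 / 6 * (abs t * \<eta> * (1 / real (m n)) + 6 * \<eta> powr (2 - p) * (expectation (\<lambda>x. abs (X n i x) powr p) / N powr p))"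
   proof -
    have "w = 1 - t^2 * (1 / real (m n)) / 2" by (simp add: w_def)
    then show ?thesis using char_normalized_summand_approx[OF _ _ N p _ \<eta>, of "X n i" t] X i unfolding e by simp
   qed
   also have "\<dots> \<le> t^2 / 6 * (abs t * \<eta> * (1 / real (m n)) + 6 * \<eta> powr (2 - p) * (\<beta> n / N powr p))"
    using X(5) i by (intro mult_left_mono add_left_mono divide_right_mono) auto
   finally show "cmod (char (distr M borel (\<lambda>x. X n i x / N)) t - complex_of_real w)
    \<le> t^2 / 6 * (abs t * \<eta> * (1 / real (m n)) + 6 * \<eta> powr (2 - p) * (\<beta> n / N powr p))" .
  qed
  also have "\<dots> = t^2 / 6 * (abs t * \<eta> + 6 * \<eta> powr (2 - p) * (real (m n) * (\<beta> n / N powr p)))"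
   using m0 by (simp add: algebra_simps)
  also have "real (m n) * (\<beta> n / N powr p) = \<gamma> n"
  proof -
   have "real (m n) powr (1 - p / 2) = real (m n) / real (m n) powr (p / 2)" by (simp only: powr_diff powr_one)
   then show ?thesis unfolding \<gamma>_def Np by (simp add: mult.commute)
  qed
  finally show ?case by (simp add: w_def)
 qed
 have "(\<lambda>n. char (distr M borel (S n)) t - (1 + (- (t^2) / 2) / real (m n)) ^ m n) \<longlonglongrightarrow> 0"
 proof (rule tendstoI)
  fix e :: real assume e: "e > 0"
  \<comment> \<open>This \<open>\<eta>\<close> makes the cubic part at most e / 6; with
    \<open>\<eta>\<close> fixed, the other part tends to 0 with the Lyapunov ratio.\<close>
  define \<eta> where "\<eta> = e / (abs t ^ 3 + 1)"
  have \<eta>: "\<eta> > 0" using e by (simp add: \<eta>_def add_nonneg_pos)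
  have t3: "t^2 / 6 * (abs t * \<eta>) \<le> e / 6"
  proof -
   have "t^2 * abs t = abs t ^ 3" by (simp add: power3_eq_cube power2_eq_square)
   then have "t^2 / 6 * (abs t * \<eta>) = e / 6 * (abs t ^ 3 / (abs t ^ 3 + 1))" by (simp add: \<eta>_def)
   also have "\<dots> \<le> e / 6 * 1" using e by (intro mult_left_mono) (auto simp: divide_le_eq_1 add_nonneg_pos)
   finally show ?thesis by simp
  qed
  have "(\<lambda>n. t^2 / 6 * (6 * \<eta> powr (2 - p) * \<gamma> n)) \<longlonglongrightarrow> t^2 / 6 * (6 * \<eta> powr (2 - p) * 0)"
   using lim by (intro tendsto_intros) (simp add: \<gamma>_def)
  then have "eventually (\<lambda>n. t^2 / 6 * (6 * \<eta> powr (2 - p) * \<gamma> n) < e / 2) sequentially"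
   by (rule order_tendstoD(2)) (use e in simp)
  with bound[OF \<eta>] show "eventually (\<lambda>n. dist (char (distr M borel (S n)) t - (1 + (- (t^2) / 2) / real (m n)) ^ m n) 0 < e) sequentially"
  proof eventually_elim
   case (elim n)
   then show ?case using t3 e by (simp add: distrib_left)
  qed
 qed
 moreover have "(\<lambda>n. complex_of_real ((1 + (- (t^2) / 2) / real (m n)) ^ m n)) \<longlonglongrightarrow> complex_of_real (exp (- (t^2) / 2))"
  by (intro tendsto_of_real filterlim_compose[OF tendsto_exp_limit_sequentially m])
 ultimately have "(\<lambda>n. (char (distr M borel (S n)) t - (1 + (- (t^2) / 2) / real (m n)) ^ m n)
   + complex_of_real ((1 + (- (t^2) / 2) / real (m n)) ^ m n)) \<longlonglongrightarrow> 0 + complex_of_real (exp (- (t^2) / 2))"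
  by (rule tendsto_add)
 then show ?thesis by (simp add: S_def[abs_def] char_std_normal_distribution)
qed

lemma expectation_sum_sq_indep:
 fixes X :: "'i \<Rightarrow> 'a \<Rightarrow> real"
 assumes I: "finite I" and ind: "indep_vars (\<lambda>_. borel) X I"
  and X: "\<And>i. i \<in> I \<Longrightarrow> square_int (X i)" "\<And>i. i \<in> I \<Longrightarrow> expectation (X i) = 0"
   "\<And>i. i \<in> I \<Longrightarrow> expectation (\<lambda>x. (X i x)^2) = v"
 shows "expectation (\<lambda>x. (\<Sum>i\<in>I. X i x)^2) = real (card I) * v"
proof -
 have "expectation (\<lambda>x. (\<Sum>i\<in>J. X i x)^2) = real (card J) * v" if "J \<subseteq> I" for J using finite_subset[OF that I] that
 proof (induction J rule: finite_induct)
  case (insert i J)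
  have J: "J \<subseteq> I" "i \<in> I" using insert by auto
  have sqs: "square_int (X i)" "square_int (\<lambda>x. \<Sum>j\<in>J. X j x)" using X J by (auto intro!: square_int_sum)
  have ij: "indep_var borel (X i) borel (\<lambda>x. \<Sum>j\<in>J. X j x)"
   using indep_vars_subset[OF ind, of "insert i J"] insert by (intro indep_vars_sum) auto
  have "expectation (\<lambda>x. X i x * (\<Sum>j\<in>J. X j x)) = expectation (X i) * expectation (\<lambda>x. \<Sum>j\<in>J. X j x)"
   by (intro indep_var_lebesgue_integral ij square_int_integrable sqs)
  then have z: "expectation (\<lambda>x. X i x * (\<Sum>j\<in>J. X j x)) = 0" using X J by simp
  have "expectation (\<lambda>x. (\<Sum>j\<in>insert i J. X j x)^2) = (l2norm (\<lambda>x. X i x + (\<Sum>j\<in>J. X j x)))^2"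
   using insert by (simp add: l2norm_sq)
  also have "\<dots> = v + real (card J) * v" unfolding l2norm_add_sq[OF sqs] z using X insert J by (simp add: l2norm_sq)
  finally show ?case using insert by (simp add: algebra_simps)
 qed simp
 then show ?thesis by simp
qed

text \<open>An L2 error that is small relative to the standard deviation of the sum also forces the
  standard deviations of \<open>Y n\<close> and of the sum to be asymptotically equal, so the
  normalisation by that of \<open>Y n\<close> is harmless.\<close>

lemma asymptotically_normal_if_approx:
 fixes X :: "nat \<Rightarrow> nat \<Rightarrow> 'a \<Rightarrow> real" and m :: "nat \<Rightarrow> nat"
 assumes ev: "eventually (\<lambda>n. indep_vars (\<lambda>_. borel) (X n) {..<m n} \<and> v n > 0 \<and>
   (\<forall>i<m n. square_int (X n i) \<and> expectation (X n i) = 0 \<and> expectation (\<lambda>x. (X n i x)^2) = v n \<and>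
    integrable M (\<lambda>x. abs (X n i x) powr p) \<and> expectation (\<lambda>x. abs (X n i x) powr p) \<le> \<beta> n)) sequentially"
  and p: "p > 2" and m: "filterlim m at_top sequentially"
  and lim: "(\<lambda>n. \<beta> n / v n powr (p / 2) * real (m n) powr (1 - p / 2)) \<longlonglongrightarrow> 0"
  and Y: "eventually (\<lambda>n. square_int (Y n)) sequentially"
  and approx: "(\<lambda>n. l2norm (\<lambda>x. centered (Y n) x - (\<Sum>i<m n. X n i x)) / sqrt (real (m n) * v n)) \<longlonglongrightarrow> 0"
 shows "asymptotically_normal Y"
proof -
 define S where "S n x = (\<Sum>i<m n. X n i x)" for n x
 define N where "N n = sqrt (real (m n) * v n)" for n
 define good where "good n \<longleftrightarrow> square_int (Y n) \<and> v n > 0 \<and> m n > 0 \<and> indep_vars (\<lambda>_. borel) (X n) {..<m n} \<and>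
  (\<forall>i<m n. square_int (X n i) \<and> expectation (X n i) = 0 \<and> expectation (\<lambda>x. (X n i x)^2) = v n)" for n
 define r where "r n = l2norm (\<lambda>x. centered (Y n) x - S n x) / N n" for n
 have good: "eventually good sequentially" using ev Y filterlim_at_top[THEN iffD1, rule_format, OF m, of 1]
  by eventually_elim (auto simp: good_def)
 have r: "r \<longlonglongrightarrow> 0" using approx by (simp add: r_def[abs_def] S_def N_def)
 have Sq: "square_int (S n)" if "good n" for n using that unfolding S_def[abs_def] good_def by (intro square_int_sum) auto
 have Nn: "N n > 0" if "good n" for n using that by (simp add: N_def good_def)
 have lS: "l2norm (S n) = N n" if g: "good n" for n using expectation_sum_sq_indep[of "{..<m n}" "X n" "v n"] g
  by (simp add: l2norm_def S_def N_def good_def)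
 have sd: "abs (sdev (Y n) - N n) \<le> r n * N n" if g: "good n" for n
 proof -
  have c: "square_int (centered (Y n))" using g by (auto simp: good_def intro: square_int_centered)
  have d: "square_int (\<lambda>x. centered (Y n) x - S n x)" by (rule square_int_diff[OF c Sq[OF g]])
  have "sdev (Y n) \<le> l2norm (\<lambda>x. centered (Y n) x - S n x) + l2norm (S n)"
   unfolding sdev_def using l2norm_triangle[OF d Sq[OF g]] by simp
  moreover have "l2norm (S n) \<le> sdev (Y n) + l2norm (\<lambda>x. centered (Y n) x - S n x)"
   unfolding sdev_def using l2norm_diff_triangle[OF c d] by simp
  moreover have "r n * N n = l2norm (\<lambda>x. centered (Y n) x - S n x)" using Nn[OF g] by (simp add: r_def)
  ultimately show ?thesis using lS[OF g] by linarith
 qed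
 define Yn where "Yn n x = (Y n x - expectation (Y n)) / sqrt (variance (Y n))" for n x
 have main: "cmod (char (distr M borel (Yn n)) t - char (distr M borel (\<lambda>x. S n x / N n)) t) \<le> abs t * (2 * r n)"
  if g: "good n" and r1: "r n < 1" for n t
 proof -
  define s where "s = sdev (Y n)"
  have s: "s > 0" using sd[OF g] r1 Nn[OF g] unfolding s_def by (smt (verit) mult_less_cancel_right2)
  have Yn: "Yn n = (\<lambda>x. 1 / s * centered (Y n) x)" by (simp add: Yn_def[abs_def] centered_def s_def sdev_eq_sqrt_variance)
  have c: "square_int (centered (Y n))" using g by (auto simp: good_def intro: square_int_centered)
  have d: "square_int (\<lambda>x. centered (Y n) x - S n x)" by (rule square_int_diff[OF c Sq[OF g]])
  have sqY: "square_int (Yn n)" unfolding Yn by (rule square_int_cmult[OF c])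
  have sqS: "square_int (\<lambda>x. S n x / N n)" using square_int_cmult[OF Sq[OF g], of "1 / N n"] by simp
  have eq: "(\<lambda>x. Yn n x - S n x / N n) = (\<lambda>x. (1 / s - 1 / N n) * centered (Y n) x + 1 / N n * (centered (Y n) x - S n x))"
   unfolding Yn by (auto simp: algebra_simps diff_divide_distrib)
  have "l2norm (\<lambda>x. Yn n x - S n x / N n) \<le> l2norm (\<lambda>x. (1 / s - 1 / N n) * centered (Y n) x)
    + l2norm (\<lambda>x. 1 / N n * (centered (Y n) x - S n x))"
   unfolding eq by (intro l2norm_triangle square_int_cmult c d)
  also have "l2norm (\<lambda>x. (1 / s - 1 / N n) * centered (Y n) x) = abs (1 / s - 1 / N n) * s"
   unfolding l2norm_cmult by (simp add: s_def sdev_def)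
  also have "\<dots> = abs (N n - s) / N n"
  proof -
   have "1 / s - 1 / N n = (N n - s) / (s * N n)" using s Nn[OF g] by (simp add: field_simps)
   then show ?thesis using s Nn[OF g] by (simp add: abs_mult)
  qed
  also have "\<dots> \<le> r n" using sd[OF g] Nn[OF g] by (simp add: s_def divide_le_eq abs_minus_commute)
  also have "l2norm (\<lambda>x. 1 / N n * (centered (Y n) x - S n x)) = r n" unfolding l2norm_cmult using Nn[OF g] by (simp add: r_def)
  finally have "l2norm (\<lambda>x. Yn n x - S n x / N n) \<le> 2 * r n" by simp
  then show ?thesis using char_diff_le_l2norm[OF sqY sqS, of t] mult_left_mono[of _ "2 * r n" "abs t"] by force
 qed
 \<comment> \<open>Levy's continuity theorem wants a distribution for every \<open>n\<close>; the
   finitely many bad indices get the limit law.\<close>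
 define P where "P n = (if good n then distr M borel (Yn n) else std_normal_distribution)" for n
 have "weak_conv_m P std_normal_distribution"
 proof (rule levy_continuity)
  show "real_distribution (P n)" for n
  proof (cases "good n")
   case True
   then have [measurable]: "random_variable borel (Y n)" by (simp add: good_def square_int_def)
   show ?thesis using True unfolding P_def Yn_def by (auto intro!: real_distribution_distr)
  qed (simp add: P_def real_dist_normal_dist)
  show "real_distribution std_normal_distribution" by (rule real_dist_normal_dist)
  fix t
  have 1: "eventually (\<lambda>n. cmod (char (P n) t - char (distr M borel (\<lambda>x. S n x / N n)) t) \<le> abs t * (2 * r n)) sequentially"
   using good order_tendstoD(2)[OF r zero_less_one] by eventually_elim (simp add: P_def main)
  have "(\<lambda>n. abs t * (2 * r n)) \<longlonglongrightarrow> (abs t) * (2 * 0)" by (intro tendsto_intros r)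
  then have 2: "(\<lambda>n. abs t * (2 * r n)) \<longlonglongrightarrow> 0" by simp
  have "(\<lambda>n. char (P n) t - char (distr M borel (\<lambda>x. S n x / N n)) t) \<longlonglongrightarrow> 0" by (rule Lim_null_comparison[OF 1 2])
  from tendsto_add[OF this lyapunov_char_limit[OF ev p m lim, of t]]
  show "(\<lambda>n. char (P n) t) \<longlonglongrightarrow> char std_normal_distribution t" by (simp add: S_def N_def)
 qed
 moreover have "eventually (\<lambda>n. P n = distr M borel (Yn n)) sequentially" using good by eventually_elim (simp add: P_def)
 ultimately show ?thesis unfolding asymptotically_normal_def Yn_def[abs_def] by (rule weak_conv_m_cong_eventually[rotated])
qed

end

section \<open>Inequalities for p-th powers and p-integrable variables\<close>

lemma one_plus_powr_le:
 assumes "0 < p" "0 < \<eta>"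
 obtains \<delta> :: real where "0 < \<delta>" "\<delta> \<le> 1" "(1 + \<delta>) powr p \<le> 1 + \<eta>"
proof -
 define \<delta> where "\<delta> = min 1 (ln (1 + \<eta>) / p)"
 have \<delta>: "0 < \<delta>" "\<delta> \<le> 1" using assms by (auto simp: \<delta>_def)
 have "(1 + \<delta>) powr p \<le> exp \<delta> powr p" using \<delta> assms by (intro powr_mono2) auto
 also have "\<dots> = exp (\<delta> * p)" by (simp add: powr_def mult.commute)
 also have "\<dots> \<le> exp (ln (1 + \<eta>))"
 proof -
  have "\<delta> * p \<le> ln (1 + \<eta>) / p * p" using assms by (intro mult_right_mono) (auto simp: \<delta>_def)
  also have "ln (1 + \<eta>) / p * p = ln (1 + \<eta>)" using assms by simp
  finally show ?thesis by (simp only: exp_le_cancel_iff)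
 qed
 finally show ?thesis using that \<delta> assms by simp
qed

lemma abs_add_powr_scale:
 fixes x y :: real
 assumes "0 < p" "0 \<le> \<delta>" "abs y \<le> \<delta> * abs x"
 shows "abs (x + y) powr p \<le> (1 + \<delta>) powr p * abs x powr p"
proof -
 have "abs (x + y) \<le> (1 + \<delta>) * abs x" using assms(3) by (simp add: distrib_right)
 then have "abs (x + y) powr p \<le> ((1 + \<delta>) * abs x) powr p" using assms by (intro powr_mono2) auto
 then show ?thesis unfolding powr_mult .
qed

lemma abs_add_powr_le_left:
 assumes "0 < p" "0 < \<eta>"
 obtains C :: real where "0 < C"
  "\<And>x y. abs (x + y) powr p \<le> (1 + \<eta>) * abs x powr p + C * abs y powr p"
proof -
 obtain \<delta> where \<delta>: "0 < \<delta>" "(1 + \<delta>) powr p \<le> 1 + \<eta>" using one_plus_powr_le[OF assms] by metis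
 have "0 < 1 + 1 / \<delta>" using \<delta> by (intro add_pos_pos) auto
 then have C: "0 < (1 + 1 / \<delta>) powr p" by simp
 have "abs (x + y) powr p \<le> (1 + \<eta>) * abs x powr p + (1 + 1 / \<delta>) powr p * abs y powr p" for x y :: real
 proof (cases "abs y \<le> \<delta> * abs x")
  case True
  then have "abs (x + y) powr p \<le> (1 + \<delta>) powr p * abs x powr p" using assms \<delta> by (intro abs_add_powr_scale) auto
  also have "\<dots> \<le> (1 + \<eta>) * abs x powr p" using \<delta> by (intro mult_right_mono) auto
  finally show ?thesis using C by (simp add: add_increasing2)
 next
  case False
  then show ?thesis
   using abs_add_powr_scale[of p "1 / \<delta>" x y] assms \<delta> by (intro add_increasing) (auto simp: add.commute field_simps)
 qed
 with C show ?thesis by (rule that)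
qed

lemma powr_minus_one_mult: "0 \<le> x \<Longrightarrow> x powr (p - 1) * x = x powr p" for x p :: real by (cases "x = 0") (auto simp: powr_diff)

text \<open>The coefficient of both p-th powers must be close to 1, since it becomes the growth
  factor under doubling. The mixed term is linear in \<open>y\<close>, so that after integrating
  over an independent \<open>y\<close> only its first absolute moment appears.\<close>

lemma abs_add_powr_le:
 assumes "1 < p" "0 < \<eta>"
 obtains C :: real where "0 < C"
  "\<And>x y. abs (x + y) powr p \<le> (1 + \<eta>) * (abs x powr p + abs y powr p) + C * (abs x powr (p - 1) * abs y)"
proof -
 obtain \<delta> where \<delta>: "0 < \<delta>" "(1 + \<delta>) powr p \<le> 1 + \<eta>" using one_plus_powr_le[of p \<eta>] assms by (metis less_trans zero_less_one)
 define C where "C = (1 + 1 / \<delta>) powr p / \<delta>"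
 have "0 < 1 + 1 / \<delta>" using \<delta> by (intro add_pos_pos) auto
 then have C: "0 < C" using \<delta> by (simp add: C_def)
 have small: "abs (x + y) powr p \<le> (1 + \<eta>) * abs x powr p" if "abs y \<le> \<delta> * abs x" for x y :: real
  using abs_add_powr_scale[of p \<delta> y x] mult_right_mono[OF \<delta>(2), of "abs x powr p"] assms \<delta> that by simp
 show ?thesis
 proof (rule that[OF C])
  fix x y :: real
  have nn: "0 \<le> (1 + \<eta>) * abs x powr p" "0 \<le> (1 + \<eta>) * abs y powr p" "0 \<le> C * (abs x powr (p - 1) * abs y)"
   using assms C by auto
  \<comment> \<open>If one variable dominates, the other costs only the factor
    \<open>1 + \<eta>\<close>; if they are comparable, the p-th power of the sum is bounded by the
    mixed term.\<close>
  consider "abs y \<le> \<delta> * abs x" | "abs x \<le> \<delta> * abs y" | "abs y > \<delta> * abs x" "abs x > \<delta> * abs y" by linarith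
  then show "abs (x + y) powr p \<le> (1 + \<eta>) * (abs x powr p + abs y powr p) + C * (abs x powr (p - 1) * abs y)"
  proof cases
   case 1
   then show ?thesis using small[OF 1] nn unfolding distrib_left by linarith
  next
   case 2
   then show ?thesis using small[OF 2] nn unfolding distrib_left add.commute[of y x] by linarith
  next
   case 3
   have "abs (x + y) powr p \<le> (1 + 1 / \<delta>) powr p * (abs x powr (p - 1) * abs x)"
    unfolding powr_minus_one_mult[OF abs_ge_zero] using 3 assms \<delta> by (intro abs_add_powr_scale) (auto simp: field_simps)
   also have "\<dots> \<le> (1 + 1 / \<delta>) powr p * (abs x powr (p - 1) * (abs y / \<delta>))"
    using 3 \<delta> by (intro mult_left_mono) (auto simp: field_simps)
   also have "\<dots> = C * (abs x powr (p - 1) * abs y)" by (simp add: C_def)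
   finally show ?thesis using nn by (simp add: distrib_left)
  qed
 qed
qed

text \<open>The tangent at 1, obtained from Young's inequality; it replaces derivative arguments for
  real powers below.\<close>

lemma powr_ge_tangent:
 fixes t q :: real
 assumes "0 \<le> t" "1 \<le> q"
 shows "1 + q * (t - 1) \<le> t powr q"
proof (cases "t = 0")
 case False
 then have "(t powr q) powr (1 / q) * 1 powr (1 - 1 / q) \<le> 1 / q * t powr q + (1 - 1 / q) * 1"
  using assms by (intro Youngs_inequality_0) auto
 then have "q * t \<le> q * (1 / q * t powr q + (1 - 1 / q) * 1)" using assms by (simp add: powr_powr)
 then show ?thesis using assms by (simp add: algebra_simps)
qed (use assms in simp)

lemma young_powr:
 assumes "1 < p" "0 < \<eta>"
 obtains C :: real where "0 < C" "\<And>x v. 0 \<le> v \<Longrightarrow> abs x powr (p - 1) * v \<le> \<eta> * abs x powr p + C * v powr p"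
proof -
 show ?thesis
 proof (rule that)
  show "0 < (1 / \<eta>) powr (p - 1)" using assms by simp
  fix x v :: real assume v: "0 \<le> v"
  show "abs x powr (p - 1) * v \<le> \<eta> * abs x powr p + (1 / \<eta>) powr (p - 1) * v powr p"
  proof (cases "v \<le> \<eta> * abs x")
   case True
   then have "abs x powr (p - 1) * v \<le> abs x powr (p - 1) * (\<eta> * abs x)" by (intro mult_left_mono) auto
   also have "\<dots> = \<eta> * abs x powr p" using powr_minus_one_mult[of "abs x" p] by (simp add: mult.left_commute)
   finally show ?thesis using assms by (intro add_increasing2) auto
  next
   case False
   then have "abs x powr (p - 1) * v \<le> (1 / \<eta> * v) powr (p - 1) * v"
    using assms v by (intro mult_right_mono powr_mono2) (auto simp: field_simps)
   also have "\<dots> = (1 / \<eta>) powr (p - 1) * v powr p" using powr_minus_one_mult[OF v, of p] by (simp only: powr_mult mult.assoc)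
   finally show ?thesis using assms by (intro add_increasing) auto
  qed
 qed
qed

lemma abs_add_powr_le_two:
 fixes x y :: real
 assumes "0 < p"
 shows "abs (x + y) powr p \<le> 2 powr p * (abs x powr p + abs y powr p)"
proof -
 have "abs (x + y) powr p \<le> (2 * max (abs x) (abs y)) powr p" using assms by (intro powr_mono2) auto
 also have "\<dots> = 2 powr p * max (abs x) (abs y) powr p" by (rule powr_mult)
 also have "\<dots> \<le> 2 powr p * (abs x powr p + abs y powr p)" by (intro mult_left_mono) (auto simp: max_def)
 finally show ?thesis .
qed

context prob_space
begin

definition p_int :: "real \<Rightarrow> ('a \<Rightarrow> real) \<Rightarrow> bool" where
 "p_int p X \<longleftrightarrow> random_variable borel X \<and> integrable M (\<lambda>x. abs (X x) powr p)"

lemma p_int_add: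
 assumes "0 < p" "p_int p X" "p_int p Y"
 shows "p_int p (\<lambda>x. X x + Y x)"
 unfolding p_int_def
proof
 have [measurable]: "random_variable borel X" "random_variable borel Y" using assms by (auto simp: p_int_def)
 show "random_variable borel (\<lambda>x. X x + Y x)" by measurable
 show "integrable M (\<lambda>x. abs (X x + Y x) powr p)"
 proof (rule integrable_bounded_by)
  show "integrable M (\<lambda>x. 2 powr p * (abs (X x) powr p + abs (Y x) powr p))" using assms by (auto simp: p_int_def)
 qed (use abs_add_powr_le_two[OF assms(1)] in auto)
qed

lemma p_int_const: "p_int p (\<lambda>_. c)" by (simp add: p_int_def)

lemma p_int_uminus: "p_int p X \<Longrightarrow> p_int p (\<lambda>x. - X x)" by (simp add: p_int_def)

lemma p_int_diff: "0 < p \<Longrightarrow> p_int p X \<Longrightarrow> p_int p Y \<Longrightarrow> p_int p (\<lambda>x. X x - Y x)" using p_int_add[OF _ _ p_int_uminus, of p X Y] by simp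

lemma p_int_centered: "0 < p \<Longrightarrow> p_int p X \<Longrightarrow> p_int p (centered X)" unfolding centered_def[abs_def] by (intro p_int_diff p_int_const)

lemma p_int_le_exponent:
 assumes "0 < r" "r \<le> p" "p_int p X"
 shows "p_int r X"
 unfolding p_int_def
proof
 have [measurable]: "random_variable borel X" using assms by (auto simp: p_int_def)
 show "random_variable borel X" by measurable
 show "integrable M (\<lambda>x. abs (X x) powr r)"
 proof (rule integrable_bounded_by)
  show "integrable M (\<lambda>x. 1 + abs (X x) powr p)" using assms by (auto simp: p_int_def)
  show "abs (abs (X x) powr r) \<le> 1 + abs (X x) powr p" for x
  proof (cases "abs (X x) \<le> 1")
   case True
   then have "abs (X x) powr r \<le> 1 powr r" using assms by (intro powr_mono2) auto
   then show ?thesis by (simp add: add_increasing2)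
  next
   case False
   then have "abs (X x) powr r \<le> abs (X x) powr p" using assms by (intro powr_mono) auto
   then show ?thesis by simp
  qed
 qed measurable
qed

lemma p_int_imp_square_int:
 assumes "2 \<le> p" "p_int p X"
 shows "square_int X"
proof -
 have "abs (X x) powr 2 = (X x)^2" for x by (cases "X x = 0") simp_all
 then show ?thesis using p_int_le_exponent[of 2 p X] assms by (simp add: p_int_def square_int_def)
qed

end

section \<open>Abstract block processes\<close>

lemma sum_lessThan_add: "(\<Sum>i<m + n. f i) = (\<Sum>i<m. f i) + (\<Sum>i<n. f (m + i))"
 for f :: "nat \<Rightarrow> 'b::comm_monoid_add"
 by (induction n) (simp_all add: add.assoc)

lemma obtain_power_two_between:
 fixes m :: nat
 assumes "m \<ge> 1"
 obtains J where "m \<le> 2 ^ J" "2 ^ J \<le> 2 * m"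
proof -
 define J where "J = (LEAST J. m \<le> 2 ^ J)"
 have ex: "m \<le> 2 ^ m" by simp
 then have 1: "m \<le> 2 ^ J" unfolding J_def by (rule LeastI)
 have "2 ^ J \<le> 2 * m"
 proof (cases J)
  case 0 then show ?thesis using assms by simp
 next
  case (Suc k)
  then have "\<not> m \<le> 2 ^ k" using not_less_Least[of k "\<lambda>J. m \<le> 2 ^ J"] unfolding J_def by simp
  then show ?thesis using Suc by simp
 qed
 with 1 show ?thesis by (rule that)
qed

text \<open>An axiomatic tube: \<open>\<tau> a b\<close> stands for the crossing time of a slab,
  \<open>D a b\<close> for the variables determined by that slab, and \<open>\<Delta>\<close> bounds
  the junction error both in L2 and in Lp. Closing \<open>D\<close> under sums and differences keeps
  the accumulated junction errors of neighbouring stretches independent.\<close>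

locale block_process = prob_space M for M :: "'a measure" +
 fixes \<tau> :: "nat \<Rightarrow> nat \<Rightarrow> 'a \<Rightarrow> real"
  and D :: "nat \<Rightarrow> nat \<Rightarrow> ('a \<Rightarrow> real) set"
  and p \<Delta> :: real
 assumes p: "p > 2" and \<Delta>: "\<Delta> > 0"
  and \<tau>_D: "a < b \<Longrightarrow> \<tau> a b \<in> D a b"
  and D_add: "X \<in> D a b \<Longrightarrow> Y \<in> D a b \<Longrightarrow> (\<lambda>x. X x + Y x) \<in> D a b"
  and D_diff: "X \<in> D a b \<Longrightarrow> Y \<in> D a b \<Longrightarrow> (\<lambda>x. X x - Y x) \<in> D a b"
  and D_mono: "a' \<le> a \<Longrightarrow> b \<le> b' \<Longrightarrow> D a b \<subseteq> D a' b'"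
  and D_indep: "X \<in> D a b \<Longrightarrow> Y \<in> D b c \<Longrightarrow> indep_var borel X borel Y"
  and blocks_indep: "l > 0 \<Longrightarrow> indep_vars (\<lambda>_. borel) (\<lambda>i. \<tau> (i * l) (i * l + l)) {..<m}"
  and \<tau>_distr: "l > 0 \<Longrightarrow> distr M borel (\<tau> a (a + l)) = distr M borel (\<tau> 0 l)"
  and \<tau>_p: "a < b \<Longrightarrow> p_int p (\<tau> a b)"
  and err_l2: "a < b \<Longrightarrow> b < c \<Longrightarrow> l2norm (\<lambda>x. \<tau> a c x - \<tau> a b x - \<tau> b c x) \<le> \<Delta>"
  and err_p: "a < b \<Longrightarrow> b < c \<Longrightarrow> expectation (\<lambda>x. abs (\<tau> a c x - \<tau> a b x - \<tau> b c x) powr p) \<le> \<Delta> powr p"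
begin

definition err :: "nat \<Rightarrow> nat \<Rightarrow> nat \<Rightarrow> 'a \<Rightarrow> real" where
 "err a b c x = \<tau> a c x - \<tau> a b x - \<tau> b c x"

definition pmom :: "nat \<Rightarrow> real" where
 "pmom l = expectation (\<lambda>x. abs (centered (\<tau> 0 l) x) powr p)"

definition sd :: "nat \<Rightarrow> real" where
 "sd l = sdev (\<tau> 0 l)"

lemma \<tau>_sq: "a < b \<Longrightarrow> square_int (\<tau> a b)" using p_int_imp_square_int[OF _ \<tau>_p] p by simp

lemma \<tau>_measurable [measurable]: "a < b \<Longrightarrow> random_variable borel (\<tau> a b)" using \<tau>_p by (simp add: p_int_def)

lemma err_sq: "a < b \<Longrightarrow> b < c \<Longrightarrow> square_int (err a b c)" unfolding err_def[abs_def] by (intro square_int_diff \<tau>_sq) auto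

lemma expectation_shift:
 assumes "l > 0" "g \<in> borel_measurable borel"
 shows "expectation (\<lambda>x. g (\<tau> a (a + l) x)) = expectation (\<lambda>x. g (\<tau> 0 l x) :: real)"
proof -
 have "expectation (\<lambda>x. g (\<tau> a (a + l) x)) = integral\<^sup>L (distr M borel (\<tau> a (a + l))) g"
  using assms by (intro integral_distr[symmetric]) auto
 also have "\<dots> = expectation (\<lambda>x. g (\<tau> 0 l x))" unfolding \<tau>_distr[OF assms(1)] using assms by (intro integral_distr) auto
 finally show ?thesis .
qed

lemma mean_shift: "l > 0 \<Longrightarrow> expectation (\<tau> a (a + l)) = expectation (\<tau> 0 l)" using expectation_shift[of l "\<lambda>x. x" a] by simp

lemma sdev_shift: "l > 0 \<Longrightarrow> sdev (\<tau> a (a + l)) = sd l" unfolding sd_def sdev_eq_sqrt_variance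
 using expectation_shift[of l "\<lambda>x. (x - expectation (\<tau> 0 l))^2" a] by (simp add: mean_shift)

lemma pmom_shift: "l > 0 \<Longrightarrow> expectation (\<lambda>x. abs (centered (\<tau> a (a + l)) x) powr p) = pmom l" unfolding pmom_def centered_def
 using expectation_shift[of l "\<lambda>x. abs (x - expectation (\<tau> 0 l)) powr p" a] by (simp add: mean_shift)

lemma pmom_nonneg: "0 \<le> pmom l" by (simp add: pmom_def)

lemma sdev_err: "a < b \<Longrightarrow> b < c \<Longrightarrow> sdev (err a b c) \<le> \<Delta>"
 using sdev_le_l2norm[OF err_sq, of a b c] err_l2[of a b c] by (simp add: err_def[abs_def])

text \<open>Standard deviations are almost monotone in the length: appending an independent stretch
  cannot decrease the variance, and the junction costs at most \<open>\<Delta>\<close>. This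
  controls an incomplete last block.\<close>

lemma sd_add_le:
 assumes "0 < k" "0 < l"
 shows "sd k \<le> sd (k + l) + \<Delta>"
proof -
 have sq: "square_int (\<tau> 0 k)" "square_int (\<tau> k (k + l))" "square_int (\<tau> 0 (k + l))" using assms by (auto intro: \<tau>_sq)
 have "indep_var borel (\<tau> 0 k) borel (\<tau> k (k + l))" using assms by (intro D_indep[of _ 0 k _ "k + l"] \<tau>_D) auto
 then have "(sdev (\<lambda>x. \<tau> 0 k x + \<tau> k (k + l) x))^2 = (sd k)^2 + (sd l)^2"
  using assms sq by (subst sdev_add_indep) (auto simp: sdev_shift sd_def)
 then have "(sd k)^2 \<le> (sdev (\<lambda>x. \<tau> 0 k x + \<tau> k (k + l) x))^2" by simp
 then have "sd k \<le> sdev (\<lambda>x. \<tau> 0 k x + \<tau> k (k + l) x)" by (rule power2_le_imp_le) simp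
 also have "(\<lambda>x. \<tau> 0 k x + \<tau> k (k + l) x) = (\<lambda>x. \<tau> 0 (k + l) x - err 0 k (k + l) x)" by (simp add: err_def)
 also have "sdev \<dots> \<le> sd (k + l) + sdev (err 0 k (k + l))"
  unfolding sd_def using assms sq by (intro sdev_diff_triangle err_sq) auto
 also have "\<dots> \<le> sd (k + l) + \<Delta>" using sdev_err assms by simp
 finally show ?thesis .
qed

definition err_sum :: "nat \<Rightarrow> nat \<Rightarrow> nat \<Rightarrow> 'a \<Rightarrow> real" where
 "err_sum l a m x = \<tau> a (a + m * l) x - (\<Sum>i<m. \<tau> (a + i * l) (a + i * l + l) x)"

text \<open>The merging errors of a dyadic tree are independent within each level, so level \<open>j\<close>
 contributes only \<open>sqrt (2 ^ j) * \<Delta>\<close>.\<close>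

lemma sdev_err_sum_dyadic:
 assumes l: "l > 0"
 shows "1 \<le> m \<Longrightarrow> m \<le> 2 ^ J \<Longrightarrow>
  err_sum l a m \<in> D a (a + m * l) \<and> square_int (err_sum l a m) \<and>
  sdev (err_sum l a m) \<le> (sqrt 2 + 1) * (sqrt 2 ^ J - 1) * \<Delta>"
proof (induction J arbitrary: a m)
 case 0
 then have m: "m = 1" by simp
 have z: "err_sum l a m = (\<lambda>x. \<tau> a (a + l) x - \<tau> a (a + l) x)" by (simp add: err_sum_def m fun_eq_iff)
 have "sdev (err_sum l a m) = 0" by (simp add: z sdev_eq_sqrt_variance)
 moreover have "err_sum l a m \<in> D a (a + m * l)" unfolding z using D_diff[OF \<tau>_D \<tau>_D, of a "a + l"] l m by simp
 moreover have "square_int (err_sum l a m)" unfolding z by (simp add: square_int_const)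
 ultimately show ?case by simp
next
 case (Suc J)
 show ?case
 proof (cases "m \<le> 2 ^ J")
  case True
  have "(sqrt 2 + 1) * (sqrt 2 ^ J - 1) * \<Delta> \<le> (sqrt 2 + 1) * (sqrt 2 ^ Suc J - 1) * \<Delta>"
   using \<Delta> by (intro mult_right_mono mult_left_mono diff_right_mono power_increasing) auto
  then show ?thesis using Suc.IH[OF Suc.prems(1) True, of a] by linarith
 next
  case False
  \<comment> \<open>The left part takes \<open>2 ^ J\<close> blocks, a full tree, and the right part
    the remaining \<open>m2 \<le> 2 ^ J\<close>.\<close>
  define m1 where "m1 = (2::nat) ^ J"
  define m2 where "m2 = m - m1"
  have m: "m = m1 + m2" "1 \<le> m2" "m2 \<le> 2 ^ J" "1 \<le> m1" using False Suc.prems by (auto simp: m1_def m2_def)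
  define b where "b = a + m1 * l"
  define c where "c = a + m * l"
  have c: "c = b + m2 * l" by (simp add: b_def c_def m algebra_simps)
  have abc: "a < b" "b < c" using m l by (auto simp: b_def c)
  define A where "A = err_sum l a m1"
  define B where "B = err_sum l b m2"
  have IA: "A \<in> D a b" "square_int A" "sdev A \<le> (sqrt 2 + 1) * (sqrt 2 ^ J - 1) * \<Delta>"
   using Suc.IH[of m1 a] m by (auto simp: A_def b_def m1_def)
  have IB: "B \<in> D b c" "square_int B" "sdev B \<le> (sqrt 2 + 1) * (sqrt 2 ^ J - 1) * \<Delta>"
   using Suc.IH[of m2 b] m by (auto simp: B_def c)
  have "(\<Sum>i<m. \<tau> (a + i * l) (a + i * l + l) x)
   = (\<Sum>i<m1. \<tau> (a + i * l) (a + i * l + l) x) + (\<Sum>i<m2. \<tau> (b + i * l) (b + i * l + l) x)" for x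
   by (simp add: m(1) sum_lessThan_add b_def algebra_simps)
  then have eq: "err_sum l a m = (\<lambda>x. (A x + B x) + err a b c x)"
   by (simp add: fun_eq_iff A_def B_def err_sum_def err_def b_def[symmetric] c_def[symmetric] c[symmetric])
  have "(sdev (\<lambda>x. A x + B x))^2 = (sdev A)^2 + (sdev B)^2" using IA IB by (intro sdev_add_indep D_indep)
  also have "\<dots> \<le> ((sqrt 2 + 1) * (sqrt 2 ^ J - 1) * \<Delta>)^2 + ((sqrt 2 + 1) * (sqrt 2 ^ J - 1) * \<Delta>)^2"
   using IA IB by (intro add_mono power_mono) auto
  also have "\<dots> = (sqrt 2 * ((sqrt 2 + 1) * (sqrt 2 ^ J - 1) * \<Delta>))^2" by (simp add: power_mult_distrib)
  finally have "sdev (\<lambda>x. A x + B x) \<le> sqrt 2 * ((sqrt 2 + 1) * (sqrt 2 ^ J - 1) * \<Delta>)"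
   by (rule power2_le_imp_le) (use \<Delta> in \<open>auto simp: one_le_power\<close>)
  moreover have "sdev (err_sum l a m) \<le> sdev (\<lambda>x. A x + B x) + sdev (err a b c)"
   unfolding eq using IA IB abc by (intro sdev_triangle square_int_add err_sq)
  ultimately have "sdev (err_sum l a m) \<le> sqrt 2 * ((sqrt 2 + 1) * (sqrt 2 ^ J - 1) * \<Delta>) + \<Delta>" using sdev_err[OF abc] by linarith
  \<comment> \<open>In units of \<open>\<Delta>\<close>, the bound solves the recursion x' = sqrt 2
    * x + 1 with value 0 at \<open>J = 0\<close>.\<close>
  also have "\<dots> = (sqrt 2 + 1) * (sqrt 2 ^ Suc J - 1) * \<Delta>"
  proof -
   have "sqrt 2 * sqrt 2 = (2::real)" by simp
   then show ?thesis by (simp add: algebra_simps)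
  qed
  finally have "sdev (err_sum l a m) \<le> (sqrt 2 + 1) * (sqrt 2 ^ Suc J - 1) * \<Delta>" .
  moreover have "err_sum l a m \<in> D a c"
  proof -
   have "A \<in> D a c" "B \<in> D a c" using IA IB D_mono abc by (meson less_imp_le order_refl subsetD)+
   moreover have "\<tau> a b \<in> D a c" "\<tau> b c \<in> D a c" "\<tau> a c \<in> D a c"
    using \<tau>_D D_mono abc by (meson less_imp_le order_refl subsetD less_trans)+
   ultimately show ?thesis unfolding eq err_def
    using D_add[OF D_add D_diff[OF D_diff], of A a c B "\<tau> a c" "\<tau> a b" "\<tau> b c"] by simp
  qed
  moreover have "square_int (err_sum l a m)" unfolding eq using IA IB abc by (intro square_int_add err_sq)
  ultimately show ?thesis by (simp add: c_def)
 qed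
qed

text \<open>Adding up the m - 1 junction errors directly would give order m; the square root is what
  makes them negligible against the standard deviation of the block sum, which is sqrt m times that
  of one block.\<close>

lemma sdev_err_sum:
 assumes l: "l > 0" and m: "1 \<le> m"
 shows "square_int (err_sum l a m)" and "sdev (err_sum l a m) \<le> 4 * sqrt (real m) * \<Delta>"
proof -
 obtain J where J: "m \<le> 2 ^ J" "2 ^ J \<le> 2 * m" using obtain_power_two_between[OF m] .
 note * = sdev_err_sum_dyadic[OF l m J(1), of a]
 show "square_int (err_sum l a m)" using * by simp
 have "real (2 ^ J) \<le> real (2 * m)" using J(2) by (rule of_nat_mono)
 then have "sqrt (2 ^ J) \<le> sqrt (2 * real m)" by simp
 then have 1: "sqrt 2 ^ J \<le> sqrt 2 * sqrt (real m)" by (simp add: real_sqrt_power real_sqrt_mult)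
 have "sdev (err_sum l a m) \<le> (sqrt 2 + 1) * (sqrt 2 ^ J - 1) * \<Delta>" using * by simp
 also have "\<dots> \<le> (sqrt 2 + 1) * (sqrt 2 * sqrt (real m)) * \<Delta>" using 1 \<Delta> by (intro mult_right_mono mult_left_mono) auto
 also have "(sqrt 2 + 1) * (sqrt 2 * sqrt (real m)) = (2 + sqrt 2) * sqrt (real m)" by (simp add: algebra_simps)
 also have "\<dots> \<le> 4 * sqrt (real m)" using sqrt2_less_2 by (intro mult_right_mono) auto
 finally show "sdev (err_sum l a m) \<le> 4 * sqrt (real m) * \<Delta>" using \<Delta> by simp
qed

text \<open>Beyond the junctions between complete blocks there remain a last piece shorter than
  \<open>l\<close>, handled by \<open>sd_add_le\<close>, and the junction in front of it.\<close>

lemma block_sum_approx: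
 assumes l: "l > 0" and m: "1 \<le> m" and r: "r < l" and n: "n = m * l + r"
 shows "l2norm (\<lambda>x. centered (\<tau> 0 n) x - (\<Sum>i<m. centered (\<tau> (i * l) (i * l + l)) x))
  \<le> 4 * sqrt (real m) * \<Delta> + sd l + 2 * \<Delta>"
proof -
 define B where "B x = (\<Sum>i<m. \<tau> (i * l) (i * l + l) x)" for x
 have sqB: "square_int B" unfolding B_def[abs_def] using l by (intro square_int_sum \<tau>_sq) auto
 have ml: "0 < m * l" using l m by simp
 have cB: "centered B = (\<lambda>x. \<Sum>i<m. centered (\<tau> (i * l) (i * l + l)) x)"
  unfolding B_def[abs_def] using l by (intro centered_sum \<tau>_sq) auto
 have E: "\<tau> 0 (m * l) = (\<lambda>x. B x + err_sum l 0 m x)" by (simp add: err_sum_def B_def fun_eq_iff)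
 have "sdev (\<lambda>x. \<tau> 0 n x - B x) \<le> 4 * sqrt (real m) * \<Delta> + sd l + 2 * \<Delta>"
 proof (cases "r = 0")
  case True
  then have "(\<lambda>x. \<tau> 0 n x - B x) = err_sum l 0 m" using E n by (simp add: fun_eq_iff)
  then have "sdev (\<lambda>x. \<tau> 0 n x - B x) \<le> 4 * sqrt (real m) * \<Delta>" using sdev_err_sum[OF l m] by simp
  then show ?thesis using \<Delta> by (simp add: sd_def add_increasing2)
 next
  case False
  have eq: "(\<lambda>x. \<tau> 0 n x - B x) = (\<lambda>x. err_sum l 0 m x + (\<tau> (m * l) (m * l + r) x + err 0 (m * l) n x))"
   using E by (simp add: err_def n fun_eq_iff)
  have sq: "square_int (err_sum l 0 m)" "square_int (\<tau> (m * l) (m * l + r))" "square_int (err 0 (m * l) n)"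
   using sdev_err_sum[OF l m] False n ml by (auto intro!: \<tau>_sq err_sq)
  have "sdev (\<lambda>x. \<tau> 0 n x - B x) \<le> sdev (err_sum l 0 m) + (sdev (\<tau> (m * l) (m * l + r)) + sdev (err 0 (m * l) n))"
   unfolding eq by (intro order_trans[OF sdev_triangle] add_left_mono sdev_triangle square_int_add sq)
  moreover have "sdev (\<tau> (m * l) (m * l + r)) \<le> sd l + \<Delta>" using sd_add_le[of r "l - r"] False r by (simp add: sdev_shift)
  moreover have "sdev (err 0 (m * l) n) \<le> \<Delta>" using False n ml by (intro sdev_err) auto
  ultimately show ?thesis using sdev_err_sum(2)[OF l m, of 0] by linarith
 qed
 then show ?thesis unfolding sdev_def using sqB n ml by (subst (asm) centered_diff) (auto simp: cB \<tau>_sq)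
qed

end

text \<open>Doubling a block multiplies the \<open>p\<close>-th moment by little more than \<open>2\<close>, up to terms of the
 order of the standard deviation; this is what keeps the loss in the Lyapunov ratio small.\<close>

lemma pmom_double:
 fixes p \<epsilon> :: real
 assumes p: "p > 2" and \<epsilon>: "\<epsilon> > 0"
 shows "\<exists>C>0. \<forall>(M :: 'a measure) \<tau> D \<Delta> l. block_process M \<tau> D p \<Delta> \<longrightarrow> l > 0 \<longrightarrow>
  block_process.pmom M \<tau> p (2 * l) \<le> 2 powr (1 + \<epsilon>) * block_process.pmom M \<tau> p l
   + C * (block_process.sd M \<tau> l powr p + \<Delta> powr p)"
proof -
 \<comment> \<open>Chosen so that the total loss \<open>exp (4 * \<eta>)\<close> equals
   \<open>2 powr \<epsilon>\<close>.\<close>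
 define \<eta> where "\<eta> = \<epsilon> * ln 2 / 4"
 have \<eta>: "\<eta> > 0" using \<epsilon> by (simp add: \<eta>_def)
 have \<eta>_le: "(1 + \<eta>) * (2 * (1 + \<eta>) + \<eta>) \<le> 2 powr (1 + \<epsilon>)"
 proof -
  have "(1 + \<eta>) * (2 * (1 + \<eta>) + \<eta>) \<le> (1 + 2 * \<eta>) * (2 * (1 + 2 * \<eta>))" using \<eta> by (intro mult_mono) auto
  also have "\<dots> \<le> exp (2 * \<eta>) * (2 * exp (2 * \<eta>))" using \<eta> by (intro mult_mono mult_left_mono exp_ge_add_one_self) auto
  also have "\<dots> = 2 * exp (4 * \<eta>)" by (simp add: exp_add[symmetric])
  also have "exp (4 * \<eta>) = 2 powr \<epsilon>" by (simp add: \<eta>_def powr_def)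
  finally show ?thesis by (simp add: powr_add)
 qed
 obtain C1 where C1: "0 < C1" "\<And>x y. abs (x + y) powr p \<le> (1 + \<eta>) * abs x powr p + C1 * abs y powr p"
  using abs_add_powr_le_left[of p \<eta>] p \<eta> by auto
 obtain C2 where C2: "0 < C2"
  "\<And>x y. abs (x + y) powr p \<le> (1 + \<eta>) * (abs x powr p + abs y powr p) + C2 * (abs x powr (p - 1) * abs y)"
  using abs_add_powr_le[of p \<eta>] p \<eta> by auto
 obtain C3 where C3: "0 < C3" "\<And>x v. 0 \<le> v \<Longrightarrow> abs x powr (p - 1) * v \<le> \<eta> / C2 * abs x powr p + C3 * v powr p"
  using young_powr[of p "\<eta> / C2"] p \<eta> C2 by auto
 define C where "C = max ((1 + \<eta>) * C2 * C3) (C1 * (2 powr p * 2))"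
 have C: "C > 0" using C1 by (simp add: C_def less_max_iff_disj)
 have "block_process.pmom M \<tau> p (2 * l) \<le> 2 powr (1 + \<epsilon>) * block_process.pmom M \<tau> p l
   + C * (block_process.sd M \<tau> l powr p + \<Delta> powr p)"
  if bp: "block_process M \<tau> D p \<Delta>" and l: "l > 0" for M :: "'a measure" and \<tau> D \<Delta> l
 proof -
  interpret block_process M \<tau> D p \<Delta> by fact
  define X where "X = centered (\<tau> 0 l)"
  define X' where "X' = centered (\<tau> l (l + l))"
  define W where "W = centered (err 0 l (l + l))"
  have sq: "square_int X" "square_int X'" "square_int W"
   unfolding X_def X'_def W_def using l by (auto intro!: square_int_centered \<tau>_sq err_sq)
  have p0: "0 < p" using p by simp
  have perr: "p_int p (err 0 l (l + l))" unfolding err_def[abs_def] using l by (intro p_int_diff p0 \<tau>_p) auto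
  have pi: "p_int p X" "p_int p X'" "p_int p W"
   unfolding X_def X'_def W_def using l perr by (auto intro!: p_int_centered \<tau>_p p0)
  have int: "integrable M (\<lambda>x. abs (X x) powr p)" "integrable M (\<lambda>x. abs (X' x) powr p)" "integrable M (\<lambda>x. abs (W x) powr p)"
   using pi by (auto simp: p_int_def)
  have eq: "centered (\<tau> 0 (l + l)) x = (X x + X' x) + W x" for x
  proof -
   have "\<tau> 0 (l + l) = (\<lambda>x. (\<tau> 0 l x + \<tau> l (l + l) x) + err 0 l (l + l) x)" by (simp add: err_def fun_eq_iff)
   then have "centered (\<tau> 0 (l + l)) = (\<lambda>x. (X x + X' x) + W x)" unfolding X_def X'_def W_def using l
    by (simp add: centered_add square_int_add \<tau>_sq err_sq)
   then show ?thesis by simp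
  qed
  have EX: "expectation (\<lambda>x. abs (X x) powr p) = pmom l" by (simp add: X_def pmom_def)
  have EX': "expectation (\<lambda>x. abs (X' x) powr p) = pmom l" using pmom_shift[OF l, of l] by (simp add: X'_def)
  have ind: "indep_var borel (\<lambda>x. abs (X x) powr (p - 1)) borel (\<lambda>x. abs (X' x))"
  proof -
   have "indep_var borel (\<tau> 0 l) borel (\<tau> l (l + l))" using l by (intro D_indep[of _ 0 l _ "l + l"] \<tau>_D) auto
   from indep_var_compose[OF this, of "\<lambda>u. abs (u - expectation (\<tau> 0 l)) powr (p - 1)" borel
     "\<lambda>u. abs (u - expectation (\<tau> l (l + l)))" borel]
   show ?thesis by (simp add: comp_def X_def X'_def centered_def)
  qed
  have intp1: "integrable M (\<lambda>x. abs (X x) powr (p - 1))" using p_int_le_exponent[of "p - 1" p X] p pi by (simp add: p_int_def)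
  have intX': "integrable M (\<lambda>x. abs (X' x))" using square_int_integrable[OF sq(2)] by simp
  \<comment> \<open>Independence separates the mixed term and leaves a first moment of
    \<open>X'\<close>, at most the standard deviation. Young's inequality with weight
    \<open>\<eta> / C2\<close> then returns, once multiplied by \<open>C2\<close>, no more than
    \<open>\<eta>\<close> times the p-th moment.\<close>
  have "expectation (\<lambda>x. abs (X x) powr (p - 1) * abs (X' x))
    = expectation (\<lambda>x. abs (X x) powr (p - 1)) * expectation (\<lambda>x. abs (X' x))"
   by (intro indep_var_lebesgue_integral ind intp1 intX')
  also have "\<dots> \<le> expectation (\<lambda>x. abs (X x) powr (p - 1)) * sd l"
  proof (intro mult_left_mono)
   have "l2norm X' = sd l" using sdev_shift[OF l, of l] by (simp add: X'_def sdev_def)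
   then show "expectation (\<lambda>x. abs (X' x)) \<le> sd l" using expectation_abs_le_l2norm[OF sq(2)] by simp
  qed simp
  also have "\<dots> = expectation (\<lambda>x. abs (X x) powr (p - 1) * sd l)" by simp
  also have "\<dots> \<le> expectation (\<lambda>x. \<eta> / C2 * abs (X x) powr p + C3 * sd l powr p)"
   using int intp1 by (intro integral_mono C3(2)) (auto simp: sd_def)
  also have "\<dots> = \<eta> / C2 * pmom l + C3 * sd l powr p" using int by (simp add: EX prob_space)
  finally have cross: "expectation (\<lambda>x. abs (X x) powr (p - 1) * abs (X' x)) \<le> \<eta> / C2 * pmom l + C3 * sd l powr p" .
  have intc: "integrable M (\<lambda>x. abs (X x) powr (p - 1) * abs (X' x))" by (rule indep_var_integrable[OF ind intp1 intX'])
  have intS: "integrable M (\<lambda>x. abs (X x + X' x) powr p)" using p_int_add[OF p0 pi(1,2)] by (simp add: p_int_def)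
  have "expectation (\<lambda>x. abs (X x + X' x) powr p)
    \<le> expectation (\<lambda>x. (1 + \<eta>) * (abs (X x) powr p + abs (X' x) powr p) + C2 * (abs (X x) powr (p - 1) * abs (X' x)))"
   using int intc intS by (intro integral_mono C2(2)) auto
  also have "\<dots> \<le> (1 + \<eta>) * (pmom l + pmom l) + C2 * (\<eta> / C2 * pmom l + C3 * sd l powr p)"
  using int intc cross C2 by (simp add: EX EX')
  also have "\<dots> = (2 * (1 + \<eta>) + \<eta>) * pmom l + C2 * C3 * sd l powr p" using C2 by (simp add: algebra_simps)
  finally have S: "expectation (\<lambda>x. abs (X x + X' x) powr p) \<le> (2 * (1 + \<eta>) + \<eta>) * pmom l + C2 * C3 * sd l powr p" .
  have W: "expectation (\<lambda>x. abs (W x) powr p) \<le> 2 powr p * 2 * \<Delta> powr p"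
  proof -
   define e where "e = expectation (err 0 l (l + l))"
   have "abs e \<le> expectation (\<lambda>x. abs (err 0 l (l + l) x))" unfolding e_def by (rule integral_abs_bound)
   also have "\<dots> \<le> \<Delta>"
    using expectation_abs_le_l2norm[OF err_sq, of 0 l "l + l"] err_l2[of 0 l "l + l"] l by (simp add: err_def[abs_def])
   finally have e: "abs e powr p \<le> \<Delta> powr p" using p0 by (intro powr_mono2) auto
   have "expectation (\<lambda>x. abs (W x) powr p) \<le> expectation (\<lambda>x. 2 powr p * (abs (err 0 l (l + l) x) powr p + abs e powr p))"
    using int perr abs_add_powr_le_two[OF p0, of "err 0 l (l + l) _" "- e"]
    by (intro integral_mono) (auto simp: p_int_def W_def centered_def e_def)
   also have "\<dots> = 2 powr p * (expectation (\<lambda>x. abs (err 0 l (l + l) x) powr p) + abs e powr p)"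
    using perr by (simp add: p_int_def prob_space)
   also have "\<dots> \<le> 2 powr p * (\<Delta> powr p + \<Delta> powr p)"
    using e err_p[of 0 l "l + l"] l by (intro mult_left_mono add_mono) (auto simp: err_def)
   finally show ?thesis by simp
  qed
  have "pmom (2 * l) = expectation (\<lambda>x. abs ((X x + X' x) + W x) powr p)" by (simp add: pmom_def eq mult_2)
  also have "\<dots> \<le> expectation (\<lambda>x. (1 + \<eta>) * abs (X x + X' x) powr p + C1 * abs (W x) powr p)"
  proof (rule integral_mono)
   show "integrable M (\<lambda>x. abs ((X x + X' x) + W x) powr p)"
    using p_int_add[OF p0 p_int_add[OF p0 pi(1,2)] pi(3)] by (simp add: p_int_def)
  qed (use intS int C1 in auto)
  also have "\<dots> = (1 + \<eta>) * expectation (\<lambda>x. abs (X x + X' x) powr p) + C1 * expectation (\<lambda>x. abs (W x) powr p)"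
   using intS int by simp
  also have "\<dots> \<le> (1 + \<eta>) * ((2 * (1 + \<eta>) + \<eta>) * pmom l + C2 * C3 * sd l powr p) + C1 * (2 powr p * 2 * \<Delta> powr p)"
   using S W \<eta> C1 by (intro add_mono mult_left_mono) auto
  also have "\<dots> = (1 + \<eta>) * (2 * (1 + \<eta>) + \<eta>) * pmom l + ((1 + \<eta>) * C2 * C3 * sd l powr p + C1 * (2 powr p * 2) * \<Delta> powr p)"
   by (simp add: algebra_simps)
  also have "\<dots> \<le> 2 powr (1 + \<epsilon>) * pmom l + (C * sd l powr p + C * \<Delta> powr p)"
   using \<eta>_le pmom_nonneg[of l] by (intro add_mono mult_right_mono) (auto simp: C_def)
  finally show ?thesis by (simp add: distrib_left)
 qed
 then show ?thesis using C by blast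
qed

text \<open>Doubling is stopped at the first dyadic multiple of \<open>l\<close> whose standard
  deviation reaches \<open>T\<close>. Up to then the additive terms in \<open>pmom_double\<close>
  are of order \<open>T powr p\<close>, and since the growth factor is at least 2 they are absorbed
  into the starting value. The constant is chosen before the process, so it serves all tubes at
  once.\<close>

lemma block_selection:
 fixes p \<epsilon> :: real
 assumes p: "p > 2" and \<epsilon>: "\<epsilon> > 0"
 shows "\<exists>C>0. \<forall>(M :: 'a measure) \<tau> D \<Delta> l T j0. block_process M \<tau> D p \<Delta> \<longrightarrow> l > 0 \<longrightarrow> \<Delta> \<le> T \<longrightarrow>
  T \<le> block_process.sd M \<tau> (2 ^ j0 * l) \<longrightarrow>
  (\<exists>j. T \<le> block_process.sd M \<tau> (2 ^ j * l) \<and>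
   (\<forall>i<j. block_process.sd M \<tau> (2 ^ i * l) < T) \<and>
   block_process.pmom M \<tau> p (2 ^ j * l)
    \<le> C * (2 ^ j) powr (1 + \<epsilon>) * (block_process.pmom M \<tau> p l + T powr p))"
proof -
 obtain C where C: "C > 0" and *: "\<And>(M :: 'a measure) \<tau> D \<Delta> l. block_process M \<tau> D p \<Delta> \<Longrightarrow> l > 0 \<Longrightarrow>
  block_process.pmom M \<tau> p (2 * l) \<le> 2 powr (1 + \<epsilon>) * block_process.pmom M \<tau> p l
   + C * (block_process.sd M \<tau> l powr p + \<Delta> powr p)"
  using pmom_double[OF p \<epsilon>] by blast
 define a where "a = (2::real) powr (1 + \<epsilon>)"
 have a: "a \<ge> 2" using \<epsilon> powr_mono[of 1 "1 + \<epsilon>" "2::real"] by (simp add: a_def)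
 define C' where "C' = max 1 (2 * C)"
 have "\<exists>j. T \<le> block_process.sd M \<tau> (2 ^ j * l) \<and>
   (\<forall>i<j. block_process.sd M \<tau> (2 ^ i * l) < T) \<and>
   block_process.pmom M \<tau> p (2 ^ j * l)
    \<le> C' * (2 ^ j) powr (1 + \<epsilon>) * (block_process.pmom M \<tau> p l + T powr p)"
  if bp: "block_process M \<tau> D p \<Delta>" and l: "l > 0" and T: "\<Delta> \<le> T"
   and j0: "T \<le> block_process.sd M \<tau> (2 ^ j0 * l)" for M :: "'a measure" and \<tau> D \<Delta> l T j0
 proof -
  interpret block_process M \<tau> D p \<Delta> by fact
  define j where "j = (LEAST j. T \<le> sd (2 ^ j * l))"
  have 1: "T \<le> sd (2 ^ j * l)" unfolding j_def by (rule LeastI) (rule j0)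
  have 2: "sd (2 ^ i * l) < T" if "i < j" for i
   using not_less_Least[of i "\<lambda>j. T \<le> sd (2 ^ j * l)"] that by (simp add: j_def not_le)
  have T0: "0 < T" using T \<Delta> by simp
  \<comment> \<open>Adding \<open>b\<close> turns the affine recursion into a purely multiplicative
    one, as the factor \<open>a\<close> is at least 2.\<close>
  define b where "b = 2 * C * T powr p"
  have b: "b \<ge> 0" using C by (simp add: b_def)
  have rec: "i \<le> j \<Longrightarrow> pmom (2 ^ i * l) + b \<le> a ^ i * (pmom l + b)" for i
  proof (induction i)
   case (Suc i)
   have "sd (2 ^ i * l) powr p + \<Delta> powr p \<le> T powr p + T powr p"
    using 2[of i] Suc.prems T \<Delta> p by (intro add_mono powr_mono2) (auto simp: sd_def)
   then have "C * (sd (2 ^ i * l) powr p + \<Delta> powr p) \<le> b"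
    using C mult_left_mono[of _ "T powr p + T powr p" C] by (simp add: b_def)
   then have "pmom (2 * (2 ^ i * l)) \<le> a * pmom (2 ^ i * l) + b" using *[OF bp, of "2 ^ i * l"] l unfolding a_def by fastforce
   then have "pmom (2 ^ Suc i * l) + b \<le> a * pmom (2 ^ i * l) + 2 * b" by (simp add: mult.assoc)
   also have "\<dots> \<le> a * pmom (2 ^ i * l) + a * b" using a b by (intro add_left_mono mult_right_mono) auto
   also have "\<dots> = a * (pmom (2 ^ i * l) + b)" by (simp add: distrib_left)
   also have "\<dots> \<le> a * (a ^ i * (pmom l + b))" using a Suc by (intro mult_left_mono) auto
   finally show ?case by (simp add: mult.assoc)
  qed simp
  have "pmom (2 ^ j * l) \<le> a ^ j * (pmom l + b)" using rec[of j] b by simp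
  also have "\<dots> \<le> a ^ j * (C' * (pmom l + T powr p))"
  proof (intro mult_left_mono)
   have "1 * pmom l + 2 * C * T powr p \<le> C' * pmom l + C' * T powr p"
    using pmom_nonneg by (intro add_mono mult_right_mono) (auto simp: C'_def)
   then show "pmom l + b \<le> C' * (pmom l + T powr p)" by (simp add: b_def distrib_left)
  qed (use a in simp)
  also have "a ^ j = (2 ^ j) powr (1 + \<epsilon>)" by (simp add: a_def powr_powr powr_realpow[symmetric] mult.commute)
  finally have "pmom (2 ^ j * l) \<le> C' * (2 ^ j) powr (1 + \<epsilon>) * (pmom l + T powr p)" by (simp add: mult_ac)
  with 1 2 show ?thesis by blast
 qed
 moreover have "C' > 0" by (simp add: C'_def)
 ultimately show ?thesis by blast
qed

section \<open>The Efron-Stein inequality\<close>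

context prob_space
begin

lemma nn_integral_sq_less_top_imp_square_int:
 assumes "random_variable borel X" "(\<integral>\<^sup>+x. ennreal ((X x)^2) \<partial>M) < \<infinity>"
 shows "square_int X"
 unfolding square_int_def
proof
 have [measurable]: "random_variable borel X" by fact
 show "integrable M (\<lambda>x. (X x)^2)" by (rule integrableI_nonneg) (use assms in auto)
qed fact

lemma nn_integral_sq_eq: "square_int X \<Longrightarrow> (\<integral>\<^sup>+x. ennreal ((X x)^2) \<partial>M) = ennreal (expectation (\<lambda>x. (X x)^2))"
 by (intro nn_integral_eq_integral) (auto simp: square_int_def)

lemma expectation_sq_le: "square_int X \<Longrightarrow> (expectation X)^2 \<le> expectation (\<lambda>x. (X x)^2)"
 using sdev_sq[of X] variance_eq[of X] by (simp add: square_int_integrable square_int_def) (metis diff_ge_0_iff_ge zero_le_power2)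

lemma variance_le_nn_integral:
 assumes "square_int X"
 shows "ennreal (expectation (\<lambda>x. (X x)^2) - (expectation X)^2) \<le> (\<integral>\<^sup>+x. ennreal ((X x - a)^2) \<partial>M)"
proof -
 have sq: "square_int (\<lambda>x. X x - a)" by (intro square_int_diff square_int_const assms)
 have "expectation (\<lambda>x. (X x - a)^2) = expectation (\<lambda>x. (X x)^2) + a^2 - 2 * a * expectation X"
  using assms by (simp add: power2_diff mult_ac square_int_def square_int_integrable prob_space)
 then have "expectation (\<lambda>x. (X x)^2) - (expectation X)^2 + (expectation X - a)^2 = expectation (\<lambda>x. (X x - a)^2)"
  by (simp add: power2_diff)
 then have "expectation (\<lambda>x. (X x)^2) - (expectation X)^2 \<le> expectation (\<lambda>x. (X x - a)^2)" by (smt (verit) zero_le_power2)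
 then show ?thesis unfolding nn_integral_sq_eq[OF sq] by simp
qed

lemma integral_diff_sq_le_nn_integral:
 assumes X: "square_int X" and Y: "random_variable borel Y"
 shows "ennreal ((expectation X - expectation Y)^2) \<le> (\<integral>\<^sup>+x. ennreal ((X x - Y x)^2) \<partial>M)"
proof (cases "(\<integral>\<^sup>+x. ennreal ((X x - Y x)^2) \<partial>M) < \<infinity>")
 case False
 then show ?thesis by (simp add: not_less top_unique)
next
 case True
 have [measurable]: "random_variable borel X" "random_variable borel Y" using X Y by (auto simp: square_int_def)
 have d: "square_int (\<lambda>x. X x - Y x)" by (rule nn_integral_sq_less_top_imp_square_int[OF _ True]) measurable
 have "square_int Y" using square_int_diff[OF X d] by simp
 then have "expectation X - expectation Y = expectation (\<lambda>x. X x - Y x)" using X by (simp add: square_int_integrable)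
 then show ?thesis unfolding nn_integral_sq_eq[OF d] using expectation_sq_le[OF d] by (simp add: ennreal_leI)
qed

end

lemma measurable_PiM_fun_upd:
 "i \<in> E \<Longrightarrow> c \<in> space (N i) \<Longrightarrow> (\<lambda>w. w(i := c)) \<in> measurable (PiM E N) (PiM E N)"
 by (rule measurable_fun_upd[where J = E]) auto

text \<open>The variance is split off one coordinate at a time; given the other coordinates, it is
  at most the mean square distance to any number, here the value of \<open>f\<close> with that
  coordinate set to \<open>c\<close>. Resampling is thus replaced by a fixed value, without a second
  copy of the weights. The right side is an extended integral and may be infinite.\<close>

theorem efron_stein:
 fixes F :: "real measure" and f :: "('e \<Rightarrow> real) \<Rightarrow> real"
 assumes F: "real_distribution F" and E: "finite E"
  and f: "f \<in> borel_measurable (PiM E (\<lambda>_. F))" "integrable (PiM E (\<lambda>_. F)) (\<lambda>w. (f w)^2)"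
 shows "ennreal ((\<integral>w. (f w)^2 \<partial>PiM E (\<lambda>_. F)) - (\<integral>w. f w \<partial>PiM E (\<lambda>_. F))^2)
  \<le> (\<Sum>i\<in>E. \<integral>\<^sup>+w. ennreal ((f w - f (w(i := c)))^2) \<partial>PiM E (\<lambda>_. F))"
 using E f
proof (induction E arbitrary: f rule: finite_induct)
 case empty
 then show ?case by (simp add: PiM_empty lebesgue_integral_count_space_finite)
next
 case (insert e E)
 interpret F: real_distribution F by fact
 interpret product_prob_space "\<lambda>_::'e. F" "E" by unfold_locales
 interpret P: prob_space "PiM E (\<lambda>_. F)" by (intro prob_space_PiM F.prob_space_axioms)
 let ?P = "PiM E (\<lambda>_. F)" and ?Q = "PiM (insert e E) (\<lambda>_. F)"
 interpret Q: prob_space ?Q by (intro prob_space_PiM F.prob_space_axioms)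
 let ?N = "\<lambda>i. \<integral>\<^sup>+w. ennreal ((f w - f (w(i := c)))^2) \<partial>?Q"
 note [measurable] = insert.prems(1)
 have fm [measurable]: "(\<lambda>(x, y). f (x(e := y))) \<in> borel_measurable (?P \<Otimes>\<^sub>M F)" by simp
 have Qsq: "Q.square_int f" using insert.prems by (simp add: Q.square_int_def)
 define g where "g x = (\<integral>y. f (x(e := y)) \<partial>F)" for x
 define h where "h x = (\<integral>y. (f (x(e := y)))^2 \<partial>F)" for x
 let ?g2 = "\<integral>x. (g x)^2 \<partial>?P"
 let ?h = "\<integral>x. h x \<partial>?P"
 have [measurable]: "g \<in> borel_measurable ?P" "h \<in> borel_measurable ?P" unfolding g_def h_def by auto
 have fx [measurable]: "(\<lambda>y. f (x(e := y))) \<in> borel_measurable F" if "x \<in> space ?P" for x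
  using measurable_Pair2[OF fm that] by simp
 have fin: "(\<integral>\<^sup>+x. \<integral>\<^sup>+y. ennreal ((f (x(e := y)))^2) \<partial>F \<partial>?P) = ennreal (\<integral>w. (f w)^2 \<partial>?Q)"
  unfolding Q.nn_integral_sq_eq[OF Qsq, symmetric] using insert.hyps by (intro product_nn_integral_insert[symmetric]) auto
 have "AE x in ?P. (\<integral>\<^sup>+y. ennreal ((f (x(e := y)))^2) \<partial>F) \<noteq> \<infinity>" by (rule nn_integral_PInf_AE) (auto simp: fin)
 then have sqx: "AE x in ?P. F.square_int (\<lambda>y. f (x(e := y)))"
 proof (rule AE_mp, intro AE_I2 impI)
  fix x assume x: "x \<in> space ?P" "(\<integral>\<^sup>+y. ennreal ((f (x(e := y)))^2) \<partial>F) \<noteq> \<infinity>"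
  then show "F.square_int (\<lambda>y. f (x(e := y)))" by (intro F.nn_integral_sq_less_top_imp_square_int fx) (auto simp: less_top)
 qed
 have gh: "AE x in ?P. (g x)^2 \<le> h x" using sqx by eventually_elim (auto simp: g_def h_def intro: F.expectation_sq_le)
 have hn: "(\<integral>\<^sup>+x. ennreal (h x) \<partial>?P) = ennreal (\<integral>w. (f w)^2 \<partial>?Q)" unfolding fin[symmetric]
 proof (rule nn_integral_cong_AE)
  show "AE x in ?P. ennreal (h x) = (\<integral>\<^sup>+y. ennreal ((f (x(e := y)))^2) \<partial>F)"
   using sqx by eventually_elim (simp add: h_def F.nn_integral_sq_eq)
 qed
 have h0: "0 \<le> h x" for x by (simp add: h_def)
 have hint: "integrable ?P h" by (rule integrableI_nonneg) (auto simp: h0 hn)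
 have hI: "?h = (\<integral>w. (f w)^2 \<partial>?Q)" using nn_integral_eq_integral[OF hint] h0 hn by auto
 have g2int: "integrable ?P (\<lambda>x. (g x)^2)" by (rule Bochner_Integration.integrable_bound[OF hint]) (use gh h0 in auto)
 have gI: "(\<integral>x. g x \<partial>?P) = (\<integral>w. f w \<partial>?Q)" unfolding g_def using insert.hyps Q.square_int_integrable[OF Qsq]
  by (intro product_integral_insert[symmetric]) auto
 have e_part: "ennreal (?h - ?g2)
   \<le> ?N e"
 proof -
  have [measurable]: "(\<lambda>w. f (w(e := c))) \<in> borel_measurable ?Q"
   by (intro measurable_compose[OF measurable_PiM_fun_upd insert.prems(1)]) auto
  have "ennreal (?h - ?g2) = ennreal (\<integral>x. h x - (g x)^2 \<partial>?P)" using hint g2int by simp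
  also have "\<dots> = (\<integral>\<^sup>+x. ennreal (h x - (g x)^2) \<partial>?P)" using hint g2int gh by (intro nn_integral_eq_integral[symmetric]) auto
  also have "\<dots> \<le> (\<integral>\<^sup>+x. \<integral>\<^sup>+y. ennreal ((f (x(e := y)) - f (x(e := c)))^2) \<partial>F \<partial>?P)"
  proof (rule nn_integral_mono_AE)
   show "AE x in ?P. ennreal (h x - (g x)^2) \<le> (\<integral>\<^sup>+y. ennreal ((f (x(e := y)) - f (x(e := c)))^2) \<partial>F)"
    using sqx by eventually_elim (auto simp: g_def h_def intro: F.variance_le_nn_integral)
  qed
  also have "\<dots> = (\<integral>\<^sup>+x. \<integral>\<^sup>+y. (\<lambda>w. ennreal ((f w - f (w(e := c)))^2)) (x(e := y)) \<partial>F \<partial>?P)" by simp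
  also have "\<dots> = ?N e" using insert.hyps by (intro product_nn_integral_insert[symmetric]) auto
  finally show ?thesis .
 qed
 \<comment> \<open>For the coordinates in \<open>E\<close> the inequality is applied to the
   conditional mean \<open>g\<close>; by Jensen, averaging over \<open>e\<close> only decreases
   squared differences.\<close>
 have i_part: "(\<integral>\<^sup>+x. ennreal ((g x - g (x(i := c)))^2) \<partial>?P) \<le> ?N i"
  if i: "i \<in> E" for i
 proof -
  have ie: "i \<noteq> e" using i insert.hyps by auto
  have [measurable]: "(\<lambda>w. f (w(i := c))) \<in> borel_measurable ?Q"
   using i by (intro measurable_compose[OF measurable_PiM_fun_upd insert.prems(1)]) auto
  have "(\<integral>\<^sup>+x. ennreal ((g x - g (x(i := c)))^2) \<partial>?P)
    \<le> (\<integral>\<^sup>+x. \<integral>\<^sup>+y. ennreal ((f (x(e := y)) - f (x(i := c, e := y)))^2) \<partial>F \<partial>?P)"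
  proof (rule nn_integral_mono_AE)
   have "AE x in ?P. x \<in> space ?P" by simp
   with sqx show "AE x in ?P. ennreal ((g x - g (x(i := c)))^2)
     \<le> (\<integral>\<^sup>+y. ennreal ((f (x(e := y)) - f (x(i := c, e := y)))^2) \<partial>F)"
   proof eventually_elim
    case (elim x)
    have "x(i := c) \<in> space ?P" using elim(2) i by (auto simp: space_PiM extensional_def)
    then show ?case unfolding g_def by (intro F.integral_diff_sq_le_nn_integral elim fx)
   qed
  qed
  also have "\<dots> = (\<integral>\<^sup>+x. \<integral>\<^sup>+y. (\<lambda>w. ennreal ((f w - f (w(i := c)))^2)) (x(e := y)) \<partial>F \<partial>?P)" using ie by (simp add: fun_upd_twist)
  also have "\<dots> = ?N i" using insert.hyps by (intro product_nn_integral_insert[symmetric]) auto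
  finally show ?thesis .
 qed
 have "(\<integral>w. (f w)^2 \<partial>?Q) - (\<integral>w. f w \<partial>?Q)^2
   = (?h - ?g2) + (?g2 - (\<integral>x. g x \<partial>?P)^2)"
  by (simp add: hI gI)
 also have "ennreal \<dots> = ennreal (?h - ?g2) + ennreal (?g2 - (\<integral>x. g x \<partial>?P)^2)"
 proof (rule ennreal_plus)
  show "0 \<le> ?h - ?g2" using integral_mono_AE[OF g2int hint gh] by simp
  have "P.square_int g" using g2int by (simp add: P.square_int_def)
  then show "0 \<le> ?g2 - (\<integral>x. g x \<partial>?P)^2" using P.expectation_sq_le by simp
 qed
 also have "\<dots> \<le> ?N e
   + (\<Sum>i\<in>E. ?N i)"
 proof (intro add_mono e_part)
  have "ennreal (?g2 - (\<integral>x. g x \<partial>?P)^2) \<le> (\<Sum>i\<in>E. \<integral>\<^sup>+x. ennreal ((g x - g (x(i := c)))^2) \<partial>?P)"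
   by (rule insert.IH[OF _ g2int]) measurable
  also have "\<dots> \<le> (\<Sum>i\<in>E. ?N i)" by (intro sum_mono i_part)
  finally show "ennreal (?g2 - (\<integral>x. g x \<partial>?P)^2) \<le> (\<Sum>i\<in>E. ?N i)" .
 qed
 finally show ?case unfolding sum.insert[OF insert.hyps] .
qed

section \<open>Minimal weights over families of edge sets\<close>

definition fmin :: "'e set set \<Rightarrow> ('e \<Rightarrow> real) \<Rightarrow> real" where
 "fmin \<P> w = Min ((\<lambda>P. sum w P) ` \<P>)"

text \<open>Ties are broken by a choice that sees only the finite set of minimisers. This is what
  makes \<open>opt\<close> measurable and a function of the weights in \<open>E\<close>
  alone.\<close>

definition opt :: "'e set set \<Rightarrow> ('e \<Rightarrow> real) \<Rightarrow> 'e set" where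
 "opt \<P> w = (SOME P. P \<in> {P \<in> \<P>. sum w P = fmin \<P> w})"

locale path_family =
 fixes E :: "'e set" and \<P> :: "'e set set"
 assumes finite_E: "finite E" and \<P>_sub: "\<P> \<subseteq> Pow E" and \<P>_ne: "\<P> \<noteq> {}"
begin

lemma finite_\<P>: "finite \<P>" by (rule finite_subset[OF \<P>_sub]) (simp add: finite_E)

lemma finite_path: "P \<in> \<P> \<Longrightarrow> finite P" using \<P>_sub finite_E by (auto intro: finite_subset)

lemma fmin_le: "P \<in> \<P> \<Longrightarrow> fmin \<P> w \<le> sum w P" by (simp add: fmin_def finite_\<P>)

lemma le_fminI: "(\<And>P. P \<in> \<P> \<Longrightarrow> a \<le> sum w P) \<Longrightarrow> a \<le> fmin \<P> w" unfolding fmin_def using finite_\<P> \<P>_ne by simp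

lemma opt_props: "opt \<P> w \<in> \<P>" "sum w (opt \<P> w) = fmin \<P> w"
proof -
 have "fmin \<P> w \<in> (\<lambda>P. sum w P) ` \<P>" unfolding fmin_def using finite_\<P> \<P>_ne by simp
 then have "\<exists>P. P \<in> {P \<in> \<P>. sum w P = fmin \<P> w}" by auto
 from someI_ex[OF this] show "opt \<P> w \<in> \<P>" "sum w (opt \<P> w) = fmin \<P> w" unfolding opt_def by auto
qed

lemma opt_subset: "opt \<P> w \<subseteq> E" using opt_props \<P>_sub by blast

lemma sum_fun_upd: "P \<in> \<P> \<Longrightarrow> sum (w(e := c)) P = sum w P + (if e \<in> P then c - w e else 0)"
 for w :: "'e \<Rightarrow> real"
proof (cases "e \<in> P")
 case True
 assume "P \<in> \<P>"
 then have fin: "finite P" by (rule finite_path)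
 have "sum (w(e := c)) (P - {e}) = sum w (P - {e})" by simp
 then show ?thesis using sum.remove[OF fin True, of "w(e := c)"] sum.remove[OF fin True, of w] True by simp
next
 case False
 then show ?thesis by (auto intro!: sum.cong)
qed

lemma fmin_mono: "(\<And>e. e \<in> E \<Longrightarrow> w e \<le> w' e) \<Longrightarrow> fmin \<P> w \<le> fmin \<P> w'"
 by (rule le_fminI, rule order_trans[OF fmin_le sum_mono]) (use \<P>_sub in auto)

lemma fmin_cong: "(\<And>e. e \<in> E \<Longrightarrow> w e = w' e) \<Longrightarrow> fmin \<P> w = fmin \<P> w'" by (intro antisym fmin_mono) auto

text \<open>The old minimiser still competes after one weight has been changed.\<close>

lemma fmin_upd_le: "fmin \<P> (w(e := c)) \<le> fmin \<P> w + (if e \<in> opt \<P> w then c - w e else 0)"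
 using fmin_le[OF opt_props(1), of "w(e := c)" w] sum_fun_upd[OF opt_props(1), of w e c w] opt_props(2)[of w] by simp

lemma fmin_upd_raise:
 assumes "w e \<le> c"
 shows "fmin \<P> w \<le> fmin \<P> (w(e := c))" "fmin \<P> (w(e := c)) \<le> fmin \<P> w + (if e \<in> opt \<P> w then c - w e else 0)"
 using assms by (auto intro!: fmin_mono fmin_upd_le[THEN order_trans])

lemma abs_fmin_upd_le:
 assumes "w e \<le> c"
 shows "abs (fmin \<P> (w(e := c)) - fmin \<P> w) \<le> (if e \<in> opt \<P> w then c - w e else 0)"
 using fmin_upd_raise[of w e c] assms by auto

lemma opt_lower:
 assumes "y \<le> c" "e \<in> opt \<P> (w(e := c))"
 shows "e \<in> opt \<P> (w(e := y))"
proof (cases "y = c")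
 case False
 then have lt: "y < c" using assms by simp
 have eq: "(w(e := c))(e := y) = w(e := y)" by simp
 have "fmin \<P> (w(e := y)) \<le> fmin \<P> (w(e := c)) + (y - c)" using fmin_upd_le[of "w(e := c)" e y] assms(2) unfolding eq by simp
 then have l: "fmin \<P> (w(e := y)) < fmin \<P> (w(e := c))" using lt by simp
 show ?thesis
 proof (rule ccontr)
  assume n: "e \<notin> opt \<P> (w(e := y))"
  have "fmin \<P> ((w(e := y))(e := c)) \<le> fmin \<P> (w(e := y))" using fmin_upd_le[of "w(e := y)" e c] n by simp
  then show False using l by simp
 qed
qed (use assms in simp)

lemma abs_fmin_le: "abs (fmin \<P> w) \<le> (\<Sum>e\<in>E. abs (w e))"
proof -
 have "abs (sum w (opt \<P> w)) \<le> (\<Sum>e\<in>opt \<P> w. abs (w e))" by simp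
 also have "\<dots> \<le> (\<Sum>e\<in>E. abs (w e))" using opt_subset finite_E by (intro sum_mono2) auto
 finally show ?thesis by (simp add: opt_props)
qed

lemma measurable_sum_path:
 assumes "sets N = sets (borel :: real measure)" "P \<subseteq> E"
 shows "(\<lambda>w. sum w P) \<in> borel_measurable (PiM E (\<lambda>_. N))"
proof (rule borel_measurable_sum)
 fix i assume "i \<in> P"
 then have "(\<lambda>w. w i) \<in> measurable (PiM E (\<lambda>_. N)) N" using assms by (intro measurable_component_singleton) auto
 then show "(\<lambda>w. w i) \<in> borel_measurable (PiM E (\<lambda>_. N))" using assms(1) measurable_cong_sets by blast
qed

lemma measurable_fmin:
 assumes "sets N = sets (borel :: real measure)"
 shows "fmin \<P> \<in> borel_measurable (PiM E (\<lambda>_. N))"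
 unfolding fmin_def[abs_def] by (rule borel_measurable_Min[OF finite_\<P>]) (use assms \<P>_sub measurable_sum_path in auto)

lemma measurable_opt:
 assumes N: "sets N = sets (borel :: real measure)"
 shows "opt \<P> \<in> measurable (PiM E (\<lambda>_. N)) (count_space UNIV)"
proof -
 let ?P = "PiM E (\<lambda>_. N)"
 note [measurable] = measurable_fmin[OF N]
 have "(\<lambda>w. {P \<in> \<P>. sum w P = fmin \<P> w}) \<in> measurable ?P (count_space (Pow \<P>))"
 proof (subst measurable_count_space_eq2, simp add: finite_\<P>, intro conjI ballI)
  fix A assume A: "A \<in> Pow \<P>"
  have "(\<lambda>w. {P \<in> \<P>. sum w P = fmin \<P> w}) -` {A} \<inter> space ?P
    = {w \<in> space ?P. \<forall>P\<in>\<P>. (sum w P = fmin \<P> w) \<longleftrightarrow> P \<in> A}"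
   using A by auto
  also have "\<dots> \<in> sets ?P"
  proof (rule sets.sets_Collect_finite_All[OF _ finite_\<P>])
   fix P assume "P \<in> \<P>"
   then have P: "(\<lambda>w. sum w P) \<in> borel_measurable ?P" using \<P>_sub by (intro measurable_sum_path N) auto
   show "{w \<in> space ?P. (sum w P = fmin \<P> w) \<longleftrightarrow> P \<in> A} \<in> sets ?P"
    using borel_measurable_eq[OF P measurable_fmin[OF N]] borel_measurable_neq[OF P measurable_fmin[OF N]] by simp
  qed
  finally show "(\<lambda>w. {P \<in> \<P>. sum w P = fmin \<P> w}) -` {A} \<inter> space ?P \<in> sets ?P" .
 qed auto
 from measurable_compose[OF this, of "\<lambda>A. SOME P. P \<in> A" "count_space UNIV"]
 show ?thesis unfolding opt_def[abs_def] by simp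
qed

end

lemma one_plus_le_mult:
 fixes c x y :: real
 assumes "0 \<le> c" "0 \<le> x" "y \<le> x + c"
 shows "1 + y \<le> (1 + c) * (1 + x)" and "1 + x + y \<le> 2 * (1 + c) * (1 + x)" and "1 + y + x \<le> 2 * (1 + x) * (1 + c)"
proof -
 define t where "t = c * x"
 have cx: "0 \<le> t" using assms by (simp add: t_def)
 have 1: "(1 + c) * (1 + x) = 1 + x + c + t" by (simp add: t_def algebra_simps)
 show "1 + y \<le> (1 + c) * (1 + x)" unfolding 1 using assms cx by simp
 have "1 + x + y \<le> 2 * ((1 + c) * (1 + x))" unfolding 1 using assms cx by simp
 then show "1 + x + y \<le> 2 * (1 + c) * (1 + x)" "1 + y + x \<le> 2 * (1 + x) * (1 + c)"
  by (simp_all only: mult.assoc mult.commute[of "1 + x"] add.assoc add.commute[of y])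
qed

text \<open>A coordinate above \<open>c\<close> matters only if it is used by the optimal path when lowered to \<open>c\<close>;
 since at least half of the mass of \<open>F\<close> lies below \<open>c\<close>, this event is charged to
 configurations whose optimal path really uses the coordinate.\<close>

lemma resample_bound:
 fixes F :: "real measure" and c p r :: real
 assumes F: "real_distribution F" and F0: "AE x in F. 0 \<le> x"
  and c: "0 \<le> c" "1 / 2 \<le> measure F {..c}"
  and r: "0 \<le> r" and int: "integrable F (\<lambda>y. y^2 * (1 + abs y) powr r)"
 shows "\<exists>C>0. \<forall>(E :: 'e set) \<P> z e. path_family E \<P> \<longrightarrow> e \<in> E \<longrightarrow>
  (\<integral>\<^sup>+w. ennreal ((fmin \<P> w - fmin \<P> (w(e := c)))^2 *
    (1 + abs (fmin \<P> w - z) + abs (fmin \<P> (w(e := c)) - z)) powr r) \<partial>PiM E (\<lambda>_. F))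
  \<le> ennreal C * (\<integral>\<^sup>+w. ennreal (of_bool (e \<in> opt \<P> w) * (1 + abs (fmin \<P> w - z)) powr r) \<partial>PiM E (\<lambda>_. F))"
proof -
 interpret F: real_distribution F by fact
 define m where "m = (\<integral>y. y^2 * (1 + abs y) powr r \<partial>F)"
 have m: "0 \<le> m" by (simp add: m_def)
 define K1 where "K1 = c^2 * (2 * (1 + c)) powr r"
 define K2 where "K2 = 2 powr r * m * 2 * (1 + c) powr r"
 have K: "0 \<le> K1" "0 \<le> K2" using m by (auto simp: K1_def K2_def)
 have "(\<integral>\<^sup>+w. ennreal ((fmin \<P> w - fmin \<P> (w(e := c)))^2 *
    (1 + abs (fmin \<P> w - z) + abs (fmin \<P> (w(e := c)) - z)) powr r) \<partial>PiM E (\<lambda>_. F))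
  \<le> ennreal (K1 + K2 + 1) * (\<integral>\<^sup>+w. ennreal (of_bool (e \<in> opt \<P> w) * (1 + abs (fmin \<P> w - z)) powr r) \<partial>PiM E (\<lambda>_. F))"
  if pf: "path_family E \<P>" and e: "e \<in> E" for E :: "'e set" and \<P> z e
 proof -
  interpret path_family E \<P> by fact
  define E' where "E' = E - {e}"
  have E: "E = insert e E'" "e \<notin> E'" "finite E'" using e finite_E by (auto simp: E'_def)
  interpret product_prob_space "\<lambda>_::'e. F" E' by unfold_locales
  let ?P = "PiM E (\<lambda>_. F)"
  have SF: "sets F = sets borel" by simp
  note fm [measurable] = measurable_fmin[OF SF]
  have [measurable]: "Measurable.pred ?P (\<lambda>w. e \<in> opt \<P> w)" by (rule measurable_compose[OF measurable_opt[OF SF]]) simp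
  have [measurable]: "(\<lambda>w. fmin \<P> (w(e := c))) \<in> borel_measurable ?P"
   using e by (intro measurable_compose[OF measurable_PiM_fun_upd fm]) auto
  define H where "H w = of_bool (e \<in> opt \<P> w) * (1 + abs (fmin \<P> w - z)) powr r" for w
  define G where "G w = (fmin \<P> w - fmin \<P> (w(e := c)))^2 * (1 + abs (fmin \<P> w - z) + abs (fmin \<P> (w(e := c)) - z)) powr r" for w
  have [measurable]: "H \<in> borel_measurable ?P" "G \<in> borel_measurable ?P" unfolding H_def G_def by auto
  have H0: "0 \<le> H w" for w by (simp add: H_def)
  let ?I = "\<lambda>x. \<integral>\<^sup>+y. ennreal (H (x(e := y))) \<partial>F"
  have inner: "(\<integral>\<^sup>+y. ennreal (G (x(e := y))) \<partial>F) \<le> ennreal (K1 + K2 + 1) * ?I x"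
   if x: "x \<in> space (PiM E' (\<lambda>_. F))" for x
  proof -
   have upd [measurable]: "(\<lambda>y. x(e := y)) \<in> measurable F ?P" unfolding E(1) using x E by simp
   have [measurable]: "(\<lambda>y. H (x(e := y))) \<in> borel_measurable F" by simp
   define T where "T y = fmin \<P> (x(e := y))" for y
   define A where "A \<longleftrightarrow> e \<in> opt \<P> (x(e := c))"
   define a where "a = (1 + abs (T c - z)) powr r"
   have Gy: "G (x(e := y)) = (T y - T c)^2 * (1 + abs (T y - z) + abs (T c - z)) powr r" for y by (simp add: G_def T_def)
   let ?k = "\<lambda>y. y^2 * (1 + abs y) powr r"
   let ?a = "of_bool A * a"
   let ?J = "\<integral>\<^sup>+y. ennreal ?a * indicator {..c} y \<partial>F"
   \<comment> \<open>Below \<open>c\<close> the coordinate moves the minimum by at most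
     \<open>c\<close>, and only if it is used at its present value.\<close>
   have low: "G (x(e := y)) \<le> K1 * H (x(e := y))" if y: "0 \<le> y" "y \<le> c" for y
   proof (cases "e \<in> opt \<P> (x(e := y))")
    case True
    have d: "abs (T c - T y) \<le> c" using abs_fmin_upd_le[of "x(e := y)" e c] y True by (simp add: T_def)
    have "(T y - T c)^2 \<le> c^2" using d c by (intro abs_le_square_iff[THEN iffD1]) (simp add: abs_minus_commute)
    moreover have "(1 + abs (T y - z) + abs (T c - z)) powr r \<le> (2 * (1 + c) * (1 + abs (T y - z))) powr r"
    proof (rule powr_mono2[OF r])
     have "abs (T c - z) \<le> abs (T y - z) + c" using d by simp
     then show "1 + abs (T y - z) + abs (T c - z) \<le> 2 * (1 + c) * (1 + abs (T y - z))"
      using c by (intro one_plus_le_mult) auto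
    qed simp
    ultimately have "G (x(e := y)) \<le> c^2 * (2 * (1 + c) * (1 + abs (T y - z))) powr r" unfolding Gy by (intro mult_mono) auto
    also have "\<dots> = K1 * H (x(e := y))" using True by (simp add: K1_def H_def powr_mult T_def)
    finally show ?thesis .
   next
    case False
    then have "T c = T y" using abs_fmin_upd_le[of "x(e := y)" e c] y by (simp add: T_def)
    then show ?thesis using H0 K by (simp add: Gy)
   qed
   \<comment> \<open>Above \<open>c\<close> the change is at most \<open>y\<close>, and it vanishes
     unless \<open>e\<close> is used at level \<open>c\<close>; the event \<open>A\<close> does not
     involve \<open>y\<close>.\<close>
   have high: "G (x(e := y)) \<le> ?a * 2 powr r * ?k y" if y: "c < y" for y
   proof (cases A)
    case True
    have y0: "0 \<le> y" using c y by simp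
    have d: "abs (T y - T c) \<le> y" using abs_fmin_upd_le[of "x(e := c)" e y] y True c by (simp add: T_def A_def)
    have "(T y - T c)^2 \<le> y^2" using d y0 by (intro abs_le_square_iff[THEN iffD1]) simp
    moreover have "(1 + abs (T y - z) + abs (T c - z)) powr r \<le> (2 * (1 + abs (T c - z)) * (1 + abs y)) powr r"
    proof (rule powr_mono2[OF r])
     have "abs (T y - z) \<le> abs (T c - z) + y" using d by simp
     then show "1 + abs (T y - z) + abs (T c - z) \<le> 2 * (1 + abs (T c - z)) * (1 + abs y)"
      using y0 by (intro one_plus_le_mult) auto
    qed simp
    ultimately have "G (x(e := y)) \<le> y^2 * (2 * (1 + abs (T c - z)) * (1 + abs y)) powr r"
     unfolding Gy by (intro mult_mono) auto
    also have "\<dots> = ?a * 2 powr r * ?k y" using True unfolding a_def powr_mult by simp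
    finally show ?thesis .
   next
    case False
    then have "T y = T c" using abs_fmin_upd_le[of "x(e := c)" e y] y by (simp add: T_def A_def)
    then show ?thesis using False by (simp add: Gy)
   qed
   have pt: "ennreal (G (x(e := y))) \<le> ennreal K1 * ennreal (H (x(e := y)))
     + ennreal (?a * 2 powr r) * ennreal (?k y)" if "0 \<le> y" for y
   proof (cases "y \<le> c")
    case True
    then have "ennreal (G (x(e := y))) \<le> ennreal (K1 * H (x(e := y)))" by (intro ennreal_leI low that)
    then show ?thesis using K H0 by (simp add: ennreal_mult add_increasing2)
   next
    case False
    then have "ennreal (G (x(e := y))) \<le> ennreal (?a * 2 powr r * ?k y)" by (intro ennreal_leI high) simp
    also have "\<dots> = ennreal (?a * 2 powr r) * ennreal (?k y)" by (intro ennreal_mult) (auto simp: a_def)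
    finally show ?thesis by (simp add: add_increasing)
   qed
   \<comment> \<open>The charging step: on \<open>A\<close> the coordinate is used at every level up
     to \<open>c\<close>, by \<open>opt_lower\<close>, and these levels carry at least half of the
     mass, whence the factor 2.\<close>
   have aA: "ennreal (?a) \<le> ennreal (2 * (1 + c) powr r) * ?I x"
   proof -
    have "ennreal (?a) * ennreal 1 \<le> ennreal (?a) * ennreal (2 * measure F {..c})"
     using c by (intro mult_left_mono ennreal_leI) auto
    also have "ennreal (2 * measure F {..c}) = 2 * emeasure F {..c}" by (simp add: F.emeasure_eq_measure ennreal_mult)
    also have "ennreal (?a) * (2 * emeasure F {..c}) = 2 * ?J" by (simp add: nn_integral_cmult mult_ac)
    finally have 1: "ennreal (?a) \<le> 2 * ?J" by simp
    have "?J \<le> (\<integral>\<^sup>+y. ennreal ((1 + c) powr r) * ennreal (H (x(e := y))) \<partial>F)"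
    proof (rule nn_integral_mono_AE)
     show "AE y in F. ennreal (?a) * indicator {..c} y \<le> ennreal ((1 + c) powr r) * ennreal (H (x(e := y)))" using F0
     proof eventually_elim
      case (elim y)
      show ?case
      proof (cases "y \<le> c \<and> A")
       case True
       then have y: "y \<le> c" and A: A by auto
       have o: "e \<in> opt \<P> (x(e := y))" using opt_lower[OF y] A unfolding A_def by simp
       have d: "abs (T c - T y) \<le> c" using abs_fmin_upd_le[of "x(e := y)" e c] y o elim by (simp add: T_def)
       have "a \<le> ((1 + c) * (1 + abs (T y - z))) powr r" unfolding a_def
       proof (rule powr_mono2[OF r])
        have "abs (T c - z) \<le> abs (T y - z) + c" using d by simp
        then show "1 + abs (T c - z) \<le> (1 + c) * (1 + abs (T y - z))" using c by (intro one_plus_le_mult) auto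
       qed simp
       also have "\<dots> = (1 + c) powr r * H (x(e := y))" using o by (simp add: H_def T_def powr_mult)
       finally have "ennreal a \<le> ennreal ((1 + c) powr r * H (x(e := y)))" by (rule ennreal_leI)
       then show ?thesis using True H0 by (simp add: ennreal_mult)
      qed auto
     qed
    qed
    also have "(\<integral>\<^sup>+y. ennreal ((1 + c) powr r) * ennreal (H (x(e := y))) \<partial>F) = ennreal ((1 + c) powr r) * ?I x"
     by (rule nn_integral_cmult) measurable
    finally have "2 * ?J
      \<le> 2 * (ennreal ((1 + c) powr r) * ?I x)"
     by (rule mult_left_mono) simp
    from order_trans[OF 1 this]
    show ?thesis by (simp only: ennreal_mult mult.assoc ennreal_numeral powr_ge_zero zero_le_numeral)
   qed
   have "(\<integral>\<^sup>+y. ennreal (G (x(e := y))) \<partial>F) \<le> (\<integral>\<^sup>+y. ennreal K1 * ennreal (H (x(e := y)))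
     + ennreal (?a * 2 powr r) * ennreal (?k y) \<partial>F)"
    by (rule nn_integral_mono_AE) (use F0 pt in auto)
   also have "\<dots> = ennreal K1 * ?I x
     + ennreal (?a * 2 powr r) * (\<integral>\<^sup>+y. ennreal (?k y) \<partial>F)"
    by (subst nn_integral_add) (auto simp: nn_integral_cmult)
   also have "(\<integral>\<^sup>+y. ennreal (?k y) \<partial>F) = ennreal m" unfolding m_def using int by (intro nn_integral_eq_integral) auto
   also have "ennreal (?a * 2 powr r) * ennreal m = ennreal (?a) * ennreal (2 powr r * m)"
    using m by (simp add: ennreal_mult a_def mult.assoc flip: ennreal_mult)
   also have "\<dots> \<le> ennreal (2 * (1 + c) powr r) * ?I x * ennreal (2 powr r * m)" by (intro mult_right_mono aA) simp
   also have "\<dots> = ennreal K2 * ?I x" using m by (simp add: K2_def ennreal_mult mult_ac)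
   finally have "(\<integral>\<^sup>+y. ennreal (G (x(e := y))) \<partial>F) \<le> ennreal K1 * ?I x
     + ennreal K2 * ?I x"
    by fastforce
   also have "\<dots> \<le> ennreal (K1 + K2 + 1) * ?I x" using K by (simp add: distrib_right)
   finally show ?thesis .
  qed
  have "(\<integral>\<^sup>+w. ennreal (G w) \<partial>?P) = (\<integral>\<^sup>+x. \<integral>\<^sup>+y. ennreal (G (x(e := y))) \<partial>F \<partial>PiM E' (\<lambda>_. F))"
   unfolding E(1) using E by (intro product_nn_integral_insert) (auto simp flip: E(1))
  also have "\<dots> \<le> (\<integral>\<^sup>+x. ennreal (K1 + K2 + 1) * ?I x \<partial>PiM E' (\<lambda>_. F))" by (intro nn_integral_mono inner)
  also have "\<dots> = ennreal (K1 + K2 + 1) * (\<integral>\<^sup>+x. \<integral>\<^sup>+y. ennreal (H (x(e := y))) \<partial>F \<partial>PiM E' (\<lambda>_. F))"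
  proof (rule nn_integral_cmult)
   have "(\<lambda>(x, y). ennreal (H (x(e := y)))) \<in> borel_measurable (PiM E' (\<lambda>_. F) \<Otimes>\<^sub>M F)"
   proof -
    have "(\<lambda>(x, y). x(e := y)) \<in> measurable (PiM E' (\<lambda>_. F) \<Otimes>\<^sub>M F) (PiM E (\<lambda>_. F))" unfolding E(1) by simp
    then show ?thesis by simp
   qed
   then show "(\<lambda>x. \<integral>\<^sup>+y. ennreal (H (x(e := y))) \<partial>F) \<in> borel_measurable (PiM E' (\<lambda>_. F))" by simp
  qed
  also have "(\<integral>\<^sup>+x. \<integral>\<^sup>+y. ennreal (H (x(e := y))) \<partial>F \<partial>PiM E' (\<lambda>_. F)) = (\<integral>\<^sup>+w. ennreal (H w) \<partial>?P)"
   unfolding E(1) using E by (intro product_nn_integral_insert[symmetric]) (auto simp flip: E(1))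
  finally show ?thesis by (simp only: G_def H_def)
 qed
 moreover have "K1 + K2 + 1 > 0" using K by simp
 ultimately show ?thesis by blast
qed

section \<open>Central moments of minimal weights\<close>

lemma abs_powr_diff_le:
 fixes a b r :: real
 assumes r: "1 \<le> r"
 shows "abs (abs a powr r - abs b powr r) \<le> r * abs (a - b) * (1 + abs a + abs b) powr (r - 1)"
proof -
 have main: "y powr r - x powr r \<le> r * (y - x) * y powr (r - 1)" if "0 \<le> x" "x \<le> y" for x y :: real
 proof (cases "y = 0")
  case False
  have "y powr r * (1 + r * (x / y - 1)) \<le> y powr r * (x / y) powr r"
   using that False r by (intro mult_left_mono powr_ge_tangent) auto
  also have "\<dots> = x powr r" using that False by (simp add: powr_divide)
  finally show ?thesis using that False by (simp add: powr_diff field_simps)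
 qed (use that in simp)
 have gen: "abs (y powr r - x powr r) \<le> r * (y - x) * (1 + x + y) powr (r - 1)" if "0 \<le> x" "x \<le> y" for x y :: real
 proof -
  have "x powr r \<le> y powr r" using that r by (intro powr_mono2) auto
  then have "abs (y powr r - x powr r) \<le> r * (y - x) * y powr (r - 1)" using main[OF that] by simp
  also have "\<dots> \<le> r * (y - x) * (1 + x + y) powr (r - 1)" using that r by (intro mult_left_mono powr_mono2) auto
  finally show ?thesis .
 qed
 have "abs (abs a powr r - abs b powr r) \<le> r * abs (abs a - abs b) * (1 + abs a + abs b) powr (r - 1)"
 proof (cases "abs a \<le> abs b")
  case True
  then show ?thesis using gen[of "abs a" "abs b"] by (simp add: abs_minus_commute)
 next
  case False
  then show ?thesis using gen[of "abs b" "abs a"] by (simp add: add_ac)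
 qed
 also have "\<dots> \<le> r * abs (a - b) * (1 + abs a + abs b) powr (r - 1)"
  using r by (intro mult_right_mono mult_left_mono) (auto simp: abs_triangle_ineq3)
 finally show ?thesis .
qed

text \<open>Young's inequality for the exponents p / 2 and p / (p - 2); a small coefficient of
  \<open>u powr p\<close> is what allows that term to be absorbed later.\<close>

lemma mult_powr_le:
 fixes p \<eta> N u :: real
 assumes "p > 2" "\<eta> > 0" "0 \<le> N" "0 \<le> u"
 shows "N * u powr (p - 2) \<le> \<eta> * u powr p + \<eta> powr (- ((p - 2) / 2)) * N powr (p / 2)"
proof (cases "N = 0 \<or> u = 0")
 case False
 then have "(\<eta> * u powr p) powr ((p - 2) / p) * (\<eta> powr (- ((p - 2) / 2)) * N powr (p / 2)) powr (2 / p)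
   \<le> (p - 2) / p * (\<eta> * u powr p) + 2 / p * (\<eta> powr (- ((p - 2) / 2)) * N powr (p / 2))"
  using assms by (intro Youngs_inequality_0) (auto simp: field_simps)
 also have "\<dots> \<le> 1 * (\<eta> * u powr p) + 1 * (\<eta> powr (- ((p - 2) / 2)) * N powr (p / 2))"
  using assms by (intro add_mono mult_right_mono) auto
 also have "(\<eta> * u powr p) powr ((p - 2) / p) * (\<eta> powr (- ((p - 2) / 2)) * N powr (p / 2)) powr (2 / p)
   = (\<eta> powr ((p - 2) / p) * \<eta> powr (- ((p - 2) / p))) * (u powr (p - 2) * N)"
 proof -
  have e: "- ((p - 2) / 2) * (2 / p) = - ((p - 2) / p)" "p * ((p - 2) / p) = p - 2" "p / 2 * (2 / p) = 1"
   using assms by (simp_all add: field_simps)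
  show ?thesis using assms unfolding powr_mult powr_powr e by (simp add: mult_ac)
 qed
 also have "\<dots> = N * u powr (p - 2)" using assms by (simp add: powr_minus)
 finally show ?thesis by simp
qed (use assms in auto)

text \<open>Says that \<open>C\<close> bounds the p-th central moment through the number of edges of
  the optimal path, uniformly over all families. The edge type has to appear as an argument because
  \<open>E\<close> and \<open>\<P>\<close> are bound inside.\<close>

definition moment_const :: "'e itself \<Rightarrow> real measure \<Rightarrow> real \<Rightarrow> real \<Rightarrow> bool" where
 "moment_const _ F p C \<longleftrightarrow> (\<forall>(E :: 'e set) \<P> B. path_family E \<P> \<longrightarrow> 1 \<le> B \<longrightarrow>
  (\<integral>w. real (card (opt \<P> w)) \<partial>PiM E (\<lambda>_. F)) \<le> B \<longrightarrow>
  (\<integral>w. real (card (opt \<P> w)) powr (p / 2) \<partial>PiM E (\<lambda>_. F)) \<le> B powr (p / 2) \<longrightarrow>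
  (\<integral>w. abs (fmin \<P> w - (\<integral>w. fmin \<P> w \<partial>PiM E (\<lambda>_. F))) powr p \<partial>PiM E (\<lambda>_. F)) \<le> C * B powr (p / 2))"

text \<open>Efron-Stein is combined twice with the resampling bound: for the minimum itself, which
  bounds its variance by a multiple of \<open>B\<close>, and for the power p / 2 of its centred
  absolute value. The second use bounds \<open>m - A^2\<close> by a multiple of the mean of N (1 +
  |Z|)^(p - 2), with N the number of edges of the optimal path. This term and \<open>A^2\<close> are
  each at most \<open>m / 4\<close> up to a multiple of \<open>B powr (p / 2)\<close>, so
  \<open>m\<close> can be absorbed.\<close>

lemma fmin_moment_bound:
 fixes F :: "real measure" and c p :: real
 assumes F: "real_distribution F" and F0: "AE x in F. 0 \<le> x"
  and c: "0 \<le> c" "1 / 2 \<le> measure F {..c}"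
  and p: "2 < p" and int: "integrable F (\<lambda>x. abs x powr p)"
 shows "\<exists>C>0. moment_const TYPE('e) F p C"
proof -
 interpret F: real_distribution F by fact
 let ?G = "\<lambda>(\<P> :: 'e set set) z e r w. (fmin \<P> w - fmin \<P> (w(e := c)))^2 *
  (1 + abs (fmin \<P> w - z) + abs (fmin \<P> (w(e := c)) - z)) powr r"
 have pF: "F.p_int p (\<lambda>x. x)" using int by (simp add: F.p_int_def)
 have intr: "integrable F (\<lambda>y. y^2 * (1 + abs y) powr r)" if r: "0 \<le> r" "r \<le> p - 2" for r
 proof (rule F.integrable_bounded_by)
  have "F.p_int p (\<lambda>y. 1 + abs y)" using pF p by (intro F.p_int_add F.p_int_const) (auto simp: F.p_int_def)
  then show "integrable F (\<lambda>y. (1 + abs y) powr p)" by (simp add: F.p_int_def)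
  fix y :: real
  have "abs (y^2 * (1 + abs y) powr r) = y^2 * (1 + abs y) powr r" by simp
  also have "\<dots> \<le> (1 + abs y) powr 2 * (1 + abs y) powr (p - 2)"
  proof (intro mult_mono powr_mono)
   have "y^2 = abs y^2" by simp
   also have "\<dots> \<le> (1 + abs y)^2" by (intro power_mono) auto
   finally show "y^2 \<le> (1 + abs y) powr 2" by simp
  qed (use r in auto)
  also have "\<dots> = (1 + abs y) powr p" by (simp only: powr_add[symmetric]) simp
  finally show "abs (y^2 * (1 + abs y) powr r) \<le> (1 + abs y) powr p" .
 qed measurable
 have p2: "0 \<le> p - 2" using p by simp
 obtain C1 where C1: "C1 > 0" and C1a: "\<forall>(E :: 'e set) \<P> z e. path_family E \<P> \<longrightarrow> e \<in> E \<longrightarrow>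
  (\<integral>\<^sup>+w. ennreal (?G \<P> z e 0 w) \<partial>PiM E (\<lambda>_. F))
  \<le> ennreal C1 * (\<integral>\<^sup>+w. ennreal (of_bool (e \<in> opt \<P> w) * (1 + abs (fmin \<P> w - z)) powr 0) \<partial>PiM E (\<lambda>_. F))"
  using resample_bound[OF F F0 c order_refl intr[OF order_refl p2]] by auto
 note C1b = C1a[rule_format]
 obtain C2 where C2: "C2 > 0" and C2a: "\<forall>(E :: 'e set) \<P> z e. path_family E \<P> \<longrightarrow> e \<in> E \<longrightarrow>
  (\<integral>\<^sup>+w. ennreal (?G \<P> z e (p - 2) w) \<partial>PiM E (\<lambda>_. F))
  \<le> ennreal C2 * (\<integral>\<^sup>+w. ennreal (of_bool (e \<in> opt \<P> w) * (1 + abs (fmin \<P> w - z)) powr (p - 2)) \<partial>PiM E (\<lambda>_. F))"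
  using resample_bound[OF F F0 c p2 intr[OF p2 order_refl]] by auto
 note C2b = C2a[rule_format]
 define \<kappa> where "\<kappa> = C2 * (p / 2)^2"
 have \<kappa>: "0 < \<kappa>" using C2 p by (simp add: \<kappa>_def)
 \<comment> \<open>Chosen so that \<open>\<kappa> * \<eta> * 2 powr p\<close> is 1 / 4, which leaves
   room to absorb \<open>m\<close>.\<close>
 define \<eta> where "\<eta> = 1 / (4 * \<kappa> * 2 powr p)"
 have \<eta>: "0 < \<eta>" using \<kappa> by (simp add: \<eta>_def)
 let ?h = "\<eta> powr (- ((p - 2) / 2))"
 define K where "K = 2 * (2 * (8 * C1) powr (p / 2) + 1 / 4 + \<kappa> * ?h)"
 have K: "0 < K" using \<kappa> by (simp add: K_def add_nonneg_pos add_pos_nonneg)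
 have "(\<integral>w. abs (fmin \<P> w - (\<integral>w. fmin \<P> w \<partial>PiM E (\<lambda>_. F))) powr p \<partial>PiM E (\<lambda>_. F)) \<le> K * B powr (p / 2)"
  if pf: "path_family E \<P>" and B: "1 \<le> B" "(\<integral>w. real (card (opt \<P> w)) \<partial>PiM E (\<lambda>_. F)) \<le> B"
   "(\<integral>w. real (card (opt \<P> w)) powr (p / 2) \<partial>PiM E (\<lambda>_. F)) \<le> B powr (p / 2)"
  for E :: "'e set" and \<P> B
 proof -
  interpret path_family E \<P> by fact
  let ?P = "PiM E (\<lambda>_. F)"
  interpret P: prob_space ?P by (intro prob_space_PiM F.prob_space_axioms)
  interpret product_prob_space "\<lambda>_::'e. F" E by unfold_locales
  have SF: "sets F = sets borel" by simp
  note fm [measurable] = measurable_fmin[OF SF]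
  have [measurable]: "Measurable.pred ?P (\<lambda>w. e \<in> opt \<P> w)" for e by (rule measurable_compose[OF measurable_opt[OF SF]]) simp
  define N where "N w = real (card (opt \<P> w))" for w
  have Nm [measurable]: "N \<in> borel_measurable ?P" unfolding N_def by (rule measurable_compose[OF measurable_opt[OF SF]]) simp
  have N0: "0 \<le> N w" for w by (simp add: N_def)
  have NE: "N w \<le> real (card E)" for w unfolding N_def using opt_subset finite_E by (intro of_nat_mono card_mono) auto
  have Nsum: "N w = (\<Sum>e\<in>E. of_bool (e \<in> opt \<P> w))" for w
  proof -
   have "(\<Sum>e\<in>E. of_bool (e \<in> opt \<P> w)) = (\<Sum>e\<in>opt \<P> w. (1::real))"
    using opt_subset[of w] finite_E by (intro sum.mono_neutral_cong_right) auto
   then show ?thesis by (simp add: N_def)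
  qed
  have Tp: "P.p_int p (fmin \<P>)"
  proof -
   have comp: "P.p_int p (\<lambda>w. abs (w e))" if e: "e \<in> E" for e
   proof -
    have m: "(\<lambda>w. w e) \<in> measurable ?P F" using e by simp
    have "integrable (distr ?P F (\<lambda>w. w e)) (\<lambda>x. abs x powr p)" using int PiM_component[OF e] by simp
    then have "integrable ?P (\<lambda>w. abs (w e) powr p)" by (subst (asm) integrable_distr_eq[OF m]) auto
    moreover have "(\<lambda>w. abs (w e)) \<in> borel_measurable ?P"
     using m by (intro borel_measurable_abs) (simp add: measurable_cong_sets[OF refl SF])
    ultimately show ?thesis by (simp add: P.p_int_def)
   qed
   have sum_p: "P.p_int p (\<lambda>w. \<Sum>e\<in>A. abs (w e))" if "A \<subseteq> E" for A using finite_subset[OF that finite_E] that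
    by (induction A rule: finite_induct) (use p comp in \<open>auto intro!: P.p_int_add P.p_int_const\<close>)
   show ?thesis unfolding P.p_int_def
   proof
    show "fmin \<P> \<in> borel_measurable ?P" by simp
    show "integrable ?P (\<lambda>w. abs (fmin \<P> w) powr p)"
    proof (rule P.integrable_bounded_by)
     show "integrable ?P (\<lambda>w. abs (\<Sum>e\<in>E. abs (w e)) powr p)" using sum_p[of E] by (simp add: P.p_int_def)
     show "abs (abs (fmin \<P> w) powr p) \<le> abs (\<Sum>e\<in>E. abs (w e)) powr p" for w
      using abs_fmin_le[of w] p by (simp, intro powr_mono2) auto
    qed measurable
   qed
  qed
  define z where "z = (\<integral>w. fmin \<P> w \<partial>?P)"
  define Z where "Z w = fmin \<P> w - z" for w
  have Zm [measurable]: "Z \<in> borel_measurable ?P" unfolding Z_def by simp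
  let ?u = "\<lambda>w. 1 + abs (Z w)" and ?q = "\<lambda>w. abs (Z w) powr (p / 2)"
  let ?J = "\<integral>w. N w * ?u w powr (p - 2) \<partial>?P"
  have Zp: "P.p_int p Z" unfolding Z_def[abs_def] using p by (intro P.p_int_diff Tp P.p_int_const) auto
  have Zsq: "P.square_int Z" using P.p_int_imp_square_int[OF _ Zp] p by simp
  define m where "m = (\<integral>w. abs (Z w) powr p \<partial>?P)"
  have m0: "0 \<le> m" by (simp add: m_def)
  have mint: "integrable ?P (\<lambda>w. abs (Z w) powr p)" using Zp by (simp add: P.p_int_def)
  define V where "V = (\<integral>w. (Z w)^2 \<partial>?P)"
  have V0: "0 \<le> V" by (simp add: V_def)
  have EZ: "(\<integral>w. Z w \<partial>?P) = 0" unfolding Z_def using P.square_int_integrable[OF P.p_int_imp_square_int[OF _ Tp]] p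
   by (simp add: z_def P.prob_space)
  have u1p: "P.p_int p (\<lambda>w. 1 + abs (Z w))" using Zp p by (intro P.p_int_add P.p_int_const) (auto simp: P.p_int_def)
  have u1: "integrable ?P (\<lambda>w. ?u w powr p)" using u1p by (simp add: P.p_int_def)
  \<comment> \<open>Common form of both applications: summing the resampling bound over the edges
    turns the indicators of being used into the number \<open>N w\<close> of used edges.\<close>
  have es: "ennreal ((\<integral>w. (\<psi> (Z w))^2 \<partial>?P) - (\<integral>w. \<psi> (Z w) \<partial>?P)^2)
    \<le> ennreal (k * C) * (\<integral>\<^sup>+w. ennreal (N w * ?u w powr r) \<partial>?P)"
   if \<psi>m: "\<psi> \<in> borel_measurable borel" and \<psi>i: "integrable ?P (\<lambda>w. (\<psi> (Z w))^2)" and k: "0 \<le> k" "0 < C"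
    and \<psi>: "\<And>a b. (\<psi> a - \<psi> b)^2 \<le> k * ((a - b)^2 * (1 + abs a + abs b) powr r)"
    and Cb: "\<And>e. e \<in> E \<Longrightarrow> (\<integral>\<^sup>+w. ennreal (?G \<P> z e r w) \<partial>?P)
     \<le> ennreal C * (\<integral>\<^sup>+w. ennreal (of_bool (e \<in> opt \<P> w) * (1 + abs (fmin \<P> w - z)) powr r) \<partial>?P)"
   for \<psi> :: "real \<Rightarrow> real" and k C r :: real
  proof -
   have [measurable]: "(\<lambda>w. fmin \<P> (w(e := c))) \<in> borel_measurable ?P" if "e \<in> E" for e
    using that by (intro measurable_compose[OF measurable_PiM_fun_upd fm]) auto
   have "ennreal ((\<integral>w. (\<psi> (Z w))^2 \<partial>?P) - (\<integral>w. \<psi> (Z w) \<partial>?P)^2)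
     \<le> (\<Sum>e\<in>E. \<integral>\<^sup>+w. ennreal ((\<psi> (Z w) - \<psi> (Z (w(e := c))))^2) \<partial>?P)"
    by (rule efron_stein[OF F finite_E measurable_compose[OF Zm \<psi>m] \<psi>i])
   also have "\<dots> \<le> (\<Sum>e\<in>E. ennreal (k * C) * (\<integral>\<^sup>+w. ennreal (of_bool (e \<in> opt \<P> w) * ?u w powr r) \<partial>?P))"
   proof (rule sum_mono)
    fix e assume e: "e \<in> E"
    note [measurable] = measurable_compose[OF measurable_PiM_fun_upd fm, OF e]
    have "(\<integral>\<^sup>+w. ennreal ((\<psi> (Z w) - \<psi> (Z (w(e := c))))^2) \<partial>?P)
     \<le> (\<integral>\<^sup>+w. ennreal k * ennreal (?G \<P> z e r w) \<partial>?P)"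
    proof (rule nn_integral_mono)
     fix w
     have "ennreal ((\<psi> (Z w) - \<psi> (Z (w(e := c))))^2) \<le> ennreal (k * ((Z w - Z (w(e := c)))^2 * (1 + abs (Z w) + abs (Z (w(e := c)))) powr r))"
      by (intro ennreal_leI \<psi>)
     then show "ennreal ((\<psi> (Z w) - \<psi> (Z (w(e := c))))^2) \<le> ennreal k * ennreal (?G \<P> z e r w)"
      using k by (simp only: ennreal_mult' Z_def) (simp add: ennreal_mult')
    qed
    also have "\<dots> = ennreal k * (\<integral>\<^sup>+w. ennreal (?G \<P> z e r w) \<partial>?P)" using e by (intro nn_integral_cmult) measurable
    also have "\<dots> \<le> ennreal k * (ennreal C * (\<integral>\<^sup>+w. ennreal (of_bool (e \<in> opt \<P> w) * (1 + abs (fmin \<P> w - z)) powr r) \<partial>?P))"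
     by (intro mult_left_mono Cb e) simp
    finally show "(\<integral>\<^sup>+w. ennreal ((\<psi> (Z w) - \<psi> (Z (w(e := c))))^2) \<partial>?P)
     \<le> ennreal (k * C) * (\<integral>\<^sup>+w. ennreal (of_bool (e \<in> opt \<P> w) * ?u w powr r) \<partial>?P)"
     using k unfolding Z_def by (simp add: ennreal_mult mult.assoc)
   qed
   also have "\<dots> = ennreal (k * C) * (\<integral>\<^sup>+w. (\<Sum>e\<in>E. ennreal (of_bool (e \<in> opt \<P> w) * ?u w powr r)) \<partial>?P)"
    by (subst nn_integral_sum) (auto simp: sum_distrib_left)
   also have "(\<lambda>w. \<Sum>e\<in>E. ennreal (of_bool (e \<in> opt \<P> w) * ?u w powr r)) = (\<lambda>w. ennreal (N w * ?u w powr r))"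
    by (subst sum_ennreal) (auto simp: Nsum sum_distrib_right fun_eq_iff)
   finally show ?thesis .
  qed
  have V: "V \<le> C1 * B"
  proof -
   have "ennreal (V - (\<integral>w. Z w \<partial>?P)^2) \<le> ennreal (1 * C1) * (\<integral>\<^sup>+w. ennreal (N w * ?u w powr 0) \<partial>?P)" unfolding V_def
   proof (rule es[of "\<lambda>x. x" 1 C1 0])
    show "(a - b)^2 \<le> 1 * ((a - b)^2 * (1 + abs a + abs b) powr 0)" for a b :: real by auto
   qed (use C1 C1b[OF pf, of _ z] Zsq in \<open>auto simp: P.square_int_def\<close>)
   also have "(\<integral>\<^sup>+w. ennreal (N w * ?u w powr 0) \<partial>?P) = (\<integral>\<^sup>+w. ennreal (N w) \<partial>?P)"
   proof (intro nn_integral_cong)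
    fix w
    have "1 + abs (Z w) \<noteq> 0" by simp
    then show "ennreal (N w * ?u w powr 0) = ennreal (N w)" by simp
   qed
   also have "\<dots> = ennreal (\<integral>w. N w \<partial>?P)"
    using N0 NE by (intro nn_integral_eq_integral P.integrable_const_bound[of _ "real (card E)"]) auto
   finally have "ennreal V \<le> ennreal (C1 * (\<integral>w. N w \<partial>?P))" using C1 N0 by (simp add: ennreal_mult EZ)
   then have "V \<le> C1 * (\<integral>w. N w \<partial>?P)" using C1 N0 by (subst (asm) ennreal_le_iff) auto
   also have "\<dots> \<le> C1 * B" using B C1 by (simp add: N_def)
   finally show ?thesis .
  qed
  define A where "A = (\<integral>w. ?q w \<partial>?P)"
  have A0: "0 \<le> A" by (simp add: A_def)
  have hsq: "(abs x powr (p / 2))^2 = abs x powr p" for x :: real by (simp add: power2_eq_square powr_add[symmetric])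
  have Wsq: "P.square_int (\<lambda>w. ?q w)" using mint by (simp add: P.square_int_def hsq)
  have var: "m - A^2 \<le> \<kappa> * ?J"
  proof -
   have Nint: "integrable ?P (\<lambda>w. N w * ?u w powr (p - 2))"
   proof (rule P.integrable_bounded_by)
    have "P.p_int (p - 2) (\<lambda>w. 1 + abs (Z w))" using P.p_int_le_exponent[of "p - 2" p, OF _ _ u1p] p by simp
    then show "integrable ?P (\<lambda>w. real (card E) * ?u w powr (p - 2))" by (simp add: P.p_int_def)
    show "abs (N w * ?u w powr (p - 2)) \<le> real (card E) * ?u w powr (p - 2)" for w using N0 NE by (simp add: mult_right_mono)
   qed measurable
   have \<psi>: "(abs a powr (p / 2) - abs b powr (p / 2))^2 \<le> (p / 2)^2 * ((a - b)^2 * (1 + abs a + abs b) powr (p - 2))" for a b :: real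
   proof -
    have "abs (abs a powr (p / 2) - abs b powr (p / 2))^2 \<le> (p / 2 * abs (a - b) * (1 + abs a + abs b) powr (p / 2 - 1))^2"
     using p by (intro power_mono abs_powr_diff_le) auto
    also have "\<dots> = (p / 2)^2 * ((a - b)^2 * ((1 + abs a + abs b) powr (p / 2 - 1))^2)"
     by (simp only: power_mult_distrib power2_abs mult.assoc)
    also have "((1 + abs a + abs b) powr (p / 2 - 1))^2 = (1 + abs a + abs b) powr (p - 2)"
     by (simp add: power2_eq_square powr_add[symmetric])
    finally show ?thesis by simp
   qed
   have "ennreal (m - A^2) \<le> ennreal ((p / 2)^2 * C2) * (\<integral>\<^sup>+w. ennreal (N w * ?u w powr (p - 2)) \<partial>?P)"
    unfolding m_def A_def hsq[symmetric]
    by (rule es[of "\<lambda>x. abs x powr (p / 2)" "(p / 2)^2" C2 "p - 2"]) (use C2 C2b[OF pf, of _ z] Wsq \<psi> in \<open>auto simp: P.square_int_def\<close>)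
   also have "(\<integral>\<^sup>+w. ennreal (N w * ?u w powr (p - 2)) \<partial>?P) = ennreal ?J" using N0 Nint by (intro nn_integral_eq_integral) auto
   also have "ennreal ((p / 2)^2 * C2) * \<dots> = ennreal (\<kappa> * ?J)"
    unfolding \<kappa>_def using C2 N0 by (subst ennreal_mult[symmetric]) (auto simp: mult.commute)
   finally show ?thesis using \<kappa> N0 by (subst (asm) ennreal_le_iff) (auto intro!: mult_nonneg_nonneg integral_nonneg)
  qed
  have var2: "?J
    \<le> \<eta> * (2 powr p * (1 + m)) + ?h * B powr (p / 2)"
  proof -
   have Npint: "integrable ?P (\<lambda>w. N w powr (p / 2))" by (rule P.integrable_const_bound[of _ "real (card E) powr (p / 2)"])
     (use N0 NE p in \<open>auto intro!: powr_mono2\<close>)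
   have u2: "?u w powr p \<le> 2 powr p * (1 + abs (Z w) powr p)" for w using abs_add_powr_le_two[of p 1 "abs (Z w)"] p by simp
   have "?J
    \<le> (\<integral>w. \<eta> * (2 powr p * (1 + abs (Z w) powr p)) + ?h * N w powr (p / 2) \<partial>?P)"
   proof (rule integral_mono')
    show "integrable ?P (\<lambda>w. \<eta> * (2 powr p * (1 + abs (Z w) powr p)) + ?h * N w powr (p / 2))" using mint Npint by auto
    fix w
    have "N w * ?u w powr (p - 2) \<le> \<eta> * ?u w powr p + ?h * N w powr (p / 2)" using p \<eta> N0 by (intro mult_powr_le) auto
    also have "\<dots> \<le> \<eta> * (2 powr p * (1 + abs (Z w) powr p)) + ?h * N w powr (p / 2)" using u2[of w] \<eta> by simp
    finally show "N w * ?u w powr (p - 2) \<le> \<eta> * (2 powr p * (1 + abs (Z w) powr p)) + ?h * N w powr (p / 2)" .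
   qed (use \<eta> in \<open>auto intro!: add_nonneg_nonneg mult_nonneg_nonneg\<close>)
   also have "\<dots> = \<eta> * (2 powr p * (1 + m)) + ?h * (\<integral>w. N w powr (p / 2) \<partial>?P)"
    using mint Npint by (simp add: m_def P.prob_space)
   also have "\<dots> \<le> \<eta> * (2 powr p * (1 + m)) + ?h * B powr (p / 2)"
    using B(3) by (intro add_left_mono mult_left_mono) (auto simp: N_def)
   finally show ?thesis .
  qed
  have Asq: "A^2 \<le> 2 * (8 * C1) powr (p / 2) * B powr (p / 2) + m / 4"
  proof -
   \<comment> \<open>The level \<open>R\<close> is a multiple of the bound for the standard
     deviation. Below it |Z|^(p/2) is bounded; above it Cauchy-Schwarz gives at most sqrt m * sqrt V
     / R, whose square is at most m / 8.\<close>
   define R where "R = sqrt (8 * C1 * B)"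
   have R: "0 < R" using C1 B by (simp add: R_def)
   have Rsq: "R^2 = 8 * C1 * B" using C1 B by (simp add: R_def)
   have Rp: "(R powr (p / 2))^2 = (8 * C1) powr (p / 2) * B powr (p / 2)"
   proof -
    have "(R powr (p / 2))^2 = (8 * C1 * B) powr (p / 2)"
  using hsq[of R] R C1 B by (simp add: R_def powr_half_sqrt[symmetric] powr_powr)
    then show ?thesis by (simp only: powr_mult)
   qed
   have absZ: "P.square_int (\<lambda>w. abs (Z w))" using Zsq by (simp add: P.square_int_def)
   have prodint: "integrable ?P (\<lambda>w. ?q w * abs (Z w))" by (rule P.square_int_mult_integrable[OF Wsq absZ])
   have "A \<le> (\<integral>w. R powr (p / 2) + 1 / R * (?q w * abs (Z w)) \<partial>?P)" unfolding A_def
   proof (rule integral_mono)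
    show "integrable ?P (\<lambda>w. ?q w)" by (rule P.square_int_integrable[OF Wsq])
    show "integrable ?P (\<lambda>w. R powr (p / 2) + 1 / R * (?q w * abs (Z w)))" using prodint by auto
    fix w
    show "?q w \<le> R powr (p / 2) + 1 / R * (?q w * abs (Z w))"
    proof (cases "abs (Z w) \<le> R")
     case True
     then have "?q w \<le> R powr (p / 2)" using p by (intro powr_mono2) auto
     then show ?thesis using R by (intro add_increasing2) auto
    next
     case False
     then have "?q w * 1 \<le> ?q w * (abs (Z w) / R)" using R by (intro mult_left_mono) auto
     then show ?thesis by (simp add: add_increasing)
    qed
   qed
   also have "\<dots> = R powr (p / 2) + 1 / R * (\<integral>w. ?q w * abs (Z w) \<partial>?P)" using prodint by (simp add: P.prob_space)
   also have "\<dots> \<le> R powr (p / 2) + 1 / R * (sqrt m * sqrt V)" using P.expectation_mult_le_l2norm[OF Wsq absZ] R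
    by (intro add_left_mono mult_left_mono) (auto simp: P.l2norm_def hsq m_def V_def)
   finally have "A^2 \<le> (R powr (p / 2) + 1 / R * (sqrt m * sqrt V))^2" using A0 by (intro power_mono)
   also have "\<dots> \<le> 2 * (R powr (p / 2))^2 + 2 * (1 / R * (sqrt m * sqrt V))^2"
    using sum_squares_bound[of "R powr (p / 2)" "1 / R * (sqrt m * sqrt V)"] unfolding power2_sum by simp
   also have "(1 / R * (sqrt m * sqrt V))^2 = m * (V / (8 * C1 * B))"
    using m0 V0 by (simp add: power_mult_distrib power_divide Rsq)
   also have "2 * (R powr (p / 2))^2 + 2 * (m * (V / (8 * C1 * B))) \<le> 2 * (R powr (p / 2))^2 + 2 * (m * (1 / 8))"
    using V C1 B m0 by (intro add_left_mono mult_left_mono) (auto simp: divide_le_eq)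
   finally show ?thesis unfolding Rp by simp
  qed
  have B1: "1 \<le> B powr (p / 2)" using B p by (intro ge_one_powr_ge_zero) auto
  have "m \<le> A^2 + \<kappa> * (\<eta> * (2 powr p * (1 + m)) + ?h * B powr (p / 2))" using var mult_left_mono[OF var2, of \<kappa>] \<kappa> by linarith
  also have "\<dots> = A^2 + (1 / 4 + m / 4) + \<kappa> * ?h * B powr (p / 2)" using \<kappa> by (simp add: \<eta>_def field_simps)
  also have "\<dots> \<le> (2 * (8 * C1) powr (p / 2) * B powr (p / 2) + m / 4) + (1 / 4 * B powr (p / 2) + m / 4) + \<kappa> * ?h * B powr (p / 2)"
   using Asq B1 by simp
  finally have "m / 2 \<le> (2 * (8 * C1) powr (p / 2) + 1 / 4 + \<kappa> * ?h) * B powr (p / 2)" by (simp add: distrib_right)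
  then have "m \<le> 2 * ((2 * (8 * C1) powr (p / 2) + 1 / 4 + \<kappa> * ?h) * B powr (p / 2))" by simp
  then have "m \<le> K * B powr (p / 2)" unfolding K_def by linarith
  then show ?thesis by (simp add: m_def Z_def z_def)
 qed
 then show ?thesis using K unfolding moment_const_def by blast
qed

lemma (in path_family) opt_cong: "(\<And>e. e \<in> E \<Longrightarrow> w e = w' e) \<Longrightarrow> opt \<P> w = opt \<P> w'"
proof -
 assume eq: "\<And>e. e \<in> E \<Longrightarrow> w e = w' e"
 have "sum w P = sum w' P" if "P \<in> \<P>" for P using that \<P>_sub eq by (intro sum.cong) auto
 then have "{P \<in> \<P>. sum w P = fmin \<P> w} = {P \<in> \<P>. sum w' P = fmin \<P> w'}" using fmin_cong[OF eq] by auto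
 then show ?thesis by (simp only: opt_def)
qed

section \<open>Independent weights and a lower bound for the standard deviation\<close>

lemma (in prob_space) indep_vars_inj_reindex:
 assumes "indep_vars M' X I" "inj_on h J" "h ` J \<subseteq> I"
 shows "indep_vars (\<lambda>j. M' (h j)) (\<lambda>j. X (h j)) J"
proof -
 have "indep_vars (\<lambda>j. PiM {h j} M') (\<lambda>j x. restrict (\<lambda>i. X i x) {h j}) J"
  using assms by (intro indep_vars_restrict[OF assms(1)]) (auto simp: disjoint_family_on_def inj_on_def)
 then have "indep_vars (\<lambda>j. M' (h j)) (\<lambda>j x. (\<lambda>w. w (h j)) (restrict (\<lambda>i. X i x) {h j})) J" by (rule indep_vars_compose2) auto
 then show ?thesis by simp
qed

text \<open>Weights are nonnegative at every sample point, not only almost surely, so that path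
  inequalities hold pointwise; the given weights are truncated at the end to arrange this.\<close>

locale iid_weights = prob_space M for M :: "'a measure" +
 fixes I :: "'e set" and \<omega> :: "'e \<Rightarrow> 'a \<Rightarrow> real" and F :: "real measure" and p :: real
 assumes indep: "indep_vars (\<lambda>_. borel) \<omega> I"
  and distr_\<omega>: "e \<in> I \<Longrightarrow> distr M borel (\<omega> e) = F"
  and F: "real_distribution F"
  and \<omega>_nonneg: "0 \<le> \<omega> e x"
  and p: "2 < p" and int_F: "integrable F (\<lambda>x. abs x powr p)"
begin

sublocale F: real_distribution F by (rule F)

lemma \<omega>_measurable: "e \<in> I \<Longrightarrow> random_variable borel (\<omega> e)" using indep by (auto simp: indep_vars_def2)

lemma integrable_\<omega>_iff:
 "e \<in> I \<Longrightarrow> f \<in> borel_measurable borel \<Longrightarrow> integrable M (\<lambda>x. f (\<omega> e x) :: real) \<longleftrightarrow> integrable F f"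
 using integrable_distr_eq[OF \<omega>_measurable, of e f] distr_\<omega> by simp

lemma expectation_\<omega>:
 "e \<in> I \<Longrightarrow> f \<in> borel_measurable borel \<Longrightarrow> expectation (\<lambda>x. f (\<omega> e x) :: real) = (\<integral>y. f y \<partial>F)"
 using integral_distr[OF \<omega>_measurable, of e f] distr_\<omega> by simp

lemma \<omega>_p: "e \<in> I \<Longrightarrow> p_int p (\<omega> e)" using integrable_\<omega>_iff[of e "\<lambda>x. abs x powr p"] int_F by (simp add: p_int_def \<omega>_measurable)

lemma \<omega>_sq: "e \<in> I \<Longrightarrow> square_int (\<omega> e)" using p_int_imp_square_int[OF _ \<omega>_p] p by simp

text \<open>Determined by the weights in \<open>J\<close>, through an explicit measurable function
  on the product space. Independence of variables with disjoint \<open>J\<close> then follows from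
  that of the restricted families.\<close>

definition dep :: "'e set \<Rightarrow> 'b measure \<Rightarrow> ('a \<Rightarrow> 'b) \<Rightarrow> bool" where
 "dep J N X \<longleftrightarrow> (\<exists>f\<in>measurable (PiM J (\<lambda>_. borel)) N. X = (\<lambda>x. f (\<lambda>e\<in>J. \<omega> e x)))"

lemma restrict_\<omega>_measurable: "J \<subseteq> I \<Longrightarrow> (\<lambda>x. \<lambda>e\<in>J. \<omega> e x) \<in> measurable M (PiM J (\<lambda>_. borel))"
 by (rule measurable_restrict) (auto intro: \<omega>_measurable)

lemma dep_measurable: "dep J N X \<Longrightarrow> J \<subseteq> I \<Longrightarrow> X \<in> measurable M N"
 unfolding dep_def by (auto intro!: measurable_compose[OF restrict_\<omega>_measurable])

lemma depI: "f \<in> measurable (PiM J (\<lambda>_. borel)) N \<Longrightarrow> (\<And>x. X x = f (\<lambda>e\<in>J. \<omega> e x)) \<Longrightarrow> dep J N X" unfolding dep_def by auto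

lemma dep_compose:
 assumes "dep J N X" "g \<in> measurable N N'"
 shows "dep J N' (\<lambda>x. g (X x))"
proof -
 obtain f where f: "f \<in> measurable (PiM J (\<lambda>_. borel)) N" "X = (\<lambda>x. f (\<lambda>e\<in>J. \<omega> e x))" using assms(1) unfolding dep_def by blast
 show ?thesis by (rule depI[OF measurable_compose[OF f(1) assms(2)]]) (simp add: f(2))
qed

lemma dep_Pair:
 assumes "dep J N X" "dep J N' Y"
 shows "dep J (N \<Otimes>\<^sub>M N') (\<lambda>x. (X x, Y x))"
proof -
 obtain f where f: "f \<in> measurable (PiM J (\<lambda>_. borel)) N" "X = (\<lambda>x. f (\<lambda>e\<in>J. \<omega> e x))" using assms(1) unfolding dep_def by blast
 obtain g where g: "g \<in> measurable (PiM J (\<lambda>_. borel)) N'" "Y = (\<lambda>x. g (\<lambda>e\<in>J. \<omega> e x))" using assms(2) unfolding dep_def by blast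
 show ?thesis by (rule depI[OF measurable_Pair[OF f(1) g(1)]]) (simp add: f(2) g(2))
qed

lemma dep_mono:
 assumes "dep J N X" "J \<subseteq> J'"
 shows "dep J' N X"
proof -
 obtain f where f: "f \<in> measurable (PiM J (\<lambda>_. borel)) N" "X = (\<lambda>x. f (\<lambda>e\<in>J. \<omega> e x))" using assms(1) unfolding dep_def by blast
 have "restrict (\<lambda>e\<in>J'. \<omega> e x) J = (\<lambda>e\<in>J. \<omega> e x)" for x using assms(2) by (auto simp: restrict_def fun_eq_iff)
 then show ?thesis by (intro depI[OF measurable_compose[OF measurable_restrict_subset[OF assms(2)] f(1)]]) (simp add: f(2))
qed

lemma dep_\<omega>: "e \<in> J \<Longrightarrow> dep J borel (\<omega> e)" by (rule depI[OF measurable_component_singleton]) auto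

lemma dep_const: "c \<in> space N \<Longrightarrow> dep J N (\<lambda>_. c)" by (rule depI[of "\<lambda>_. c"]) auto

lemma dep_diff: "dep J borel X \<Longrightarrow> dep J borel Y \<Longrightarrow> dep J borel (\<lambda>x. X x - Y x :: real)"
 using dep_compose[OF dep_Pair, of J borel X borel Y "\<lambda>(a, b). a - b" borel] by simp

lemma dep_add: "dep J borel X \<Longrightarrow> dep J borel Y \<Longrightarrow> dep J borel (\<lambda>x. X x + Y x :: real)"
 using dep_compose[OF dep_Pair, of J borel X borel Y "\<lambda>(a, b). a + b" borel] by simp

lemma dep_sum: "(\<And>i. i \<in> A \<Longrightarrow> dep J borel (X i)) \<Longrightarrow> dep J borel (\<lambda>x. \<Sum>i\<in>A. X i x :: real)"
 by (induction A rule: infinite_finite_induct) (auto intro: dep_add dep_const)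

lemma dep_indep_var:
 assumes "dep J N X" "dep J' N' Y" "J \<inter> J' = {}" "J \<subseteq> I" "J' \<subseteq> I"
 shows "indep_var N X N' Y"
proof -
 obtain f where f: "f \<in> measurable (PiM J (\<lambda>_. borel)) N" "X = (\<lambda>x. f (\<lambda>e\<in>J. \<omega> e x))" using assms(1) unfolding dep_def by blast
 obtain g where g: "g \<in> measurable (PiM J' (\<lambda>_. borel)) N'" "Y = (\<lambda>x. g (\<lambda>e\<in>J'. \<omega> e x))"
  using assms(2) unfolding dep_def by blast
 show ?thesis using indep_var_compose[OF indep_var_restrict[OF indep assms(3-5)] f(1) g(1)] by (simp add: f(2) g(2) comp_def)
qed

lemma dep_indep_vars:
 assumes "\<And>j. j \<in> L \<Longrightarrow> dep (K j) N (X j)" "disjoint_family_on K L" "\<And>j. j \<in> L \<Longrightarrow> K j \<subseteq> I"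
 shows "indep_vars (\<lambda>_. N) X L"
proof -
 have "\<forall>j. \<exists>f. j \<in> L \<longrightarrow> f \<in> measurable (PiM (K j) (\<lambda>_. borel)) N \<and> X j = (\<lambda>x. f (\<lambda>e\<in>K j. \<omega> e x))"
  using assms(1) unfolding dep_def by blast
 then obtain f where f: "\<And>j. j \<in> L \<Longrightarrow> f j \<in> measurable (PiM (K j) (\<lambda>_. borel)) N"
  "\<And>j. j \<in> L \<Longrightarrow> X j = (\<lambda>x. f j (\<lambda>e\<in>K j. \<omega> e x))" by metis
 have "indep_vars (\<lambda>_. N) (\<lambda>j x. f j (\<lambda>e\<in>K j. \<omega> e x)) L"
  by (rule indep_vars_compose2[OF indep_vars_restrict[OF indep assms(3,2)] f(1)]) auto
 then show ?thesis by (subst indep_vars_cong[OF refl f(2) refl]) auto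
qed

lemma dep_fmin:
 assumes "path_family E \<P>" "E \<subseteq> J"
 shows "dep J borel (\<lambda>x. fmin \<P> (\<lambda>e. \<omega> e x))"
proof (rule dep_mono[OF _ assms(2)])
 interpret path_family E \<P> by fact
 show "dep E borel (\<lambda>x. fmin \<P> (\<lambda>e. \<omega> e x))" by (rule depI[OF measurable_fmin]) (auto intro: fmin_cong)
qed

lemma dep_opt:
 assumes "path_family E \<P>" "E \<subseteq> J"
 shows "dep J (count_space UNIV) (\<lambda>x. opt \<P> (\<lambda>e. \<omega> e x))"
proof (rule dep_mono[OF _ assms(2)])
 interpret path_family E \<P> by fact
 show "dep E (count_space UNIV) (\<lambda>x. opt \<P> (\<lambda>e. \<omega> e x))" by (rule depI[OF measurable_opt]) (simp, rule opt_cong, simp)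
qed

lemma distr_restrict_\<omega>:
 assumes "inj_on h E" "h ` E \<subseteq> I" "E \<noteq> {}"
 shows "distr M (PiM E (\<lambda>_. borel)) (\<lambda>x. \<lambda>e\<in>E. \<omega> (h e) x) = PiM E (\<lambda>_. F)"
proof -
 have "indep_vars (\<lambda>_. borel) (\<lambda>e. \<omega> (h e)) E" using indep_vars_inj_reindex[OF indep assms(1,2)] .
 then have "distr M (PiM E (\<lambda>_. borel)) (\<lambda>x. \<lambda>e\<in>E. \<omega> (h e) x) = PiM E (\<lambda>e. distr M borel (\<omega> (h e)))"
  using assms by (subst (asm) indep_vars_iff_distr_eq_PiM') (auto intro!: \<omega>_measurable)
 also have "\<dots> = PiM E (\<lambda>_. F)" using assms by (intro PiM_cong refl distr_\<omega>) auto
 finally show ?thesis .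
qed

text \<open>An injective relabelling of i.i.d. weights keeps the law; applied to the shift of the
  tube, this yields stationarity.\<close>

lemma distr_shift:
 assumes "inj_on h E" "h ` E \<subseteq> I" "E \<subseteq> I" "E \<noteq> {}" "g \<in> measurable (PiM E (\<lambda>_. borel)) N"
 shows "distr M N (\<lambda>x. g (\<lambda>e\<in>E. \<omega> (h e) x)) = distr M N (\<lambda>x. g (\<lambda>e\<in>E. \<omega> e x))"
proof -
 have D: "distr M N (\<lambda>x. g (\<lambda>e\<in>E. \<omega> (k e) x)) = distr (PiM E (\<lambda>_. F)) N g"
  if k: "inj_on k E" "k ` E \<subseteq> I" for k
 proof -
  have m: "(\<lambda>x. \<lambda>e\<in>E. \<omega> (k e) x) \<in> measurable M (PiM E (\<lambda>_. borel))" using k by (intro measurable_restrict \<omega>_measurable) auto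
  show ?thesis unfolding distr_restrict_\<omega>[OF k assms(4), symmetric] by (subst distr_distr[OF assms(5) m]) (simp add: comp_def)
 qed
 show ?thesis using D[of h] D[of "\<lambda>e. e"] assms by (simp add: inj_on_def)
qed

lemma expectation_PiM:
 fixes g :: "('e \<Rightarrow> real) \<Rightarrow> real"
 assumes "E \<subseteq> I" "E \<noteq> {}" "g \<in> borel_measurable (PiM E (\<lambda>_. borel))"
 shows "expectation (\<lambda>x. g (\<lambda>e\<in>E. \<omega> e x)) = (\<integral>w. g w \<partial>PiM E (\<lambda>_. F))"
proof -
 have "(\<integral>w. g w \<partial>PiM E (\<lambda>_. F)) = (\<integral>w. g w \<partial>distr M (PiM E (\<lambda>_. borel)) (\<lambda>x. \<lambda>e\<in>E. \<omega> e x))"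
  using distr_restrict_\<omega>[of "\<lambda>e. e" E] assms by (simp add: inj_on_def)
 also have "\<dots> = expectation (\<lambda>x. g (\<lambda>e\<in>E. \<omega> e x))" by (rule integral_distr[OF restrict_\<omega>_measurable[OF assms(1)] assms(3)])
 finally show ?thesis by simp
qed

lemma square_int_fmin:
 assumes "path_family E \<P>" "E \<subseteq> I"
 shows "square_int (\<lambda>x. fmin \<P> (\<lambda>e. \<omega> e x))"
proof -
 interpret path_family E \<P> by fact
 have S: "square_int (\<lambda>x. \<Sum>e\<in>E. \<omega> e x)" using assms by (intro square_int_sum \<omega>_sq) auto
 show ?thesis
 proof (rule square_int_bounded_by[OF S])
  show "random_variable borel (\<lambda>x. fmin \<P> (\<lambda>e. \<omega> e x))" by (rule dep_measurable[OF dep_fmin[OF assms(1) order_refl] assms(2)])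
  show "abs (fmin \<P> (\<lambda>e. \<omega> e x)) \<le> (\<Sum>e\<in>E. \<omega> e x)" for x using abs_fmin_le[of "\<lambda>e. \<omega> e x"] \<omega>_nonneg by simp
 qed
qed

text \<open>The covariance of the passage time with \<open>min (\<omega> e) b\<close> is compared with the passage time in
 which \<open>\<omega> e\<close> is replaced by the mean \<open>c\<close> of \<open>min (\<omega> e) b\<close>: it then no longer depends on
 \<open>\<omega> e\<close>, and both factors of the product change sign at \<open>c\<close>.\<close>

lemma sdev_fmin_lower_bound:
 assumes pf: "path_family E \<P>" and EI: "E \<subseteq> I" and b: "0 \<le> b"
 defines "c \<equiv> \<integral>y. min y b \<partial>F"
 defines "n x \<equiv> real (card {e \<in> opt \<P> (\<lambda>e. \<omega> e x). b \<le> \<omega> e x})"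
 shows "(b - c)^2 * expectation n \<le> sdev (\<lambda>x. fmin \<P> (\<lambda>e. \<omega> e x)) * (b * sqrt (real (card E)))"
proof -
 interpret path_family E \<P> by fact
 let ?w = "\<lambda>x e. \<omega> e x"
 define T where "T x = fmin \<P> (?w x)" for x
 define Te where "Te e x = fmin \<P> ((?w x)(e := c))" for e x
 define G where "G e x = min (\<omega> e x) b - c" for e x
 define u where "u e x = (of_bool (e \<in> opt \<P> (?w x) \<and> b \<le> \<omega> e x) :: real)" for e x
 have EIe: "e \<in> I" if "e \<in> E" for e using that EI by auto
 have Tsq: "square_int T" unfolding T_def[abs_def] by (rule square_int_fmin[OF pf EI])
 have um: "random_variable borel (u e)" if "e \<in> E" for e
 proof -
  have [measurable]: "random_variable borel (\<omega> e)" by (rule \<omega>_measurable[OF EIe[OF that]])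
  have "Measurable.pred M (\<lambda>x. e \<in> opt \<P> (?w x))"
   by (rule measurable_compose[OF dep_measurable[OF dep_opt[OF pf order_refl] EI]]) simp
  then show ?thesis unfolding u_def by measurable
 qed
 have uint: "integrable M (u e)" if "e \<in> E" for e
  by (rule integrable_const_bound[of _ 1]) (use um[OF that] in \<open>auto simp: u_def\<close>)
 have nsum: "n x = (\<Sum>e\<in>E. u e x)" for x
 proof -
  have "(\<Sum>e\<in>E. u e x) = (\<Sum>e\<in>{e \<in> opt \<P> (?w x). b \<le> \<omega> e x}. (1::real))"
   using opt_subset finite_E by (intro sum.mono_neutral_cong_right) (auto simp: u_def)
  then show ?thesis by (simp add: n_def)
 qed
 have Gsq: "square_int (G e)" if e: "e \<in> E" for e
 proof -
  have [measurable]: "random_variable borel (\<omega> e)" by (rule \<omega>_measurable[OF EIe[OF e]])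
  have "square_int (\<lambda>x. min (\<omega> e x) b)"
   by (rule square_int_bounded_by[OF square_int_const[of b]]) (use \<omega>_nonneg b in \<open>auto simp: min_def\<close>)
  then show ?thesis unfolding G_def by (intro square_int_diff square_int_const)
 qed
 have minint: "integrable F (\<lambda>y. min y b)"
 proof -
  have "F.p_int p (\<lambda>y. y)" using int_F by (simp add: F.p_int_def)
  then have "integrable F (\<lambda>y. abs y)" using F.p_int_imp_square_int[of p "\<lambda>y. y"] p F.square_int_integrable[of "\<lambda>y. y"] by auto
  then have "integrable F (\<lambda>y. abs y + abs b)" by auto
  then show ?thesis by (rule F.integrable_bounded_by) (auto simp: min_def)
 qed
 have cb: "c \<le> b"
 proof -
  have "c \<le> (\<integral>y. b \<partial>F)" unfolding c_def by (intro integral_mono minint) auto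
  then show ?thesis using F.prob_space by simp
 qed
 have EG: "expectation (G e) = 0" if e: "e \<in> E" for e
 proof -
  have "expectation (\<lambda>x. min (\<omega> e x) b) = c" unfolding c_def by (rule expectation_\<omega>[OF EIe[OF e]]) simp
  moreover have "integrable M (\<lambda>x. min (\<omega> e x) b)" using integrable_\<omega>_iff[OF EIe[OF e], of "\<lambda>y. min y b"] minint by simp
  ultimately show ?thesis by (simp add: G_def[abs_def] prob_space)
 qed
 \<comment> \<open>Subtracting \<open>Te e\<close>, which is independent of
   \<open>\<omega> e\<close>, does not change the covariance with the centred variable
   \<open>G e\<close>, and makes the product nonnegative.\<close>
 have trm: "(b - c)^2 * expectation (u e) \<le> expectation (\<lambda>x. T x * G e x)" if e: "e \<in> E" for e
 proof -
  have depT: "dep (E - {e}) borel (Te e)"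
  proof (rule depI)
   have "(\<lambda>w. w(e := c)) \<in> measurable (PiM (E - {e}) (\<lambda>_. borel)) (PiM E (\<lambda>_. borel))"
    by (rule measurable_fun_upd[where J = "E - {e}"]) (use e in auto)
   from measurable_compose[OF this measurable_fmin]
   show "(\<lambda>w. fmin \<P> (w(e := c))) \<in> borel_measurable (PiM (E - {e}) (\<lambda>_. borel))" by simp
   show "Te e x = fmin \<P> ((\<lambda>e\<in>E - {e}. \<omega> e x)(e := c))" for x unfolding Te_def by (rule fmin_cong) auto
  qed
  have depG: "dep {e} borel (G e)" unfolding G_def by (rule dep_compose[OF dep_\<omega>]) auto
  have ind: "indep_var borel (Te e) borel (G e)" using EI e by (intro dep_indep_var[OF depT depG]) auto
  have Tem: "random_variable borel (Te e)" by (rule dep_measurable[OF depT]) (use EI in auto)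
  have dT: "abs (T x - Te e x) \<le> \<omega> e x + abs c" for x
  proof (cases "\<omega> e x \<le> c")
   case True
   then show ?thesis using abs_fmin_upd_le[of "\<lambda>e. \<omega> e x" e c] \<omega>_nonneg[of e x] by (auto simp: T_def Te_def split: if_splits)
  next
   case False
   have "((?w x)(e := c))(e := \<omega> e x) = (?w x)" by (simp add: fun_eq_iff)
   from abs_fmin_upd_le[of "(?w x)(e := c)" e "\<omega> e x", unfolded this]
   show ?thesis using \<omega>_nonneg[of e x] False by (auto simp: T_def Te_def split: if_splits)
  qed
  have dsq: "square_int (\<lambda>x. T x - Te e x)"
   by (rule square_int_bounded_by[OF square_int_add[OF \<omega>_sq[OF EIe[OF e]] square_int_const[of "abs c"]]])
    (use Tem square_int_measurable[OF Tsq] dT in auto)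
  have Tesq: "square_int (Te e)" using square_int_diff[OF Tsq dsq] by simp
  have 0: "expectation (\<lambda>x. Te e x * G e x) = 0"
   using indep_var_lebesgue_integral[OF ind square_int_integrable[OF Tesq] square_int_integrable[OF Gsq[OF e]]] EG[OF e]
   by simp
  \<comment> \<open>Both factors have the sign of \<open>\<omega> e x - c\<close>. If
    \<open>e\<close> is used and has weight at least \<open>b\<close>, lowering it to
    \<open>c\<close> saves at least \<open>b - c\<close>, and \<open>G e x = b - c\<close>.\<close>
  have pt: "(b - c)^2 * u e x \<le> (T x - Te e x) * G e x" for x
  proof (cases "c \<le> \<omega> e x")
   case True
   have eq: "((?w x)(e := c))(e := \<omega> e x) = (?w x)" by (simp add: fun_eq_iff)
   have ge: "0 \<le> T x - Te e x"
    using fmin_upd_raise(1)[of "(?w x)(e := c)" e "\<omega> e x"] True unfolding eq by (simp add: T_def Te_def)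
   show ?thesis
   proof (cases "e \<in> opt \<P> (?w x) \<and> b \<le> \<omega> e x")
    case u: True
    have "Te e x \<le> T x + (c - \<omega> e x)" using fmin_upd_le[of "\<lambda>e. \<omega> e x" e c] u by (simp add: T_def Te_def)
    then have "b - c \<le> T x - Te e x" using u by simp
    then have "(b - c) * (b - c) \<le> (T x - Te e x) * (b - c)" using cb by (intro mult_right_mono) auto
    moreover have "min (\<omega> e x) b = b" using u by simp
    ultimately show ?thesis using u by (simp add: u_def G_def power2_eq_square)
   next
    case False
    then have "u e x = 0" by (auto simp: u_def)
    moreover have "0 \<le> G e x" using True cb by (simp add: G_def)
    ultimately show ?thesis using ge by simp
   qed
  next
   case False
   then have "T x - Te e x \<le> 0" using fmin_upd_raise(1)[of "\<lambda>e. \<omega> e x" e c] by (simp add: T_def Te_def)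
   moreover have "G e x \<le> 0" using False by (simp add: G_def min_def)
   ultimately have "0 \<le> (T x - Te e x) * G e x" by (simp add: mult_nonpos_nonpos)
   moreover have "u e x = 0" using False cb by (simp add: u_def)
   ultimately show ?thesis by simp
  qed
  have "(b - c)^2 * expectation (u e) = expectation (\<lambda>x. (b - c)^2 * u e x)" by simp
  also have "\<dots> \<le> expectation (\<lambda>x. (T x - Te e x) * G e x)"
   using uint[OF e] square_int_mult_integrable[OF dsq Gsq[OF e]] by (intro integral_mono pt) auto
  also have "\<dots> = expectation (\<lambda>x. T x * G e x) - expectation (\<lambda>x. Te e x * G e x)"
   using square_int_mult_integrable[OF Tsq Gsq[OF e]] square_int_mult_integrable[OF Tesq Gsq[OF e]]
   by (simp add: left_diff_distrib)
  finally show ?thesis using 0 by simp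
 qed
 \<comment> \<open>Summing over the edges costs only the standard deviation of \<open>S\<close>, at
   most \<open>b\<close> times the root of the number of edges, because the \<open>G e\<close> are
   independent and centred.\<close>
 define S where "S x = (\<Sum>e\<in>E. G e x)" for x
 have Ssq: "square_int S" unfolding S_def[abs_def] by (intro square_int_sum Gsq)
 have ES: "expectation S = 0" unfolding S_def[abs_def]
  using Gsq EG by (subst Bochner_Integration.integral_sum) (auto simp: square_int_integrable)
 have ESsq: "expectation (\<lambda>x. (S x)^2) \<le> real (card E) * b^2"
 proof -
  define \<sigma> where "\<sigma> = (\<integral>y. (min y b - c)^2 \<partial>F)"
  have ind: "indep_vars (\<lambda>_. borel) G E" unfolding G_def[abs_def]
   by (rule indep_vars_compose2[OF indep_vars_subset[OF indep EI], of "\<lambda>_ y. min y b - c"]) auto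
  have EG2: "expectation (\<lambda>x. (G e x)^2) = \<sigma>" if "e \<in> E" for e
   unfolding G_def \<sigma>_def by (rule expectation_\<omega>[OF EIe[OF that]]) simp
  have "expectation (\<lambda>x. (S x)^2) = real (card E) * \<sigma>"
   unfolding S_def by (rule expectation_sum_sq_indep[OF finite_E ind Gsq EG EG2])
  moreover have "real (card E) * \<sigma> \<le> real (card E) * b^2"
  proof (cases "E = {}")
   case False
   then obtain e where e: "e \<in> E" by auto
   have [measurable]: "random_variable borel (\<omega> e)" by (rule \<omega>_measurable[OF EIe[OF e]])
   have sqm: "square_int (\<lambda>x. min (\<omega> e x) b)" using square_int_add[OF Gsq[OF e] square_int_const[of c]] by (simp add: G_def)
   have "\<sigma> = (sdev (\<lambda>x. min (\<omega> e x) b))^2"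
   proof -
    have "expectation (\<lambda>x. min (\<omega> e x) b) = c" unfolding c_def by (rule expectation_\<omega>[OF EIe[OF e]]) simp
    then show ?thesis unfolding sdev_sq EG2[OF e, symmetric] by (simp add: G_def)
   qed
   also have "\<dots> \<le> (l2norm (\<lambda>x. min (\<omega> e x) b))^2" using sdev_le_l2norm[OF sqm] by (intro power_mono) auto
   also have "\<dots> \<le> (l2norm (\<lambda>x. b))^2"
    by (intro power_mono l2norm_mono square_int_const) (use \<omega>_nonneg b in \<open>auto simp: min_def\<close>)
   also have "\<dots> = b^2" by (simp add: l2norm_sq prob_space)
   finally show ?thesis by (intro mult_left_mono) auto
  qed simp
  ultimately show ?thesis by simp
 qed
 have "(b - c)^2 * expectation n = (\<Sum>e\<in>E. (b - c)^2 * expectation (u e))"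
  unfolding nsum by (subst Bochner_Integration.integral_sum) (auto simp: uint sum_distrib_left)
 also have "\<dots> \<le> (\<Sum>e\<in>E. expectation (\<lambda>x. T x * G e x))" by (intro sum_mono trm)
 also have "\<dots> = expectation (\<lambda>x. T x * S x)" unfolding S_def sum_distrib_left
  by (subst Bochner_Integration.integral_sum) (auto intro: square_int_mult_integrable Tsq Gsq)
 also have "\<dots> = expectation (\<lambda>x. centered T x * S x)"
  using square_int_mult_integrable[OF Tsq Ssq] square_int_integrable[OF Ssq] ES by (simp add: centered_def left_diff_distrib)
 also have "\<dots> \<le> sdev T * l2norm S" unfolding sdev_def by (intro expectation_mult_le_l2norm square_int_centered Tsq Ssq)
 also have "\<dots> \<le> sdev T * (b * sqrt (real (card E)))"
 proof (intro mult_left_mono)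
  have "l2norm S \<le> sqrt (real (card E) * b^2)" unfolding l2norm_def using ESsq by (rule real_sqrt_le_mono)
  also have "\<dots> = b * sqrt (real (card E))" using b by (simp add: real_sqrt_mult mult.commute)
  finally show "l2norm S \<le> b * sqrt (real (card E))" .
 qed simp
 finally show ?thesis by (simp only: T_def[abs_def])
qed

end

section \<open>Walks and crossings of a tube\<close>

lemma path_edges_simps [simp]:
 "path_edges [] = []" "path_edges [x] = []" "path_edges (x # y # zs) = {x, y} # path_edges (y # zs)"
 by (simp_all add: path_edges_def)

lemma length_path_edges: "length (path_edges xs) = length xs - 1" by (simp add: path_edges_def)

lemma successively_edge_iff: "successively (\<lambda>x y. {x, y} \<in> S) xs \<longleftrightarrow> set (path_edges xs) \<subseteq> S"
 by (induction xs rule: induct_list012) auto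

lemma path_edges_append:
 "xs \<noteq> [] \<Longrightarrow> ys \<noteq> [] \<Longrightarrow> path_edges (xs @ ys) = path_edges xs @ {last xs, hd ys} # path_edges ys"
proof (induction xs rule: induct_list012)
 case (2 x)
 then show ?case by (cases ys) auto
qed auto

lemma path_edges_glue: "path_edges (xs @ y # ys) = path_edges (xs @ [y]) @ path_edges (y # ys)"
 by (induction xs rule: induct_list012) auto

lemma path_edges_nth:
 assumes "e \<in> set (path_edges xs)"
 shows "\<exists>i. Suc i < length xs \<and> e = {xs ! i, xs ! Suc i}"
 using assms
proof (induction xs rule: induct_list012)
 case (3 x y zs)
 then consider "e = {x, y}" | "\<exists>i. Suc i < length (y # zs) \<and> e = {(y # zs) ! i, (y # zs) ! Suc i}" by auto
 then show ?case
 proof cases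
  case 1
  then show ?thesis by auto
 next
  case 2
  then obtain i where "Suc i < length (y # zs)" "e = {(y # zs) ! i, (y # zs) ! Suc i}" by blast
  then show ?thesis by auto
 qed
qed simp_all

lemma path_edges_subset_vertices: "e \<in> set (path_edges xs) \<Longrightarrow> e \<subseteq> set xs" by (induction xs rule: induct_list012) auto

lemma distinct_path_edges: "distinct xs \<Longrightarrow> distinct (path_edges xs)"
proof (induction xs rule: induct_list012)
 case (3 x y zs)
 have "{x, y} \<notin> set (path_edges (y # zs))" using path_edges_subset_vertices[of "{x, y}" "y # zs"] 3 by auto
 then show ?case using 3 by simp
qed auto

lemma path_edges_tl_butlast:
 "{x, y} \<in> set (path_edges xs) \<Longrightarrow>
  (x \<in> set (butlast xs) \<and> y \<in> set (tl xs)) \<or> (y \<in> set (butlast xs) \<and> x \<in> set (tl xs))"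
proof (induction xs rule: induct_list012)
 case (3 u v zs)
 then show ?case by fastforce
qed auto

lemma path_edges_elim:
 assumes "e \<in> set (path_edges xs)"
 obtains x y where "e = {x, y}" "x \<in> set (butlast xs)" "y \<in> set (tl xs)"
proof -
 have "\<exists>x y. e = {x, y} \<and> x \<in> set (butlast xs) \<and> y \<in> set (tl xs)" using assms
 proof (induction xs rule: induct_list012)
  case (3 u v zs)
  show ?case
  proof (cases "e = {u, v}")
   case True
   then show ?thesis by auto
  next
   case False
   then have "\<exists>x y. e = {x, y} \<and> x \<in> set (butlast (v # zs)) \<and> y \<in> set (tl (v # zs))" using 3 by auto
   then show ?thesis by force
  qed
 qed auto
 then show ?thesis using that by blast
qed

lemma path_weight_eq_sum: "distinct xs \<Longrightarrow> path_weight w xs = sum w (set (path_edges xs))"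
 by (simp add: path_weight_def sum_list_distinct_conv_sum_set distinct_path_edges)

lemma sum_le_sum_list:
 fixes w :: "'b \<Rightarrow> real"
 assumes "P \<subseteq> set es" "\<And>e. 0 \<le> w e"
 shows "sum w P \<le> sum_list (map w es)"
proof -
 have "sum w (set es) \<le> sum_list (map w es)"
 proof (induction es)
  case (Cons e es)
  then show ?case using assms(2) by (auto simp: insert_absorb sum.insert_if add_increasing)
 qed simp
 moreover have "sum w P \<le> sum w (set es)" using assms by (intro sum_mono2) auto
 ultimately show ?thesis by simp
qed

locale fin_graph =
 fixes H :: "'v ugraph"
 assumes finite_H: "finite_graph H" and connected_H: "connected_graph H"
begin

abbreviation "V \<equiv> verts H"
abbreviation "PG \<equiv> graph_prod int_line H"
abbreviation "diam \<equiv> graph_diameter H"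

lemma finite_V: "finite V" and finite_EH: "finite (edges H)" using finite_H by (auto simp: finite_graph_def)

lemma V_ne: "V \<noteq> {}" using connected_H by (simp add: connected_graph_def)

lemma edge_verts: "{u, v} \<in> edges H \<Longrightarrow> u \<in> V \<and> v \<in> V \<and> u \<noteq> v"
 using connected_H by (fastforce simp: connected_graph_def simple_graph_def doubleton_eq_iff)

lemma edgeE:
 assumes "e \<in> edges H" obtains u v where "e = {u, v}" "u \<in> V" "v \<in> V" "u \<noteq> v"
 using assms connected_H by (fastforce simp: connected_graph_def simple_graph_def)

lemma PG_edge_iff:
 "{x, y} \<in> edges PG \<longleftrightarrow> snd x \<in> V \<and> snd y \<in> V \<and>
  ((snd x = snd y \<and> (fst y = fst x + 1 \<or> fst x = fst y + 1)) \<or> (fst x = fst y \<and> {snd x, snd y} \<in> edges H))"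
proof
 assume "{x, y} \<in> edges PG"
 then show "snd x \<in> V \<and> snd y \<in> V \<and>
  ((snd x = snd y \<and> (fst y = fst x + 1 \<or> fst x = fst y + 1)) \<or> (fst x = fst y \<and> {snd x, snd y} \<in> edges H))"
  by (auto simp: graph_prod_def int_line_def doubleton_eq_iff insert_commute dest: edge_verts)
next
 obtain i u j v where [simp]: "x = (i, u)" "y = (j, v)" by force
 assume "snd x \<in> V \<and> snd y \<in> V \<and>
  ((snd x = snd y \<and> (fst y = fst x + 1 \<or> fst x = fst y + 1)) \<or> (fst x = fst y \<and> {snd x, snd y} \<in> edges H))"
 then consider "u = v" "j = i + 1" "u \<in> V" | "u = v" "i = j + 1" "u \<in> V" | "i = j" "{u, v} \<in> edges H" by auto
 then show "{x, y} \<in> edges PG"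
 proof cases
  case 1
  have "{(i, u), (i + 1, u)} \<in> edges PG" using 1 by (auto simp: graph_prod_def int_line_def)
  then show ?thesis using 1 by simp
 next
  case 2
  have "{(j, u), (j + 1, u)} \<in> edges PG" using 2 by (auto simp: graph_prod_def int_line_def)
  then show ?thesis using 2 by (simp add: insert_commute)
 next
  case 3
  then have "{(i, u), (i, v)} \<in> edges PG" by (auto simp: graph_prod_def int_line_def)
  then show ?thesis using 3 by simp
 qed
qed

lemma PG_edgeE:
 assumes "e \<in> edges PG" obtains x y where "e = {x, y}" "x \<noteq> y"
proof -
 obtain x y where xy: "e = {x, y}" using assms by (auto simp: graph_prod_def)
 have "x \<noteq> y" using assms edge_verts unfolding xy PG_edge_iff by auto
 with xy show ?thesis by (rule that)
qed

lemma PG_edge_fst: "{x, y} \<in> edges PG \<Longrightarrow> abs (fst x - fst y) \<le> 1" unfolding PG_edge_iff by auto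

definition walk :: "(int \<times> 'v) list \<Rightarrow> bool" where
 "walk xs \<longleftrightarrow> xs \<noteq> [] \<and> set xs \<subseteq> UNIV \<times> V \<and> set (path_edges xs) \<subseteq> edges PG"

text \<open>Touching the left side only at the start and the right side only at the end keeps the
  edges of a crossing off the two bounding slices.\<close>

definition crossing_path :: "int \<Rightarrow> int \<Rightarrow> (int \<times> 'v) list \<Rightarrow> bool" where
 "crossing_path a b xs \<longleftrightarrow> walk xs \<and> distinct xs \<and> fst (hd xs) = a \<and> fst (last xs) = b \<and>
  (\<forall>x\<in>set (tl xs). a < fst x) \<and> (\<forall>x\<in>set (butlast xs). fst x < b)"

definition cross :: "int \<Rightarrow> int \<Rightarrow> (int \<times> 'v) set set set" where
 "cross a b = {set (path_edges xs) | xs. crossing_path a b xs}"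

text \<open>Edges inside the two bounding slices are left out. Adjacent slabs are therefore
  disjoint, and the weights in the slice between them are independent of both; that slice carries
  the connecting paths.\<close>

definition slab :: "int \<Rightarrow> int \<Rightarrow> (int \<times> 'v) set set" where
 "slab a b = {e \<in> edges PG. (\<forall>x\<in>e. a \<le> fst x \<and> fst x \<le> b) \<and> (\<exists>x\<in>e. a < fst x) \<and> (\<exists>x\<in>e. fst x < b)}"

definition slice :: "int \<Rightarrow> (int \<times> 'v) set set" where
 "slice i = {e \<in> edges PG. \<forall>x\<in>e. fst x = i}"

lemma slab_subset: "slab a b \<subseteq> edges PG" and slice_subset: "slice i \<subseteq> edges PG" by (auto simp: slab_def slice_def)

lemma slabD:
 assumes "e \<in> slab a b"
 shows "e \<in> edges PG" "\<And>x. x \<in> e \<Longrightarrow> a \<le> fst x \<and> fst x \<le> b" "\<exists>x\<in>e. a < fst x" "\<exists>x\<in>e. fst x < b"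
 using assms by (auto simp: slab_def)

lemma slab_mono:
 assumes "a' \<le> a" "b \<le> b'" shows "slab a b \<subseteq> slab a' b'"
proof
 fix e assume e: "e \<in> slab a b"
 obtain x y where "x \<in> e" "a < fst x" "y \<in> e" "fst y < b" using slabD(3,4)[OF e] by blast
 then have "\<exists>x\<in>e. a' < fst x" "\<exists>x\<in>e. fst x < b'" using assms by (meson le_less_trans less_le_trans)+
 moreover have "a' \<le> fst x \<and> fst x \<le> b'" if "x \<in> e" for x using slabD(2)[OF e that] assms by simp
 ultimately show "e \<in> slab a' b'" using slabD(1)[OF e] by (simp add: slab_def)
qed

lemma slab_disjoint: "b \<le> a' \<Longrightarrow> slab a b \<inter> slab a' b' = {}"
 by (meson disjoint_iff dual_order.strict_trans2 linorder_not_less slabD(2,3,4) order_trans)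

lemma slab_slice_disjoint:
 assumes "i \<le> a \<or> b \<le> i" shows "slab a b \<inter> slice i = {}"
proof -
 have "e \<notin> slice i" if e: "e \<in> slab a b" for e
 proof
  assume s: "e \<in> slice i"
  obtain x y where "x \<in> e" "a < fst x" "y \<in> e" "fst y < b" using slabD(3,4)[OF e] by blast
  then show False using s assms by (auto simp: slice_def)
 qed
 then show ?thesis by auto
qed

lemma crossing_bounds:
 assumes "crossing_path a b xs" "x \<in> set xs" "a \<le> b"
 shows "a \<le> fst x" "fst x \<le> b" "snd x \<in> V"
proof -
 have "xs \<noteq> []" using assms by auto
 then have "x = hd xs \<or> x \<in> set (tl xs)" "x = last xs \<or> x \<in> set (butlast xs)"
  using assms(2) by (cases xs, auto) (cases xs rule: rev_cases, auto)
 then show "a \<le> fst x" "fst x \<le> b" using assms by (auto simp: crossing_path_def)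
 show "snd x \<in> V" using assms by (auto simp: crossing_path_def walk_def)
qed

lemma crossing_subset_slab:
 assumes "crossing_path a b xs" "a \<le> b"
 shows "set (path_edges xs) \<subseteq> slab a b"
proof
 fix e assume e: "e \<in> set (path_edges xs)"
 then have "e \<in> edges PG" using assms by (auto simp: crossing_path_def walk_def)
 moreover obtain x y where "e = {x, y}" "x \<in> set (butlast xs)" "y \<in> set (tl xs)" using e by (rule path_edges_elim)
 moreover have "a \<le> fst z \<and> fst z \<le> b" if "z \<in> e" for z
  using crossing_bounds[OF assms(1) _ assms(2), of z] path_edges_subset_vertices[OF e] that by auto
 ultimately show "e \<in> slab a b" using assms(1) unfolding slab_def crossing_path_def by auto
qed

lemma finite_box: "finite ({a..b} \<times> V)" for a b :: int using finite_V by auto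

lemma finite_slab: "finite (slab a b)"
proof (rule finite_subset)
 show "slab a b \<subseteq> Pow ({a..b} \<times> V)"
 proof
  fix e assume e: "e \<in> slab a b"
  then obtain x y where "e = {x, y}" using PG_edgeE[OF slabD(1)] by blast
  then show "e \<in> Pow ({a..b} \<times> V)" using e by (auto simp: slab_def PG_edge_iff mem_Times_iff)
 qed
qed (simp add: finite_V)

text \<open>A shortest list among those that use only edges of \<open>xs\<close> and run from height
  at most \<open>a\<close> to height at least \<open>b\<close> is a crossing: an early return, an
  early arrival or a repeated vertex would each allow a shorter one.\<close>

lemma extract_crossing:
 assumes w: "walk xs" and ab: "a < b" and hd: "fst (hd xs) \<le> a" and last: "b \<le> fst (last xs)"
 shows "\<exists>P\<in>cross a b. P \<subseteq> set (path_edges xs)"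
proof -
 define good where "good ys \<longleftrightarrow> ys \<noteq> [] \<and> set ys \<subseteq> UNIV \<times> V \<and> set (path_edges ys) \<subseteq> set (path_edges xs)
  \<and> fst (hd ys) \<le> a \<and> b \<le> fst (last ys)" for ys
 have "good xs" using w hd last by (auto simp: good_def walk_def)
 then obtain ys where ys: "good ys" and min: "\<And>zs. good zs \<Longrightarrow> length ys \<le> length zs"
  using ex_has_least_nat[of good xs length] by blast
 have sub: "set (path_edges ys) \<subseteq> edges PG" using ys w by (auto simp: good_def walk_def)
 have two: "tl ys \<noteq> []" using ys ab by (cases ys) (auto simp: good_def)
 have suffix: "False" if "ys = us @ x # vs" "us \<noteq> []" "fst x \<le> a" for us x vs
 proof -
  have "set (path_edges (x # vs)) \<subseteq> set (path_edges ys)" unfolding that(1) path_edges_glue[of us x vs] by simp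
  then have "good (x # vs)" using ys that by (auto simp: good_def)
  then show False using min[of "x # vs"] that by simp
 qed
 have prefix: "False" if "ys = us @ x # vs" "vs \<noteq> []" "b \<le> fst x" for us x vs
 proof -
  have "set (path_edges (us @ [x])) \<subseteq> set (path_edges ys)" unfolding that(1) path_edges_glue[of us x vs] by simp
  then have "good (us @ [x])" using ys that by (cases us) (auto simp: good_def)
  then show False using min[of "us @ [x]"] that by simp
 qed
 have tl: "a < fst x" if x: "x \<in> set (tl ys)" for x
 proof (rule ccontr)
  assume "\<not> a < fst x"
  obtain us vs where uv: "tl ys = us @ x # vs" using split_list[OF x] by blast
  have "ys = (hd ys # us) @ x # vs" using uv two by (cases ys) auto
  then show False using suffix[of "hd ys # us" x vs] \<open>\<not> a < fst x\<close> by simp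
 qed
 have bl: "fst x < b" if x: "x \<in> set (butlast ys)" for x
 proof (rule ccontr)
  assume "\<not> fst x < b"
  obtain us vs where uv: "butlast ys = us @ x # vs" using split_list[OF x] by blast
  have "ys = us @ x # (vs @ [last ys])" using uv append_butlast_last_id[of ys] ys by force
  then show False using prefix[of us x "vs @ [last ys]"] \<open>\<not> fst x < b\<close> by simp
 qed
 \<comment> \<open>Steps have length at most 1 and the second vertex lies beyond \<open>a\<close>,
   so the first lies exactly over \<open>a\<close>.\<close>
 have hd_eq: "fst (hd ys) = a"
 proof -
  obtain y z zs where y: "ys = y # z # zs" using two by (cases ys, simp) (metis list.sel(3) neq_Nil_conv)
  have "{y, z} \<in> edges PG" using sub y by simp
  then have "abs (fst y - fst z) \<le> 1" by (rule PG_edge_fst)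
  moreover have "a < fst z" using tl y by simp
  moreover have "fst y \<le> a" using ys y by (simp add: good_def)
  ultimately show ?thesis using y by simp
 qed
 have last_eq: "fst (last ys) = b"
 proof -
  obtain us z where u: "ys = us @ [z]" using ys by (metis good_def rev_exhaust)
  have "us \<noteq> []" using u two by auto
  then have "{last us, z} \<in> edges PG" using sub u by (simp add: path_edges_append)
  then have "abs (fst (last us) - fst z) \<le> 1" by (rule PG_edge_fst)
  moreover have "fst (last us) < b" using bl u \<open>us \<noteq> []\<close> by simp
  moreover have "b \<le> fst z" using ys u by (simp add: good_def)
  ultimately show ?thesis using u by simp
 qed
 have dist: "distinct ys"
 proof (rule ccontr)
  assume "\<not> distinct ys"
  then obtain us vs ws x where d: "ys = us @ [x] @ vs @ [x] @ ws" using not_distinct_decomp by blast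
  have pe: "set (path_edges (us @ x # ws)) \<subseteq> set (path_edges ys)"
  proof -
   have 1: "path_edges (us @ x # zs) = path_edges (us @ [x]) @ path_edges (x # zs)" for zs by (rule path_edges_glue)
   have 2: "set (path_edges (x # ws)) \<subseteq> set (path_edges (x # vs @ x # ws))"
    using path_edges_append[of "x # vs" "x # ws"] by auto
   show ?thesis using 1[of ws] 1[of "vs @ x # ws"] 2 d by auto
  qed
  have "good (us @ x # ws)" using ys pe d by (cases us; cases ws) (auto simp: good_def)
  then show False using min[of "us @ x # ws"] d by simp
 qed
 have "crossing_path a b ys" unfolding crossing_path_def walk_def using ys sub dist hd_eq last_eq tl bl by (auto simp: good_def)
 then show ?thesis using ys unfolding cross_def good_def by blast
qed

lemma crossE:
 assumes "P \<in> cross a b" obtains xs where "P = set (path_edges xs)" "crossing_path a b xs"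
 using assms by (auto simp: cross_def)

lemma cross_restrict:
 assumes "P \<in> cross a b" "a \<le> a'" "a' < b'" "b' \<le> b"
 shows "\<exists>P'\<in>cross a' b'. P' \<subseteq> P"
 using assms extract_crossing[of _ a' b'] by (elim crossE) (auto simp: crossing_path_def)

lemma straight_crossing:
 assumes "a < b" shows "\<exists>P\<in>cross a b. card P \<le> nat (b - a)"
proof -
 obtain v where v: "v \<in> V" using V_ne by auto
 define n where "n = nat (b - a)"
 define xs where "xs = map (\<lambda>i. (a + int i, v)) [0..<Suc n]"
 have len: "length xs = Suc n" by (simp add: xs_def)
 have nth: "xs ! i = (a + int i, v)" if "i < Suc n" for i using that by (simp add: xs_def del: upt_Suc)
 have "set (path_edges xs) \<subseteq> edges PG"
 proof
  fix e assume "e \<in> set (path_edges xs)"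
  then obtain i where "Suc i < length xs" "e = {xs ! i, xs ! Suc i}" using path_edges_nth by blast
  then show "e \<in> edges PG" using v by (simp add: len nth PG_edge_iff)
 qed
 then have "walk xs" using v by (auto simp: walk_def xs_def)
 moreover have "fst (hd xs) = a" using nth[of 0] len by (simp add: hd_conv_nth length_greater_0_conv[symmetric] del: length_greater_0_conv)
 moreover have "fst (last xs) = b"
  using nth[of n] len assms by (simp add: last_conv_nth length_greater_0_conv[symmetric] n_def del: length_greater_0_conv)
 ultimately obtain P where P: "P \<in> cross a b" "P \<subseteq> set (path_edges xs)" using extract_crossing[of xs a b] assms by auto
 have "card P \<le> card (set (path_edges xs))" using P by (intro card_mono) auto
 also have "\<dots> \<le> length (path_edges xs)" by (rule card_length)
 also have "\<dots> = n" by (simp add: length_path_edges len)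
 finally show ?thesis using P by (auto simp: n_def)
qed

lemma cross_subset: "a \<le> b \<Longrightarrow> cross a b \<subseteq> Pow (slab a b)" using crossing_subset_slab by (auto simp: cross_def)

lemma cross_nonempty: "a < b \<Longrightarrow> cross a b \<noteq> {}" using straight_crossing by blast

lemma obtain_short_path:
 assumes "u \<in> V" "v \<in> V"
 obtains ys where "is_path H u ys v" "length (path_edges ys) \<le> diam"
proof -
 let ?L = "(\<lambda>xs. length (path_edges xs)) ` {xs. is_path H u xs v}"
 have "{xs. is_path H u xs v} \<noteq> {}" using connected_H assms by (auto simp: connected_graph_def)
 then have "Inf ?L \<in> ?L" by (intro Inf_nat_def1) auto
 then obtain ys where ys: "is_path H u ys v" "length (path_edges ys) = graph_dist H u v" by (auto simp: graph_dist_def)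
 have "finite {graph_dist H u v | u v. u \<in> V \<and> v \<in> V}"
  by (rule finite_subset[of _ "(\<lambda>(u, v). graph_dist H u v) ` (V \<times> V)"]) (auto simp: finite_V)
 then have "graph_dist H u v \<le> diam" unfolding graph_diameter_def using assms by (intro Max_ge) auto
 with ys show ?thesis by (intro that[of ys]) auto
qed

text \<open>In a connected graph with more than one vertex every vertex lies on an edge. A bound on
  the number of edges thus also controls the slab sizes.\<close>

lemma card_V_le: "card V \<le> 2 * card (edges H) + 1"
proof (cases "card V \<le> 1")
 case False
 have "V \<subseteq> \<Union>(edges H)"
 proof
  fix u assume u: "u \<in> V"
  obtain v where v: "v \<in> V" "v \<noteq> u" using False u finite_V by (metis card_le_Suc0_iff_eq One_nat_def)
  obtain xs where xs: "is_path H u xs v" using connected_H u v by (auto simp: connected_graph_def)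
  then obtain y ys where "xs = u # y # ys" using v by (metis is_path_def hd_Cons_tl last_ConsL list.collapse list.sel(1))
  then have "{u, y} \<in> edges H" using xs by (simp add: is_path_def)
  then show "u \<in> \<Union>(edges H)" by auto
 qed
 then have "card V \<le> card (\<Union>(edges H))" by (rule card_mono[rotated]) (use finite_EH in \<open>auto elim: edgeE\<close>)
 also have "\<dots> \<le> (\<Sum>e\<in>edges H. card e)" by (rule card_Union_le_sum_card)
 also have "\<dots> \<le> (\<Sum>e\<in>edges H. 2)"
 proof (rule sum_mono)
  fix e assume "e \<in> edges H"
  then obtain u v where "e = {u, v}" by (rule edgeE)
  then show "card e \<le> 2" by (simp add: card_insert_if)
 qed
 finally show ?thesis by simp
qed simp

lemma card_slab_le: "card (slab a b) \<le> nat (b - a + 1) * (card V + card (edges H))"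
proof -
 let ?A = "(\<lambda>(i, w). {(i, w), (i + 1, w)}) ` ({a..b} \<times> V)"
 let ?B = "(\<lambda>(i, e). Pair i ` e) ` ({a..b} \<times> edges H)"
 have "slab a b \<subseteq> ?A \<union> ?B"
 proof
  fix e assume e: "e \<in> slab a b"
  obtain x y where xy: "e = {x, y}" using PG_edgeE[OF slabD(1)[OF e]] by blast
  have b: "a \<le> fst x" "fst x \<le> b" "a \<le> fst y" "fst y \<le> b" using slabD(2)[OF e] xy by auto
  obtain i u j v where s [simp]: "x = (i, u)" "y = (j, v)" by force
  have "{x, y} \<in> edges PG" using slabD(1)[OF e] xy by simp
  then consider "u = v" "j = i + 1" "u \<in> V" | "u = v" "i = j + 1" "u \<in> V" | "i = j" "{u, v} \<in> edges H"
   unfolding PG_edge_iff by auto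
  then show "e \<in> ?A \<union> ?B"
  proof cases
   case 1
   then have "e = (\<lambda>(i, w). {(i, w), (i + 1, w)}) (i, u)" "(i, u) \<in> {a..b} \<times> V" using xy b by auto
   then show ?thesis by blast
  next
   case 2
   then have "e = (\<lambda>(i, w). {(i, w), (i + 1, w)}) (j, u)" "(j, u) \<in> {a..b} \<times> V" using xy b by auto
   then show ?thesis by blast
  next
   case 3
   then have "e = (\<lambda>(i, e). Pair i ` e) (i, {u, v})" "(i, {u, v}) \<in> {a..b} \<times> edges H" using xy b by auto
   then show ?thesis by blast
  qed
 qed
 then have "card (slab a b) \<le> card (?A \<union> ?B)" by (rule card_mono[rotated]) (simp add: finite_V finite_EH)
 also have "\<dots> \<le> card ?A + card ?B" by (rule card_Un_le)
 also have "\<dots> \<le> card ({a..b} \<times> V) + card ({a..b} \<times> edges H)" by (intro add_mono card_image_le) (simp_all add: finite_V finite_EH)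
 finally show ?thesis by (simp add: card_cartesian_product distrib_left)
qed

definition lift :: "int \<Rightarrow> 'v list \<Rightarrow> (int \<times> 'v) list" where
 "lift i ys = map (Pair i) ys"

lemma path_edges_lift: "path_edges (lift i ys) = map ((`) (Pair i)) (path_edges ys)"
 unfolding lift_def by (induction ys rule: induct_list012) auto

lemma walk_lift:
 assumes "is_path H u ys v"
 shows "walk (lift i ys)" "set (path_edges (lift i ys)) \<subseteq> slice i"
  "hd (lift i ys) = (i, u)" "last (lift i ys) = (i, v)" "length (path_edges (lift i ys)) = length (path_edges ys)"
proof -
 have ys: "ys \<noteq> []" "set ys \<subseteq> V" "set (path_edges ys) \<subseteq> edges H" "hd ys = u" "last ys = v"
  using assms by (auto simp: is_path_def successively_edge_iff)
 have *: "Pair i ` e \<in> slice i" if e: "e \<in> edges H" for e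
 proof -
  obtain u v where uv: "e = {u, v}" "u \<in> V" "v \<in> V" using e by (rule edgeE)
  then have "{(i, u), (i, v)} \<in> edges PG" using e by (simp add: PG_edge_iff)
  then show ?thesis using uv by (simp add: slice_def)
 qed
 show 1: "set (path_edges (lift i ys)) \<subseteq> slice i" unfolding path_edges_lift using ys * by auto
 show "walk (lift i ys)" unfolding walk_def using ys 1 order_trans[OF 1 slice_subset] by (auto simp: lift_def)
 show "hd (lift i ys) = (i, u)" "last (lift i ys) = (i, v)" "length (path_edges (lift i ys)) = length (path_edges ys)"
  using ys by (simp_all add: lift_def hd_map last_map length_path_edges)
qed

lemma walk_join:
 assumes "walk xs" "walk ys" "last xs = hd ys"
 shows "walk (xs @ tl ys)" "hd (xs @ tl ys) = hd xs" "last (xs @ tl ys) = last ys"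
  "path_edges (xs @ tl ys) = path_edges xs @ path_edges ys"
proof -
 have ne: "xs \<noteq> []" "ys \<noteq> []" using assms by (auto simp: walk_def)
 obtain us x where x: "xs = us @ [x]" using ne by (metis rev_exhaust)
 obtain vs where v: "ys = x # vs" using ne assms x by (cases ys) auto
 show pe: "path_edges (xs @ tl ys) = path_edges xs @ path_edges ys" unfolding x v using path_edges_glue[of us x vs] by simp
 show "walk (xs @ tl ys)" using assms pe ne by (auto simp: walk_def dest: list.set_sel(2))
 show "hd (xs @ tl ys) = hd xs" using ne by simp
 show "last (xs @ tl ys) = last ys" using x v by simp
qed

lemma walk_ends:
 assumes "walk xs" shows "snd (hd xs) \<in> V" "snd (last xs) \<in> V"
proof -
 have "hd xs \<in> UNIV \<times> V" "last xs \<in> UNIV \<times> V" using assms hd_in_set[of xs] last_in_set[of xs] unfolding walk_def by blast+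
 then show "snd (hd xs) \<in> V" "snd (last xs) \<in> V" by auto
qed

text \<open>A crossing of \<open>[a, b]\<close> and one of \<open>[b, c]\<close> are joined by a geodesic of the slice over \<open>b\<close>.\<close>

lemma cross_join:
 assumes "P \<in> cross a b" "Q \<in> cross b c" "a < b" "b < c"
 shows "\<exists>s. set s \<subseteq> slice b \<and> length s \<le> diam \<and> (\<exists>R\<in>cross a c. R \<subseteq> P \<union> set s \<union> Q)"
proof -
 obtain xs where xs: "P = set (path_edges xs)" "crossing_path a b xs" using assms by (auto elim: crossE)
 obtain zs where zs: "Q = set (path_edges zs)" "crossing_path b c zs" using assms by (auto elim: crossE)
 have w: "walk xs" "walk zs" "fst (hd xs) = a" "fst (last xs) = b" "fst (hd zs) = b" "fst (last zs) = c"
  using xs zs by (auto simp: crossing_path_def)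
 have "snd (last xs) \<in> V" "snd (hd zs) \<in> V" using walk_ends w by auto
 then obtain ys where ys: "is_path H (snd (last xs)) ys (snd (hd zs))" "length (path_edges ys) \<le> diam"
  by (rule obtain_short_path)
 note l = walk_lift[OF ys(1), of b]
 have j1: "last xs = hd (lift b ys)" using w l by auto
 note 1 = walk_join[OF w(1) l(1) j1]
 have j2: "last (xs @ tl (lift b ys)) = hd zs" using 1 w l by (simp add: prod_eq_iff)
 note 2 = walk_join[OF 1(1) w(2) j2]
 obtain R where R: "R \<in> cross a c" "R \<subseteq> set (path_edges ((xs @ tl (lift b ys)) @ tl zs))"
  using extract_crossing[OF 2(1), of a c] w 1 2 assms by auto
 have "R \<subseteq> P \<union> set (path_edges (lift b ys)) \<union> Q" using R(2) 1 2 xs zs by auto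
 then show ?thesis using R(1) l ys(2) by (intro exI[of _ "path_edges (lift b ys)"]) auto
qed

definition shift :: "int \<Rightarrow> (int \<times> 'v) set \<Rightarrow> (int \<times> 'v) set" where
 "shift k e = (\<lambda>(i, v). (i + k, v)) ` e"

lemma shift_shift [simp]: "shift k (shift l e) = shift (k + l) e" by (auto simp: shift_def image_image case_prod_unfold add_ac)

lemma shift_0 [simp]: "shift 0 e = e" by (simp add: shift_def)

lemma inj_shift: "inj_on (shift k) A" by (rule inj_on_inverseI[of _ "shift (- k)"]) simp

lemma shift_edge: "e \<in> edges PG \<Longrightarrow> shift k e \<in> edges PG"
proof -
 assume e: "e \<in> edges PG"
 obtain x y where xy: "e = {x, y}" using PG_edgeE[OF e] by blast
 show ?thesis using e unfolding xy shift_def by (cases x; cases y) (auto simp: PG_edge_iff)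
qed

lemma crossing_path_shift:
 assumes "crossing_path a b xs"
 shows "crossing_path (a + k) (b + k) (map (\<lambda>(i, v). (i + k, v)) xs)"
  "set (path_edges (map (\<lambda>(i, v). (i + k, v)) xs)) = shift k ` set (path_edges xs)"
proof -
 let ?f = "\<lambda>(i, v). (i + k, v) :: int \<times> 'v"
 have ne: "xs \<noteq> []" using assms by (auto simp: crossing_path_def walk_def)
 show pe: "set (path_edges (map ?f xs)) = shift k ` set (path_edges xs)"
  by (induction xs rule: induct_list012) (auto simp: shift_def)
 have inj: "inj_on ?f A" for A by (auto simp: inj_on_def)
 show "crossing_path (a + k) (b + k) (map ?f xs)"
  using assms inj pe shift_edge by (auto simp: crossing_path_def walk_def distinct_map hd_map last_map map_tl[symmetric] map_butlast[symmetric] case_prod_unfold)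
qed

lemma cross_shift: "cross (a + k) (b + k) = (`) (shift k) ` cross a b"
proof -
 have sub: "(`) (shift k) ` cross a b \<subseteq> cross (a + k) (b + k)" for a b k using crossing_path_shift unfolding cross_def by blast
 have "cross (a + k) (b + k) \<subseteq> (`) (shift k) ` cross a b"
 proof
  fix P assume P: "P \<in> cross (a + k) (b + k)"
  have "shift (- k) ` P \<in> cross a b" using sub[of "- k" "a + k" "b + k"] P by auto
  moreover have "P = shift k ` shift (- k) ` P" by force
  ultimately show "P \<in> (`) (shift k) ` cross a b" by blast
 qed
 with sub show ?thesis by blast
qed

lemma slab_shift: "shift k ` slab a b = slab (a + k) (b + k)"
proof -
 have sub: "shift k ` slab a b \<subseteq> slab (a + k) (b + k)" for a b k using shift_edge unfolding slab_def by (force simp: shift_def)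
 have "slab (a + k) (b + k) \<subseteq> shift k ` slab a b"
 proof
  fix e assume "e \<in> slab (a + k) (b + k)"
  then have "shift (- k) e \<in> slab a b" using sub[of "- k" "a + k" "b + k"] by auto
  moreover have "e = shift k (shift (- k) e)" by simp
  ultimately show "e \<in> shift k ` slab a b" by blast
 qed
 with sub show ?thesis by blast
qed

end

text \<open>Jensen's inequality, by tangents to the power function at the mean
  \<open>m\<close>.\<close>

lemma sum_powr_le:
 fixes y :: "'i \<Rightarrow> real" and q :: real
 assumes "finite A" "1 \<le> q" "\<And>i. i \<in> A \<Longrightarrow> 0 \<le> y i"
 shows "(\<Sum>i\<in>A. y i) powr q \<le> real (card A) powr (q - 1) * (\<Sum>i\<in>A. y i powr q)"
proof (cases "(\<Sum>i\<in>A. y i) = 0")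
 case True
 then show ?thesis by (simp add: sum_nonneg)
next
 case False
 define S where "S = (\<Sum>i\<in>A. y i)"
 have S: "0 < S" using False assms by (simp add: S_def sum_nonneg less_le)
 have n: "0 < real (card A)" using False assms by (auto simp: card_gt_0_iff)
 define m where "m = S / real (card A)"
 have m: "0 < m" using S n by (simp add: m_def)
 have "real (card A) * m powr q = (\<Sum>i\<in>A. m powr q * (1 + q * (y i / m - 1)))"
 proof -
  have "(\<Sum>i\<in>A. m powr q * (1 + q * (y i / m - 1))) = m powr q * (real (card A) + q * (S / m - real (card A)))"
   by (simp add: sum_distrib_left[symmetric] sum.distrib sum_subtractf sum_divide_distrib[symmetric] S_def)
  also have "S / m = real (card A)" using S n by (simp add: m_def)
  finally show ?thesis by simp
 qed
 also have "\<dots> \<le> (\<Sum>i\<in>A. y i powr q)"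
 proof (rule sum_mono)
  fix i assume i: "i \<in> A"
  have "m powr q * (1 + q * (y i / m - 1)) \<le> m powr q * (y i / m) powr q"
   using assms i m by (intro mult_left_mono powr_ge_tangent) auto
  also have "\<dots> = y i powr q" using i m by (simp add: powr_divide)
  finally show "m powr q * (1 + q * (y i / m - 1)) \<le> y i powr q" .
 qed
 finally have "real (card A) * m powr q \<le> (\<Sum>i\<in>A. y i powr q)" .
 then have "real (card A) powr (q - 1) * (real (card A) * m powr q) \<le> real (card A) powr (q - 1) * (\<Sum>i\<in>A. y i powr q)"
  by (intro mult_left_mono) auto
 moreover have "real (card A) powr (q - 1) * (real (card A) * m powr q) = S powr q"
 proof -
  have "real (card A) powr (q - 1) * real (card A) = real (card A) powr q" by (rule powr_minus_one_mult) simp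
  moreover have "(real (card A) * m) powr q = real (card A) powr q * m powr q" by (rule powr_mult)
  moreover have "real (card A) * m = S" using n by (simp add: m_def)
  ultimately show ?thesis by simp
 qed
 ultimately show ?thesis by (simp add: S_def)
qed

text \<open>On an uncountable type the product of two discrete sigma-algebras need not be discrete.
  Pairs of optimal crossings have finite range, which makes the pairing measurable.\<close>

lemma (in iid_weights) dep_Pair_count_space:
 assumes X: "dep J (count_space UNIV) X" and Y: "dep J (count_space UNIV) Y"
  and A: "finite A" and B: "finite B" and XA: "\<And>x. X x \<in> A" and YB: "\<And>x. Y x \<in> B"
 shows "dep J (count_space UNIV) (\<lambda>x. (X x, Y x))"
proof -
 let ?P = "PiM J (\<lambda>_. borel :: real measure)"
 obtain f where f: "f \<in> measurable ?P (count_space UNIV)" "X = (\<lambda>x. f (\<lambda>e\<in>J. \<omega> e x))" using X unfolding dep_def by blast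
 obtain g where g: "g \<in> measurable ?P (count_space UNIV)" "Y = (\<lambda>x. g (\<lambda>e\<in>J. \<omega> e x))" using Y unfolding dep_def by blast
 obtain a b where ab: "a \<in> A" "b \<in> B" using XA YB by blast
 \<comment> \<open>\<open>f\<close> is known to lie in \<open>A\<close> only along the samples;
   elsewhere it is redirected to a default value.\<close>
 define f' where "f' w = (if f w \<in> A then f w else a)" for w
 define g' where "g' w = (if g w \<in> B then g w else b)" for w
 have fg': "f' \<in> measurable ?P (count_space UNIV)" "g' \<in> measurable ?P (count_space UNIV)" unfolding f'_def g'_def
  using measurable_compose[OF f(1), of "\<lambda>y. if y \<in> A then y else a" "count_space UNIV"]
   measurable_compose[OF g(1), of "\<lambda>y. if y \<in> B then y else b" "count_space UNIV"] by auto
 have "(\<lambda>w. (f' w, g' w)) \<in> measurable ?P (count_space (A \<times> B))"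
 proof (subst measurable_count_space_eq2, simp add: A B, intro conjI ballI)
  show "(\<lambda>w. (f' w, g' w)) \<in> space ?P \<rightarrow> A \<times> B" using ab by (auto simp: f'_def g'_def)
  fix c
  have "(\<lambda>w. (f' w, g' w)) -` {c} \<inter> space ?P = (f' -` {fst c} \<inter> space ?P) \<inter> (g' -` {snd c} \<inter> space ?P)" by auto
  also have "\<dots> \<in> sets ?P" by (intro sets.Int measurable_sets[OF fg'(1)] measurable_sets[OF fg'(2)]) auto
  finally show "(\<lambda>w. (f' w, g' w)) -` {c} \<inter> space ?P \<in> sets ?P" .
 qed
 from measurable_compose[OF this, of "\<lambda>y. y" "count_space UNIV"]
 have m: "(\<lambda>w. (f' w, g' w)) \<in> measurable ?P (count_space UNIV)" by simp
 show ?thesis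
 proof (rule depI[OF m])
  fix x
  show "(X x, Y x) = (f' (\<lambda>e\<in>J. \<omega> e x), g' (\<lambda>e\<in>J. \<omega> e x))" using XA[of x] YB[of x] f(2) g(2) by (simp add: f'_def g'_def)
 qed
qed

section \<open>Crossing times of a fixed tube and their junction errors\<close>

locale fpp = fin_graph H + iid_weights M "edges (graph_prod int_line H)" \<omega> F p
 for H :: "'v ugraph" and M :: "'a measure" and \<omega> F p
begin

definition tau :: "nat \<Rightarrow> nat \<Rightarrow> 'a \<Rightarrow> real" where
 "tau a b x = fmin (cross (int a) (int b)) (\<lambda>e. \<omega> e x)"

text \<open>The L2 norm plus the Lp norm of a weight; the 1 makes it positive.\<close>

definition \<kappa> :: real where
 "\<kappa> = 1 + sqrt (\<integral>y. y^2 \<partial>F) + (\<integral>y. abs y powr p \<partial>F) powr (1 / p)"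

lemma pf: "a < b \<Longrightarrow> path_family (slab a b) (cross a b)" by unfold_locales (use finite_slab cross_subset cross_nonempty in auto)

lemma cross_elem_nonempty:
 assumes "P \<in> cross a b" "a < b" shows "P \<noteq> {}"
proof -
 obtain xs where xs: "P = set (path_edges xs)" "crossing_path a b xs" using assms by (auto elim: crossE)
 obtain x ys where "xs = x # ys" using xs by (cases xs) (auto simp: crossing_path_def walk_def)
 then show ?thesis using xs assms(2) by (cases ys) (auto simp: crossing_path_def)
qed

lemma slab_ne: "a < b \<Longrightarrow> slab a b \<noteq> {}" using cross_nonempty[of a b] cross_elem_nonempty[of _ a b] cross_subset[of a b] by auto

lemma tau_dep: "a < b \<Longrightarrow> dep (slab (int a) (int b)) borel (tau a b)" unfolding tau_def[abs_def] by (rule dep_fmin[OF pf]) auto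

lemma expectation_sum_powr_le:
 assumes "finite A" "A' ` A \<subseteq> edges PG" "1 \<le> q" "q \<le> p"
 shows "integrable M (\<lambda>x. (\<Sum>i\<in>A. \<omega> (A' i) x) powr q)"
  and "expectation (\<lambda>x. (\<Sum>i\<in>A. \<omega> (A' i) x) powr q) \<le> real (card A) powr q * (\<integral>y. abs y powr q \<partial>F)"
proof -
 have e: "A' i \<in> edges PG" if "i \<in> A" for i using assms that by auto
 have [measurable]: "random_variable borel (\<omega> (A' i))" if "i \<in> A" for i by (rule \<omega>_measurable[OF e[OF that]])
 have pq: "p_int q (\<omega> (A' i))" if "i \<in> A" for i using p_int_le_exponent[of q p, OF _ _ \<omega>_p[OF e[OF that]]] assms by simp
 have iq: "integrable M (\<lambda>x. \<omega> (A' i) x powr q)" if "i \<in> A" for i using pq[OF that] \<omega>_nonneg by (simp add: p_int_def)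
 have le: "(\<Sum>i\<in>A. \<omega> (A' i) x) powr q \<le> real (card A) powr (q - 1) * (\<Sum>i\<in>A. \<omega> (A' i) x powr q)" for x
  using assms \<omega>_nonneg by (intro sum_powr_le) auto
 have intr: "integrable M (\<lambda>x. real (card A) powr (q - 1) * (\<Sum>i\<in>A. \<omega> (A' i) x powr q))" using iq by auto
 show int: "integrable M (\<lambda>x. (\<Sum>i\<in>A. \<omega> (A' i) x) powr q)" by (rule integrable_bounded_by[OF intr]) (use le in auto)
 have "expectation (\<lambda>x. (\<Sum>i\<in>A. \<omega> (A' i) x) powr q) \<le> expectation (\<lambda>x. real (card A) powr (q - 1) * (\<Sum>i\<in>A. \<omega> (A' i) x powr q))"
  by (rule integral_mono[OF int intr le])
 also have "\<dots> = real (card A) powr (q - 1) * (\<Sum>i\<in>A. expectation (\<lambda>x. \<omega> (A' i) x powr q))" using iq by simp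
 also have "(\<Sum>i\<in>A. expectation (\<lambda>x. \<omega> (A' i) x powr q)) = (\<Sum>i\<in>A. (\<integral>y. abs y powr q \<partial>F))"
 proof (rule sum.cong[OF refl])
  fix i assume "i \<in> A"
  from expectation_\<omega>[OF e[OF this], of "\<lambda>y. abs y powr q"]
  show "expectation (\<lambda>x. \<omega> (A' i) x powr q) = (\<integral>y. abs y powr q \<partial>F)" using \<omega>_nonneg by simp
 qed
 also have "real (card A) powr (q - 1) * \<dots> = real (card A) powr q * (\<integral>y. abs y powr q \<partial>F)"
  using powr_minus_one_mult[of "real (card A)" q] by simp
 finally show "expectation (\<lambda>x. (\<Sum>i\<in>A. \<omega> (A' i) x) powr q) \<le> real (card A) powr q * (\<integral>y. abs y powr q \<partial>F)" .
qed

lemma expectation_sum_list_powr_le: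
 assumes "set s \<subseteq> edges PG" "1 \<le> q" "q \<le> p"
 shows "integrable M (\<lambda>x. sum_list (map (\<lambda>e. \<omega> e x) s) powr q)"
  and "expectation (\<lambda>x. sum_list (map (\<lambda>e. \<omega> e x) s) powr q) \<le> real (length s) powr q * (\<integral>y. abs y powr q \<partial>F)"
proof -
 have eq: "sum_list (map (\<lambda>e. \<omega> e x) s) = (\<Sum>i\<in>{..<length s}. \<omega> (s ! i) x)" for x by (simp add: sum_list_sum_nth atLeast0LessThan)
 have sub: "(!) s ` {..<length s} \<subseteq> edges PG" using assms(1) by auto
 show "integrable M (\<lambda>x. sum_list (map (\<lambda>e. \<omega> e x) s) powr q)"
  "expectation (\<lambda>x. sum_list (map (\<lambda>e. \<omega> e x) s) powr q) \<le> real (length s) powr q * (\<integral>y. abs y powr q \<partial>F)"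
  unfolding eq using expectation_sum_powr_le[OF _ sub assms(2,3)] by auto
qed

text \<open>The connecting path may depend on the two optimal crossings, but these are independent
 of the weights it uses.\<close>

lemma random_connection_moment:
 assumes C: "finite \<C>" "dep J (count_space UNIV) c" "\<And>x. c x \<in> \<C>" "J \<subseteq> edges PG"
  and s: "\<And>y. y \<in> \<C> \<Longrightarrow> set (s y) \<subseteq> S \<and> length (s y) \<le> n" and S: "S \<subseteq> edges PG" "J \<inter> S = {}"
  and q: "1 \<le> q" "q \<le> p"
  and E: "random_variable borel E" "\<And>x. 0 \<le> E x" "\<And>x. E x \<le> sum_list (map (\<lambda>e. \<omega> e x) (s (c x)))"
 shows "integrable M (\<lambda>x. E x powr q)" and "expectation (\<lambda>x. E x powr q) \<le> real n powr q * (\<integral>y. abs y powr q \<partial>F)"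
proof -
 define W where "W y x = sum_list (map (\<lambda>e. \<omega> e x) (s y))" for y x
 define mq where "mq = (\<integral>y. abs y powr q \<partial>F)"
 have mq: "0 \<le> mq" by (simp add: mq_def)
 have Wint: "integrable M (\<lambda>x. W y x powr q)" and WE: "expectation (\<lambda>x. W y x powr q) \<le> real n powr q * mq"
  if y: "y \<in> \<C>" for y
 proof -
  have sub: "set (s y) \<subseteq> edges PG" using s[OF y] S by auto
  show "integrable M (\<lambda>x. W y x powr q)" unfolding W_def by (rule expectation_sum_list_powr_le[OF sub q])
  have "expectation (\<lambda>x. W y x powr q) \<le> real (length (s y)) powr q * mq"
   unfolding W_def mq_def by (rule expectation_sum_list_powr_le[OF sub q])
  also have "\<dots> \<le> real n powr q * mq" using s[OF y] q mq by (intro mult_right_mono powr_mono2) auto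
  finally show "expectation (\<lambda>x. W y x powr q) \<le> real n powr q * mq" .
 qed
 have ind: "indep_var borel (\<lambda>x. of_bool (c x = y) :: real) borel (\<lambda>x. W y x powr q)" if y: "y \<in> \<C>" for y
 proof (rule dep_indep_var[OF _ _ S(2) C(4) S(1)])
  show "dep J borel (\<lambda>x. of_bool (c x = y) :: real)" using dep_compose[OF C(2), of "\<lambda>z. of_bool (z = y) :: real" borel] by simp
  have "W y = (\<lambda>x. \<Sum>i\<in>{..<length (s y)}. \<omega> (s y ! i) x)" by (simp add: W_def fun_eq_iff sum_list_sum_nth atLeast0LessThan)
  moreover have "dep S borel \<dots>" using s[OF y] by (intro dep_sum dep_\<omega>) auto
  ultimately have "dep S borel (W y)" by simp
  from dep_compose[OF this, of "\<lambda>z. z powr q" borel]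
  show "dep S borel (\<lambda>x. W y x powr q)" by simp
 qed
 have cm [measurable]: "c \<in> measurable M (count_space UNIV)" by (rule dep_measurable[OF C(2,4)])
 have oint: "integrable M (\<lambda>x. of_bool (c x = y) :: real)" for y by (rule integrable_const_bound[of _ 1]) auto
 have pint: "integrable M (\<lambda>x. of_bool (c x = y) * W y x powr q)" if "y \<in> \<C>" for y
  by (rule indep_var_integrable[OF ind[OF that] oint Wint[OF that]])
 have le: "E x powr q \<le> (\<Sum>y\<in>\<C>. of_bool (c x = y) * W y x powr q)" for x
 proof -
  have "E x powr q \<le> W (c x) x powr q" using E q by (intro powr_mono2) (auto simp: W_def)
  also have "\<dots> = (\<Sum>y\<in>\<C>. of_bool (c x = y) * W y x powr q)" using C by simp
  finally show ?thesis .
 qed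
 have sint: "integrable M (\<lambda>x. \<Sum>y\<in>\<C>. of_bool (c x = y) * W y x powr q)" using pint by auto
 show int: "integrable M (\<lambda>x. E x powr q)" by (rule integrable_bounded_by[OF sint]) (use E le in auto)
 have "expectation (\<lambda>x. E x powr q) \<le> expectation (\<lambda>x. \<Sum>y\<in>\<C>. of_bool (c x = y) * W y x powr q)"
  by (rule integral_mono[OF int sint le])
 also have "\<dots> = (\<Sum>y\<in>\<C>. expectation (\<lambda>x. of_bool (c x = y)) * expectation (\<lambda>x. W y x powr q))"
  using pint indep_var_lebesgue_integral[OF ind oint Wint] by simp
 also have "\<dots> \<le> (\<Sum>y\<in>\<C>. expectation (\<lambda>x. of_bool (c x = y)) * (real n powr q * mq))"
  using WE by (intro sum_mono mult_left_mono) auto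
 also have "\<dots> = expectation (\<lambda>x. \<Sum>y\<in>\<C>. of_bool (c x = y)) * (real n powr q * mq)" using oint by (simp add: sum_distrib_right)
 also have "(\<lambda>x. \<Sum>y\<in>\<C>. of_bool (c x = y)) = (\<lambda>x. 1 :: real)" using C by auto
 finally show "expectation (\<lambda>x. E x powr q) \<le> real n powr q * (\<integral>y. abs y powr q \<partial>F)" by (simp add: prob_space mq_def)
qed

lemma tau_nonneg: "a < b \<Longrightarrow> 0 \<le> tau a b x"
 unfolding tau_def by (rule path_family.le_fminI[OF pf]) (auto intro: sum_nonneg \<omega>_nonneg)

text \<open>Every crossing of [a, c] contains crossings of both parts, and these use disjoint
  slabs.\<close>

lemma tau_superadditive:
 assumes "a < b" "b < c"
 shows "tau a b x + tau b c x \<le> tau a c x"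
 unfolding tau_def[of a c]
proof (rule path_family.le_fminI[OF pf])
 show "int a < int c" using assms by simp
 fix P assume P: "P \<in> cross (int a) (int c)"
 obtain P1 P2 where P1: "P1 \<in> cross (int a) (int b)" "P1 \<subseteq> P" and P2: "P2 \<in> cross (int b) (int c)" "P2 \<subseteq> P"
  using cross_restrict[OF P, of "int a" "int b"] cross_restrict[OF P, of "int b" "int c"] assms by auto
 have fin: "finite P" using path_family.finite_path[OF pf P] assms by simp
 have "P1 \<subseteq> slab (int a) (int b)" "P2 \<subseteq> slab (int b) (int c)"
  using cross_subset[of "int a" "int b"] cross_subset[of "int b" "int c"] P1 P2 assms by auto
 then have "P1 \<inter> P2 = {}" using slab_disjoint[of "int b" "int b" "int a" "int c"] by blast
 then have "sum (\<lambda>e. \<omega> e x) P1 + sum (\<lambda>e. \<omega> e x) P2 = sum (\<lambda>e. \<omega> e x) (P1 \<union> P2)"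
  using fin P1 P2 by (intro sum.union_disjoint[symmetric]) (auto intro: finite_subset)
 also have "\<dots> \<le> sum (\<lambda>e. \<omega> e x) P" using fin P1 P2 \<omega>_nonneg by (intro sum_mono2) auto
 finally show "tau a b x + tau b c x \<le> sum (\<lambda>e. \<omega> e x) P"
  using path_family.fmin_le[OF pf P1(1), of "\<lambda>e. \<omega> e x"] path_family.fmin_le[OF pf P2(1), of "\<lambda>e. \<omega> e x"] assms
  by (simp add: tau_def)
qed

lemma tau_p_int: "a < b \<Longrightarrow> p_int p (tau a b)" unfolding p_int_def
proof
 assume ab: "a < b"
 show m: "random_variable borel (tau a b)" by (rule dep_measurable[OF tau_dep[OF ab] slab_subset])
 obtain P where P: "P \<in> cross (int a) (int b)" using straight_crossing[of "int a" "int b"] ab by auto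
 have PE: "P \<subseteq> edges PG" using P cross_subset[of "int a" "int b"] slab_subset ab by force
 have fin: "finite P" using path_family.finite_path[OF pf P] ab by simp
 have p1: "1 \<le> p" using p by simp
 show "integrable M (\<lambda>x. abs (tau a b x) powr p)"
 proof (rule integrable_bounded_by)
  show "integrable M (\<lambda>x. (\<Sum>e\<in>P. \<omega> e x) powr p)" using expectation_sum_powr_le(1)[OF fin, of "\<lambda>e. e" p] PE p1 by simp
  show "abs (abs (tau a b x) powr p) \<le> (\<Sum>e\<in>P. \<omega> e x) powr p" for x
   using path_family.fmin_le[OF pf P, of "\<lambda>e. \<omega> e x"] tau_nonneg[OF ab, of x] ab p by (auto intro!: powr_mono2 simp: tau_def)
 qed (use m in measurable)
qed

lemma tau_moment:
 assumes "0 < l" "1 \<le> q" "q \<le> p"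
 shows "expectation (\<lambda>x. tau 0 l x powr q) \<le> real l powr q * (\<integral>y. abs y powr q \<partial>F)"
proof -
 obtain P where P: "P \<in> cross 0 (int l)" "card P \<le> nat (int l - 0)" using straight_crossing[of 0 "int l"] assms by auto
 have PE: "P \<subseteq> edges PG" using P cross_subset[of 0 "int l"] slab_subset by force
 have fin: "finite P" using path_family.finite_path[OF pf P(1)] assms by simp
 have t0: "0 \<le> tau 0 l x" for x using tau_nonneg assms by simp
 have le: "tau 0 l x powr q \<le> (\<Sum>e\<in>P. \<omega> e x) powr q" for x using path_family.fmin_le[OF pf P(1), of "\<lambda>e. \<omega> e x"] t0[of x] assms
  by (auto intro!: powr_mono2 simp: tau_def)
 have "p_int q (tau 0 l)" using p_int_le_exponent[OF _ assms(3) tau_p_int[OF assms(1)]] assms by simp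
 then have int: "integrable M (\<lambda>x. tau 0 l x powr q)" using t0 by (simp add: p_int_def)
 have "expectation (\<lambda>x. tau 0 l x powr q) \<le> expectation (\<lambda>x. (\<Sum>e\<in>P. \<omega> e x) powr q)"
  using expectation_sum_powr_le(1)[OF fin, of "\<lambda>e. e" q] PE assms by (intro integral_mono int le) auto
 also have "\<dots> \<le> real (card P) powr q * (\<integral>y. abs y powr q \<partial>F)"
  using expectation_sum_powr_le(2)[OF fin, of "\<lambda>e. e" q] PE assms by simp
 also have "\<dots> \<le> real l powr q * (\<integral>y. abs y powr q \<partial>F)" using P(2) assms by (intro mult_right_mono powr_mono2) auto
 finally show ?thesis .
qed

lemma \<kappa>_pos: "0 < \<kappa>" by (simp add: \<kappa>_def add_pos_nonneg)

lemma \<kappa>_bounds: "(\<integral>y. y^2 \<partial>F) \<le> \<kappa>^2" "(\<integral>y. abs y powr p \<partial>F) \<le> \<kappa> powr p"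
proof -
 define a where "a = (\<integral>y. y^2 \<partial>F)"
 define b where "b = (\<integral>y. abs y powr p \<partial>F)"
 have ab: "0 \<le> a" "0 \<le> b" by (auto simp: a_def b_def)
 have "a = (sqrt a)^2" using ab by simp
 also have "\<dots> \<le> \<kappa>^2" using ab by (intro power_mono) (auto simp: \<kappa>_def a_def)
 finally show "(\<integral>y. y^2 \<partial>F) \<le> \<kappa>^2" by (simp add: a_def)
 have "b = (b powr (1 / p)) powr p" using ab p by (simp add: powr_powr)
 also have "\<dots> \<le> \<kappa> powr p" using ab p by (intro powr_mono2) (auto simp: \<kappa>_def b_def)
 finally show "(\<integral>y. abs y powr p \<partial>F) \<le> \<kappa> powr p" by (simp add: b_def)
qed

text \<open>Dominates the L2 and Lp norms of the weight of a path with at most \<open>diam\<close>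
  edges; adding 1 keeps it positive for a one-vertex graph.\<close>

definition \<Delta> :: real where "\<Delta> = \<kappa> * (real diam + 1)"

lemma \<Delta>_pos: "0 < \<Delta>" using \<kappa>_pos by (simp add: \<Delta>_def)

lemma random_connection_bounds:
 assumes "finite \<C>" "dep J (count_space UNIV) c" "\<And>x. c x \<in> \<C>" "J \<subseteq> edges PG"
  and "\<And>y. y \<in> \<C> \<Longrightarrow> set (s y) \<subseteq> S \<and> length (s y) \<le> diam" and "S \<subseteq> edges PG" "J \<inter> S = {}"
  and E: "random_variable borel E" "\<And>x. 0 \<le> E x" "\<And>x. E x \<le> sum_list (map (\<lambda>e. \<omega> e x) (s (c x)))"
 shows "square_int E \<and> l2norm E \<le> \<Delta> \<and> expectation (\<lambda>x. E x powr p) \<le> \<Delta> powr p"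
proof (intro conjI)
 have p2: "2 \<le> p" using p by simp
 have p1: "1 \<le> p" using p by simp
 have sq: "y powr 2 = y^2" if "0 \<le> y" for y :: real using that by simp
 have F2: "(\<integral>y. abs y powr 2 \<partial>F) = (\<integral>y. y^2 \<partial>F)" by simp
 have E2: "(\<lambda>x. E x powr 2) = (\<lambda>x. (E x)^2)" using sq E(2) by auto
 have n: "real diam powr q \<le> (real diam + 1) powr q" if "0 \<le> q" for q using that by (intro powr_mono2) auto
 note 2 = random_connection_moment[OF assms(1-7) _ p2 E, unfolded E2 F2, simplified]
 show "square_int E" using 2(1) E(1) by (simp add: square_int_def)
 have "expectation (\<lambda>x. (E x)^2) \<le> (real diam)^2 * (\<integral>y. y^2 \<partial>F)" using 2(2) by simp
 also have "\<dots> \<le> (real diam + 1)^2 * \<kappa>^2" using \<kappa>_bounds by (intro mult_mono power_mono) auto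
 finally have "expectation (\<lambda>x. (E x)^2) \<le> \<Delta>^2" by (simp add: \<Delta>_def power_mult_distrib mult.commute)
 then have "l2norm E \<le> sqrt (\<Delta>^2)" unfolding l2norm_def by (rule real_sqrt_le_mono)
 then show "l2norm E \<le> \<Delta>" using \<Delta>_pos by simp
 have "expectation (\<lambda>x. E x powr p) \<le> real diam powr p * (\<integral>y. abs y powr p \<partial>F)"
  by (rule random_connection_moment(2)[OF assms(1-7) p1 order_refl E])
 also have "\<dots> \<le> (real diam + 1) powr p * \<kappa> powr p" using \<kappa>_bounds n p by (intro mult_mono) auto
 also have "\<dots> = \<Delta> powr p" by (simp add: \<Delta>_def powr_mult)
 finally show "expectation (\<lambda>x. E x powr p) \<le> \<Delta> powr p" .
qed

lemma tau_err:
 assumes "a < b" "b < c"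
 defines "E \<equiv> \<lambda>x. tau a c x - tau a b x - tau b c x"
 shows "l2norm E \<le> \<Delta>" "expectation (\<lambda>x. abs (E x) powr p) \<le> \<Delta> powr p"
proof -
 let ?w = "\<lambda>x e. \<omega> e x"
 let ?P1 = "cross (int a) (int b)" and ?P2 = "cross (int b) (int c)"
 let ?J = "slab (int a) (int b) \<union> slab (int b) (int c)"
 define cc where "cc x = (opt ?P1 (?w x), opt ?P2 (?w x))" for x
 have pfs: "path_family (slab (int a) (int b)) ?P1" "path_family (slab (int b) (int c)) ?P2" "path_family (slab (int a) (int c)) (cross (int a) (int c))"
  using assms by (auto intro: pf)
 have ex: "\<exists>s. set s \<subseteq> slice (int b) \<and> length s \<le> diam \<and> (\<exists>R\<in>cross (int a) (int c). R \<subseteq> fst y \<union> set s \<union> snd y)"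
  if "y \<in> ?P1 \<times> ?P2" for y
  using cross_join[of "fst y" "int a" "int b" "snd y" "int c"] that assms by auto
 \<comment> \<open>The connecting path is a function of the pair of crossings alone; the slice
   weights along it remain independent of that pair.\<close>
 then obtain s where s: "\<And>y. y \<in> ?P1 \<times> ?P2 \<Longrightarrow> set (s y) \<subseteq> slice (int b) \<and> length (s y) \<le> diam \<and>
   (\<exists>R\<in>cross (int a) (int c). R \<subseteq> fst y \<union> set (s y) \<union> snd y)"
  by metis
 have E0: "0 \<le> E x" for x using tau_superadditive[OF assms(1,2), of x] by (simp add: E_def)
 have cin: "cc x \<in> ?P1 \<times> ?P2" for x
  using path_family.opt_props(1)[OF pfs(1)] path_family.opt_props(1)[OF pfs(2)] by (simp add: cc_def)
 have main: "square_int E \<and> l2norm E \<le> \<Delta> \<and> expectation (\<lambda>x. E x powr p) \<le> \<Delta> powr p"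
 proof (rule random_connection_bounds[of "?P1 \<times> ?P2" ?J cc s "slice (int b)"])
  show "finite (?P1 \<times> ?P2)" using path_family.finite_\<P>[OF pfs(1)] path_family.finite_\<P>[OF pfs(2)] by simp
  show "dep ?J (count_space UNIV) cc" unfolding cc_def
   by (rule dep_Pair_count_space[OF dep_opt[OF pfs(1)] dep_opt[OF pfs(2)] path_family.finite_\<P>[OF pfs(1)] path_family.finite_\<P>[OF pfs(2)]])
    (auto intro: path_family.opt_props(1)[OF pfs(1)] path_family.opt_props(1)[OF pfs(2)])
  show "?J \<subseteq> edges PG" "slice (int b) \<subseteq> edges PG" using slab_subset slice_subset by auto
  show "?J \<inter> slice (int b) = {}" using slab_slice_disjoint by blast
  show "random_variable borel E" unfolding E_def using tau_p_int assms by (auto simp: p_int_def intro!: borel_measurable_diff)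
  show "set (s y) \<subseteq> slice (int b) \<and> length (s y) \<le> diam" if "y \<in> ?P1 \<times> ?P2" for y using s[OF that] by simp
  show "E x \<le> sum_list (map (?w x) (s (cc x)))" for x
  proof -
   obtain R where R: "R \<in> cross (int a) (int c)" "R \<subseteq> fst (cc x) \<union> set (s (cc x)) \<union> snd (cc x)" using s[OF cin] by blast
   have fin: "finite (fst (cc x))" "finite (snd (cc x))"
    using cin[of x] path_family.finite_path[OF pfs(1)] path_family.finite_path[OF pfs(2)] by auto
   have "tau a c x \<le> sum (?w x) R" unfolding tau_def by (rule path_family.fmin_le[OF pfs(3) R(1)])
   also have "\<dots> \<le> sum (?w x) (fst (cc x) \<union> set (s (cc x)) \<union> snd (cc x))" using R(2) fin \<omega>_nonneg by (intro sum_mono2) auto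
   also have "\<dots> \<le> sum (?w x) (fst (cc x)) + sum (?w x) (set (s (cc x))) + sum (?w x) (snd (cc x))"
   proof -
    have un: "sum (?w x) (A \<union> B) \<le> sum (?w x) A + sum (?w x) B" if "finite A" "finite B" for A B
     using sum.union_inter[OF that, of "\<lambda>e. \<omega> e x"] sum_nonneg[of "A \<inter> B" "\<lambda>e. \<omega> e x"] \<omega>_nonneg by simp
    show ?thesis using un[of "fst (cc x) \<union> set (s (cc x))" "snd (cc x)"] un[of "fst (cc x)" "set (s (cc x))"] fin by simp
   qed
   also have "sum (?w x) (fst (cc x)) = tau a b x" by (simp add: cc_def tau_def path_family.opt_props[OF pfs(1)])
   also have "sum (?w x) (snd (cc x)) = tau b c x" by (simp add: cc_def tau_def path_family.opt_props[OF pfs(2)])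
   also have "sum (?w x) (set (s (cc x))) \<le> sum_list (map (?w x) (s (cc x)))" using \<omega>_nonneg by (intro sum_le_sum_list) auto
   finally show ?thesis by (simp add: E_def)
  qed
 qed (use E0 cin in auto)
 then show "l2norm E \<le> \<Delta>" "expectation (\<lambda>x. abs (E x) powr p) \<le> \<Delta> powr p" using E0 by simp_all
qed

end

section \<open>Measurability of infima and thresholded weights\<close>

text \<open>Used for weights that may be negative on a null set, where the path weights can lack a
  lower bound: the definition of \<open>Inf\<close> then describes the same object for all such
  sets.\<close>

lemma Inf_real_not_bdd_below:
 fixes X Y :: "real set"
 assumes "\<not> bdd_below X" "\<not> bdd_below Y"
 shows "Inf X = Inf Y"
proof -
 have "(\<lambda>z. \<forall>x\<in>uminus ` X. x \<le> z) = (\<lambda>z. False)" if "\<not> bdd_below X" for X :: "real set"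
 proof
  fix z
  have "\<not> (\<forall>x\<in>uminus ` X. x \<le> z)"
  proof
   assume "\<forall>x\<in>uminus ` X. x \<le> z"
   then have "\<forall>x\<in>X. - z \<le> x" by auto
   then show False using that by (auto simp: bdd_below_def)
  qed
  then show "(\<forall>x\<in>uminus ` X. x \<le> z) = False" by simp
 qed
 then show ?thesis using assms by (simp add: Inf_real_def Sup_real_def)
qed

text \<open>The infimum of a set of reals that is not bounded below is an unspecified constant.\<close>

lemma borel_measurable_INF_countable:
 fixes f :: "'i \<Rightarrow> 'a \<Rightarrow> real"
 assumes I: "countable I" and f: "\<And>i. i \<in> I \<Longrightarrow> f i \<in> borel_measurable M"
 shows "(\<lambda>x. Inf ((\<lambda>i. f i x) ` I)) \<in> borel_measurable M"
proof (cases "I = {}")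
 case False
 define B where "B = {x \<in> space M. \<exists>k::nat. \<forall>i\<in>I. - real k \<le> f i x}"
 have B: "B \<in> sets M" unfolding B_def
 proof (intro sets.sets_Collect_countable_Ex)
  fix k :: nat
  have "{x \<in> space M. - real k \<le> f i x} \<in> sets M" if "i \<in> I" for i using f[OF that] by simp
  then show "{x \<in> space M. \<forall>i\<in>I. - real k \<le> f i x} \<in> sets M" by (rule sets.sets_Collect_countable_All'[OF _ I])
 qed
 have iff: "x \<in> B \<longleftrightarrow> bdd_below ((\<lambda>i. f i x) ` I)" if "x \<in> space M" for x
 proof
  assume "x \<in> B" then show "bdd_below ((\<lambda>i. f i x) ` I)" by (auto simp: B_def)
 next
  assume "bdd_below ((\<lambda>i. f i x) ` I)"
  then obtain m where m: "\<forall>i\<in>I. m \<le> f i x" by (auto simp: bdd_below_def)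
  obtain k :: nat where "- m \<le> real k" using real_arch_simple by blast
  then have "\<forall>i\<in>I. - real k \<le> f i x" using m by fastforce
  then show "x \<in> B" using that by (auto simp: B_def)
 qed
 define g where "g x = (INF i\<in>I. if x \<in> B then f i x else 0)" for x
 have g: "g \<in> borel_measurable M" unfolding g_def
 proof (rule borel_measurable_cINF[OF I])
  show "(\<lambda>x. if x \<in> B then f i x else 0) \<in> borel_measurable M" if "i \<in> I" for i using f[OF that] B by simp
  show "bdd_below ((\<lambda>i. if x \<in> B then f i x else 0) ` I)" if "x \<in> space M" for x using iff[OF that] by auto
 qed
 define c where "c = Inf (UNIV :: real set)"
 have "\<not> bdd_below (UNIV :: real set)" by (auto simp: bdd_below_def not_le intro: lt_ex)
 then have "Inf ((\<lambda>i. f i x) ` I) = (if x \<in> B then g x else c)" if "x \<in> space M" for x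
  using iff[OF that] Inf_real_not_bdd_below[of "(\<lambda>i. f i x) ` I" UNIV] by (cases "x \<in> B") (simp_all add: g_def c_def)
 then show ?thesis using g B by (subst measurable_cong[where g = "\<lambda>x. if x \<in> B then g x else c"]) auto
qed simp

text \<open>Thresholding at \<open>b\<close> turns i.i.d. weights into a Bernoulli configuration of
  parameter \<open>F.prob {..<b}\<close>; edges lighter than \<open>b\<close> count as open.\<close>

lemma (in iid_weights) prob_open_set:
 assumes E: "finite E" "E \<subseteq> I"
 shows "{x \<in> space M. Q {e \<in> E. \<omega> e x < b}} \<in> events"
  "prob {x \<in> space M. Q {e \<in> E. \<omega> e x < b}} = bern_exp (F.prob {..<b}) E (\<lambda>S. of_bool (Q S))"
proof -
 define op where "op x = {e \<in> E. \<omega> e x < b}" for x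
 define A where "A S e = (if e \<in> S then {..<b} else {b..})" for S :: "'e set" and e
 have ev: "{x \<in> space M. op x = S} = space M \<inter> (\<Inter>e\<in>E. \<omega> e -` A S e \<inter> space M)" if "S \<subseteq> E" for S
  using that by (auto simp: op_def A_def not_less split: if_splits)
 have meas: "\<omega> e -` A S e \<inter> space M \<in> events" if "e \<in> E" for e S
  using \<omega>_measurable[of e] E that by (intro measurable_sets[of _ _ borel]) (auto simp: A_def)
 have S_ev: "{x \<in> space M. op x = S} \<in> events" if "S \<subseteq> E" for S
 proof (cases "E = {}")
  case False
  show ?thesis unfolding ev[OF that] by (intro sets.Int sets.top sets.finite_INT E(1) False meas)
 qed (use that in \<open>simp add: op_def\<close>)
 have prob_S: "prob {x \<in> space M. op x = S} = bern_wt (F.prob {..<b}) E S" if S: "S \<subseteq> E" for S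
 proof (cases "E = {}")
  case True
  then show ?thesis using S by (simp add: op_def bern_wt_def prob_space)
 next
  case False
  have pA: "prob (\<omega> e -` A S e \<inter> space M) = (if e \<in> S then F.prob {..<b} else 1 - F.prob {..<b})" if e: "e \<in> E" for e
  proof -
   have "prob (\<omega> e -` A S e \<inter> space M) = measure (distr M borel (\<omega> e)) (A S e)"
    using \<omega>_measurable[of e] E e by (subst measure_distr) (auto simp: A_def)
   also have "\<dots> = F.prob (A S e)" using distr_\<omega>[of e] E e by auto
   also have "F.prob {b..} = 1 - F.prob {..<b}" using F.prob_compl[of "{..<b}"] by (simp add: Compl_eq_Diff_UNIV[symmetric])
   then have "F.prob (A S e) = (if e \<in> S then F.prob {..<b} else 1 - F.prob {..<b})" by (simp add: A_def)
   finally show ?thesis .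
  qed
  have "space M \<inter> (\<Inter>e\<in>E. \<omega> e -` A S e \<inter> space M) = (\<Inter>e\<in>E. \<omega> e -` A S e \<inter> space M)" using False by auto
  then have "prob {x \<in> space M. op x = S} = (\<Prod>e\<in>E. prob (\<omega> e -` A S e \<inter> space M))"
   unfolding ev[OF S] by (simp only:) (rule indep_varsD[OF indep False E], simp add: A_def)
  also have "\<dots> = F.prob {..<b} ^ card (E \<inter> S) * (1 - F.prob {..<b}) ^ card (E - S)"
   using E by (simp add: pA prod.If_cases Diff_eq)
  finally show ?thesis using S by (simp add: bern_wt_def Int_absorb1)
 qed
 show "{x \<in> space M. Q {e \<in> E. \<omega> e x < b}} \<in> events"
  "prob {x \<in> space M. Q {e \<in> E. \<omega> e x < b}} = bern_exp (F.prob {..<b}) E (\<lambda>S. of_bool (Q S))"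
  using prob_random_subset[of E op "F.prob {..<b}" Q] E(1) S_ev prob_S unfolding op_def by blast+
qed

context fin_graph
begin

lemma is_path_line: "is_path PG q xs r \<longleftrightarrow> walk xs \<and> hd xs = q \<and> last xs = r"
 by (auto simp: is_path_def walk_def successively_edge_iff) (auto simp: graph_prod_def int_line_def)

lemma segment_edge_iff:
 "{x, y} \<in> edges (graph_prod (int_segment n) H) \<longleftrightarrow>
  {x, y} \<in> edges PG \<and> fst x \<in> {0..int n} \<and> fst y \<in> {0..int n}"
proof -
 obtain i u j v where s: "x = (i, u)" "y = (j, v)" by force
 have "{(i, u), (j, v)} \<in> edges (graph_prod (int_segment n) H) \<longleftrightarrow>
  (u = v \<and> u \<in> V \<and> ((j = i + 1 \<and> 0 \<le> i \<and> i < int n) \<or> (i = j + 1 \<and> 0 \<le> j \<and> j < int n)))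
   \<or> (i = j \<and> 0 \<le> i \<and> i \<le> int n \<and> {u, v} \<in> edges H)" (is "?e \<longleftrightarrow> ?A")
 proof
  assume ?e
  then show ?A by (auto simp: graph_prod_def int_segment_def doubleton_eq_iff insert_commute)
 next
  assume a: ?A
  have 1: "{(k, u), (k + 1, u)} \<in> edges (graph_prod (int_segment n) H)" if "0 \<le> k" "k < int n" "u \<in> V" for k
   using that by (auto simp: graph_prod_def int_segment_def)
  have 2: "{(k, u), (k, v)} \<in> edges (graph_prod (int_segment n) H)" if "0 \<le> k" "k \<le> int n" "{u, v} \<in> edges H" for k
   using that by (auto simp: graph_prod_def int_segment_def)
  show ?e using a 1[of i] 1[of j] 2[of i] by (auto simp: insert_commute)
 qed
 then show ?thesis unfolding s PG_edge_iff using edge_verts by auto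
qed

lemma is_path_segment:
 "is_path (graph_prod (int_segment n) H) q xs r \<longleftrightarrow> walk xs \<and> set xs \<subseteq> {0..int n} \<times> V \<and> hd xs = q \<and> last xs = r"
proof -
 have e: "set (path_edges xs) \<subseteq> edges (graph_prod (int_segment n) H) \<longleftrightarrow> set (path_edges xs) \<subseteq> edges PG"
  if s: "set xs \<subseteq> {0..int n} \<times> V"
 proof -
  have "e \<in> edges (graph_prod (int_segment n) H) \<longleftrightarrow> e \<in> edges PG" if e: "e \<in> set (path_edges xs)" for e
  proof -
   obtain x y where xy: "e = {x, y}" using e by (rule path_edges_elim)
   have "x \<in> set xs" "y \<in> set xs" using path_edges_subset_vertices[OF e] xy by auto
   then show ?thesis unfolding xy segment_edge_iff using s by auto
  qed
  then show ?thesis by blast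
 qed
 have v: "verts (graph_prod (int_segment n) H) = {0..int n} \<times> V" by (simp add: graph_prod_def int_segment_def)
 show ?thesis unfolding is_path_def walk_def successively_edge_iff v using e by auto
qed

lemma finite_crossing_in_box: "crossing_path a b xs \<Longrightarrow> a \<le> b \<Longrightarrow> set xs \<subseteq> {a..b} \<times> V" using crossing_bounds by auto

end

section \<open>Block structure, heavy slabs and the three passage times\<close>

context fpp
begin

lemma block_process_tau: "block_process M tau (\<lambda>a b. {X. dep (slab (int a) (int b)) borel X}) p \<Delta>"
proof unfold_locales
 let ?D = "\<lambda>a b. {X. dep (slab (int a) (int b)) borel X}"
 show "2 < p" by (rule p)
 show "0 < \<Delta>" by (rule \<Delta>_pos)
 show "tau a b \<in> ?D a b" if "a < b" for a b using tau_dep[OF that] by simp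
 show "(\<lambda>x. X x + Y x) \<in> ?D a b"
  if "X \<in> ?D a b" "Y \<in> ?D a b" for X Y :: "'a \<Rightarrow> real" and a b
  using that dep_add[of _ X Y] by simp
 show "(\<lambda>x. X x - Y x) \<in> ?D a b"
  if "X \<in> ?D a b" "Y \<in> ?D a b" for X Y :: "'a \<Rightarrow> real" and a b
  using that dep_diff[of _ X Y] by simp
 show "?D a b \<subseteq> ?D a' b'"
  if "a' \<le> a" "b \<le> b'" for a a' b b'
  using dep_mono slab_mono[of "int a'" "int a" "int b" "int b'"] that by auto
 show "indep_var borel X borel Y"
  if "X \<in> ?D a b" "Y \<in> ?D b c" for X Y :: "'a \<Rightarrow> real" and a b c
  using that slab_disjoint[of "int b" "int b" "int a" "int c"] slab_subset by (auto intro!: dep_indep_var)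
 show "indep_vars (\<lambda>_. borel) (\<lambda>i. tau (i * l) (i * l + l)) {..<m}" if l: "0 < l" for l m
 proof (rule dep_indep_vars[where K = "\<lambda>i. slab (int (i * l)) (int (i * l + l))"])
  show "dep (slab (int (j * l)) (int (j * l + l))) borel (tau (j * l) (j * l + l))" for j by (rule tau_dep) (use l in simp)
  have d: "slab (int (i * l)) (int (i * l + l)) \<inter> slab (int (j * l)) (int (j * l + l)) = {}" if "i < j" for i j
  proof (rule slab_disjoint)
   have "Suc i * l \<le> j * l" using that by (intro mult_le_mono1) simp
   then show "int (i * l + l) \<le> int (j * l)" by (simp only: of_nat_le_iff mult_Suc add.commute)
  qed
  show "disjoint_family_on (\<lambda>i. slab (int (i * l)) (int (i * l + l))) {..<m}"
   unfolding disjoint_family_on_def using d by (metis inf_commute nat_neq_iff)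
 qed (rule slab_subset)
 show "distr M borel (tau a (a + l)) = distr M borel (tau 0 l)" if l: "0 < l" for a l
 proof -
  have pf0: "path_family (slab 0 (int l)) (cross 0 (int l))" using l by (intro pf) simp
  let ?g = "fmin (cross 0 (int l))"
  have g: "?g \<in> borel_measurable (PiM (slab 0 (int l)) (\<lambda>_. borel))" by (rule path_family.measurable_fmin[OF pf0]) simp
  have "tau a (a + l) x = ?g (\<lambda>e\<in>slab 0 (int l). \<omega> (shift (int a) e) x)" for x
  proof -
   have "fmin (cross (int a) (int (a + l))) w = ?g (\<lambda>e. w (shift (int a) e))" for w :: "(int \<times> 'v) set \<Rightarrow> real"
   proof -
    have "cross (int a) (int (a + l)) = (`) (shift (int a)) ` cross 0 (int l)"
     using cross_shift[of 0 "int a" "int l"] by (simp add: add.commute)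
    then show ?thesis unfolding fmin_def by (simp add: image_image sum.reindex[OF inj_shift] comp_def)
   qed
   then show ?thesis unfolding tau_def by (simp, intro path_family.fmin_cong[OF pf0]) simp
  qed
  then have "tau a (a + l) = (\<lambda>x. ?g (\<lambda>e\<in>slab 0 (int l). \<omega> (shift (int a) e) x))" by auto
  moreover have "tau 0 l = (\<lambda>x. ?g (\<lambda>e\<in>slab 0 (int l). \<omega> e x))"
   unfolding tau_def by (rule ext, simp, intro path_family.fmin_cong[OF pf0]) simp
  moreover have "shift (int a) ` slab 0 (int l) \<subseteq> edges PG" using slab_shift slab_subset by metis
  ultimately show ?thesis using distr_shift[OF inj_shift _ slab_subset slab_ne g] l by simp
 qed
 show "p_int p (tau a b)" if "a < b" for a b using that by (rule tau_p_int)
 show "l2norm (\<lambda>x. tau a c x - tau a b x - tau b c x) \<le> \<Delta>" if "a < b" "b < c" for a b c using that by (rule tau_err)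
 show "expectation (\<lambda>x. abs (tau a c x - tau a b x - tau b c x) powr p) \<le> \<Delta> powr p" if "a < b" "b < c" for a b c
  using that by (rule tau_err)
qed

lemma closed_event: "{x \<in> space M. \<forall>P\<in>cross a (a + int L). \<exists>e\<in>P. b \<le> \<omega> e x} \<in> events"
proof -
 have "{x \<in> space M. \<forall>P\<in>cross a (a + int L). \<exists>e\<in>P. b \<le> \<omega> e x}
  = {x \<in> space M. (\<lambda>S. \<forall>P\<in>cross a (a + int L). \<not> P \<subseteq> S) {e \<in> slab a (a + int L). \<omega> e x < b}}"
  using cross_subset[of a "a + int L"] by force
 then show ?thesis using prob_open_set(1)[OF finite_slab slab_subset] by simp
qed

text \<open>In a slab where every crossing has an edge of weight at least \<open>b\<close>, the
  optimal path uses such an edge. Disjoint slabs give distinct edges, so the mean number of heavy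
  used edges is at least \<open>\<delta>\<close> per slab, which is what
  \<open>sdev_fmin_lower_bound\<close> takes as input.\<close>

lemma sdev_tau_lower_bound:
 assumes L: "0 < L" and b: "0 \<le> b" and l: "0 < l"
  and \<delta>: "\<And>i. \<delta> \<le> prob {x \<in> space M. \<forall>P\<in>cross (int (i * L)) (int (i * L + L)). \<exists>e\<in>P. b \<le> \<omega> e x}"
 shows "(b - (\<integral>y. min y b \<partial>F))^2 * (\<delta> * real (l div L)) \<le> sdev (tau 0 l) * (b * sqrt (real (card (slab 0 (int l)))))"
proof -
 let ?w = "\<lambda>x e. \<omega> e x"
 let ?\<P> = "cross 0 (int l)"
 have pf0: "path_family (slab 0 (int l)) ?\<P>" using l by (intro pf) simp
 interpret path_family "slab 0 (int l)" ?\<P> by fact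
 define G where "G i = {x \<in> space M. \<forall>P\<in>cross (int (i * L)) (int (i * L + L)). \<exists>e\<in>P. b \<le> \<omega> e x}" for i
 define n where "n x = real (card {e \<in> opt ?\<P> (?w x). b \<le> \<omega> e x})" for x
 have G: "G i \<in> sets M" for i using closed_event[of "int (i * L)" L b] by (simp add: G_def)
 have le: "(\<Sum>i<l div L. indicator (G i) x) \<le> n x" if x: "x \<in> space M" for x
 proof -
  define Q where "Q = {e \<in> opt ?\<P> (?w x). b \<le> \<omega> e x}"
  define J where "J = {i. i < l div L \<and> x \<in> G i}"
  have "\<exists>e\<in>Q. e \<in> slab (int (i * L)) (int (i * L + L))" if i: "i \<in> J" for i
  proof -
   have "Suc i * L \<le> l div L * L" using i by (intro mult_le_mono1) (simp add: J_def)
   also have "\<dots> \<le> l" by simp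
   finally have "i * L + L \<le> l" by simp
   then have il: "int (i * L + L) \<le> int l" by linarith
   obtain P where P: "P \<in> cross (int (i * L)) (int (i * L + L))" "P \<subseteq> opt ?\<P> (?w x)"
    using cross_restrict[OF opt_props(1)[of "\<lambda>e. \<omega> e x"] _ _ il, of "int (i * L)"] L by auto
   then obtain e where "e \<in> P" "b \<le> \<omega> e x" using i by (auto simp: J_def G_def)
   moreover have "P \<subseteq> slab (int (i * L)) (int (i * L + L))" using P cross_subset[of "int (i * L)" "int (i * L + L)"] by auto
   ultimately show ?thesis using P by (auto simp: Q_def)
  qed
  then obtain f where f: "\<And>i. i \<in> J \<Longrightarrow> f i \<in> Q \<and> f i \<in> slab (int (i * L)) (int (i * L + L))" by metis
  have d: "slab (int (i * L)) (int (i * L + L)) \<inter> slab (int (j * L)) (int (j * L + L)) = {}" if "i < j" for i j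
  proof (rule slab_disjoint)
   have "Suc i * L \<le> j * L" using that by (intro mult_le_mono1) simp
   then show "int (i * L + L) \<le> int (j * L)" by (simp only: of_nat_le_iff mult_Suc add.commute)
  qed
  have "inj_on f J"
  proof (rule inj_onI)
   fix i j assume "i \<in> J" "j \<in> J" "f i = f j"
   then show "i = j" using f[of i] f[of j] d[of i j] d[of j i] by (metis disjoint_iff nat_neq_iff)
  qed
  moreover have "f ` J \<subseteq> Q" using f by auto
  moreover have "finite Q" unfolding Q_def using opt_subset finite_E by (auto intro: finite_subset)
  ultimately have "card J \<le> card Q" by (rule card_inj_on_le)
  moreover have "(\<Sum>i<l div L. indicator (G i) x :: real) = real (card J)"
   unfolding J_def by (simp add: indicator_def Int_def lessThan_def conj_commute)
  ultimately show ?thesis by (simp add: n_def Q_def)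
 qed
 have nm: "n \<in> borel_measurable M"
 proof -
  have eq: "n x = (\<Sum>e\<in>slab 0 (int l). of_bool (e \<in> opt ?\<P> (?w x) \<and> b \<le> \<omega> e x))" for x
  proof -
   have "(\<Sum>e\<in>slab 0 (int l). of_bool (e \<in> opt ?\<P> (?w x) \<and> b \<le> \<omega> e x) :: real)
    = (\<Sum>e\<in>{e \<in> opt ?\<P> (?w x). b \<le> \<omega> e x}. 1)"
    using opt_subset finite_E by (intro sum.mono_neutral_cong_right) auto
   then show ?thesis by (simp add: n_def)
  qed
  show ?thesis unfolding eq
  proof (rule borel_measurable_sum)
   fix e assume "e \<in> slab 0 (int l)"
   then have [measurable]: "random_variable borel (\<omega> e)" using slab_subset by (intro \<omega>_measurable) auto
   have [measurable]: "Measurable.pred M (\<lambda>x. e \<in> opt ?\<P> (?w x))"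
    by (rule measurable_compose[OF dep_measurable[OF dep_opt[OF pf0 order_refl] slab_subset]]) simp
   show "(\<lambda>x. of_bool (e \<in> opt ?\<P> (?w x) \<and> b \<le> \<omega> e x) :: real) \<in> borel_measurable M" by simp
  qed
 qed
 have nint: "integrable M n"
 proof (rule integrable_const_bound[of _ "real (card (slab 0 (int l)))"])
  have "card {e \<in> opt ?\<P> (?w x). b \<le> \<omega> e x} \<le> card (slab 0 (int l))" for x using opt_subset finite_E by (intro card_mono) auto
  then show "AE x in M. norm (n x) \<le> real (card (slab 0 (int l)))" by (simp add: n_def)
 qed (rule nm)
 have Gi: "integrable M (indicat_real (G i))" for i using G by (intro integrable_real_indicator) (auto simp: emeasure_eq_measure)
 have "\<delta> * real (l div L) = (\<Sum>i<l div L. \<delta>)" by simp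
 also have "\<dots> \<le> (\<Sum>i<l div L. prob (G i))" using \<delta> by (intro sum_mono) (simp add: G_def)
 also have "\<dots> = expectation (\<lambda>x. \<Sum>i<l div L. indicator (G i) x)" using G Gi by simp
 also have "\<dots> \<le> expectation n" using Gi by (intro integral_mono nint le) auto
 finally have "(b - (\<integral>y. min y b \<partial>F))^2 * (\<delta> * real (l div L)) \<le> (b - (\<integral>y. min y b \<partial>F))^2 * expectation n"
  by (rule mult_left_mono) simp
 also have "\<dots> \<le> sdev (\<lambda>x. fmin ?\<P> (?w x)) * (b * sqrt (real (card (slab 0 (int l)))))"
  unfolding n_def by (rule sdev_fmin_lower_bound[OF pf0 slab_subset b])
 finally show ?thesis by (simp add: tau_def[abs_def])
qed

lemma AE_F_nonneg: "AE y in F. 0 \<le> y"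
proof -
 obtain e where e: "e \<in> edges PG" using slab_ne[of 0 1] slab_subset[of 0 1] by auto
 have "AE y in distr M borel (\<omega> e). 0 \<le> y" using \<omega>_nonneg by (subst AE_distr_iff[OF \<omega>_measurable[OF e]]) auto
 then show ?thesis unfolding distr_\<omega>[OF e] .
qed

text \<open>Geodesics in the two end slices lead from the origin to the crossing and back; like the
  junctions, they use edges outside the slab.\<close>

lemma connect_origin:
 assumes P: "P \<in> cross 0 (int n)" and n: "0 < n" and o: "r \<in> V"
 shows "\<exists>s0 s1. set s0 \<subseteq> slice 0 \<and> length s0 \<le> diam \<and> set s1 \<subseteq> slice (int n) \<and> length s1 \<le> diam \<and>
  (\<forall>w. (\<forall>e. 0 \<le> w e) \<longrightarrow> t_time H r n w \<le> sum w P + sum_list (map w s0) + sum_list (map w s1))"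
proof -
 obtain xs where xs: "P = set (path_edges xs)" "crossing_path 0 (int n) xs" using P by (auto elim: crossE)
 have w: "walk xs" "fst (hd xs) = 0" "fst (last xs) = int n" "distinct xs" using xs by (auto simp: crossing_path_def)
 obtain ys where ys: "is_path H r ys (snd (hd xs))" "length (path_edges ys) \<le> diam"
  using obtain_short_path[OF o walk_ends(1)[OF w(1)]] by blast
 obtain zs where zs: "is_path H (snd (last xs)) zs r" "length (path_edges zs) \<le> diam"
  using obtain_short_path[OF walk_ends(2)[OF w(1)] o] by blast
 note l1 = walk_lift[OF ys(1), of 0] and l2 = walk_lift[OF zs(1), of "int n"]
 have j1: "last (lift 0 ys) = hd xs" using w l1 by (simp add: prod_eq_iff)
 note 1 = walk_join[OF l1(1) w(1) j1]
 have j2: "last (lift 0 ys @ tl xs) = hd (lift (int n) zs)" using 1 w l2 by (simp add: prod_eq_iff)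
 note 2 = walk_join[OF 1(1) l2(1) j2]
 define W where "W = (lift 0 ys @ tl xs) @ tl (lift (int n) zs)"
 have tl_sub: "set (tl us) \<subseteq> set us" for us :: "(int \<times> 'v) list" by (cases us) auto
 have "set ys \<subseteq> V" "set zs \<subseteq> V" using ys zs by (auto simp: is_path_def)
 moreover have "set xs \<subseteq> {0..int n} \<times> V" by (rule finite_crossing_in_box[OF xs(2)]) simp
 ultimately have "set W \<subseteq> {0..int n} \<times> V"
  unfolding W_def using tl_sub[of xs] tl_sub[of "lift (int n) zs"] by (auto simp: lift_def)
 then have path: "is_path (graph_prod (int_segment n) H) (0, r) W (int n, r)"
  unfolding is_path_segment W_def using 1 2 l1 l2 by simp
 have "t_time H r n w \<le> sum w P + sum_list (map w (path_edges (lift 0 ys))) + sum_list (map w (path_edges (lift (int n) zs)))"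
  if w0: "\<forall>e. 0 \<le> w e" for w
 proof -
  have "t_time H r n w \<le> path_weight w W" unfolding t_time_def
  proof (rule cInf_lower)
   show "path_weight w W \<in> {path_weight w xs |xs. is_path (graph_prod (int_segment n) H) (0, r) xs (int n, r)}"
    using path by blast
   show "bdd_below {path_weight w xs |xs. is_path (graph_prod (int_segment n) H) (0, r) xs (int n, r)}"
    using w0 by (intro bdd_belowI[of _ 0]) (auto simp: path_weight_def intro!: sum_list_nonneg)
  qed
  also have "\<dots> = sum_list (map w (path_edges (lift 0 ys))) + path_weight w xs + sum_list (map w (path_edges (lift (int n) zs)))"
   unfolding W_def path_weight_def using 1 2 by simp
  also have "path_weight w xs = sum w P" using path_weight_eq_sum[OF w(4)] xs by simp
  finally show ?thesis by simp
 qed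
 then show ?thesis using l1 l2 ys zs by (intro exI[of _ "path_edges (lift 0 ys)"] exI[of _ "path_edges (lift (int n) zs)"]) auto
qed

lemma fmin_le_path_weight:
 assumes "walk xs" "fst (hd xs) = 0" "fst (last xs) = int n" "0 < n" "\<And>e. 0 \<le> w e"
 shows "fmin (cross 0 (int n)) w \<le> path_weight w xs"
proof -
 obtain P where P: "P \<in> cross 0 (int n)" "P \<subseteq> set (path_edges xs)"
  using extract_crossing[OF assms(1), of 0 "int n"] assms by auto
 have "fmin (cross 0 (int n)) w \<le> sum w P" using assms by (intro path_family.fmin_le[OF pf P(1)]) simp
 also have "\<dots> \<le> path_weight w xs" unfolding path_weight_def using P assms by (intro sum_le_sum_list)
 finally show ?thesis .
qed

text \<open>Every path between the two ends contains a crossing, which gives the lower bounds; the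
  line admits more paths than the segment.\<close>

lemma passage_time_bounds:
 assumes n: "0 < n" and r: "r \<in> V" and w: "\<And>e. 0 \<le> w e"
 shows "T_time H n w = fmin (cross 0 (int n)) w"
  and "fmin (cross 0 (int n)) w \<le> a_time H r n w" "a_time H r n w \<le> t_time H r n w"
proof -
 have pfn: "path_family (slab 0 (int n)) (cross 0 (int n))" using n by (intro pf) simp
 show "T_time H n w = fmin (cross 0 (int n)) w" unfolding T_time_def
 proof (rule cInf_eq_minimum)
  obtain xs where xs: "opt (cross 0 (int n)) w = set (path_edges xs)" "crossing_path 0 (int n) xs"
   using path_family.opt_props(1)[OF pfn, of w] by (auto elim: crossE)
  have cx: "walk xs" "distinct xs" "fst (hd xs) = 0" "fst (last xs) = int n" using xs by (auto simp: crossing_path_def)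
  have "is_path (graph_prod (int_segment n) H) (0, snd (hd xs)) xs (int n, snd (last xs))"
   unfolding is_path_segment using cx finite_crossing_in_box[OF xs(2)] by (auto simp: prod_eq_iff)
  moreover have "path_weight w xs = fmin (cross 0 (int n)) w"
   using path_weight_eq_sum[OF cx(2), of w] xs path_family.opt_props(2)[OF pfn, of w] by simp
  ultimately show "fmin (cross 0 (int n)) w \<in> {path_weight w xs |xs u v. u \<in> V \<and> v \<in> V \<and> is_path (graph_prod (int_segment n) H) (0, u) xs (int n, v)}"
   using walk_ends[OF cx(1)] by (metis (mono_tags, lifting) mem_Collect_eq)
  show "fmin (cross 0 (int n)) w \<le> x" if "x \<in> {path_weight w xs |xs u v. u \<in> V \<and> v \<in> V \<and> is_path (graph_prod (int_segment n) H) (0, u) xs (int n, v)}" for x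
   using that n w by (auto simp: is_path_segment intro!: fmin_le_path_weight)
 qed
 have bdd: "bdd_below {path_weight w xs |xs. is_path G q xs z}" for G q z
  using w by (intro bdd_belowI[of _ 0]) (auto simp: path_weight_def intro!: sum_list_nonneg)
 obtain P where "P \<in> cross 0 (int n)" using cross_nonempty[of 0 "int n"] n by auto
 have ne: "{path_weight w xs |xs. is_path (graph_prod (int_segment n) H) (0, r) xs (int n, r)} \<noteq> {}"
 proof -
  obtain v where "v \<in> V" using V_ne by auto
  define xs where "xs = map (\<lambda>i. (int i, r)) [0..<Suc n]"
  have len: "length xs = Suc n" by (simp add: xs_def)
  have nth: "xs ! i = (int i, r)" if "i < Suc n" for i using that by (simp add: xs_def del: upt_Suc)
  have "set (path_edges xs) \<subseteq> edges PG"
  proof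
   fix e assume "e \<in> set (path_edges xs)"
   then obtain i where "Suc i < length xs" "e = {xs ! i, xs ! Suc i}" using path_edges_nth by blast
   then show "e \<in> edges PG" using r by (simp add: len nth PG_edge_iff)
  qed
  then have "walk xs" "set xs \<subseteq> {0..int n} \<times> V" using r by (auto simp: walk_def xs_def)
  moreover have "xs \<noteq> []" using len by auto
  then have "hd xs = (0, r)" "last xs = (int n, r)" using len nth by (simp_all add: hd_conv_nth last_conv_nth)
  ultimately show ?thesis unfolding is_path_segment by blast
 qed
 have sub: "is_path PG q xs z" if "is_path (graph_prod (int_segment n) H) q xs z" for q xs z
  using that unfolding is_path_segment is_path_line by simp
 show "a_time H r n w \<le> t_time H r n w"
  unfolding a_time_def t_time_def by (rule cInf_superset_mono[OF ne bdd]) (use sub in blast)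
 show "fmin (cross 0 (int n)) w \<le> a_time H r n w" unfolding a_time_def
 proof (rule cInf_greatest)
  show "{path_weight w xs |xs. is_path PG (0, r) xs (int n, r)} \<noteq> {}" using ne sub by blast
  show "fmin (cross 0 (int n)) w \<le> x" if "x \<in> {path_weight w xs |xs. is_path PG (0, r) xs (int n, r)}" for x
   using that n w by (auto simp: is_path_line intro!: fmin_le_path_weight)
 qed
qed

text \<open>Treats all three passage times at once: each lies between the crossing time and
  \<open>t_time\<close>, and these differ by at most the two end connections.\<close>

lemma t_time_sandwich:
 assumes n: "0 < n" and r: "r \<in> V" and X: "random_variable borel X"
  and le: "\<And>x. tau 0 n x \<le> X x" "\<And>x. X x \<le> t_time H r n (\<lambda>e. \<omega> e x)"
 shows "square_int X" "l2norm (\<lambda>x. X x - tau 0 n x) \<le> 2 * \<Delta>"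
proof -
 let ?w = "\<lambda>x e. \<omega> e x"
 let ?\<P> = "cross 0 (int n)"
 have pfn: "path_family (slab 0 (int n)) ?\<P>" using n by (intro pf) simp
 define c where "c x = opt ?\<P> (?w x)" for x
 have cin: "c x \<in> ?\<P>" for x unfolding c_def by (rule path_family.opt_props(1)[OF pfn])
 obtain s0 s1 where s: "\<And>P. P \<in> ?\<P> \<Longrightarrow> set (s0 P) \<subseteq> slice 0 \<and> length (s0 P) \<le> diam \<and> set (s1 P) \<subseteq> slice (int n) \<and> length (s1 P) \<le> diam \<and>
  (\<forall>w. (\<forall>e. 0 \<le> w e) \<longrightarrow> t_time H r n w \<le> sum w P + sum_list (map w (s0 P)) + sum_list (map w (s1 P)))"
  using connect_origin[OF _ n r] by metis
 have s0: "set (s0 P) \<subseteq> slice 0" "length (s0 P) \<le> diam" and s1: "set (s1 P) \<subseteq> slice (int n)" "length (s1 P) \<le> diam"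
  if "P \<in> ?\<P>" for P using s[OF that] by auto
 have sE: "set (s0 P) \<subseteq> edges PG" "set (s1 P) \<subseteq> edges PG" if "P \<in> ?\<P>" for P using s0[OF that] s1[OF that] slice_subset by blast+
 define R where "R s x = sum_list (map (?w x) (s (c x)))" for s x
 have depc: "dep (slab 0 (int n)) (count_space UNIV) c" unfolding c_def by (rule dep_opt[OF pfn order_refl])
 have cm: "c \<in> measurable M (count_space UNIV)" by (rule dep_measurable[OF depc slab_subset])
 have Rm: "random_variable borel (R s)" if s: "\<And>P. P \<in> ?\<P> \<Longrightarrow> set (s P) \<subseteq> edges PG" for s
 proof -
  have eq: "R s x = (\<Sum>P\<in>?\<P>. of_bool (c x = P) * sum_list (map (?w x) (s P)))" for x
  using cin path_family.finite_\<P>[OF pfn] by (auto simp: R_def)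
  show ?thesis unfolding eq
  proof (rule borel_measurable_sum)
   fix P assume "P \<in> ?\<P>"
   then have "(\<lambda>x. sum_list (map (?w x) (s P))) \<in> borel_measurable M"
    using s[of P] by (simp add: sum_list_sum_nth) (intro borel_measurable_sum \<omega>_measurable, auto)
   moreover have "(\<lambda>x. of_bool (c x = P) :: real) \<in> borel_measurable M" by (rule measurable_compose[OF cm]) simp
   ultimately show "(\<lambda>x. of_bool (c x = P) * sum_list (map (?w x) (s P))) \<in> borel_measurable M" by simp
  qed
 qed
 have R0: "0 \<le> R s x" for s x unfolding R_def using \<omega>_nonneg by (auto intro!: sum_list_nonneg)
 have b0: "square_int (R s0) \<and> l2norm (R s0) \<le> \<Delta> \<and> expectation (\<lambda>x. R s0 x powr p) \<le> \<Delta> powr p"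
  using s0 sE slab_slice_disjoint[of 0 0 "int n"] R0 slice_subset
  by (intro random_connection_bounds[of ?\<P> "slab 0 (int n)" c s0 "slice 0"] Rm path_family.finite_\<P>[OF pfn] depc cin slab_subset)
   (auto simp: R_def)
 have b1: "square_int (R s1) \<and> l2norm (R s1) \<le> \<Delta> \<and> expectation (\<lambda>x. R s1 x powr p) \<le> \<Delta> powr p"
  using s1 sE slab_slice_disjoint[of "int n" 0 "int n"] R0 slice_subset
  by (intro random_connection_bounds[of ?\<P> "slab 0 (int n)" c s1 "slice (int n)"] Rm path_family.finite_\<P>[OF pfn] depc cin slab_subset)
   (auto simp: R_def)
 have sq: "square_int (\<lambda>x. R s0 x + R s1 x)" using b0 b1 by (intro square_int_add) auto
 have d: "abs (X x - tau 0 n x) \<le> R s0 x + R s1 x" for x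
 proof -
  have "t_time H r n (?w x) \<le> sum (?w x) (c x) + R s0 x + R s1 x" using s[OF cin[of x]] \<omega>_nonneg by (auto simp: R_def)
  moreover have "sum (?w x) (c x) = tau 0 n x" by (simp add: c_def tau_def path_family.opt_props(2)[OF pfn])
  ultimately show ?thesis using le[of x] by simp
 qed
 have tausq: "square_int (tau 0 n)" using p_int_imp_square_int[OF _ tau_p_int[OF n]] p by simp
 have m: "random_variable borel (\<lambda>x. X x - tau 0 n x)" using X square_int_measurable[OF tausq] by simp
 have dsq: "square_int (\<lambda>x. X x - tau 0 n x)" by (rule square_int_bounded_by[OF sq m d])
 show "square_int X" using square_int_add[OF dsq tausq] by simp
 have "l2norm (\<lambda>x. X x - tau 0 n x) \<le> l2norm (\<lambda>x. R s0 x + R s1 x)" by (rule l2norm_mono[OF sq m d])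
 also have "\<dots> \<le> l2norm (R s0) + l2norm (R s1)" using b0 b1 by (intro l2norm_triangle) auto
 finally show "l2norm (\<lambda>x. X x - tau 0 n x) \<le> 2 * \<Delta>" using b0 b1 by simp
qed

end

section \<open>Choice of exponents and the central limit theorem for blocks\<close>

text \<open>At \<open>\<gamma> = 0\<close> the claim is the hypothesis multiplied by
  \<open>p / 2 - 1\<close>. It is strict, so continuity leaves room for a small positive
  \<open>\<gamma>\<close>; the 5 counts the losses of size \<open>\<gamma>\<close> in the block
  length.\<close>

lemma obtain_exponent_slack:
 fixes a \<theta> p :: real
 assumes p: "2 < p" and e: "a * (2 + \<theta> + 2 * \<theta> / (p - 2)) < 1"
 obtains \<gamma> where "0 < \<gamma>" "(a * \<theta> + 5 * \<gamma>) * (1 + \<gamma>) < (p / 2 - 1) * (1 - 2 * a - (a * \<theta> + 5 * \<gamma>))"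
proof -
 define f where "f \<gamma> = (a * \<theta> + 5 * \<gamma>) * (1 + \<gamma>) - (p / 2 - 1) * (1 - 2 * a - (a * \<theta> + 5 * \<gamma>))" for \<gamma>
 have "(p / 2 - 1) * (a * (2 + \<theta> + 2 * \<theta> / (p - 2))) < (p / 2 - 1) * 1" using p e by simp
 moreover define x where "x = 2 * \<theta> / (p - 2)"
 moreover have "(p / 2 - 1) * (a * (2 + \<theta> + x)) = (p / 2 - 1) * (2 * a + a * \<theta>) + a * ((p / 2 - 1) * x)"
  by (simp add: algebra_simps)
 moreover have "(p / 2 - 1) * x = \<theta>" using p by (simp add: x_def field_simps)
 moreover have "f 0 = a * \<theta> - ((p / 2 - 1) * 1 - (p / 2 - 1) * (2 * a + a * \<theta>))" by (simp add: f_def algebra_simps)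
 ultimately have f0: "f 0 < 0" by (simp only:)
 have "f \<midarrow>0\<rightarrow> f 0" unfolding f_def[abs_def] by (intro tendsto_intros)
 then have "eventually (\<lambda>x. f x < 0) (at_right 0)"
  using f0 by (intro order_tendstoD(2)[of f "f 0"]) (auto intro: tendsto_mono at_le)
 moreover have "eventually (\<lambda>x::real. 0 < x) (at_right 0)" by (rule eventually_at_right_less)
 ultimately have "eventually (\<lambda>x. f x < 0 \<and> 0 < x) (at_right 0)" by (rule eventually_conj)
 then obtain \<gamma> where "f \<gamma> < 0" "0 < \<gamma>" using eventually_happens'[of "at_right (0::real)"] by auto
 then show ?thesis by (intro that) (auto simp: f_def)
qed

context block_process
begin

lemma centered_block:
 assumes "0 < l"
 shows "square_int (centered (\<tau> a (a + l)))" "expectation (centered (\<tau> a (a + l))) = 0"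
  "expectation (\<lambda>x. (centered (\<tau> a (a + l)) x)^2) = (sd l)^2"
  "integrable M (\<lambda>x. abs (centered (\<tau> a (a + l)) x) powr p)"
  "expectation (\<lambda>x. abs (centered (\<tau> a (a + l)) x) powr p) = pmom l"
proof -
 have al: "a < a + l" using assms by simp
 show "square_int (centered (\<tau> a (a + l)))" "expectation (centered (\<tau> a (a + l))) = 0"
  using \<tau>_sq[OF al] by (auto intro: square_int_centered expectation_centered)
 show "expectation (\<lambda>x. (centered (\<tau> a (a + l)) x)^2) = (sd l)^2" using sdev_shift[OF assms, of a] by (metis l2norm_sq sdev_def)
 show "integrable M (\<lambda>x. abs (centered (\<tau> a (a + l)) x) powr p)" using p_int_centered[OF _ \<tau>_p[OF al]] p by (simp add: p_int_def)
qed (rule pmom_shift[OF assms])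

lemma centered_blocks_indep:
 assumes "0 < l"
 shows "indep_vars (\<lambda>_. borel) (\<lambda>i. centered (\<tau> (i * l) (i * l + l))) {..<m}"
 unfolding centered_def[abs_def] by (rule indep_vars_compose2[OF blocks_indep[OF assms]]) simp

text \<open>Here \<open>T\<close> is the target for the standard deviation and \<open>c\<close>
  bounds length over variance, so that the target is met once the length exceeds
  \<open>c * T^2\<close>. If the selected scale is not the first, the preceding one is below target
  and hence no longer than \<open>c * T^2\<close>; this bounds both the block length and the number
  of doublings.\<close>

lemma obtain_block_length:
 fixes C \<gamma> T c :: real and l0 :: nat and A :: real
 assumes C: "\<And>l T j0. l > 0 \<Longrightarrow> \<Delta> \<le> T \<Longrightarrow> T \<le> sd (2 ^ j0 * l) \<Longrightarrow>
   \<exists>j. T \<le> sd (2 ^ j * l) \<and> (\<forall>i<j. sd (2 ^ i * l) < T) \<and>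
   pmom (2 ^ j * l) \<le> C * (2 ^ j) powr (1 + \<gamma>) * (pmom l + T powr p)"
  and C0: "0 < C" and \<gamma>: "0 < \<gamma>" and T: "\<Delta> \<le> T" and c: "0 < c"
  and l: "0 < l0" "real l0 \<le> c * T^2" "c * T^2 \<le> A * real l0" "1 \<le> A" "pmom l0 \<le> T powr p"
  and sd: "\<And>k. k \<ge> l0 \<Longrightarrow> real k \<le> c * (sd k)^2"
 obtains k where "0 < k" "T \<le> sd k" "real k \<le> 2 * (c * T^2)"
  "pmom k / ((sd k)^2) powr (p / 2) \<le> 2 * C * (2 * A) powr (1 + \<gamma>)"
proof -
 have T0: "0 < T" using T \<Delta> by simp
 obtain j0 :: nat where "c * T^2 < 2 ^ j0" using real_arch_pow[of 2 "c * T^2"] by auto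
 also have "(2::real) ^ j0 \<le> real (2 ^ j0 * l0)" using l(1) by simp
 also have "\<dots> \<le> c * (sd (2 ^ j0 * l0))^2" using l(1) by (intro sd) simp
 finally have "T^2 < (sd (2 ^ j0 * l0))^2" using c by simp
 then have "T \<le> sd (2 ^ j0 * l0)" using power_less_imp_less_base[of T 2 "sd (2 ^ j0 * l0)"] by (simp add: sd_def)
 then obtain j where j: "T \<le> sd (2 ^ j * l0)" "\<And>i. i < j \<Longrightarrow> sd (2 ^ i * l0) < T"
  "pmom (2 ^ j * l0) \<le> C * (2 ^ j) powr (1 + \<gamma>) * (pmom l0 + T powr p)"
  using C[OF l(1) T] by blast
 have len: "real (2 ^ j * l0) \<le> 2 * (c * T^2) \<and> 2 ^ j \<le> 2 * A"
 proof (cases j)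
  case 0
  then show ?thesis using l c T0 by simp
 next
  case (Suc i)
  have "real (2 ^ i * l0) \<le> c * (sd (2 ^ i * l0))^2" using l(1) by (intro sd) simp
  also have "\<dots> \<le> c * T^2" using c j(2)[of i] Suc by (intro mult_left_mono power_mono) (auto simp: sd_def)
  finally have i: "real (2 ^ i * l0) \<le> c * T^2" .
  then have "2 ^ i * real l0 \<le> A * real l0" using l(3) by simp
  then show ?thesis using i l(1) Suc by simp
 qed
 let ?k = "2 ^ j * l0"
 have "T powr p \<le> sd ?k powr p" using T0 p j(1) by (intro powr_mono2) auto
 also have sdp: "sd ?k powr p = ((sd ?k)^2) powr (p / 2)"
 proof -
  have "(sd ?k)^2 = sd ?k powr 2" using T0 j(1) by simp
  then show ?thesis by (simp only: powr_powr) simp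
 qed
 finally have Tp: "T powr p \<le> ((sd ?k)^2) powr (p / 2)" .
 have "pmom ?k \<le> C * (2 ^ j) powr (1 + \<gamma>) * (T powr p + T powr p)"
  using C0 l(5) by (intro order_trans[OF j(3)] mult_left_mono) auto
 also have "\<dots> \<le> C * (2 * A) powr (1 + \<gamma>) * (T powr p + T powr p)"
  using C0 len \<gamma> by (intro mult_right_mono mult_left_mono powr_mono2) auto
 finally have "pmom ?k \<le> 2 * C * (2 * A) powr (1 + \<gamma>) * T powr p" by simp
 also have "\<dots> \<le> 2 * C * (2 * A) powr (1 + \<gamma>) * ((sd ?k)^2) powr (p / 2)" using C0 by (intro mult_left_mono Tp) auto
 finally have "pmom ?k / ((sd ?k)^2) powr (p / 2) \<le> 2 * C * (2 * A) powr (1 + \<gamma>)" using j(1) T0 by (simp add: divide_le_eq)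
 then show ?thesis using j(1) len l(1) by (intro that[of ?k]) auto
qed

end

text \<open>The exponents come from taking blocks at whose length the standard deviation exceeds the
 junction error by a small power of \<open>n\<close>.\<close>

theorem (in prob_space) asymptotically_normal_of_blocks:
 fixes \<tau> :: "nat \<Rightarrow> nat \<Rightarrow> nat \<Rightarrow> 'a \<Rightarrow> real" and Y :: "nat \<Rightarrow> 'a \<Rightarrow> real"
 assumes p: "2 < p" and a: "0 \<le> a" and \<theta>: "0 \<le> \<theta>" and e: "a * (2 + \<theta> + 2 * \<theta> / (p - 2)) < 1"
  and bp: "\<And>n. 1 \<le> n \<Longrightarrow> block_process M (\<tau> n) (D n) p (\<Delta> n)"
  and reg: "\<And>\<gamma>. 0 < \<gamma> \<Longrightarrow> \<forall>\<^sub>F n in sequentially. \<Delta> n \<le> real n powr (a + \<gamma>) \<and>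
   (\<exists>l. real n powr (2 * a) \<le> real l \<and> real l \<le> real n powr (2 * a + \<gamma>) \<and>
    block_process.pmom M (\<tau> n) p l \<le> real n powr ((a + \<gamma>) * p) \<and>
    (\<forall>k\<ge>l. real k \<le> real n powr (a * \<theta> + \<gamma>) * (block_process.sd M (\<tau> n) k)^2))"
  and Y: "\<And>n. 1 \<le> n \<Longrightarrow> square_int (Y n) \<and> l2norm (\<lambda>x. Y n x - \<tau> n 0 n x) \<le> 2 * \<Delta> n"
 shows "asymptotically_normal Y"
proof -
 obtain \<gamma> where \<gamma>: "0 < \<gamma>" "(a * \<theta> + 5 * \<gamma>) * (1 + \<gamma>) < (p / 2 - 1) * (1 - 2 * a - (a * \<theta> + 5 * \<gamma>))"
  using obtain_exponent_slack[OF p e] .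
 \<comment> \<open>Blocks will have length at most of order n^(2a + u), so at least of order n^w of
   them fit.\<close>
 define u where "u = a * \<theta> + 5 * \<gamma>"
 define w where "w = 1 - 2 * a - u"
 \<comment> \<open>One \<open>\<gamma>\<close> more than in the bound for the junction error, so
   that \<open>\<Delta> n / T n\<close> tends to 0.\<close>
 define T where "T n = real n powr (a + 2 * \<gamma>)" for n :: nat
 have u: "5 * \<gamma> \<le> u" using a \<theta> by (simp add: u_def)
 have uw: "u * (1 + \<gamma>) < (p / 2 - 1) * w" using \<gamma>(2) by (simp add: u_def w_def)
 moreover have "0 \<le> u * (1 + \<gamma>)" using u \<gamma>(1) by simp
 ultimately have "0 < (p / 2 - 1) * w" by simp
 then have w: "0 < w" using p by (simp add: zero_less_mult_iff)
 obtain C where C: "C > 0" "\<And>(M :: 'a measure) \<tau> D \<Delta> l T j0. block_process M \<tau> D p \<Delta> \<Longrightarrow> l > 0 \<Longrightarrow> \<Delta> \<le> T \<Longrightarrow>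
  T \<le> block_process.sd M \<tau> (2 ^ j0 * l) \<Longrightarrow>
  (\<exists>j. T \<le> block_process.sd M \<tau> (2 ^ j * l) \<and>
   (\<forall>i<j. block_process.sd M \<tau> (2 ^ i * l) < T) \<and>
   block_process.pmom M \<tau> p (2 ^ j * l)
    \<le> C * (2 ^ j) powr (1 + \<gamma>) * (block_process.pmom M \<tau> p l + T powr p))"
  using block_selection[OF p \<gamma>(1), where ?'a = 'a] by blast
 define good where "good n k \<longleftrightarrow> 1 \<le> n \<and> 0 < k \<and> \<Delta> n \<le> real n powr (a + \<gamma>) \<and> T n \<le> block_process.sd M (\<tau> n) k \<and>
  real k \<le> 2 * real n powr (2 * a + u) \<and>
  block_process.pmom M (\<tau> n) p k / ((block_process.sd M (\<tau> n) k)^2) powr (p / 2) \<le> 2 * C * (2 * real n powr u) powr (1 + \<gamma>)" for n k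
 have "\<forall>\<^sub>F n in sequentially. \<exists>k. good n k" using reg[OF \<gamma>(1)] eventually_ge_at_top[of 1]
 proof eventually_elim
  case (elim n)
  then obtain l where l: "real n powr (2 * a) \<le> real l" "real l \<le> real n powr (2 * a + \<gamma>)"
   "block_process.pmom M (\<tau> n) p l \<le> real n powr ((a + \<gamma>) * p)"
   "\<And>k. k \<ge> l \<Longrightarrow> real k \<le> real n powr (a * \<theta> + \<gamma>) * (block_process.sd M (\<tau> n) k)^2" by blast
  have n: "1 \<le> real n" "0 < n" using elim by auto
  interpret B: block_process M "\<tau> n" "D n" p "\<Delta> n" using bp elim by simp
  \<comment> \<open>The exponents add up to a \<theta> + \<gamma> + 2 (a + 2 \<gamma>), which
    explains the 5 in \<open>u\<close>.\<close>
  have TT: "real n powr (a * \<theta> + \<gamma>) * (T n)^2 = real n powr (2 * a + u)"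
   using n by (simp add: T_def u_def powr_power powr_add[symmetric] algebra_simps)
  have l0: "0 < l" using l(1) n by (metis gr0I not_le of_nat_0 powr_gt_zero of_nat_0_less_iff)
  have mono: "real n powr s \<le> real n powr t" if "s \<le> t" for s t using n that by (intro powr_mono) auto
  show ?case
  proof (rule B.obtain_block_length[of C \<gamma> "T n" "real n powr (a * \<theta> + \<gamma>)" l "real n powr u", unfolded TT])
   show "real l \<le> real n powr (2 * a + u)" using l(2) mono[of "2 * a + \<gamma>" "2 * a + u"] u \<gamma> by simp
   show "real n powr (2 * a + u) \<le> real n powr u * real l"
    using mult_left_mono[OF l(1), of "real n powr u"] by (simp add: powr_add mult.commute)
   show "B.pmom l \<le> T n powr p" using l(3) mono[of "(a + \<gamma>) * p" "(a + 2 * \<gamma>) * p"] p \<gamma> by (simp add: T_def powr_powr)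
   show "\<Delta> n \<le> T n" using elim mono[of "a + \<gamma>" "a + 2 * \<gamma>"] \<gamma> by (simp add: T_def)
   show "1 \<le> real n powr u" using n u \<gamma> by (intro ge_one_powr_ge_zero) auto
   show "0 < real n powr (a * \<theta> + \<gamma>)" using n by simp
   show "\<exists>j. T' \<le> B.sd (2 ^ j * l') \<and> (\<forall>i<j. B.sd (2 ^ i * l') < T') \<and>
     B.pmom (2 ^ j * l') \<le> C * (2 ^ j) powr (1 + \<gamma>) * (B.pmom l' + T' powr p)"
    if "0 < l'" "\<Delta> n \<le> T'" "T' \<le> B.sd (2 ^ j0 * l')" for l' T' j0
    using C(2)[OF B.block_process_axioms] that by blast
   show "\<exists>k. good n k" if "0 < k" "T n \<le> B.sd k" "real k \<le> 2 * real n powr (2 * a + u)"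
    "B.pmom k / ((B.sd k)^2) powr (p / 2) \<le> 2 * C * (2 * real n powr u) powr (1 + \<gamma>)" for k
    using that elim by (auto simp: good_def)
  qed (use l0 l(4) \<gamma>(1) C(1) in auto)
 qed
 then have good_k: "\<forall>\<^sub>F n in sequentially. good n (SOME k. good n k)" by (rule eventually_mono) (rule someI_ex)
 define k where "k n = (SOME k. good n k)" for n
 note good_k = good_k[folded k_def]
 define m where "m n = n div k n" for n
 define v where "v n = (block_process.sd M (\<tau> n) (k n))^2" for n
 define \<beta> where "\<beta> n = block_process.pmom M (\<tau> n) p (k n)" for n
 let ?B = "\<lambda>n i. centered (\<tau> n (i * k n) (i * k n + k n))"
 have nw: "filterlim (\<lambda>n. real n powr w) at_top sequentially"
  using w by (intro filterlim_compose[OF real_powr_at_top] filterlim_real_sequentially) auto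
 have big: "\<forall>\<^sub>F n in sequentially. 4 \<le> real n powr w" using nw by (auto simp: filterlim_at_top)
 have m_ge: "\<forall>\<^sub>F n in sequentially. real n powr w / 4 \<le> real (m n)" using good_k big
 proof eventually_elim
  case (elim n)
  have n: "0 < real n" and k: "0 < real (k n)" "real (k n) \<le> 2 * real n powr (2 * a + u)" using elim by (auto simp: good_def)
  have "real n powr w / 2 = real n / (2 * real n powr (2 * a + u))"
   by (simp add: w_def powr_diff powr_add diff_diff_eq[symmetric])
  also have "\<dots> \<le> real n / real (k n)" using k n by (intro divide_left_mono) auto
  also have "\<dots> \<le> real (m n) + 1"
  proof -
   have "n = m n * k n + n mod k n" "n mod k n < k n" using k by (simp_all add: m_def)
   then have "n \<le> (m n + 1) * k n" by simp
   then have "real n \<le> (real (m n) + 1) * real (k n)" by (metis of_nat_1 of_nat_add of_nat_le_iff of_nat_mult)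
   then show ?thesis by (simp add: divide_le_eq)
  qed
  finally show ?case using elim by simp
 qed
 show ?thesis
 proof (rule asymptotically_normal_if_approx[where X = "\<lambda>n i. ?B n i" and m = m and v = v and \<beta> = \<beta>, OF _ p])
  show "\<forall>\<^sub>F n in sequentially. indep_vars (\<lambda>_. borel) (\<lambda>i. ?B n i) {..<m n} \<and> 0 < v n \<and>
   (\<forall>i<m n. square_int (?B n i) \<and>
    expectation (?B n i) = 0 \<and>
    expectation (\<lambda>x. (?B n i x)^2) = v n \<and>
    integrable M (\<lambda>x. abs (?B n i x) powr p) \<and>
    expectation (\<lambda>x. abs (?B n i x) powr p) \<le> \<beta> n)"
   using good_k
  proof eventually_elim
   case (elim n)
   interpret B: block_process M "\<tau> n" "D n" p "\<Delta> n" using bp elim by (simp add: good_def)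
   have k: "0 < k n" using elim by (simp add: good_def)
   have "0 < T n" using elim by (auto simp: T_def good_def)
   then have "0 < v n" using elim by (auto simp: v_def good_def)
   then show ?case using B.centered_blocks_indep[OF k] B.centered_block[OF k] by (simp add: v_def \<beta>_def)
  qed
  show "filterlim m at_top sequentially"
  proof -
   have "filterlim (\<lambda>n. real n powr w / 4) at_top sequentially"
    using filterlim_tendsto_pos_mult_at_top[OF tendsto_const _ nw, of "1 / 4"] by simp
   then have "filterlim (\<lambda>n. real (m n)) at_top sequentially" using m_ge by (rule filterlim_at_top_mono)
   then show ?thesis by (simp add: filterlim_sequentially_iff_filterlim_real)
  qed
  \<comment> \<open>The moment ratio costs n^(u (1 + \<gamma>)) and the number of blocks gains
    n^((p/2 - 1) w); \<open>uw\<close> says that the gain wins.\<close>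
  show "(\<lambda>n. \<beta> n / v n powr (p / 2) * real (m n) powr (1 - p / 2)) \<longlonglongrightarrow> 0"
  proof (rule Lim_null_comparison)
   let ?K = "2 * C * 2 powr (1 + \<gamma>) * 4 powr (p / 2 - 1)"
   show "\<forall>\<^sub>F n in sequentially. norm (\<beta> n / v n powr (p / 2) * real (m n) powr (1 - p / 2))
    \<le> ?K * real n powr (u * (1 + \<gamma>) - (p / 2 - 1) * w)"
    using good_k m_ge
   proof eventually_elim
    case (elim n)
    interpret B: block_process M "\<tau> n" "D n" p "\<Delta> n" using bp elim by (simp add: good_def)
    have n: "0 < real n" using elim by (auto simp: good_def)
    have b0: "0 \<le> \<beta> n" by (simp add: \<beta>_def B.pmom_nonneg)
    have "real (m n) powr (1 - p / 2) \<le> (real n powr w / 4) powr (1 - p / 2)" using elim n p by (intro powr_mono2') auto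
    also have "\<dots> = real n powr (- ((p / 2 - 1) * w)) * 4 powr (p / 2 - 1)"
     by (simp add: powr_divide powr_powr powr_minus_divide[symmetric] divide_powr_uminus algebra_simps)
    finally have "real (m n) powr (1 - p / 2) \<le> real n powr (- ((p / 2 - 1) * w)) * 4 powr (p / 2 - 1)" .
    moreover have "\<beta> n / v n powr (p / 2) \<le> 2 * C * (2 * real n powr u) powr (1 + \<gamma>)"
     using elim by (simp add: good_def \<beta>_def v_def)
    ultimately have "\<beta> n / v n powr (p / 2) * real (m n) powr (1 - p / 2)
     \<le> 2 * C * (2 * real n powr u) powr (1 + \<gamma>) * (real n powr (- ((p / 2 - 1) * w)) * 4 powr (p / 2 - 1))"
     using C(1) by (intro mult_mono) auto
    also have "(2 * real n powr u) powr (1 + \<gamma>) = 2 powr (1 + \<gamma>) * real n powr (u * (1 + \<gamma>))"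
     by (simp add: powr_mult powr_powr)
    finally show ?case using b0 by (simp add: powr_diff powr_minus_divide mult_ac)
   qed
   have "(\<lambda>n. real n powr (u * (1 + \<gamma>) - (p / 2 - 1) * w)) \<longlonglongrightarrow> 0"
    using uw by (intro tendsto_neg_powr filterlim_real_sequentially) auto
   then show "(\<lambda>n. ?K * real n powr (u * (1 + \<gamma>) - (p / 2 - 1) * w)) \<longlonglongrightarrow> 0" using tendsto_mult_right_zero by blast
  qed
  show "\<forall>\<^sub>F n in sequentially. square_int (Y n)" using eventually_ge_at_top[of 1] by eventually_elim (use Y in simp)
  \<comment> \<open>Relative to sqrt m times the standard deviation of a block, the junctions cost
    order \<Delta> / T and the incomplete block 1 / sqrt m.\<close>
  show "(\<lambda>n. l2norm (\<lambda>x. centered (Y n) x - (\<Sum>i<m n. ?B n i x)) / sqrt (real (m n) * v n)) \<longlonglongrightarrow> 0"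
  proof (rule Lim_null_comparison)
   show "\<forall>\<^sub>F n in sequentially. norm (l2norm (\<lambda>x. centered (Y n) x - (\<Sum>i<m n. ?B n i x)) / sqrt (real (m n) * v n))
    \<le> 8 * real n powr - \<gamma> + 2 * real n powr (- (w / 2))"
    using good_k m_ge big
   proof eventually_elim
    case (elim n)
    interpret B: block_process M "\<tau> n" "D n" p "\<Delta> n" using bp elim by (simp add: good_def)
    have n: "0 < real n" "0 < n" "1 \<le> n" and k: "0 < k n" using elim by (auto simp: good_def)
    have m1: "1 \<le> real (m n)" using elim by simp
    define s where "s = B.sd (k n)"
    have T0: "0 < T n" using n by (simp add: T_def)
    have s: "T n \<le> s" "0 < s" using elim T0 by (auto simp: s_def good_def)
    let ?S = "\<lambda>x. \<Sum>i<m n. ?B n i x"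
    have Yn: "square_int (Y n)" "l2norm (\<lambda>x. Y n x - \<tau> n 0 n x) \<le> 2 * \<Delta> n" using Y n by auto
    have tq: "square_int (\<tau> n 0 n)" using n by (intro B.\<tau>_sq)
    have Sq: "square_int ?S" using B.centered_block(1)[OF k] by (intro square_int_sum)
    have "l2norm (\<lambda>x. centered (Y n) x - ?S x) = l2norm (\<lambda>x. centered (\<lambda>x. Y n x - \<tau> n 0 n x) x + (centered (\<tau> n 0 n) x - ?S x))"
     using Yn tq by (simp add: centered_diff)
    also have "\<dots> \<le> sdev (\<lambda>x. Y n x - \<tau> n 0 n x) + l2norm (\<lambda>x. centered (\<tau> n 0 n) x - ?S x)"
     unfolding sdev_def using Yn tq Sq by (intro l2norm_triangle square_int_centered square_int_diff)
    also have "sdev (\<lambda>x. Y n x - \<tau> n 0 n x) \<le> 2 * \<Delta> n" using sdev_le_l2norm[OF square_int_diff[OF Yn(1) tq]] Yn(2) by simp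
    also have "l2norm (\<lambda>x. centered (\<tau> n 0 n) x - ?S x) \<le> 4 * sqrt (real (m n)) * \<Delta> n + s + 2 * \<Delta> n"
     unfolding s_def by (rule B.block_sum_approx[OF k, of _ "n mod k n"]) (use m1 k in \<open>auto simp: m_def\<close>)
    finally have "l2norm (\<lambda>x. centered (Y n) x - ?S x) \<le> 4 * sqrt (real (m n)) * \<Delta> n + 4 * \<Delta> n + s" by simp
    also have "\<dots> \<le> 8 * sqrt (real (m n)) * \<Delta> n + s" using m1 B.\<Delta> by simp
    finally have "l2norm (\<lambda>x. centered (Y n) x - ?S x) / (sqrt (real (m n)) * s) \<le> (8 * sqrt (real (m n)) * \<Delta> n + s) / (sqrt (real (m n)) * s)"
     using s m1 by (intro divide_right_mono) auto
    also have "\<dots> = 8 * (\<Delta> n / s) + 1 / sqrt (real (m n))" using s m1 by (simp add: field_simps)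
    also have "\<Delta> n / s \<le> real n powr - \<gamma>"
    proof -
     have "\<Delta> n / s \<le> real n powr (a + \<gamma>) / T n" using elim s T0 B.\<Delta> by (intro frac_le) (auto simp: good_def)
     also have "\<dots> = real n powr - \<gamma>" by (simp add: T_def powr_diff[symmetric])
     finally show ?thesis .
    qed
    also have "1 / sqrt (real (m n)) \<le> 2 * real n powr (- (w / 2))"
    proof -
     have "1 / sqrt (real (m n)) \<le> 1 / sqrt (real n powr w / 4)"
      using elim n by (intro divide_left_mono real_sqrt_le_mono mult_pos_pos) auto
     also have "sqrt (real n powr w / 4) = real n powr (w / 2) / 2"
      by (simp add: real_sqrt_divide powr_half_sqrt[symmetric] powr_powr)
     finally show ?thesis by (simp add: powr_minus_divide)
    qed
    finally show ?case using s m1 by (simp add: v_def s_def real_sqrt_mult)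
   qed
   have "(\<lambda>n. real n powr - \<gamma>) \<longlonglongrightarrow> 0" "(\<lambda>n. real n powr (- (w / 2))) \<longlonglongrightarrow> 0"
    using \<gamma>(1) w by (intro tendsto_neg_powr filterlim_real_sequentially; simp)+
   then show "(\<lambda>n. 8 * real n powr - \<gamma> + 2 * real n powr (- (w / 2))) \<longlonglongrightarrow> 0"
    using tendsto_add[OF tendsto_mult_right_zero tendsto_mult_right_zero] by fastforce
  qed
 qed
qed

section \<open>The bottom of the support\<close>

context real_distribution
begin

text \<open>The least point of the support is the infimum of the points where the distribution
  function is positive; in particular the \<open>LEAST\<close> exists.\<close>

lemma least_support:
 assumes nn: "prob {0..} = 1"
 defines "l \<equiv> LEAST x. x \<in> dist_support M"
 shows "0 \<le> l" "\<And>x. x < l \<Longrightarrow> cdf M x = 0" "\<And>x. l < x \<Longrightarrow> 0 < cdf M x"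
proof -
 define A where "A = {x. 0 < cdf M x}"
 define z where "z = Inf A"
 have neg: "cdf M x = 0" if "x < 0" for x
 proof -
  have "cdf M x \<le> prob (space M - {0..})" unfolding cdf_def using that by (intro finite_measure_mono) auto
  also have "\<dots> = 0" using nn prob_compl[of "{0..}"] by simp
  finally show ?thesis using cdf_nonneg[of x] by simp
 qed
 have bdd: "bdd_below A" using neg by (intro bdd_belowI[of _ 0]) (auto simp: A_def not_less[symmetric])
 have ne: "A \<noteq> {}"
 proof -
  have "eventually (\<lambda>x. 0 < cdf M x) at_top" by (rule order_tendstoD[OF cdf_lim_at_top_prob]) simp
  from eventually_happens'[OF trivial_limit_at_top_linorder this] show ?thesis by (auto simp: A_def)
 qed
 have below: "cdf M x = 0" if "x < z" for x
 using cInf_lower[OF _ bdd, of x] that cdf_nonneg[of x] by (fastforce simp: z_def A_def)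
 have above: "0 < cdf M x" if x: "z < x" for x
 proof -
  obtain y where "y \<in> A" "y < x" using cInf_less_iff[OF ne bdd] x by (auto simp: z_def)
  then show ?thesis using cdf_nondecreasing[of y x] by (simp add: A_def)
 qed
 have "l = z" unfolding l_def
 proof (rule Least_equality)
  show "z \<in> dist_support M" unfolding dist_support_def
  proof (intro CollectI allI impI)
   fix e :: real assume e: "0 < e"
   have "0 < cdf M (z + e / 2) - cdf M (z - e / 2)" using above below e by simp
   also have "\<dots> = prob {z - e / 2<..z + e / 2}" using e by (intro cdf_diff_eq) simp
   also have "\<dots> \<le> prob {z - e<..<z + e}" using e by (intro finite_measure_mono) auto
   finally show "0 < prob {z - e<..<z + e}" .
  qed
  fix y assume y: "y \<in> dist_support M"
  show "z \<le> y"
  proof (rule ccontr)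
   assume "\<not> z \<le> y"
   then have e: "0 < (z - y) / 2" "y + (z - y) / 2 < z" by (auto simp: field_simps)
   have "0 < prob {y - (z - y) / 2<..<y + (z - y) / 2}" using y e(1) by (auto simp: dist_support_def)
   also have "\<dots> \<le> cdf M (y + (z - y) / 2)" unfolding cdf_def by (intro finite_measure_mono) auto
   finally show False using below[OF e(2)] by simp
  qed
 qed
 moreover have "0 \<le> z" unfolding z_def using ne neg by (intro cInf_greatest) (auto simp: A_def not_less[symmetric])
 ultimately show "0 \<le> l" "\<And>x. x < l \<Longrightarrow> cdf M x = 0" "\<And>x. l < x \<Longrightarrow> 0 < cdf M x" using below above by auto
qed

text \<open>Otherwise all mass would sit at the least point. For a fixed graph this takes the place
  of admissibility.\<close>

lemma cdf_least_support_less_1: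
 assumes "prob {0..} = 1" "nondegenerate M"
 shows "cdf M (LEAST x. x \<in> dist_support M) < 1"
proof -
 let ?l = "LEAST x. x \<in> dist_support M"
 have "eventually (\<lambda>x. x < ?l) (at_left ?l)" by (simp add: eventually_at_filter)
 then have "eventually (\<lambda>x. 0 = cdf M x) (at_left ?l)" by eventually_elim (use least_support(2)[OF assms(1)] in simp)
 then have "(cdf M \<longlongrightarrow> 0) (at_left ?l)" by (rule Lim_transform_eventually[OF tendsto_const])
 then have "prob {..<?l} = 0" by (rule tendsto_unique[OF trivial_limit_at_left_real cdf_at_left])
 moreover have "cdf M ?l = prob {..<?l} + prob {?l}"
  unfolding cdf_def by (subst finite_measure_Union[symmetric]) (auto simp: ivl_disj_un intro: arg_cong[where f = prob])
 moreover have "prob {?l} \<noteq> 1" using assms(2) by (simp add: nondegenerate_def)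
 ultimately show ?thesis using prob_le_1[of "{?l}"] by linarith
qed

text \<open>Right continuity at the least point lets \<open>b\<close> be taken slightly above it;
  the positive mass below \<open>b\<close> is what makes the truncated mean smaller than
  \<open>b\<close>.\<close>

lemma obtain_level:
 assumes nn: "prob {0..} = 1" and s: "cdf M (LEAST x. x \<in> dist_support M) < s"
 obtains b where "0 < b" "0 < prob {..<b}" "prob {..<b} < s"
proof -
 let ?l = "LEAST x. x \<in> dist_support M"
 have "(cdf M \<longlongrightarrow> cdf M ?l) (at_right ?l)" using cdf_is_right_cont[of ?l] by (simp add: continuous_within)
 then have "eventually (\<lambda>x. cdf M x < s) (at_right ?l)" using s by (rule order_tendstoD)
 moreover have "eventually (\<lambda>x. ?l < x) (at_right ?l)" by (rule eventually_at_right_less)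
 ultimately have "eventually (\<lambda>x. cdf M x < s \<and> ?l < x) (at_right ?l)" by (rule eventually_conj)
 then obtain b where b: "cdf M b < s" "?l < b" using eventually_happens'[of "at_right ?l"] by auto
 have "0 < cdf M ((?l + b) / 2)" using b by (intro least_support(3)[OF nn]) simp
 also have "\<dots> \<le> prob {..<b}" unfolding cdf_def using b by (intro finite_measure_mono) auto
 finally have "0 < prob {..<b}" .
 moreover have "prob {..<b} \<le> cdf M b" unfolding cdf_def by (intro finite_measure_mono) auto
 ultimately show ?thesis using b least_support(1)[OF nn] by (intro that[of b]) auto
qed

lemma expectation_min_less:
 assumes nn: "AE y in M. 0 \<le> y" and b: "0 < prob {..<b}" "0 \<le> b"
 shows "(\<integral>y. min y b \<partial>M) < b"
proof -
 have int: "integrable M (\<lambda>y. min y b)" using nn b by (intro integrable_const_bound[of _ b]) (auto elim!: eventually_mono)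
 have "(\<integral>y. b - min y b \<partial>M) \<noteq> 0"
 proof
  assume "(\<integral>y. b - min y b \<partial>M) = 0"
  then have "AE y in M. b - min y b = 0" using int by (subst (asm) integral_nonneg_eq_0_iff_AE) auto
  then have "AE y in M. y \<notin> {..<b}" by auto
  then have "prob {..<b} = 0" by (subst prob_eq_0) auto
  then show False using b by simp
 qed
 moreover have "0 \<le> (\<integral>y. b - min y b \<partial>M)" by simp
 moreover have "(\<integral>y. b - min y b \<partial>M) = b - (\<integral>y. min y b \<partial>M)" using int by (simp add: prob_space[unfolded space_eq_univ])
 ultimately show ?thesis by simp
qed

lemma obtain_median_bound: obtains c where "0 \<le> c" "1 / 2 \<le> prob {..c}"
proof -
 have "eventually (\<lambda>x. 1 / 2 < cdf M x) at_top" by (rule order_tendstoD[OF cdf_lim_at_top_prob]) simp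
 then have "eventually (\<lambda>x. 1 / 2 < cdf M x \<and> 0 \<le> x) at_top" using eventually_ge_at_top[of 0] by (rule eventually_conj)
 from eventually_happens'[OF trivial_limit_at_top_linorder this] obtain c where "1 / 2 < cdf M c" "0 \<le> c" by auto
 then show ?thesis by (intro that[of c]) (auto simp: cdf_def)
qed

end

section \<open>Variance and moment bounds for tubes\<close>

context fpp
begin

definition size_H :: real where "size_H = real (card V + card (edges H))"

lemma size_H_ge_1: "1 \<le> size_H"
proof -
 have "0 < card V" using V_ne finite_V by auto
 then show ?thesis by (simp add: size_H_def)
qed

lemma card_slab_le_size: "real (card (slab a (a + int l))) \<le> (real l + 1) * size_H"
proof -
 have "real (card (slab a (a + int l))) \<le> real (nat (a + int l - a + 1) * (card V + card (edges H)))"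
  by (simp only: of_nat_le_iff card_slab_le)
 also have "nat (a + int l - a + 1) = l + 1" by simp
 finally show ?thesis by (simp only: size_H_def of_nat_mult of_nat_add of_nat_1)
qed

text \<open>Squares the bound of \<open>sdev_tau_lower_bound\<close> after inserting the number of
  edges of the slab. The slab length enters as \<open>L^2\<close>, which stays harmless as long as
  \<open>L\<close> is a small power of \<open>n\<close>.\<close>

lemma le_sdev_tau:
 assumes L: "0 < L" and b: "0 < b" and l: "L \<le> l" and \<delta>: "0 < \<delta>"
  and c: "(\<integral>y. min y b \<partial>F) < b"
  and pr: "\<And>i. \<delta> \<le> prob {x \<in> space M. \<forall>P\<in>cross (int (i * L)) (int (i * L + L)). \<exists>e\<in>P. b \<le> \<omega> e x}"
 defines "g \<equiv> (b - (\<integral>y. min y b \<partial>F))^2 * \<delta> / b"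
 shows "real l \<le> 8 / g^2 * (real L)^2 * size_H * (sdev (tau 0 l))^2"
proof -
 have l0: "0 < l" using L l by simp
 have g0: "0 < g" using b \<delta> c by (simp add: g_def)
 define s where "s = sdev (tau 0 l)"
 have s0: "0 \<le> s" by (simp add: s_def)
 have "l = l div L * L + l mod L" "l mod L < L" "1 \<le> l div L" using L l by (simp_all add: div_greater_zero_iff Suc_le_eq)
 moreover from this have "1 * L \<le> l div L * L" by simp
 \<comment> \<open>Complete slabs cover at least half of the length.\<close>
 ultimately have "l \<le> l div L * (2 * L)" by linarith
 then have "real l \<le> real (l div L) * (2 * real L)" by (metis of_nat_le_iff of_nat_mult of_nat_numeral)
 then have "g * b * real l \<le> g * b * (real (l div L) * (2 * real L))" using g0 b by (intro mult_left_mono) auto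
 also have "\<dots> = (b - (\<integral>y. min y b \<partial>F))^2 * (\<delta> * real (l div L)) * (2 * real L)" using b by (simp add: g_def)
 also have "\<dots> \<le> s * (b * sqrt (real (card (slab 0 (int l))))) * (2 * real L)"
  unfolding s_def using b by (intro mult_right_mono sdev_tau_lower_bound[OF L _ l0 pr]) auto
 also have "\<dots> \<le> s * (b * sqrt (2 * real l * size_H)) * (2 * real L)"
 proof -
  have "(real l + 1) * size_H \<le> 2 * real l * size_H" using l0 size_H_ge_1 by simp
  then have "real (card (slab 0 (int l))) \<le> 2 * real l * size_H" using card_slab_le_size[of 0 l] by simp
  then show ?thesis using s0 b by (intro mult_right_mono mult_left_mono) auto
 qed
 finally have "b * (g * real l) \<le> b * (s * sqrt (2 * real l * size_H) * (2 * real L))" by (simp add: mult_ac)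
 then have "g * real l \<le> s * sqrt (2 * real l * size_H) * (2 * real L)" using b by simp
 then have "(g * real l)^2 \<le> (s * sqrt (2 * real l * size_H) * (2 * real L))^2" using g0 by (intro power_mono) auto
 also have "\<dots> = s^2 * (2 * real l * size_H) * (4 * (real L)^2)" using size_H_ge_1 by (simp add: power_mult_distrib)
 finally have "real l * (g^2 * real l) \<le> real l * (8 * (real L)^2 * size_H * s^2)" by (simp add: power2_eq_square mult_ac)
 then have "g^2 * real l \<le> 8 * (real L)^2 * size_H * s^2" using l0 by simp
 then show ?thesis using g0 by (simp add: field_simps s_def)
qed

lemma expectation_tau_le:
 assumes "0 < l"
 shows "expectation (tau 0 l) \<le> real l * (\<integral>y. abs y \<partial>F)"
proof -
 have t0: "abs (tau 0 l x) = tau 0 l x" for x using tau_nonneg[of 0 l x] assms by simp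
 have "expectation (\<lambda>x. tau 0 l x powr 1) \<le> real l powr 1 * (\<integral>y. abs y powr 1 \<partial>F)" using tau_moment[OF assms, of 1] p by simp
 then show ?thesis by (simp add: t0)
qed

text \<open>No concentration is used. This is enough for a fixed graph, where the starting length
  can be an arbitrarily small power of \<open>n\<close>.\<close>

lemma central_moment_crude:
 assumes l: "0 < l"
 shows "expectation (\<lambda>x. abs (centered (tau 0 l) x) powr p)
  \<le> 2 powr p * ((\<integral>y. abs y powr p \<partial>F) + (\<integral>y. abs y \<partial>F) powr p) * real l powr p"
proof -
 have p0: "0 < p" "1 \<le> p" using p by auto
 let ?m = "expectation (tau 0 l)"
 have m: "0 \<le> ?m" using tau_nonneg[OF l] by simp
 have int: "integrable M (\<lambda>x. abs (tau 0 l x) powr p)" using tau_p_int[OF l] by (simp add: p_int_def)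
 have intc: "integrable M (\<lambda>x. abs (centered (tau 0 l) x) powr p)"
  using p_int_centered[OF p0(1) tau_p_int[OF l]] by (simp add: p_int_def)
 have "expectation (\<lambda>x. abs (centered (tau 0 l) x) powr p) \<le> expectation (\<lambda>x. 2 powr p * (abs (tau 0 l x) powr p + abs (- ?m) powr p))"
 proof (rule integral_mono[OF intc])
  show "integrable M (\<lambda>x. 2 powr p * (abs (tau 0 l x) powr p + abs (- ?m) powr p))" using int by auto
  show "abs (centered (tau 0 l) x) powr p \<le> 2 powr p * (abs (tau 0 l x) powr p + abs (- ?m) powr p)" for x
   using abs_add_powr_le_two[OF p0(1), of "tau 0 l x" "- ?m"] by (simp add: centered_def)
 qed
 also have "\<dots> = 2 powr p * (expectation (\<lambda>x. tau 0 l x powr p) + ?m powr p)"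
  using int tau_nonneg[OF l] m by (simp add: prob_space)
 also have "\<dots> \<le> 2 powr p * (real l powr p * (\<integral>y. abs y powr p \<partial>F) + (real l * (\<integral>y. abs y \<partial>F)) powr p)"
  using tau_moment[OF l p0(2)] expectation_tau_le[OF l] m p0 by (intro mult_left_mono add_mono powr_mono2) auto
 finally show ?thesis by (simp add: powr_mult algebra_simps)
qed

text \<open>The bound comes from the event that all edges of the slab are heavy. It is exponentially
  small in the size of the graph, hence suited to a fixed graph only.\<close>

lemma slab_closed_prob:
 assumes b: "F.prob {..<b} < 1" and L: "0 < L"
 shows "(1 - F.prob {..<b}) powr (2 * real L * size_H)
  \<le> prob {x \<in> space M. \<forall>P\<in>cross a (a + int L). \<exists>e\<in>P. b \<le> \<omega> e x}"
proof -
 define q where "q = F.prob {..<b}"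
 have q: "0 \<le> q" "q < 1" using b by (auto simp: q_def)
 let ?E = "slab a (a + int L)"
 have fin: "finite ?E" by (rule finite_slab)
 have cl: "{x \<in> space M. {e \<in> ?E. \<omega> e x < b} = {}} \<subseteq> {x \<in> space M. \<forall>P\<in>cross a (a + int L). \<exists>e\<in>P. b \<le> \<omega> e x}"
 proof safe
  fix x P assume x: "{e \<in> ?E. \<omega> e x < b} = {}" and P: "P \<in> cross a (a + int L)"
  have "P \<noteq> {}" using cross_elem_nonempty[OF P] L by simp
  then obtain e where "e \<in> P" by auto
  then show "\<exists>e\<in>P. b \<le> \<omega> e x" using x P cross_subset[of a "a + int L"] by (intro bexI[of _ e]) (auto simp: not_less)
 qed
 have "real (card ?E) \<le> 2 * real L * size_H"
 proof -
  have "(real L + 1) * size_H \<le> 2 * real L * size_H" using L size_H_ge_1 by simp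
  then show ?thesis using card_slab_le_size[of a L] by linarith
 qed
 then have "(1 - q) powr (2 * real L * size_H) \<le> (1 - q) powr real (card ?E)" using q by (intro powr_mono') auto
 also have "\<dots> = (1 - q) ^ card ?E" using q by (simp add: powr_realpow)
 also have "\<dots> = bern_exp q ?E (\<lambda>S. of_bool (S = {}))" using fin by (auto simp: bern_wt_def bern_exp_def)
 also have "\<dots> = prob {x \<in> space M. {e \<in> ?E. \<omega> e x < b} = {}}"
  unfolding q_def by (rule prob_open_set(2)[symmetric]) (auto simp: fin slab_subset)
 also have "\<dots> \<le> prob {x \<in> space M. \<forall>P\<in>cross a (a + int L). \<exists>e\<in>P. b \<le> \<omega> e x}" by (rule finite_measure_mono[OF cl closed_event])
 finally show ?thesis by (simp add: q_def)
qed

end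

lemma (in fpp) central_moment_le:
 assumes l: "0 < l" and B: "1 \<le> B"
  and C: "moment_const TYPE((int \<times> 'v) set) F p C"
  and opt: "expectation (\<lambda>x. real (card (opt (cross 0 (int l)) (\<lambda>e. \<omega> e x)))) \<le> B"
   "expectation (\<lambda>x. real (card (opt (cross 0 (int l)) (\<lambda>e. \<omega> e x))) powr (p / 2)) \<le> B powr (p / 2)"
 shows "expectation (\<lambda>x. abs (centered (tau 0 l) x) powr p) \<le> C * B powr (p / 2)"
proof -
 let ?E = "slab 0 (int l)" and ?\<P> = "cross 0 (int l)"
 have pfl: "path_family ?E ?\<P>" using l by (intro pf) simp
 have ne: "?E \<noteq> {}" using l by (intro slab_ne) simp
 have tr: "(\<integral>w. g w \<partial>PiM ?E (\<lambda>_. F)) = expectation (\<lambda>x. g (\<lambda>e. \<omega> e x))"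
  if "g \<in> borel_measurable (PiM ?E (\<lambda>_. borel))" "\<And>w w'. (\<And>e. e \<in> ?E \<Longrightarrow> w e = w' e) \<Longrightarrow> g w = g w'" for g :: "_ \<Rightarrow> real"
 proof -
  have "g (\<lambda>e\<in>?E. \<omega> e x) = g (\<lambda>e. \<omega> e x)" for x by (rule that(2)) simp
  then show ?thesis using expectation_PiM[OF slab_subset ne that(1)] by simp
 qed
 have fm: "fmin ?\<P> \<in> borel_measurable (PiM ?E (\<lambda>_. borel))" by (rule path_family.measurable_fmin[OF pfl]) simp
 have om: "opt ?\<P> \<in> measurable (PiM ?E (\<lambda>_. borel)) (count_space UNIV)" by (rule path_family.measurable_opt[OF pfl]) simp
 have 1: "(\<integral>w. fmin ?\<P> w \<partial>PiM ?E (\<lambda>_. F)) = expectation (tau 0 l)"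
  unfolding tau_def[abs_def] by (subst tr[OF fm path_family.fmin_cong[OF pfl]]) auto
 have 2: "(\<integral>w. abs (fmin ?\<P> w - expectation (tau 0 l)) powr p \<partial>PiM ?E (\<lambda>_. F)) = expectation (\<lambda>x. abs (centered (tau 0 l) x) powr p)"
 proof (subst tr)
  show "(\<lambda>w. abs (fmin ?\<P> w - expectation (tau 0 l)) powr p) \<in> borel_measurable (PiM ?E (\<lambda>_. borel))" using fm by simp
  show "abs (fmin ?\<P> w - expectation (tau 0 l)) powr p = abs (fmin ?\<P> w' - expectation (tau 0 l)) powr p" if "\<And>e. e \<in> ?E \<Longrightarrow> w e = w' e" for w w'
   using path_family.fmin_cong[OF pfl that] by simp
 qed (simp add: centered_def tau_def)
 have 3: "(\<integral>w. h (opt ?\<P> w) \<partial>PiM ?E (\<lambda>_. F)) = expectation (\<lambda>x. h (opt ?\<P> (\<lambda>e. \<omega> e x)))" for h :: "_ \<Rightarrow> real"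
 proof (rule tr)
  show "(\<lambda>w. h (opt ?\<P> w)) \<in> borel_measurable (PiM ?E (\<lambda>_. borel))" by (rule measurable_compose[OF om]) simp
  show "h (opt ?\<P> w) = h (opt ?\<P> w')" if "\<And>e. e \<in> ?E \<Longrightarrow> w e = w' e" for w w' using path_family.opt_cong[OF pfl that] by simp
 qed
 show ?thesis
  using C[unfolded moment_const_def, rule_format, OF pfl B] opt unfolding 1 2 3[of "\<lambda>P. real (card P)"] 3[of "\<lambda>P. real (card P) powr (p / 2)"] by blast
qed

section \<open>Tubes in the lattice below the percolation threshold\<close>

text \<open>The map \<open>\<phi>\<close> embeds the base graph in the lattice of dimension
  \<open>d - 1\<close>, and adding the tube coordinate embeds the tube in dimension
  \<open>d\<close>. Edges lighter than \<open>b\<close> are open, and \<open>decay\<close> is the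
  conclusion of \<open>subcritical_decay\<close> at the density of open edges.\<close>

locale lattice_fpp = fpp H M \<omega> F p for H :: "'v ugraph" and M :: "'a measure" and \<omega> F p +
 fixes d :: nat and \<phi> :: "'v \<Rightarrow> int list" and b :: real and R :: nat and \<rho> :: real
 assumes d: "1 < d" and \<phi>: "inj_on \<phi> V" "\<And>v. v \<in> V \<Longrightarrow> length (\<phi> v) = d - 1"
  "\<And>u v. {u, v} \<in> edges H \<Longrightarrow> {\<phi> u, \<phi> v} \<in> edges (lattice (d - 1))"
  and b: "0 < b" and R: "0 < R" and \<rho>: "0 \<le> \<rho>" "\<rho> < 1"
  and decay: "\<And>E x m. finite E \<Longrightarrow> E \<subseteq> edges (lattice d) \<Longrightarrow> length x = d \<Longrightarrow>
   bern_exp (measure F {..<b}) E (\<lambda>S. of_bool (far d (m * R) x S)) \<le> \<rho> ^ m"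
begin

definition \<psi> :: "int \<times> 'v \<Rightarrow> int list" where "\<psi> z = fst z # \<phi> (snd z)"

lemma length_\<psi>: "snd z \<in> V \<Longrightarrow> length (\<psi> z) = d" using d \<phi>(2) by (simp add: \<psi>_def)

lemma inj_\<psi>: "inj_on \<psi> (UNIV \<times> V)" using \<phi>(1) by (auto simp: inj_on_def \<psi>_def)

lemma ldist_\<psi>: "ldist d (\<psi> y) (\<psi> z) = abs (fst y - fst z) + ldist (d - 1) (\<phi> (snd y)) (\<phi> (snd z))"
proof -
 have "d = Suc (d - 1)" using d by simp
 then have "ldist d (\<psi> y) (\<psi> z) = (\<Sum>i<Suc (d - 1). abs (\<psi> y ! i - \<psi> z ! i))" by (simp add: ldist_def)
 then show ?thesis unfolding sum.lessThan_Suc_shift by (simp add: \<psi>_def ldist_def)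
qed

lemma \<psi>_edge: "e \<in> edges PG \<Longrightarrow> \<psi> ` e \<in> edges (lattice d)"
proof -
 assume e: "e \<in> edges PG"
 obtain y z where yz: "e = {y, z}" using PG_edgeE[OF e] by blast
 have "{\<psi> y, \<psi> z} \<in> edges (lattice d)"
  using e \<phi>(3)[of "snd y" "snd z"] unfolding yz PG_edge_iff lattice_edge_iff by (auto simp: length_\<psi> ldist_\<psi>)
 then show ?thesis by (simp add: yz)
qed

lemma inj_\<psi>_edges: "inj_on ((`) \<psi>) (edges PG)"
proof (rule inj_on_subset[OF inj_on_image_Pow[OF inj_\<psi>]])
 show "edges PG \<subseteq> Pow (UNIV \<times> V)"
 proof
  fix e assume e: "e \<in> edges PG"
  then obtain y z where yz: "e = {y, z}" by (rule PG_edgeE)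
  show "e \<in> Pow (UNIV \<times> V)" using e unfolding yz PG_edge_iff by force
 qed
qed

definition opened :: "(int \<times> 'v) set set \<Rightarrow> 'a \<Rightarrow> int list set set" where
 "opened E x = (`) \<psi> ` {e \<in> E. \<omega> e x < b}"

lemma far_event: "finite E \<Longrightarrow> E \<subseteq> edges PG \<Longrightarrow> {x \<in> space M. far d n z (opened E x)} \<in> events"
 unfolding opened_def by (rule prob_open_set(1))

lemma prob_far:
 assumes E: "finite E" "E \<subseteq> edges PG" and z: "snd z \<in> V"
 shows "prob {x \<in> space M. far d (m * R) (\<psi> z) (opened E x)} \<le> \<rho> ^ m"
proof -
 have "prob {x \<in> space M. far d (m * R) (\<psi> z) (opened E x)} = bern_exp (F.prob {..<b}) E (\<lambda>S. of_bool (far d (m * R) (\<psi> z) ((`) \<psi> ` S)))"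
  unfolding opened_def by (rule prob_open_set(2)[OF E])
 also have "\<dots> = bern_exp (F.prob {..<b}) ((`) \<psi> ` E) (\<lambda>S. of_bool (far d (m * R) (\<psi> z) S))"
  using E by (subst bern_exp_image) (auto intro: inj_on_subset[OF inj_\<psi>_edges])
 also have "\<dots> \<le> \<rho> ^ m" using E \<psi>_edge by (intro decay length_\<psi> z) auto
 finally show ?thesis .
qed

lemma prob_ex_far:
 assumes E: "finite E" "E \<subseteq> edges PG" and Z: "finite Z" "Z \<subseteq> UNIV \<times> V"
 shows "{x \<in> space M. \<exists>z\<in>Z. far d (m * R) (\<psi> z) (opened E x)} \<in> events"
  and "prob {x \<in> space M. \<exists>z\<in>Z. far d (m * R) (\<psi> z) (opened E x)} \<le> real (card Z) * \<rho> ^ m"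
proof -
 let ?A = "{x \<in> space M. \<exists>z\<in>Z. far d (m * R) (\<psi> z) (opened E x)}"
 let ?B = "\<lambda>z. {x \<in> space M. far d (m * R) (\<psi> z) (opened E x)}"
 have eq: "?A = (\<Union>z\<in>Z. ?B z)" by auto
 show "?A \<in> events" unfolding eq using far_event[OF E] Z by auto
 have "prob (\<Union>z\<in>Z. ?B z) \<le> (\<Sum>z\<in>Z. prob (?B z))" using far_event[OF E] Z by (intro finite_measure_subadditive_finite) auto
 also have "\<dots> \<le> (\<Sum>z\<in>Z. \<rho> ^ m)" using Z by (intro sum_mono prob_far[OF E]) auto
 finally show "prob ?A \<le> real (card Z) * \<rho> ^ m" unfolding eq by simp
qed

lemma conn_opened_path:
 assumes "\<And>j. s \<le> j \<Longrightarrow> j < s + i \<Longrightarrow> {xs ! j, xs ! Suc j} \<in> E \<and> \<omega> {xs ! j, xs ! Suc j} x < b"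
 shows "(\<psi> (xs ! s), \<psi> (xs ! (s + i))) \<in> conn (opened E x)"
 using assms
proof (induction i)
 case (Suc i)
 have "{xs ! (s + i), xs ! Suc (s + i)} \<in> E \<and> \<omega> {xs ! (s + i), xs ! Suc (s + i)} x < b" by (rule Suc.prems) auto
 then have "\<psi> ` {xs ! (s + i), xs ! Suc (s + i)} \<in> opened E x" unfolding opened_def by blast
 then have "(\<psi> (xs ! (s + i)), \<psi> (xs ! Suc (s + i))) \<in> conn (opened E x)" by (intro conn_edge) simp
 moreover have "(\<psi> (xs ! s), \<psi> (xs ! (s + i))) \<in> conn (opened E x)" by (rule Suc.IH, rule Suc.prems) auto
 ultimately show ?case using conn_trans by fastforce
qed simp

lemma nth_path_edges: "Suc j < length xs \<Longrightarrow> path_edges xs ! j = {xs ! j, xs ! Suc j}" by (simp add: path_edges_def nth_tl)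

text \<open>A crossing without heavy edges joins a vertex over \<open>a\<close> to one at distance
  at least \<open>m * R\<close>; a union bound over the left slice makes this improbable once
  \<open>m\<close> exceeds a multiple of the logarithm of the size.\<close>

lemma closed_prob:
 assumes m: "size_H * \<rho> ^ m \<le> 1 / 2" "0 < m"
 shows "1 / 2 \<le> prob {x \<in> space M. \<forall>P\<in>cross a (a + int (m * R)). \<exists>e\<in>P. b \<le> \<omega> e x}"
proof -
 let ?L = "m * R" and ?E = "slab a (a + int (m * R))"
 let ?A = "{x \<in> space M. \<forall>P\<in>cross a (a + int (m * R)). \<exists>e\<in>P. b \<le> \<omega> e x}"
 let ?B = "{x \<in> space M. \<exists>z\<in>{a} \<times> V. far d ?L (\<psi> z) (opened ?E x)}"
 have Z: "finite ({a} \<times> V)" "{a} \<times> V \<subseteq> UNIV \<times> V" using finite_V by auto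
 have sub: "space M - ?A \<subseteq> ?B"
 proof
  fix x assume "x \<in> space M - ?A"
  then obtain P where x: "x \<in> space M" and P: "P \<in> cross a (a + int ?L)" "\<And>e. e \<in> P \<Longrightarrow> \<omega> e x < b" by force
  obtain xs where xs: "P = set (path_edges xs)" "crossing_path a (a + int ?L) xs" using P(1) by (rule crossE)
  have c: "walk xs" "fst (hd xs) = a" "fst (last xs) = a + int ?L" "xs \<noteq> []" using xs(2) by (auto simp: crossing_path_def walk_def)
  have PE: "P \<subseteq> ?E" using cross_subset[of a "a + int ?L"] P(1) by auto
  have "(\<psi> (xs ! 0), \<psi> (xs ! (0 + (length xs - 1)))) \<in> conn (opened ?E x)"
  proof (rule conn_opened_path)
   fix j assume "j < 0 + (length xs - 1)"
   then have j: "Suc j < length xs" by simp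
   have "path_edges xs ! j \<in> P" unfolding xs(1) using j by (intro nth_mem) (simp add: length_path_edges)
   then show "{xs ! j, xs ! Suc j} \<in> ?E \<and> \<omega> {xs ! j, xs ! Suc j} x < b" using P(2) PE by (auto simp: nth_path_edges[OF j])
  qed
  then have "(\<psi> (hd xs), \<psi> (last xs)) \<in> conn (opened ?E x)" using c(4) by (simp add: hd_conv_nth last_conv_nth)
  moreover have "int ?L \<le> ldist d (\<psi> (hd xs)) (\<psi> (last xs))" using c by (simp add: ldist_\<psi>)
  ultimately have "far d ?L (\<psi> (hd xs)) (opened ?E x)" unfolding far_def using length_\<psi> walk_ends(2)[OF c(1)] by blast
  moreover have "hd xs \<in> {a} \<times> V" using walk_ends(1)[OF c(1)] c(2) by (simp add: mem_Times_iff)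
  ultimately show "x \<in> ?B" using x by (intro CollectI conjI bexI[of _ "hd xs"])
 qed
 have "prob (space M - ?A) \<le> prob ?B" by (rule finite_measure_mono[OF sub prob_ex_far(1)[OF finite_slab slab_subset Z]])
 also have "\<dots> \<le> real (card ({a} \<times> V)) * \<rho> ^ m" by (rule prob_ex_far(2)[OF finite_slab slab_subset Z])
 also have "\<dots> \<le> size_H * \<rho> ^ m" using \<rho> by (intro mult_right_mono) (auto simp: size_H_def card_cartesian_product)
 also have "\<dots> \<le> 1 / 2" by fact
 finally show ?thesis using prob_compl[OF closed_event[of a ?L b]] by simp
qed

text \<open>Every stretch of \<open>N\<close> consecutive edges of a self-avoiding path contains a closed edge, since
 otherwise \<open>N + 1\<close> distinct lattice points would lie in a ball with at most \<open>N\<close> points.\<close>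

lemma card_opt_le:
 assumes l: "0 < l" and m: "0 < m"
  and x: "\<And>z. z \<in> {0..int l} \<times> V \<Longrightarrow> \<not> far d (m * R) (\<psi> z) (opened (slab 0 (int l)) x)"
 defines "N \<equiv> (2 * (m * R) + 1) ^ d"
 shows "real (card (opt (cross 0 (int l)) (\<lambda>e. \<omega> e x))) \<le> real N * (tau 0 l x / b + 1)"
proof -
 let ?E = "slab 0 (int l)"
 have pfl: "path_family ?E (cross 0 (int l))" using l by (intro pf) simp
 let ?P = "opt (cross 0 (int l)) (\<lambda>e. \<omega> e x)"
 have N0: "0 < N" by (simp add: N_def)
 obtain xs where xs: "?P = set (path_edges xs)" "crossing_path 0 (int l) xs"
  using path_family.opt_props(1)[OF pfl] by (rule crossE)
 have c: "walk xs" "distinct xs" using xs(2) by (auto simp: crossing_path_def)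
 have xsV: "set xs \<subseteq> {0..int l} \<times> V" by (rule finite_crossing_in_box[OF xs(2)]) simp
 have PE: "set (path_edges xs) \<subseteq> ?E" by (rule crossing_subset_slab[OF xs(2)]) simp
 define K where "K = length (path_edges xs)"
 define w where "w i = \<omega> (path_edges xs ! i) x" for i
 have w0: "0 \<le> w i" for i by (simp add: w_def \<omega>_nonneg)
 have len: "K = length xs - 1" by (simp add: K_def length_path_edges)
 have cardP: "card ?P = K" unfolding xs(1) K_def by (rule distinct_card[OF distinct_path_edges[OF c(2)]])
 have "tau 0 l x = sum (\<lambda>e. \<omega> e x) ?P" by (simp add: tau_def path_family.opt_props(2)[OF pfl])
 also have "\<dots> = sum_list (map (\<lambda>e. \<omega> e x) (path_edges xs))"
  unfolding xs(1) by (rule sum_list_distinct_conv_sum_set[symmetric, OF distinct_path_edges[OF c(2)]])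
 also have "\<dots> = (\<Sum>i<K. w i)" by (simp add: sum_list_sum_nth w_def K_def atLeast0LessThan)
 finally have tau: "tau 0 l x = (\<Sum>i<K. w i)" .
 have chunk: "b \<le> (\<Sum>i\<in>{k * N..<k * N + N}. w i)" if k: "k < K div N" for k
 proof -
  have "Suc k * N \<le> K div N * N" using k by (intro mult_le_mono1) simp
  also have "\<dots> \<le> K" by simp
  finally have kN: "k * N + N \<le> K" by simp
  have "\<exists>i\<in>{k * N..<k * N + N}. b \<le> w i"
  proof (rule ccontr)
   assume "\<not> (\<exists>i\<in>{k * N..<k * N + N}. b \<le> w i)"
   then have op: "w i < b" if "k * N \<le> i" "i < k * N + N" for i using that by (auto simp: not_le)
   let ?z = "xs ! (k * N)"
   have inb: "k * N + i < length xs" if "i \<le> N" for i using kN that len N0 by simp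
   have zV: "xs ! (k * N + i) \<in> {0..int l} \<times> V" if "i \<le> N" for i using nth_mem[OF inb[OF that]] xsV by auto
   have "ldist d (\<psi> ?z) (\<psi> (xs ! (k * N + i))) \<le> int (m * R)" if i: "i \<le> N" for i
   proof -
    have "(\<psi> ?z, \<psi> (xs ! (k * N + i))) \<in> conn (opened ?E x)"
    proof (rule conn_opened_path)
     fix j assume j: "k * N \<le> j" "j < k * N + i"
     then have j': "Suc j < length xs" using inb[OF i] by simp
     have "path_edges xs ! j \<in> ?E" using PE j' by (auto simp: length_path_edges)
     then show "{xs ! j, xs ! Suc j} \<in> ?E \<and> \<omega> {xs ! j, xs ! Suc j} x < b"
      using op[of j] j i by (simp add: w_def nth_path_edges[OF j'])
    qed
    moreover have "length (\<psi> (xs ! (k * N + i))) = d" using zV[OF i] by (intro length_\<psi>) auto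
    ultimately have "far d (m * R) (\<psi> ?z) (opened ?E x)" if "int (m * R) \<le> ldist d (\<psi> ?z) (\<psi> (xs ! (k * N + i)))"
     unfolding far_def using that by (intro exI[of _ "\<psi> (xs ! (k * N + i))"] conjI)
    then show ?thesis using x[OF zV[of 0, simplified]] by linarith
   qed
   then have "(\<lambda>i. \<psi> (xs ! (k * N + i))) ` {..N} \<subseteq> {y. length y = d \<and> ldist d (\<psi> ?z) y \<le> int (m * R)}"
    using zV length_\<psi> by fastforce
   moreover have "inj_on (\<lambda>i. \<psi> (xs ! (k * N + i))) {..N}"
   proof (rule inj_onI)
    fix i j assume ij: "i \<in> {..N}" "j \<in> {..N}" "\<psi> (xs ! (k * N + i)) = \<psi> (xs ! (k * N + j))"
    then have "xs ! (k * N + i) = xs ! (k * N + j)" using zV[of i] zV[of j] by (intro inj_onD[OF inj_\<psi>]) auto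
    then show "i = j" using c(2) inb[of i] inb[of j] ij by (simp add: nth_eq_iff_index_eq)
   qed
   moreover have lz: "length (\<psi> ?z) = d" using zV[of 0] by (intro length_\<psi>) auto
   ultimately have "card {..N} \<le> card {y. length y = d \<and> ldist d (\<psi> ?z) y \<le> int (m * R)}"
    by (intro card_inj_on_le lattice_ball)
   also have "\<dots> \<le> N" using lattice_ball(2)[OF lz, of "m * R"] unfolding N_def[symmetric] .
   finally show False by simp
  qed
  then obtain i where "i \<in> {k * N..<k * N + N}" "b \<le> w i" by blast
  then show ?thesis using w0 by (intro order_trans[OF _ member_le_sum[of i]]) auto
 qed
 have "b * real (K div N) = (\<Sum>k<K div N. b)" by simp
 also have "\<dots> \<le> (\<Sum>k<K div N. \<Sum>i\<in>{k * N..<k * N + N}. w i)" by (intro sum_mono chunk) simp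
 also have "\<dots> = (\<Sum>i<K div N * N. w i)" by (rule sum.nat_group)
 also have "\<dots> \<le> (\<Sum>i<K. w i)" using w0 by (intro sum_mono2) auto
 finally have "real (K div N) \<le> tau 0 l x / b" using b by (simp add: tau pos_le_divide_eq mult.commute)
 \<comment> \<open>The incomplete last stretch is charged as one more, hence the
   \<open>+ 1\<close>.\<close>
 moreover have "K \<le> N * (K div N + 1)"
  using div_mult_mod_eq[of K N] mod_less_divisor[OF N0, of K] unfolding distrib_left mult.commute[of N] by linarith
 then have "real K \<le> real N * (real (K div N) + 1)" by (metis of_nat_1 of_nat_add of_nat_le_iff of_nat_mult)
 moreover have "real N * (real (K div N) + 1) \<le> real N * (tau 0 l x / b + 1)" if "real (K div N) \<le> tau 0 l x / b"
  using that by (intro mult_left_mono) auto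
 ultimately show ?thesis unfolding cardP by simp
qed

text \<open>Outside the event \<open>Bad\<close> that some vertex is joined to a far point by open
  edges, the optimal path has at most \<open>N * (tau 0 l x / b + 1)\<close> edges, whose mean is
  linear in \<open>l\<close>. On \<open>Bad\<close> the trivial bound by the size of the slab is
  paid, and the smallness assumption on \<open>\<rho> ^ m\<close> reduces that contribution to at
  most 1.\<close>

lemma central_moment_lattice:
 assumes l: "0 < l" and m: "0 < m" "((real l + 1) * size_H) powr (p / 2 + 1) * \<rho> ^ m \<le> 1"
  and C: "0 < C" "moment_const TYPE((int \<times> 'v) set) F p C"
 defines "c \<equiv> (\<integral>y. abs y \<partial>F) / b + 2 + (2 powr (p / 2) * ((\<integral>y. abs y powr (p / 2) \<partial>F) / b powr (p / 2) + 1) + 1) powr (2 / p)"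
 shows "expectation (\<lambda>x. abs (centered (tau 0 l) x) powr p) \<le> C * (c * (2 * (m * R) + 1) ^ d * real l) powr (p / 2)"
proof -
 define q where "q = p / 2"
 have q: "1 \<le> q" "q \<le> p" "0 < q" using p by (auto simp: q_def)
 define N where "N = real ((2 * (m * R) + 1) ^ d)"
 have "1 \<le> (2 * (m * R) + 1) ^ d" by simp
 then have N: "1 \<le> N" unfolding N_def using of_nat_mono by fastforce
 let ?E = "slab 0 (int l)"
 have pfl: "path_family ?E (cross 0 (int l))" using l by (intro pf) simp
 define n where "n x = real (card (opt (cross 0 (int l)) (\<lambda>e. \<omega> e x)))" for x
 define Bad where "Bad = {x \<in> space M. \<exists>z\<in>{0..int l} \<times> V. far d (m * R) (\<psi> z) (opened ?E x)}"
 define S where "S = (real l + 1) * size_H"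
 have S1: "1 \<le> S" using mult_mono[of 1 "real l + 1" 1 size_H] size_H_ge_1 by (simp add: S_def)
 have Z: "finite ({0..int l} \<times> V)" "{0..int l} \<times> V \<subseteq> UNIV \<times> V" using finite_V by auto
 have Bad: "Bad \<in> events" unfolding Bad_def by (rule prob_ex_far(1)[OF finite_slab slab_subset Z])
 have "prob Bad \<le> real (card ({0..int l} \<times> V)) * \<rho> ^ m" unfolding Bad_def by (rule prob_ex_far(2)[OF finite_slab slab_subset Z])
 also have "\<dots> \<le> S * \<rho> ^ m" using \<rho> by (intro mult_right_mono) (auto simp: S_def size_H_def card_cartesian_product algebra_simps)
 finally have pB: "prob Bad \<le> S * \<rho> ^ m" .
 have bad: "S powr r * prob Bad \<le> 1" if r: "0 \<le> r" "r \<le> q" for r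
 proof -
  have "S powr r * prob Bad \<le> S powr q * (S * \<rho> ^ m)" using S1 \<rho> r pB by (intro mult_mono powr_mono) auto
  also have "\<dots> = S powr (q + 1) * \<rho> ^ m" using S1 by (simp add: powr_add)
  finally show ?thesis using m(2) by (simp add: S_def q_def)
 qed
 have n0: "0 \<le> n x" for x by (simp add: n_def)
 have nS: "n x \<le> S" for x
 proof -
  have "card (opt (cross 0 (int l)) (\<lambda>e. \<omega> e x)) \<le> card ?E"
   using path_family.opt_subset[OF pfl] by (intro card_mono finite_slab)
  then show ?thesis using card_slab_le_size[of 0 l] by (simp add: n_def S_def)
 qed
 have t0: "0 \<le> tau 0 l x" for x using tau_nonneg[of 0 l x] l by simp
 have good: "n x \<le> N * (tau 0 l x / b + 1)" if "x \<in> space M" "x \<notin> Bad" for x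
  unfolding n_def N_def using that by (intro card_opt_le[OF l m(1)]) (auto simp: Bad_def)
 have nm: "random_variable borel n" unfolding n_def[abs_def]
  by (rule measurable_compose[OF dep_measurable[OF dep_opt[OF pfl order_refl] slab_subset]]) simp
 have tint: "integrable M (\<lambda>x. tau 0 l x powr r)" if "1 \<le> r" "r \<le> p" for r
  using p_int_le_exponent[OF _ that(2) tau_p_int[OF l]] that t0 by (simp add: p_int_def)
 have nint: "integrable M (\<lambda>x. n x powr r)" if "0 \<le> r" for r
  using nm nS n0 that by (intro integrable_const_bound[of _ "S powr r"]) (auto intro: powr_mono2)
 have bint: "integrable M (indicat_real Bad)" using Bad by (auto simp: emeasure_eq_measure)
 have pt: "n x powr r \<le> N powr r * (2 powr r * (tau 0 l x powr r / b powr r + 1)) + S powr r * indicator Bad x"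
  if x: "x \<in> space M" and r: "1 \<le> r" for x r
 proof (cases "x \<in> Bad")
  case True
  have "n x powr r \<le> S powr r" using nS n0 r by (intro powr_mono2) auto
  then show ?thesis using True N by (simp add: add_increasing)
 next
  case False
  have "n x powr r \<le> (N * (tau 0 l x / b + 1)) powr r" using good[OF x False] n0 r by (intro powr_mono2) auto
  also have "\<dots> = N powr r * (tau 0 l x / b + 1) powr r" by (rule powr_mult)
  also have "(tau 0 l x / b + 1) powr r \<le> 2 powr r * (tau 0 l x powr r / b powr r + 1)"
   using abs_add_powr_le_two[of r "tau 0 l x / b" 1] r t0[of x] b by (simp add: powr_divide)
  finally show ?thesis using False by (simp add: mult_left_mono)
 qed
 define A where "A = 2 powr q * ((\<integral>y. abs y powr q \<partial>F) / b powr q + 1) + 1"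
 have A1: "1 \<le> A" by (simp add: A_def)
 define \<mu> where "\<mu> = (\<integral>y. abs y \<partial>F)"
 have \<mu>: "0 \<le> \<mu>" by (simp add: \<mu>_def)
 \<comment> \<open>The constant is a sum so that the same \<open>B\<close> dominates both the first
   moment and, after taking the power, the moment of order p / 2.\<close>
 have c: "c = \<mu> / b + 2 + A powr (1 / q)" by (simp add: c_def \<mu>_def A_def q_def)
 have Ac: "A powr (1 / q) \<le> c" "\<mu> / b + 2 \<le> c" using \<mu> b by (auto simp: c)
 define B where "B = c * N * real l"
 have Nl: "1 \<le> N * real l" using mult_mono[of 1 N 1 "real l"] N l by simp
 have c2: "2 \<le> c" using \<mu> b by (simp add: c)
 have B1: "1 \<le> B" using mult_mono[of 1 c 1 "N * real l"] c2 Nl by (simp add: B_def)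
 have "expectation n \<le> expectation (\<lambda>x. N * (tau 0 l x / b + 1) + S * indicator Bad x)"
 proof (rule integral_mono)
  show "integrable M n" using nint[of 1] n0 by simp
  show "integrable M (\<lambda>x. N * (tau 0 l x / b + 1) + S * indicator Bad x)" using tint[of 1] p t0 bint by simp
  show "n x \<le> N * (tau 0 l x / b + 1) + S * indicator Bad x" if "x \<in> space M" for x
   using good[OF that] nS[of x] N b t0[of x] by (cases "x \<in> Bad") (auto simp: add_increasing)
 qed
 also have "\<dots> = N * (expectation (tau 0 l) / b + 1) + S powr 1 * prob Bad"
  using tint[of 1] p t0 bint S1 Bad by (simp add: prob_space)
 also have "\<dots> \<le> N * (real l * \<mu> / b + 1) + 1"
  using expectation_tau_le[OF l] N b q by (intro add_mono bad mult_left_mono divide_right_mono) (auto simp: \<mu>_def)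
 also have "\<dots> \<le> N * real l * (\<mu> / b + 2)"
 proof -
  have "N \<le> N * real l" using N l by simp
  then show ?thesis using Nl by (simp add: algebra_simps)
 qed
 also have "\<dots> \<le> B" using mult_left_mono[OF Ac(2), of "N * real l"] Nl by (simp add: B_def mult_ac)
 finally have E1: "expectation n \<le> B" .
 have "expectation (\<lambda>x. n x powr q) \<le> expectation (\<lambda>x. N powr q * (2 powr q * (tau 0 l x powr q / b powr q + 1)) + S powr q * indicator Bad x)"
 proof (rule integral_mono)
  show "integrable M (\<lambda>x. N powr q * (2 powr q * (tau 0 l x powr q / b powr q + 1)) + S powr q * indicator Bad x)"
   using tint[OF q(1,2)] bint by simp
 qed (use q nint pt in auto)
 also have "\<dots> = N powr q * (2 powr q * (expectation (\<lambda>x. tau 0 l x powr q) / b powr q + 1)) + S powr q * prob Bad"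
  using tint[OF q(1,2)] bint Bad by (simp add: prob_space)
 also have "\<dots> \<le> N powr q * (2 powr q * (real l powr q * (\<integral>y. abs y powr q \<partial>F) / b powr q + 1)) + 1"
  using tau_moment[OF l q(1,2)] q by (intro add_mono bad mult_left_mono divide_right_mono) auto
 also have "\<dots> \<le> (N * real l) powr q * A"
 proof -
  have 1: "1 \<le> real l powr q" using l q by (intro ge_one_powr_ge_zero) auto
  have "2 powr q * N powr q * 1 \<le> 2 powr q * N powr q * real l powr q" using 1 by (intro mult_left_mono) auto
  moreover have "1 \<le> (N * real l) powr q" using Nl q by (intro ge_one_powr_ge_zero) auto
  ultimately show ?thesis by (simp add: A_def powr_mult algebra_simps)
 qed
 also have "\<dots> = (N * real l) powr q * (A powr (1 / q)) powr q" using A1 q by (simp add: powr_powr)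
 also have "\<dots> \<le> (N * real l) powr q * c powr q" using Ac q by (intro mult_left_mono powr_mono2) auto
 also have "\<dots> = B powr q" by (simp add: B_def powr_mult)
 finally have Eq: "expectation (\<lambda>x. n x powr q) \<le> B powr q" .
 show ?thesis using central_moment_le[OF l B1 C(2)] E1 Eq by (simp add: n_def[abs_def] q_def B_def N_def)
qed

end

section \<open>Asymptotic verification of the regularity conditions\<close>

lemma eventually_const_powr_le:
 fixes s t C :: real
 assumes "s < t"
 shows "\<forall>\<^sub>F n in sequentially. C * real n powr s \<le> real n powr t"
proof -
 have "filterlim (\<lambda>n. real n powr (t - s)) at_top sequentially"
  using assms by (intro filterlim_compose[OF real_powr_at_top] filterlim_real_sequentially) auto
 then have "\<forall>\<^sub>F n in sequentially. C \<le> real n powr (t - s)" by (auto simp: filterlim_at_top)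
 then show ?thesis using eventually_gt_at_top[of 0]
 proof eventually_elim
  case (elim n)
  have "C * real n powr s \<le> real n powr (t - s) * real n powr s" using elim by (intro mult_right_mono) auto
  also have "\<dots> = real n powr t" using elim by (simp add: powr_add[symmetric])
  finally show ?case .
 qed
qed

lemma eventually_poly_mult_power_le_1:
 fixes A K g \<rho> :: real and m :: "nat \<Rightarrow> nat"
 assumes g: "0 < g" and \<rho>: "0 \<le> \<rho>" "\<rho> < 1" and K: "0 \<le> K" and m: "\<And>n. real n powr g \<le> real (m n)"
 shows "\<forall>\<^sub>F n in sequentially. K * real n powr A * \<rho> ^ m n \<le> 1"
proof -
 \<comment> \<open>The maximum with 1 / 2 gives a positive base, so that powers become exponentials
   even when \<open>\<rho> = 0\<close>.\<close>
 define r where "r = max \<rho> (1 / 2)"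
 define c where "c = - ln r"
 have r: "0 < r" "r < 1" "\<rho> \<le> r" using \<rho> by (auto simp: r_def)
 have c: "0 < c" using r by (simp add: c_def)
 have "((\<lambda>x::real. K * x powr A * exp (- (c * x powr g))) \<longlongrightarrow> 0) at_top" using c g by real_asymp
 then have "(\<lambda>n. K * real n powr A * exp (- (c * real n powr g))) \<longlonglongrightarrow> 0"
  by (rule filterlim_compose[OF _ filterlim_real_sequentially])
 then have "\<forall>\<^sub>F n in sequentially. K * real n powr A * exp (- (c * real n powr g)) < 1" by (rule order_tendstoD) simp
 then show ?thesis
 proof eventually_elim
  case (elim n)
  have "\<rho> ^ m n \<le> r ^ m n" using \<rho> r by (intro power_mono) auto
  also have "\<dots> = r powr real (m n)" using r by (simp add: powr_realpow)
  also have "\<dots> \<le> exp (- (c * real n powr g))" using r m by (simp add: powr_def[of r] c_def)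
  finally have "K * real n powr A * \<rho> ^ m n \<le> K * real n powr A * exp (- (c * real n powr g))"
   using K by (intro mult_left_mono) auto
  then show ?case using elim by simp
 qed
qed

lemma real_nat_ceiling_bounds:
 assumes "1 \<le> (x :: real)" shows "x \<le> real (nat \<lceil>x\<rceil>)" "real (nat \<lceil>x\<rceil>) \<le> 2 * x"
 using assms by linarith+

text \<open>The three inputs of the block theorem for one \<open>n\<close>: a junction error of
  order n^a, a starting length near n^(2a) with a good moment, and a variance lower bound with loss
  n^(a \<theta>).\<close>

definition (in prob_space) regular_at ::
  "'v ugraph \<Rightarrow> ((int \<times> 'v) set \<Rightarrow> 'a \<Rightarrow> real) \<Rightarrow> real measure \<Rightarrow> real \<Rightarrow> real \<Rightarrow> real \<Rightarrow> real \<Rightarrow> nat \<Rightarrow> bool" where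
 "regular_at H \<omega> F p a \<theta> \<gamma> n \<longleftrightarrow> fpp.\<Delta> H F p \<le> real n powr (a + \<gamma>) \<and>
  (\<exists>l. real n powr (2 * a) \<le> real l \<and> real l \<le> real n powr (2 * a + \<gamma>) \<and>
   expectation (\<lambda>x. abs (centered (fpp.tau H \<omega> 0 l) x) powr p) \<le> real n powr ((a + \<gamma>) * p) \<and>
   (\<forall>k\<ge>l. real k \<le> real n powr (a * \<theta> + \<gamma>) * (sdev (fpp.tau H \<omega> 0 k))^2))"

lemma (in prob_space) asymptotically_normal_if_regular:
 fixes G :: "nat \<Rightarrow> 'v ugraph"
 assumes fpp: "\<And>n. 1 \<le> n \<Longrightarrow> fpp (G n) M \<omega> F p" and r: "\<And>n. 1 \<le> n \<Longrightarrow> r \<in> verts (G n)"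
  and p: "2 < p" and a: "0 \<le> a" and \<theta>: "0 \<le> \<theta>" and e: "a * (2 + \<theta> + 2 * \<theta> / (p - 2)) < 1"
  and reg: "\<And>\<gamma>. 0 < \<gamma> \<Longrightarrow> \<forall>\<^sub>F n in sequentially. regular_at (G n) \<omega> F p a \<theta> \<gamma> n"
  and Y: "\<And>n. 1 \<le> n \<Longrightarrow> random_variable borel (Y n)"
   "\<And>n x. 1 \<le> n \<Longrightarrow> T_time (G n) n (\<lambda>e. \<omega> e x) \<le> Y n x \<and> Y n x \<le> t_time (G n) r n (\<lambda>e. \<omega> e x)"
 shows "asymptotically_normal Y"
proof (rule asymptotically_normal_of_blocks[OF p a \<theta> e])
 let ?D = "\<lambda>n a b. {X. iid_weights.dep \<omega> (fin_graph.slab (G n) (int a) (int b)) borel X}"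
 show bp: "block_process M (fpp.tau (G n) \<omega>) (?D n) p (fpp.\<Delta> (G n) F p)" if "1 \<le> n" for n
  using fpp.block_process_tau[OF fpp[OF that]] .
 show "\<forall>\<^sub>F n in sequentially. fpp.\<Delta> (G n) F p \<le> real n powr (a + \<gamma>) \<and>
   (\<exists>l. real n powr (2 * a) \<le> real l \<and> real l \<le> real n powr (2 * a + \<gamma>) \<and>
    block_process.pmom M (fpp.tau (G n) \<omega>) p l \<le> real n powr ((a + \<gamma>) * p) \<and>
    (\<forall>k\<ge>l. real k \<le> real n powr (a * \<theta> + \<gamma>) * (block_process.sd M (fpp.tau (G n) \<omega>) k)^2))"
  if \<gamma>: "0 < \<gamma>" for \<gamma>
  using reg[OF \<gamma>] eventually_ge_at_top[of 1]
 proof eventually_elim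
  case (elim n)
  interpret B: block_process M "fpp.tau (G n) \<omega>" "?D n" p "fpp.\<Delta> (G n) F p" using bp elim by simp
  show ?case using elim by (simp add: regular_at_def B.pmom_def B.sd_def)
 qed
 show "square_int (Y n) \<and> l2norm (\<lambda>x. Y n x - fpp.tau (G n) \<omega> 0 n x) \<le> 2 * fpp.\<Delta> (G n) F p" if n: "1 \<le> n" for n
 proof -
  interpret P: fpp "G n" M \<omega> F p by (rule fpp[OF n])
  have "P.tau 0 n x \<le> Y n x" "Y n x \<le> t_time (G n) r n (\<lambda>e. \<omega> e x)" for x
   using Y(2)[OF n, of x] P.passage_time_bounds(1)[of n r "\<lambda>e. \<omega> e x"] r[OF n] P.\<omega>_nonneg n by (auto simp: P.tau_def)
  then show ?thesis using n by (intro conjI P.t_time_sandwich[of n r "Y n"] r[OF n] Y(1)[OF n]) auto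
 qed
qed

text \<open>Slabs of length 1 already force a heavy edge with a fixed positive probability, and all
  constants are absorbed by \<open>n powr \<gamma>\<close>.\<close>

lemma (in fpp) regular_fixed_graph:
 assumes b: "0 < b" "0 < F.prob {..<b}" "F.prob {..<b} < 1" and \<gamma>: "0 < \<gamma>"
 shows "\<forall>\<^sub>F n in sequentially. regular_at H \<omega> F p 0 \<theta> \<gamma> n"
proof -
 define \<delta> where "\<delta> = (1 - F.prob {..<b}) powr (2 * real 1 * size_H)"
 define c where "c = (\<integral>y. min y b \<partial>F)"
 have c: "c < b" unfolding c_def using b by (intro F.expectation_min_less AE_F_nonneg) auto
 have \<delta>: "0 < \<delta>" using b by (simp add: \<delta>_def)
 define K where "K = 8 / ((b - c)^2 * \<delta> / b)^2 * (real 1)^2 * size_H"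
 define C where "C = 2 powr p * ((\<integral>y. abs y powr p \<partial>F) + (\<integral>y. abs y \<partial>F) powr p)"
 have "\<forall>\<^sub>F n in sequentially. \<Delta> * real n powr 0 \<le> real n powr \<gamma>" "\<forall>\<^sub>F n in sequentially. K * real n powr 0 \<le> real n powr \<gamma>"
  "\<forall>\<^sub>F n in sequentially. 2 * real n powr (\<gamma> / 2) \<le> real n powr \<gamma>"
  "\<forall>\<^sub>F n in sequentially. C * 2 powr p * real n powr (\<gamma> / 2 * p) \<le> real n powr (\<gamma> * p)"
  using \<gamma> p by (intro eventually_const_powr_le; simp)+
 then show ?thesis using eventually_ge_at_top[of 1]
 proof eventually_elim
  case (elim n)
  have n: "1 \<le> real n" "0 < n" using elim by auto
  \<comment> \<open>The crude moment bound is of order l^p; using half of \<open>\<gamma>\<close>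
    leaves room for the constants.\<close>
  define l where "l = nat \<lceil>real n powr (\<gamma> / 2)\<rceil>"
  have n1: "1 \<le> real n powr (\<gamma> / 2)" using n \<gamma> by (intro ge_one_powr_ge_zero) auto
  have l: "real n powr (\<gamma> / 2) \<le> real l" "real l \<le> 2 * real n powr (\<gamma> / 2)"
   unfolding l_def using real_nat_ceiling_bounds[OF n1] by auto
  have l0: "0 < l" using l(1) n1 by (cases l) auto
  have "expectation (\<lambda>x. abs (centered (tau 0 l) x) powr p) \<le> C * real l powr p"
   unfolding C_def by (rule central_moment_crude[OF l0])
  also have "\<dots> \<le> C * (2 * real n powr (\<gamma> / 2)) powr p" using l p by (intro mult_left_mono powr_mono2) (auto simp: C_def)
  also have "\<dots> \<le> real n powr (\<gamma> * p)" using elim(4) by (simp add: powr_mult powr_powr mult.assoc)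
  finally have pm: "expectation (\<lambda>x. abs (centered (tau 0 l) x) powr p) \<le> real n powr (\<gamma> * p)" .
  have "real k \<le> real n powr \<gamma> * (sdev (tau 0 k))^2" if k: "l \<le> k" for k
  proof -
   have "real k \<le> K * (sdev (tau 0 k))^2" unfolding K_def c_def
   proof (rule le_sdev_tau)
    show "\<delta> \<le> prob {x \<in> space M. \<forall>P\<in>cross (int (i * 1)) (int (i * 1 + 1)). \<exists>e\<in>P. b \<le> \<omega> e x}" for i
     unfolding \<delta>_def using slab_closed_prob[OF b(3), of 1 "int i"] by (simp add: add.commute)
   qed (use b c \<delta> k l0 in \<open>auto simp: c_def\<close>)
   also have "\<dots> \<le> real n powr \<gamma> * (sdev (tau 0 k))^2" using elim(2) n by (intro mult_right_mono) auto
   finally show ?thesis .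
  qed
  then show ?case unfolding regular_at_def using elim(1,3) n n1 l pm by (intro conjI exI[of _ l]) auto
 qed
qed

text \<open>In contrast to a fixed graph, the moment bound and the heavy slabs come from
  percolation. The auxiliary scale \<open>m n\<close> is a small power of \<open>n\<close>: large
  enough for \<open>\<rho> ^ m n\<close> to beat every polynomial, small enough for the powers of it
  that occur to be absorbed.\<close>

lemma regular_lattice:
 fixes G :: "nat \<Rightarrow> 'v ugraph"
 assumes lat: "\<And>n. 1 \<le> n \<Longrightarrow> lattice_fpp (G n) M \<omega> F p d \<phi> b R \<rho>"
  and a: "0 \<le> a" and \<theta>: "0 \<le> \<theta>" and b: "0 < measure F {..<b}" and \<gamma>: "0 < \<gamma>" and C: "0 \<le> C1"
  and diam: "\<forall>\<^sub>F n in sequentially. real (graph_diameter (G n)) + 1 \<le> C1 * real n powr a"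
  and size: "\<forall>\<^sub>F n in sequentially. fpp.size_H (G n) \<le> C1 * real n powr (a * \<theta>)"
 shows "\<forall>\<^sub>F n in sequentially. prob_space.regular_at M (G n) \<omega> F p a \<theta> \<gamma> n"
proof -
 interpret L: lattice_fpp "G 1" M \<omega> F p d \<phi> b R \<rho> by (rule lat) simp
 obtain z where z: "0 \<le> z" "1 / 2 \<le> L.F.prob {..z}" by (rule L.F.obtain_median_bound)
 obtain C where C: "0 < C" "moment_const TYPE((int \<times> 'v) set) F p C"
  using fmin_moment_bound[OF L.F L.AE_F_nonneg z L.p L.int_F] by blast
 define c where "c = (\<integral>y. abs y \<partial>F) / b + 2 + (2 powr (p / 2) * ((\<integral>y. abs y powr (p / 2) \<partial>F) / b powr (p / 2) + 1) + 1) powr (2 / p)"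
 have c0: "0 < c" using L.b by (simp add: c_def add_nonneg_pos add_pos_nonneg)
 let ?s = "2 * a + \<gamma> / 2"
 \<comment> \<open>Makes the ball volume, of order (m R)^d, at most a constant times n^(\<gamma> /
   4).\<close>
 define g where "g = \<gamma> / (4 * real d)"
 have g: "0 < g" "real d * g = \<gamma> / 4" "g \<le> \<gamma> / 8" using \<gamma> L.d by (auto simp: g_def field_simps)
 define m where "m n = nat \<lceil>real n powr g\<rceil>" for n
 define l where "l n = nat \<lceil>real n powr ?s\<rceil>" for n
 define e where "e = (\<integral>y. min y b \<partial>F)"
 have e: "e < b" unfolding e_def using b L.b by (intro L.F.expectation_min_less L.AE_F_nonneg) auto
 define K where "K = 8 / ((b - e)^2 * (1 / 2) / b)^2"
 have K: "0 < K" using e L.b by (simp add: K_def)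
 have m_ge: "real n powr g \<le> real (m n)" for n unfolding m_def by (rule real_nat_ceiling_ge)
 \<comment> \<open>The moment at length n^(2a + \<gamma> / 2), including the volume factor
   n^(\<gamma> / 4), has to stay below n^((a + \<gamma>) p).\<close>
 have e4: "(\<gamma> / 4 + ?s) * (p / 2) < (a + \<gamma>) * p" using \<gamma> L.p by simp
 have e1: "a < a + \<gamma>" and e2: "2 * a + \<gamma> / 2 < 2 * a + \<gamma>" and e3: "g < 2 * a + \<gamma> / 2" and e5: "2 * g + a * \<theta> < a * \<theta> + \<gamma>"
  using \<gamma> g(3) a by auto
 have "\<forall>\<^sub>F n in sequentially. L.\<kappa> * C1 * real n powr a \<le> real n powr (a + \<gamma>)"
  "\<forall>\<^sub>F n in sequentially. 2 * real n powr ?s \<le> real n powr (2 * a + \<gamma>)"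
  "\<forall>\<^sub>F n in sequentially. 2 * real R * real n powr g \<le> real n powr ?s"
  "\<forall>\<^sub>F n in sequentially. C * (c * (5 * real R) ^ d * 2) powr (p / 2) * real n powr ((\<gamma> / 4 + ?s) * (p / 2)) \<le> real n powr ((a + \<gamma>) * p)"
  "\<forall>\<^sub>F n in sequentially. K * (2 * real R)^2 * C1 * real n powr (2 * g + a * \<theta>) \<le> real n powr (a * \<theta> + \<gamma>)"
  by (rule eventually_const_powr_le, fact)+
 moreover have "\<forall>\<^sub>F n in sequentially. (3 * C1) powr (p / 2 + 1) * real n powr ((2 * a + \<gamma> / 2 + a * \<theta>) * (p / 2 + 1)) * \<rho> ^ m n \<le> 1"
  by (rule eventually_poly_mult_power_le_1[OF g(1) L.\<rho> _ m_ge]) simp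
 ultimately show ?thesis using diam size eventually_ge_at_top[of 1]
 proof eventually_elim
  case (elim n)
  interpret P: lattice_fpp "G n" M \<omega> F p d \<phi> b R \<rho> using lat elim by simp
  have n: "1 \<le> real n" "0 < real n" using elim by auto
  have ng: "1 \<le> real n powr g" and nl: "1 \<le> real n powr ?s" using n g \<gamma> a by (auto intro!: ge_one_powr_ge_zero)
  have m: "real (m n) \<le> 2 * real n powr g" unfolding m_def by (rule real_nat_ceiling_bounds(2)[OF ng])
  have m0: "0 < m n" using m_ge[of n] ng by (cases "m n") auto
  have l: "real n powr ?s \<le> real (l n)" "real (l n) \<le> 2 * real n powr ?s"
   using real_nat_ceiling_bounds[OF nl] unfolding l_def by auto
  have l1: "1 \<le> real (l n)" using l nl by linarith
  then have l0: "0 < l n" by simp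
  have S: "1 \<le> P.size_H" "P.size_H \<le> C1 * real n powr (a * \<theta>)" using P.size_H_ge_1 elim by auto
  define A where "A = (real (l n) + 1) * P.size_H"
  have A2: "2 * P.size_H \<le> A" unfolding A_def using l1 S by (intro mult_right_mono) auto
  have "A \<le> (3 * real n powr ?s) * (C1 * real n powr (a * \<theta>))" unfolding A_def using l nl S by (intro mult_mono) auto
  then have "A powr (p / 2 + 1) \<le> ((3 * C1) * (real n powr ?s * real n powr (a * \<theta>))) powr (p / 2 + 1)"
   using A2 S P.p by (intro powr_mono2) (auto simp: mult_ac)
  also have "\<dots> = (3 * C1) powr (p / 2 + 1) * real n powr ((2 * a + \<gamma> / 2 + a * \<theta>) * (p / 2 + 1))"
   by (simp only: powr_mult powr_powr powr_add[symmetric])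
  finally have "A powr (p / 2 + 1) * \<rho> ^ m n \<le> (3 * C1) powr (p / 2 + 1) * real n powr ((2 * a + \<gamma> / 2 + a * \<theta>) * (p / 2 + 1)) * \<rho> ^ m n"
   using P.\<rho> by (intro mult_right_mono) auto
  also have "\<dots> \<le> 1" using elim(6) .
  finally have small: "A powr (p / 2 + 1) * \<rho> ^ m n \<le> 1" .
  \<comment> \<open>The smallness that controls the moments also makes slabs of length
    \<open>m n * R\<close> force a heavy edge with probability at least 1 / 2.\<close>
  have "2 * P.size_H * \<rho> ^ m n \<le> A powr (p / 2 + 1) * \<rho> ^ m n"
  proof (rule mult_right_mono)
   have "A powr 1 \<le> A powr (p / 2 + 1)" using A2 S P.p by (intro powr_mono) auto
   then show "2 * P.size_H \<le> A powr (p / 2 + 1)" using A2 S by simp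
  qed (use P.\<rho> in simp)
  then have half: "P.size_H * \<rho> ^ m n \<le> 1 / 2" using small by simp
  have mR: "real (m n * R) \<le> 2 * real R * real n powr g" using mult_right_mono[OF m, of "real R"] by (simp add: mult_ac)
  have "real (2 * (m n * R) + 1) \<le> 5 * real R * real n powr g"
  proof -
   have "1 * 1 \<le> real R * real n powr g" using P.R ng by (intro mult_mono) auto
   then show ?thesis using mR by simp
  qed
  then have "real ((2 * (m n * R) + 1) ^ d) \<le> (5 * real R * real n powr g) ^ d"
   unfolding of_nat_power by (intro power_mono) auto
  also have "\<dots> = (5 * real R) ^ d * real n powr (\<gamma> / 4)"
   unfolding g(2)[symmetric] using n by (simp add: power_mult_distrib powr_power mult.commute)
  finally have N: "real ((2 * (m n * R) + 1) ^ d) \<le> (5 * real R) ^ d * real n powr (\<gamma> / 4)" .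
  have "L.expectation (\<lambda>x. abs (L.centered (P.tau 0 (l n)) x) powr p) \<le> C * (c * real ((2 * (m n * R) + 1) ^ d) * real (l n)) powr (p / 2)"
   unfolding c_def using P.central_moment_lattice[OF l0 m0 small[unfolded A_def] C] by simp
  also have "\<dots> \<le> C * (c * ((5 * real R) ^ d * real n powr (\<gamma> / 4)) * (2 * real n powr ?s)) powr (p / 2)"
   using C(1) c0 N l P.p by (intro mult_left_mono powr_mono2 mult_mono) auto
  also have "\<dots> = C * (c * (5 * real R) ^ d * 2) powr (p / 2) * real n powr ((\<gamma> / 4 + ?s) * (p / 2))"
  proof -
   have "c * ((5 * real R) ^ d * real n powr (\<gamma> / 4)) * (2 * real n powr ?s)
    = (c * (5 * real R) ^ d * 2) * real n powr (\<gamma> / 4 + ?s)" by (simp only: powr_add[of "real n"] mult_ac)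
   then show ?thesis by (simp only: powr_mult powr_powr mult.assoc)
  qed
  finally have pm: "L.expectation (\<lambda>x. abs (L.centered (P.tau 0 (l n)) x) powr p) \<le> real n powr ((a + \<gamma>) * p)"
   using elim(4) by linarith
  have sd: "real k \<le> real n powr (a * \<theta> + \<gamma>) * (L.sdev (P.tau 0 k))^2" if k: "l n \<le> k" for k
  proof -
   have "real (m n * R) \<le> real (l n)" using mR elim(3) l by linarith
   then have Lk: "m n * R \<le> k" using k by (simp only: of_nat_le_iff)
   have "real k \<le> K * (real (m n * R))^2 * P.size_H * (L.sdev (P.tau 0 k))^2" unfolding K_def e_def
   proof (rule P.le_sdev_tau[OF _ P.b Lk])
    show "1 / 2 \<le> L.prob {x \<in> space M. \<forall>P\<in>P.cross (int (i * (m n * R))) (int (i * (m n * R) + m n * R)). \<exists>e\<in>P. b \<le> \<omega> e x}" for i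
     using P.closed_prob[OF half m0, of "int (i * (m n * R))"] by (simp only: of_nat_add)
   qed (use m0 P.R e in \<open>auto simp: e_def\<close>)
   also have "\<dots> \<le> K * (2 * real R * real n powr g)^2 * (C1 * real n powr (a * \<theta>)) * (L.sdev (P.tau 0 k))^2"
    using K S mR by (intro mult_right_mono mult_mono mult_left_mono power_mono) auto
   also have "\<dots> = K * (2 * real R)^2 * C1 * real n powr (2 * g + a * \<theta>) * (L.sdev (P.tau 0 k))^2"
    using n by (simp add: power_mult_distrib powr_power powr_add mult_ac)
   also have "\<dots> \<le> real n powr (a * \<theta> + \<gamma>) * (L.sdev (P.tau 0 k))^2" using elim(5) by (intro mult_right_mono) auto
   finally show ?thesis .
  qed
  have "P.\<Delta> \<le> L.\<kappa> * (C1 * real n powr a)" unfolding P.\<Delta>_def using elim(7) P.\<kappa>_pos by (intro mult_left_mono) auto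
  then have "P.\<Delta> \<le> real n powr (a + \<gamma>)" using elim(1) by (simp add: mult.assoc)
  moreover have "real n powr (2 * a) \<le> real (l n)" using l(1) powr_mono[of "2 * a" "2 * a + \<gamma> / 2" "real n"] n \<gamma> by linarith
  moreover have "real (l n) \<le> real n powr (2 * a + \<gamma>)" using l(2) elim(2) by linarith
  ultimately show ?case unfolding L.regular_at_def using pm sd by blast
 qed
qed

section \<open>Truncation of the weights and conclusion\<close>

lemma (in prob_space) asymptotically_normal_cong_AE:
 assumes "\<And>n. 1 \<le> n \<Longrightarrow> random_variable borel (X n)" "\<And>n. 1 \<le> n \<Longrightarrow> random_variable borel (Y n)"
  and ae: "\<And>n. 1 \<le> n \<Longrightarrow> AE x in M. X n x = Y n x" and Y: "asymptotically_normal Y"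
 shows "asymptotically_normal X"
 unfolding asymptotically_normal_def
proof (rule weak_conv_m_cong_eventually[OF _ Y[unfolded asymptotically_normal_def]])
 show "\<forall>\<^sub>F n in sequentially. distr M borel (\<lambda>x. (Y n x - expectation (Y n)) / sqrt (variance (Y n)))
   = distr M borel (\<lambda>x. (X n x - expectation (X n)) / sqrt (variance (X n)))"
  using eventually_ge_at_top[of 1]
 proof eventually_elim
  case (elim n)
  note [measurable] = assms(1)[OF elim] assms(2)[OF elim]
  have E: "expectation (X n) = expectation (Y n)" by (rule integral_cong_AE) (use ae[OF elim] in auto)
  have v: "variance (X n) = variance (Y n)" unfolding E by (rule integral_cong_AE) (use ae[OF elim] in auto)
  have "AE x in M. (Y n x - expectation (Y n)) / sqrt (variance (Y n)) = (X n x - expectation (Y n)) / sqrt (variance (Y n))"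
   using ae[OF elim] by eventually_elim simp
  then show ?case unfolding v unfolding E by (rule distr_cong_AE[OF refl refl]) measurable
 qed
qed

lemma (in fin_graph) countable_walks: "countable {xs. walk xs}"
 by (rule countable_subset[of _ "lists (UNIV \<times> V)"]) (use finite_V in \<open>auto simp: walk_def countable_finite\<close>)

lemma (in fin_graph) passage_times_eq:
 "a_time H r n w = Inf (path_weight w ` {xs. walk xs \<and> hd xs = (0, r) \<and> last xs = (int n, r)})"
 "t_time H r n w = Inf (path_weight w ` {xs. walk xs \<and> set xs \<subseteq> {0..int n} \<times> V \<and> hd xs = (0, r) \<and> last xs = (int n, r)})"
 "T_time H n w = Inf (path_weight w ` {xs. walk xs \<and> set xs \<subseteq> {0..int n} \<times> V \<and>
  (\<exists>u\<in>V. \<exists>v\<in>V. hd xs = (0, u) \<and> last xs = (int n, v))})"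
 unfolding a_time_def t_time_def T_time_def is_path_line is_path_segment by (auto intro!: arg_cong[where f = Inf])

text \<open>There are only countably many walks, which makes the infimum measurable; an arbitrary
  set of walks covers all three passage times.\<close>

lemma (in prob_space) passage_time_measurable:
 assumes "fin_graph H" and X: "X \<subseteq> {xs. fin_graph.walk H xs}"
  and \<omega>: "\<And>e. e \<in> edges (graph_prod int_line H) \<Longrightarrow> random_variable borel (\<omega> e)"
 shows "random_variable borel (\<lambda>x. Inf (path_weight (\<lambda>e. \<omega> e x) ` X))"
proof -
 interpret fin_graph H by fact
 have "(\<lambda>x. path_weight (\<lambda>e. \<omega> e x) xs) \<in> borel_measurable M" if "xs \<in> X" for xs
 proof -
  have "set (path_edges xs) \<subseteq> edges PG" using X that by (auto simp: walk_def)
  then have "\<omega> (path_edges xs ! i) \<in> borel_measurable M" if "i < length (path_edges xs)" for i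
   using nth_mem[OF that] by (intro \<omega>) auto
  then show ?thesis unfolding path_weight_def by (simp add: sum_list_sum_nth)
 qed
 then show ?thesis using countable_subset[OF X countable_walks] by (intro borel_measurable_INF_countable)
qed

text \<open>Almost surely the truncation changes nothing; it trades weights that are nonnegative
  almost surely for weights that are nonnegative everywhere.\<close>

lemma iid_weights_max_0:
 assumes M: "prob_space M" and F: "real_distribution F" "supported_nonneg F" and p: "2 < p" "integrable F (\<lambda>x. x powr p)"
  and ind: "prob_space.indep_vars M (\<lambda>_. borel) \<omega> I" and distr: "\<And>e. e \<in> I \<Longrightarrow> distr M borel (\<omega> e) = F"
 shows "iid_weights M I (\<lambda>e x. max 0 (\<omega> e x)) F p" "\<And>e. e \<in> I \<Longrightarrow> AE x in M. \<omega> e x = max 0 (\<omega> e x)"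
proof -
 interpret prob_space M by fact
 interpret F: real_distribution F by fact
 have nn: "AE y in F. 0 \<le> y" using F(2) F.AE_prob_1[of "{0..}"] by (simp add: supported_nonneg_def)
 have \<omega>: "random_variable borel (\<omega> e)" if "e \<in> I" for e using ind that by (auto simp: indep_vars_def2)
 show "iid_weights M I (\<lambda>e x. max 0 (\<omega> e x)) F p"
 proof unfold_locales
  show "indep_vars (\<lambda>_. borel) (\<lambda>e x. max 0 (\<omega> e x)) I" using indep_vars_compose2[OF ind, of "\<lambda>_. max 0" "\<lambda>_. borel"] by simp
  show "distr M borel (\<lambda>x. max 0 (\<omega> e x)) = F" if e: "e \<in> I" for e
  proof -
   have "distr M borel (\<lambda>x. max 0 (\<omega> e x)) = distr (distr M borel (\<omega> e)) borel (max 0)"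
    using \<omega>[OF e] by (subst distr_distr) (auto simp: comp_def)
   also have "\<dots> = distr F borel (\<lambda>y. y)" unfolding distr[OF e] using nn by (intro distr_cong_AE) (auto elim!: eventually_mono)
   finally show ?thesis by (simp add: distr_id2)
  qed
  have "AE y in F. abs y powr p = y powr p" using nn by eventually_elim simp
  then show "integrable F (\<lambda>x. abs x powr p)" using p(2) by (subst integrable_cong_AE) auto
 qed (use p in auto)
 show "AE x in M. \<omega> e x = max 0 (\<omega> e x)" if e: "e \<in> I" for e
 proof -
  have "AE y in distr M borel (\<omega> e). 0 \<le> y" unfolding distr[OF e] by (rule nn)
  then have "AE x in M. 0 \<le> \<omega> e x" using \<omega>[OF e] by (subst (asm) AE_distr_iff) auto
  then show ?thesis by eventually_elim simp
 qed
qed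

theorem theorem2p1:
  fixes G :: "nat \<Rightarrow> 'v ugraph" and orig :: 'v
    and F :: "real measure" and M :: "'a measure"
    and \<omega> :: "(int \<times> 'v) set \<Rightarrow> 'a \<Rightarrow> real"
    and \<theta> p :: real
  assumes "\<And>n. n \<ge> 1 \<Longrightarrow> finite_graph (G n) \<and> connected_graph (G n)"
    and "\<And>n. n \<ge> 1 \<Longrightarrow> subgraph (G n) (G (Suc n))"
    and "orig \<in> verts (G 1)"
    and "\<theta> \<ge> 1"
    and "(\<lambda>n. real (card (edges (G n)))) \<in> O(\<lambda>n. real (graph_diameter (G n)) powr \<theta>)"
    and "real_distribution F" and "supported_nonneg F" and "nondegenerate F"
    and "p > 2" and "integrable F (\<lambda>x. x powr p)"
    and "prob_space M"
    and "prob_space.indep_vars M (\<lambda>_. borel) \<omega> (\<Union>n\<in>{1..}. edges (graph_prod int_line (G n)))"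
    and "\<And>e. e \<in> (\<Union>n\<in>{1..}. edges (graph_prod int_line (G n))) \<Longrightarrow> distr M borel (\<omega> e) = F"
    and "(\<exists>G0. connected_graph G0 \<and> (\<forall>n\<ge>1. G n = G0)) \<or>
         (\<exists>d>1. \<exists>\<phi>. inj_on \<phi> (\<Union>n\<in>{1..}. verts (G n)) \<and>
            (\<forall>n\<ge>1. subgraph (map_graph \<phi> (G n)) (lattice (d - 1))) \<and>
            admissible d F \<and>
            (\<exists>\<alpha>. \<alpha> < 1 / (2 + \<theta> + 2 * \<theta> / (p - 2)) \<and>
               (\<lambda>n. real (graph_diameter (G n))) \<in> o(\<lambda>n. real n powr \<alpha>)))"
  shows "prob_space.asymptotically_normal M (\<lambda>n x. a_time (G n) orig n (\<lambda>e. \<omega> e x)) \<and>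
         prob_space.asymptotically_normal M (\<lambda>n x. t_time (G n) orig n (\<lambda>e. \<omega> e x)) \<and>
         prob_space.asymptotically_normal M (\<lambda>n x. T_time (G n) n (\<lambda>e. \<omega> e x))"
proof -
 interpret prob_space M by fact
 interpret F: real_distribution F by fact
 let ?w = "\<lambda>x e. \<omega> e x"
 have F1: "F.prob {0..} = 1" using assms(7) by (simp add: supported_nonneg_def)
 let ?I = "\<Union>n\<in>{1..}. edges (graph_prod int_line (G n))"
 define \<omega>' where "\<omega>' e x = max 0 (\<omega> e x)" for e x
 note iid = iid_weights_max_0[OF assms(11,6,7,9,10,12,13)]
 have graph: "fin_graph (G n)" if "1 \<le> n" for n using assms(1)[OF that] by (simp add: fin_graph_def)
 have \<omega>_rv: "random_variable borel (\<omega> e)" if "e \<in> ?I" for e using assms(12) that by (auto simp: indep_vars_def2)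
 have fpp: "fpp (G n) M \<omega>' F p" if n: "1 \<le> n" for n
 proof -
  have "iid_weights M (edges (graph_prod int_line (G n))) (\<lambda>e x. max 0 (\<omega> e x)) F p"
   by (rule iid_weights_max_0(1)[OF assms(11,6,7,9,10) indep_vars_subset[OF assms(12)] assms(13)]) (use n in auto)
  then show ?thesis using graph[OF n] unfolding \<omega>'_def[abs_def] by (intro fpp.intro)
 qed
 have orig: "orig \<in> verts (G n)" if "1 \<le> n" for n using that
 proof (induction n rule: dec_induct)
  case (step n)
  then show ?case using assms(2)[of n] by (auto simp: subgraph_def)
 qed (rule assms(3))
 \<comment> \<open>Both cases reduce to one exponent \<open>a\<close> with the regularity
   conditions: \<open>a = 0\<close> for a fixed graph, and the exponent bounding the diameter in the
   lattice case.\<close>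
 have "\<exists>a\<ge>0. a * (2 + \<theta> + 2 * \<theta> / (p - 2)) < 1 \<and> (\<forall>\<gamma>>0. \<forall>\<^sub>F n in sequentially. regular_at (G n) \<omega>' F p a \<theta> \<gamma> n)" using assms(14)
 proof
  assume "\<exists>G0. connected_graph G0 \<and> (\<forall>n\<ge>1. G n = G0)"
  then have G: "G n = G 1" if "1 \<le> n" for n using that by auto
  obtain b where b: "0 < b" "0 < F.prob {..<b}" "F.prob {..<b} < 1"
   using F.obtain_level[OF F1 F.cdf_least_support_less_1[OF F1 assms(8)]] by blast
  interpret P: fpp "G 1" M \<omega>' F p by (rule fpp) simp
  have "\<forall>\<^sub>F n in sequentially. regular_at (G n) \<omega>' F p 0 \<theta> \<gamma> n" if "0 < \<gamma>" for \<gamma>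
   using P.regular_fixed_graph[OF b that, of \<theta>] eventually_ge_at_top[of 1]
  proof eventually_elim
   case (elim n)
   then show ?case using G[of n] by simp
  qed
  then show ?thesis by (intro exI[of _ 0]) simp
 next
  assume "\<exists>d>1. \<exists>\<phi>. inj_on \<phi> (\<Union>n\<in>{1..}. verts (G n)) \<and>
      (\<forall>n\<ge>1. subgraph (map_graph \<phi> (G n)) (lattice (d - 1))) \<and> admissible d F \<and>
      (\<exists>\<alpha>. \<alpha> < 1 / (2 + \<theta> + 2 * \<theta> / (p - 2)) \<and>
       (\<lambda>n. real (graph_diameter (G n))) \<in> o(\<lambda>n. real n powr \<alpha>))"
  then obtain d :: nat and \<phi> :: "'v \<Rightarrow> int list" and \<alpha> where d: "1 < d" and inj: "inj_on \<phi> (\<Union>n\<in>{1..}. verts (G n))"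
   and sub: "\<And>n. 1 \<le> n \<Longrightarrow> subgraph (map_graph \<phi> (G n)) (lattice (d - 1))" and adm: "admissible d F"
   and \<alpha>: "\<alpha> < 1 / (2 + \<theta> + 2 * \<theta> / (p - 2))" and o: "(\<lambda>n. real (graph_diameter (G n))) \<in> o(\<lambda>n. real n powr \<alpha>)"
   by blast
  obtain b where b: "0 < b" "0 < F.prob {..<b}" "F.prob {..<b} < critical_prob d"
   using F.obtain_level[OF F1] adm unfolding admissible_def by blast
  obtain R \<rho> where R: "0 < R" "0 \<le> \<rho>" "\<rho> < 1"
   "\<And>E x m. finite E \<Longrightarrow> E \<subseteq> edges (lattice d) \<Longrightarrow> length x = d \<Longrightarrow>
    bern_exp (F.prob {..<b}) E (\<lambda>S. of_bool (far d (m * R) x S)) \<le> \<rho> ^ m"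
   using subcritical_decay[OF _ b(3)] F.prob_le_1 by (metis measure_nonneg)
  have lat: "lattice_fpp (G n) M \<omega>' F p d \<phi> b R \<rho>" if n: "1 \<le> n" for n
  proof (rule lattice_fpp.intro[OF fpp[OF n]], unfold_locales)
   show "inj_on \<phi> (verts (G n))" by (rule inj_on_subset[OF inj]) (use n in auto)
   show "length (\<phi> v) = d - 1" if "v \<in> verts (G n)" for v
    using sub[OF n] that by (auto simp: subgraph_def map_graph_def lattice_def)
   show "{\<phi> u, \<phi> v} \<in> edges (lattice (d - 1))" if "{u, v} \<in> edges (G n)" for u v
    using sub[OF n] imageI[OF that, of "(`) \<phi>"] by (auto simp: subgraph_def map_graph_def)
  qed (use d b R in auto)
  \<comment> \<open>The hypotheses allow a negative \<open>\<alpha>\<close>; the larger exponent 0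
    then still bounds the diameter and satisfies the same inequality.\<close>
  define a where "a = max \<alpha> 0"
  have a0: "0 \<le> a" by (simp add: a_def)
  have "0 < 2 + \<theta> + 2 * \<theta> / (p - 2)" using assms(4,9) by (simp add: add_pos_nonneg)
  then have e: "a * (2 + \<theta> + 2 * \<theta> / (p - 2)) < 1" using \<alpha> by (simp add: a_def max_def pos_less_divide_eq)
  obtain c where c: "0 < c" "\<forall>\<^sub>F n in sequentially. real (card (edges (G n))) \<le> c * real (graph_diameter (G n)) powr \<theta>"
   using landau_o.bigE[OF assms(5)] by auto
  \<comment> \<open>Vertices are at most twice the edges plus one, so the size is at most 3 k + 1,
    where the number k of edges is at most c (2 n^a)^\<theta>.\<close>
  define C1 where "C1 = 3 * c * 2 powr \<theta> + 2"
  have C1: "0 \<le> C1" "2 \<le> C1" using c by (auto simp: C1_def)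
  have "\<forall>\<^sub>F n in sequentially. real (graph_diameter (G n)) + 1 \<le> 2 * real n powr a"
   using landau_o.smallD[OF o zero_less_one] eventually_ge_at_top[of 1]
  proof eventually_elim
   case (elim n)
   have "real (graph_diameter (G n)) \<le> real n powr \<alpha>" using elim by simp
   also have "\<dots> \<le> real n powr a" using elim by (intro powr_mono) (auto simp: a_def)
   finally show ?case using ge_one_powr_ge_zero[of "real n" a] a0 elim by simp
  qed
  note diam = this
  have size: "\<forall>\<^sub>F n in sequentially. fpp.size_H (G n) \<le> C1 * real n powr (a * \<theta>)" using diam c(2) eventually_ge_at_top[of 1]
  proof eventually_elim
   case (elim n)
   interpret P: fpp "G n" M \<omega>' F p using fpp elim by simp
   have "real (card (edges (G n))) \<le> c * (2 * real n powr a) powr \<theta>"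
    using elim c(1) assms(4) by (intro order_trans[OF elim(2)] mult_left_mono powr_mono2) auto
   also have "\<dots> = c * 2 powr \<theta> * real n powr (a * \<theta>)" by (simp add: powr_mult powr_powr)
   finally have k: "real (card (edges (G n))) \<le> c * 2 powr \<theta> * real n powr (a * \<theta>)" .
   have "P.size_H \<le> 3 * real (card (edges (G n))) + 1" using P.card_V_le unfolding P.size_H_def by linarith
   moreover have "1 \<le> real n powr (a * \<theta>)" using elim a0 assms(4) by (intro ge_one_powr_ge_zero) auto
   ultimately show ?case using k by (simp add: C1_def distrib_right)
  qed
  have diam': "\<forall>\<^sub>F n in sequentially. real (graph_diameter (G n)) + 1 \<le> C1 * real n powr a" using diam
  proof eventually_elim
   case (elim n)
   then show ?case using mult_right_mono[OF C1(2), of "real n powr a"] by simp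
  qed
  have "\<forall>\<^sub>F n in sequentially. regular_at (G n) \<omega>' F p a \<theta> \<gamma> n" if "0 < \<gamma>" for \<gamma>
   using regular_lattice[OF lat a0 _ b(2) that C1(1) diam' size] assms(4) by simp
  then show ?thesis using a0 e by blast
 qed
 then obtain a where a: "0 \<le> a" "a * (2 + \<theta> + 2 * \<theta> / (p - 2)) < 1"
  and reg: "\<And>\<gamma>. 0 < \<gamma> \<Longrightarrow> \<forall>\<^sub>F n in sequentially. regular_at (G n) \<omega>' F p a \<theta> \<gamma> n" by blast
 have bounds: "T_time (G n) n w \<le> a_time (G n) orig n w" "a_time (G n) orig n w \<le> t_time (G n) orig n w"
  if "1 \<le> n" "\<And>e. 0 \<le> w e" for n w
  using fpp.passage_time_bounds[OF fpp[OF that(1)] _ orig[OF that(1)], of n w] that by auto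
 \<comment> \<open>One argument for the three passage times: \<open>Z\<close> is an infimum over a
   set of walks and lies between \<open>T_time\<close> and \<open>t_time\<close>. Normality is
   proved for the truncated weights and carried back along almost sure equality.\<close>
 have normal: "asymptotically_normal (\<lambda>n x. Z n (?w x))"
  if Z: "\<And>n w. 1 \<le> n \<Longrightarrow> Z n w = Inf (path_weight w ` X n)" "\<And>n. 1 \<le> n \<Longrightarrow> X n \<subseteq> {xs. fin_graph.walk (G n) xs}"
   and b: "\<And>n w. 1 \<le> n \<Longrightarrow> (\<And>e. 0 \<le> w e) \<Longrightarrow> T_time (G n) n w \<le> Z n w \<and> Z n w \<le> t_time (G n) orig n w"
  for Z X
 proof (rule asymptotically_normal_cong_AE)
  fix n :: nat assume n: "1 \<le> n"
  interpret P: fpp "G n" M \<omega>' F p by (rule fpp[OF n])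
  have I: "edges P.PG \<subseteq> ?I" using n by auto
  show "random_variable borel (\<lambda>x. Z n (?w x))" unfolding Z(1)[OF n]
   by (rule passage_time_measurable[OF graph[OF n] Z(2)[OF n]]) (rule \<omega>_rv, rule subsetD[OF I])
  show "random_variable borel (\<lambda>x. Z n (\<lambda>e. \<omega>' e x))" unfolding Z(1)[OF n]
   by (rule passage_time_measurable[OF graph[OF n] Z(2)[OF n]]) (rule P.\<omega>_measurable)
  \<comment> \<open>The truncation must be without effect on all edges simultaneously, which holds
    almost surely because there are countably many.\<close>
  have "countable (edges P.PG)"
  proof (rule countable_subset)
   show "edges P.PG \<subseteq> (\<lambda>xs. {xs ! 0, xs ! 1}) ` lists (UNIV \<times> P.V)"
   proof
    fix e assume e: "e \<in> edges P.PG"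
    then obtain y z where yz: "e = {y, z}" by (rule P.PG_edgeE)
    then have "[y, z] \<in> lists (UNIV \<times> P.V)" using e unfolding yz P.PG_edge_iff by (auto simp: mem_Times_iff)
    then show "e \<in> (\<lambda>xs. {xs ! 0, xs ! 1}) ` lists (UNIV \<times> P.V)" by (intro image_eqI[of _ _ "[y, z]"]) (auto simp: yz)
   qed
   show "countable ((\<lambda>xs. {xs ! 0, xs ! 1}) ` lists ((UNIV :: int set) \<times> P.V))"
    by (intro countable_image countable_lists countable_SIGMA countableI_type countable_finite[OF P.finite_V])
  qed
  then have "AE x in M. \<forall>e\<in>edges P.PG. \<omega> e x = \<omega>' e x" using iid(2) I unfolding \<omega>'_def by (subst AE_ball_countable) blast+
  then show "AE x in M. Z n (?w x) = Z n (\<lambda>e. \<omega>' e x)"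
  proof eventually_elim
   case (elim x)
   have "path_weight (?w x) xs = path_weight (\<lambda>e. \<omega>' e x) xs" if "xs \<in> X n" for xs
    unfolding path_weight_def using Z(2)[OF n] that elim by (intro arg_cong[where f = sum_list] map_cong) (auto simp: P.walk_def)
   then show ?case unfolding Z(1)[OF n] by (intro arg_cong[where f = Inf] image_cong) auto
  qed
 next
  show "asymptotically_normal (\<lambda>n x. Z n (\<lambda>e. \<omega>' e x))"
  proof (rule asymptotically_normal_if_regular[OF fpp orig assms(9) a(1) _ a(2) reg])
   show "random_variable borel (\<lambda>x. Z n (\<lambda>e. \<omega>' e x))" if n: "1 \<le> n" for n
    unfolding Z(1)[OF n] by (rule passage_time_measurable[OF graph[OF n] Z(2)[OF n]])
     (rule iid_weights.\<omega>_measurable[OF fpp.axioms(2)[OF fpp[OF n]]])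
   show "T_time (G n) n (\<lambda>e. \<omega>' e x) \<le> Z n (\<lambda>e. \<omega>' e x) \<and> Z n (\<lambda>e. \<omega>' e x) \<le> t_time (G n) orig n (\<lambda>e. \<omega>' e x)"
    if "1 \<le> n" for n x using b[OF that, of "\<lambda>e. \<omega>' e x"] by (simp add: \<omega>'_def)
  qed (use assms(4) in auto)
 qed
 show ?thesis
 proof (intro conjI)
  show "asymptotically_normal (\<lambda>n x. a_time (G n) orig n (?w x))"
   by (rule normal[OF fin_graph.passage_times_eq(1)[OF graph]]) (use bounds in auto)
  show "asymptotically_normal (\<lambda>n x. t_time (G n) orig n (?w x))"
   by (rule normal[OF fin_graph.passage_times_eq(2)[OF graph]]) (auto intro: bounds order_trans[OF bounds])
  show "asymptotically_normal (\<lambda>n x. T_time (G n) n (?w x))"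
   by (rule normal[OF fin_graph.passage_times_eq(3)[OF graph]]) (auto intro: bounds order_trans[OF bounds])
 qed
qed

end
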